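(* Let $R$ be a commutative ring with unity, $G$ a discrete group, and $\mathcal{H}$ a collection of subgroups of $G$ closed under conjugation. For every left $R\mathcal{T}_{\mathcal{H}}(G)$-module $M$, there is a spectral sequence $$E_2^{p,q}=H^p(\mathcal{F}_{\mathcal{H}}(G);\mathcal{H}^q_{C,M})\Rightarrow H^{p+q}(\mathcal{T}_{\mathcal{H}}(G);M),$$ where $\mathcal{H}^q_{C,M}$ is the left $R\mathcal{F}_{\mathcal{H}}(G)$-module such that $\mathcal{H}^q_{C,M}(H)=H^q(C_G(H);M(H))$ for every $H\in\mathcal{H}$.
   Context: A left $R\mathcal{C}$-module is a covariant functor $\mathcal{C}\to R\text{-Mod}$; for a left module $M$, $H^*(\mathcal{C};M)=\mathrm{Ext}^*_{R\mathcal{C}}(\underline R,M)$ computed in the category of left $R\mathcal{C}$-modules, with $\underline R$ the constant functor. "$E_2^{p,q}\Rightarrow H^{p+q}$" means a convergent first quadrant cohomological spectral sequence. The transporter category $\mathcal{T}_{\mathcal{H}}(G)$ has objects the subgroups $H\in\mathcal{H}$ and morphisms $\mathrm{Mor}(H,K)=N_G(H,K)=\{g\in G: gHg^{-1}\le K\}$, with composition given by group multiplication. The fusion category $\mathcal{F}_{\mathcal{H}}(G)$ has the same objects and morphisms $\mathrm{Mor}(H,K)=\{gC_G(H): g\in G,\ gHg^{-1}\le K\}$ (equivalently, conjugation homomorphisms $c_g:H\to K$). $M(H)$ is a $C_G(H)$-module via the inclusion $C_G(H)\subseteq N_G(H,H)$. For a morphism $gC_G(H):H\to K$, the homomorphism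 $C_G(K)\to C_G(H)$, $c\mapsto g^{-1}cg$, and the map $M(g):M(H)\to M(K)$ together induce the map $H^q(C_G(H);M(H))\to H^q(C_G(K);M(K))$, which is independent of the representative $g$ and defines the left module structure on $\mathcal{H}^q_{C,M}$. *)

theory Defs
  imports "HOL-Algebra.AbelCoset" "HOL-Algebra.Module"
begin

section \<open>Modules over a commutative ring: homomorphisms and subquotients\<close>

definition mod_hom ::
    "('r, 's) ring_scheme \<Rightarrow> ('r, 'a) module \<Rightarrow> ('r, 'b) module \<Rightarrow> ('a \<Rightarrow> 'b) set" where
  "mod_hom R A B = {f. f \<in> carrier A \<rightarrow> carrier B \<and>
     (\<forall>x\<in>carrier A. \<forall>y\<in>carrier A. f (x \<oplus>\<^bsub>A\<^esub> y) = f x \<oplus>\<^bsub>B\<^esub> f y) \<and>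
     (\<forall>r\<in>carrier R. \<forall>x\<in>carrier A. f (r \<odot>\<^bsub>A\<^esub> x) = r \<odot>\<^bsub>B\<^esub> f x)}"

definition mod_iso ::
    "('r, 's) ring_scheme \<Rightarrow> ('r, 'a) module \<Rightarrow> ('r, 'b) module \<Rightarrow> bool" where
  "mod_iso R A B \<longleftrightarrow> (\<exists>f\<in>mod_hom R A B. bij_betw f (carrier A) (carrier B))"

definition mod_ker :: "('r, 'a) module \<Rightarrow> ('r, 'b) module \<Rightarrow> ('a \<Rightarrow> 'b) \<Rightarrow> 'a set" where
  "mod_ker A B f = {x \<in> carrier A. f x = \<zero>\<^bsub>B\<^esub>}"

text \<open>The subquotient \<open>Z / B\<close> of \<open>A\<close>, for submodules \<open>B \<subseteq> Z\<close> of \<open>A\<close>.  The type of modules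
  extends that of rings; the ring multiplication and its unit play no role for a module.\<close>

definition subquot :: "('r, 'a) module \<Rightarrow> 'a set \<Rightarrow> 'a set \<Rightarrow> ('r, 'a set) module" where
  "subquot A Z B =
     \<lparr>carrier = (\<lambda>z. B +>\<^bsub>A\<^esub> z) ` Z, monoid.mult = undefined, one = undefined,
      zero = B, add = (\<lambda>X Y. X <+>\<^bsub>A\<^esub> Y),
      smult = (\<lambda>r X. B <+>\<^bsub>A\<^esub> ((\<lambda>x. r \<odot>\<^bsub>A\<^esub> x) ` X))\<rparr>"

definition coboundaries ::
    "(nat \<Rightarrow> ('r, 'k) module) \<Rightarrow> (nat \<Rightarrow> 'k \<Rightarrow> 'k) \<Rightarrow> nat \<Rightarrow> 'k set" where
  "coboundaries K \<delta> n =
     (case n of 0 \<Rightarrow> {\<zero>\<^bsub>K 0\<^esub>} | Suc m \<Rightarrow> \<delta> m ` carrier (K m))"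

text \<open>Cohomology of a cochain complex \<open>\<delta> n : K n \<rightarrow> K (n + 1)\<close>, \<open>n \<ge> 0\<close>.\<close>

definition cohomology ::
    "(nat \<Rightarrow> ('r, 'k) module) \<Rightarrow> (nat \<Rightarrow> 'k \<Rightarrow> 'k) \<Rightarrow> nat \<Rightarrow> ('r, 'k set) module" where
  "cohomology K \<delta> n = subquot (K n) (mod_ker (K n) (K (Suc n)) (\<delta> n)) (coboundaries K \<delta> n)"


section \<open>Small categories and left modules over them\<close>

record ('o, 'm) cat =
  Obj :: "'o set"
  Hom :: "'o \<Rightarrow> 'o \<Rightarrow> 'm set"
  Id :: "'o \<Rightarrow> 'm"
  Comp :: "'m \<Rightarrow> 'm \<Rightarrow> 'm"   \<comment> \<open>\<open>Comp C g f\<close> is \<open>g\<close> after \<open>f\<close>\<close>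

definition category :: "('o, 'm) cat \<Rightarrow> bool" where
  "category C \<longleftrightarrow>
     (\<forall>x\<in>Obj C. Id C x \<in> Hom C x x) \<and>
     (\<forall>x\<in>Obj C. \<forall>y\<in>Obj C. \<forall>z\<in>Obj C. \<forall>f\<in>Hom C x y. \<forall>g\<in>Hom C y z.
        Comp C g f \<in> Hom C x z) \<and>
     (\<forall>x\<in>Obj C. \<forall>y\<in>Obj C. \<forall>f\<in>Hom C x y.
        Comp C f (Id C x) = f \<and> Comp C (Id C y) f = f) \<and>
     (\<forall>w\<in>Obj C. \<forall>x\<in>Obj C. \<forall>y\<in>Obj C. \<forall>z\<in>Obj C.
        \<forall>f\<in>Hom C w x. \<forall>g\<in>Hom C x y. \<forall>h\<in>Hom C y z.
          Comp C h (Comp C g f) = Comp C (Comp C h g) f)"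

text \<open>Hom-sets of distinct pairs of objects need not be disjoint, so the action of a module on
  a morphism also takes its source and target as arguments.\<close>

record ('o, 'm, 'r, 'a) rcmod =
  mod_at :: "'o \<Rightarrow> ('r, 'a) module"
  mod_map :: "'o \<Rightarrow> 'o \<Rightarrow> 'm \<Rightarrow> 'a \<Rightarrow> 'a"

definition left_module ::
    "('o, 'm) cat \<Rightarrow> ('r, 's) ring_scheme \<Rightarrow> ('o, 'm, 'r, 'a) rcmod \<Rightarrow> bool" where
  "left_module C R M \<longleftrightarrow>
     (\<forall>x\<in>Obj C. module R (mod_at M x)) \<and>
     (\<forall>x\<in>Obj C. \<forall>y\<in>Obj C. \<forall>f\<in>Hom C x y.
        mod_map M x y f \<in> mod_hom R (mod_at M x) (mod_at M y)) \<and>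
     (\<forall>x\<in>Obj C. \<forall>a\<in>carrier (mod_at M x). mod_map M x x (Id C x) a = a) \<and>
     (\<forall>x\<in>Obj C. \<forall>y\<in>Obj C. \<forall>z\<in>Obj C. \<forall>f\<in>Hom C x y. \<forall>g\<in>Hom C y z.
        \<forall>a\<in>carrier (mod_at M x).
          mod_map M x z (Comp C g f) a = mod_map M y z g (mod_map M x y f a))"

text \<open>Morphisms of left modules are natural transformations, given by their components.\<close>

definition rc_hom ::
    "('o, 'm) cat \<Rightarrow> ('r, 's) ring_scheme \<Rightarrow> ('o, 'm, 'r, 'a) rcmod \<Rightarrow> ('o, 'm, 'r, 'b) rcmod
      \<Rightarrow> ('o \<Rightarrow> 'a \<Rightarrow> 'b) set" where
  "rc_hom C R M N = {\<eta>.
     (\<forall>x\<in>Obj C. \<eta> x \<in> mod_hom R (mod_at M x) (mod_at N x)) \<and>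
     (\<forall>x\<in>Obj C. \<forall>y\<in>Obj C. \<forall>f\<in>Hom C x y. \<forall>a\<in>carrier (mod_at M x).
        \<eta> y (mod_map M x y f a) = mod_map N x y f (\<eta> x a))}"

definition constant_module :: "('r, 's) ring_scheme \<Rightarrow> ('o, 'm, 'r, 'r) rcmod" where
  "constant_module R =
     \<lparr>mod_at = (\<lambda>x. \<lparr>carrier = carrier R, monoid.mult = monoid.mult R, one = one R,
                     zero = zero R, add = add R, smult = monoid.mult R\<rparr>),
      mod_map = (\<lambda>x y f a. a)\<rparr>"


section \<open>Ext of left modules\<close>

text \<open>The lifting property against epimorphisms of left modules, that is, against
  objectwise surjective natural transformations.  The modules \<open>A\<close> and \<open>B\<close> range over the
  left modules with elements in the same type as those of \<open>P\<close>.\<close>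

definition projective ::
    "('o, 'm) cat \<Rightarrow> ('r, 's) ring_scheme \<Rightarrow> ('o, 'm, 'r, 'u) rcmod \<Rightarrow> bool" where
  "projective C R P \<longleftrightarrow> left_module C R P \<and>
     (\<forall>(A :: ('o, 'm, 'r, 'u) rcmod) (B :: ('o, 'm, 'r, 'u) rcmod) e f.
        left_module C R A \<and> left_module C R B \<and>
        e \<in> rc_hom C R A B \<and> (\<forall>x\<in>Obj C. e x ` carrier (mod_at A x) = carrier (mod_at B x)) \<and>
        f \<in> rc_hom C R P B \<longrightarrow>
        (\<exists>g\<in>rc_hom C R P A. \<forall>x\<in>Obj C. \<forall>a\<in>carrier (mod_at P x). e x (g x a) = f x a))"

record ('o, 'm, 'r, 'u, 'n) resolution =
  res_mod :: "nat \<Rightarrow> ('o, 'm, 'r, 'u) rcmod"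
  res_diff :: "nat \<Rightarrow> 'o \<Rightarrow> 'u \<Rightarrow> 'u"    \<comment> \<open>\<open>res_diff P n\<close> goes from degree \<open>n + 1\<close> to degree \<open>n\<close>\<close>
  res_aug :: "'o \<Rightarrow> 'u \<Rightarrow> 'n"

definition projective_resolution ::
    "('o, 'm) cat \<Rightarrow> ('r, 's) ring_scheme \<Rightarrow> ('o, 'm, 'r, 'n) rcmod
      \<Rightarrow> ('o, 'm, 'r, 'u, 'n) resolution \<Rightarrow> bool" where
  "projective_resolution C R N P \<longleftrightarrow>
     (\<forall>n. projective C R (res_mod P n)) \<and>
     (\<forall>n. res_diff P n \<in> rc_hom C R (res_mod P (Suc n)) (res_mod P n)) \<and>
     res_aug P \<in> rc_hom C R (res_mod P 0) N \<and>
     (\<forall>x\<in>Obj C.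
        res_aug P x ` carrier (mod_at (res_mod P 0) x) = carrier (mod_at N x) \<and>
        res_diff P 0 x ` carrier (mod_at (res_mod P (Suc 0)) x)
          = mod_ker (mod_at (res_mod P 0) x) (mod_at N x) (res_aug P x) \<and>
        (\<forall>n. res_diff P (Suc n) x ` carrier (mod_at (res_mod P (Suc (Suc n))) x)
          = mod_ker (mod_at (res_mod P (Suc n)) x) (mod_at (res_mod P n) x) (res_diff P n x)))"

text \<open>The type in which resolutions of a module \<open>N\<close> with elements in \<open>'n\<close> are chosen.  The
  values of the free module on all elements of \<open>N\<close> consist of finitely supported functions from
  \<open>'o \<times> 'm \<times> 'n\<close> to \<open>'r\<close>.  If \<open>'r\<close> has at least two elements, the type below has at least the
  cardinality of \<open>'o\<close>, \<open>'m\<close>, \<open>'n\<close>, \<open>'r\<close> and \<open>nat\<close>, and hence contains copies of that free module,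
  of the free module on the kernel, and so on, that is, of a free resolution of \<open>N\<close>.  It also
  contains a copy of the free module on all elements of any \<open>P\<close> with elements in this type, so
  that the lifting property within this type is projectivity in the absolute sense.  If \<open>'r\<close> has
  one element, all modules are zero.\<close>

type_synonym ('o, 'm, 'r, 'n) res_univ = "('o \<times> 'm \<times> 'n) list \<Rightarrow> 'r"

text \<open>As usual, Ext is computed by a chosen projective resolution of its first argument.\<close>

definition proj_res ::
    "('o, 'm) cat \<Rightarrow> ('r, 's) ring_scheme \<Rightarrow> ('o, 'm, 'r, 'n) rcmod
      \<Rightarrow> ('o, 'm, 'r, ('o, 'm, 'r, 'n) res_univ, 'n) resolution" where
  "proj_res C R N = (SOME P. projective_resolution C R N P)"

text \<open>The \<open>R\<close>-module of morphisms \<open>P \<rightarrow> M\<close>.  Components are extensional, so that equal morphisms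
  are equal elements.\<close>

definition hom_module ::
    "('o, 'm) cat \<Rightarrow> ('r, 's) ring_scheme \<Rightarrow> ('o, 'm, 'r, 'u) rcmod \<Rightarrow> ('o, 'm, 'r, 'a) rcmod
      \<Rightarrow> ('r, 'o \<Rightarrow> 'u \<Rightarrow> 'a) module" where
  "hom_module C R P M =
     \<lparr>carrier = rc_hom C R P M \<inter> (\<Pi>\<^sub>E x\<in>Obj C. extensional (carrier (mod_at P x))),
      monoid.mult = undefined, one = undefined,
      zero = (\<lambda>x\<in>Obj C. \<lambda>a\<in>carrier (mod_at P x). \<zero>\<^bsub>mod_at M x\<^esub>),
      add = (\<lambda>\<eta> \<theta>. \<lambda>x\<in>Obj C. \<lambda>a\<in>carrier (mod_at P x). \<eta> x a \<oplus>\<^bsub>mod_at M x\<^esub> \<theta> x a),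
      smult = (\<lambda>r \<eta>. \<lambda>x\<in>Obj C. \<lambda>a\<in>carrier (mod_at P x). r \<odot>\<^bsub>mod_at M x\<^esub> \<eta> x a)\<rparr>"

definition ext_cochains ::
    "('o, 'm) cat \<Rightarrow> ('r, 's) ring_scheme \<Rightarrow> ('o, 'm, 'r, 'n) rcmod \<Rightarrow> ('o, 'm, 'r, 'a) rcmod
      \<Rightarrow> nat \<Rightarrow> ('r, 'o \<Rightarrow> ('o, 'm, 'r, 'n) res_univ \<Rightarrow> 'a) module" where
  "ext_cochains C R N M n = hom_module C R (res_mod (proj_res C R N) n) M"

definition ext_coboundary ::
    "('o, 'm) cat \<Rightarrow> ('r, 's) ring_scheme \<Rightarrow> ('o, 'm, 'r, 'n) rcmod
      \<Rightarrow> nat \<Rightarrow> ('o \<Rightarrow> ('o, 'm, 'r, 'n) res_univ \<Rightarrow> 'a) \<Rightarrow> 'o \<Rightarrow> ('o, 'm, 'r, 'n) res_univ \<Rightarrow> 'a" where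
  "ext_coboundary C R N n \<eta> =
     (\<lambda>x\<in>Obj C. \<lambda>a\<in>carrier (mod_at (res_mod (proj_res C R N) (Suc n)) x).
        \<eta> x (res_diff (proj_res C R N) n x a))"

definition Ext ::
    "('o, 'm) cat \<Rightarrow> ('r, 's) ring_scheme \<Rightarrow> ('o, 'm, 'r, 'n) rcmod \<Rightarrow> ('o, 'm, 'r, 'a) rcmod
      \<Rightarrow> nat \<Rightarrow> ('r, ('o \<Rightarrow> ('o, 'm, 'r, 'n) res_univ \<Rightarrow> 'a) set) module" where
  "Ext C R N M = cohomology (ext_cochains C R N M) (ext_coboundary C R N)"

abbreviation cat_cohomology ::
    "('o, 'm) cat \<Rightarrow> ('r, 's) ring_scheme \<Rightarrow> ('o, 'm, 'r, 'a) rcmod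
      \<Rightarrow> nat \<Rightarrow> ('r, ('o \<Rightarrow> ('o, 'm, 'r, 'r) res_univ \<Rightarrow> 'a) set) module" where
  "cat_cohomology C R M \<equiv> Ext C R (constant_module R) M"


section \<open>Group cohomology\<close>

text \<open>A group is a category with one object; a left module over it is a module over the group
  ring, and the cohomology of this category is group cohomology.\<close>

definition delooping :: "('g, 't) monoid_scheme \<Rightarrow> (unit, 'g) cat" where
  "delooping A = \<lparr>Obj = UNIV, Hom = (\<lambda>x y. carrier A), Id = (\<lambda>x. \<one>\<^bsub>A\<^esub>),
                  Comp = (\<lambda>g f. g \<otimes>\<^bsub>A\<^esub> f)\<rparr>"

definition restrict_along :: "('g \<Rightarrow> 'h) \<Rightarrow> (unit, 'h, 'r, 'a) rcmod \<Rightarrow> (unit, 'g, 'r, 'a) rcmod" where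
  "restrict_along \<phi> M = \<lparr>mod_at = mod_at M, mod_map = (\<lambda>x y g. mod_map M x y (\<phi> g))\<rparr>"

text \<open>Let \<open>\<phi> : A \<rightarrow> B\<close> be a group homomorphism.  A comparison map is a chain map over the identity
  of the trivial module from the chosen resolution over \<open>A\<close> to the restriction along \<open>\<phi>\<close> of the
  chosen resolution over \<open>B\<close>; it is unique up to chain homotopy.\<close>

definition is_comparison ::
    "('r, 's) ring_scheme \<Rightarrow> ('g, 't) monoid_scheme \<Rightarrow> ('g, 't) monoid_scheme \<Rightarrow> ('g \<Rightarrow> 'g)
      \<Rightarrow> (nat \<Rightarrow> unit \<Rightarrow> (unit, 'g, 'r, 'r) res_univ \<Rightarrow> (unit, 'g, 'r, 'r) res_univ) \<Rightarrow> bool" where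
  "is_comparison R A B \<phi> \<tau> \<longleftrightarrow>
     (let P = proj_res (delooping A) R (constant_module R);
          Q = proj_res (delooping B) R (constant_module R) in
      (\<forall>n. \<tau> n \<in> rc_hom (delooping A) R (res_mod P n) (restrict_along \<phi> (res_mod Q n))) \<and>
      (\<forall>n x. \<forall>a\<in>carrier (mod_at (res_mod P (Suc n)) x).
         \<tau> n x (res_diff P n x a) = res_diff Q n x (\<tau> (Suc n) x a)) \<and>
      (\<forall>x. \<forall>a\<in>carrier (mod_at (res_mod P 0) x). res_aug Q x (\<tau> 0 x a) = res_aug P x a))"

text \<open>For a \<open>B\<close>-module \<open>M\<close>, an \<open>A\<close>-module \<open>N\<close> and \<open>\<theta> : M \<rightarrow> N\<close> with
  \<open>\<theta> (\<phi>(a) m) = a \<theta>(m)\<close>, the map \<open>H\<^sup>q(B; M) \<rightarrow> H\<^sup>q(A; N)\<close> induced by \<open>\<phi>\<close> and \<open>\<theta>\<close>: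
  it sends the class of a cocycle \<open>f\<close> to the class of \<open>\<theta> \<circ> f \<circ> \<tau>\<close>, for a comparison map \<open>\<tau>\<close>.\<close>

definition group_cohomology_map ::
    "('r, 's) ring_scheme \<Rightarrow> ('g, 't) monoid_scheme \<Rightarrow> ('g, 't) monoid_scheme \<Rightarrow> ('g \<Rightarrow> 'g)
      \<Rightarrow> (unit, 'g, 'r, 'a) rcmod \<Rightarrow> ('a \<Rightarrow> 'a) \<Rightarrow> nat
      \<Rightarrow> (unit \<Rightarrow> (unit, 'g, 'r, 'r) res_univ \<Rightarrow> 'a) set
      \<Rightarrow> (unit \<Rightarrow> (unit, 'g, 'r, 'r) res_univ \<Rightarrow> 'a) set" where
  "group_cohomology_map R A B \<phi> N \<theta> q X =
     (let P = proj_res (delooping A) R (constant_module R);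
          K = ext_cochains (delooping A) R (constant_module R) N;
          \<delta> = ext_coboundary (delooping A) R (constant_module R);
          \<tau> = (SOME \<tau>. is_comparison R A B \<phi> \<tau>);
          f = (SOME f. f \<in> X) in
      coboundaries K \<delta> q +>\<^bsub>K q\<^esub>
        (\<lambda>x\<in>UNIV. \<lambda>a\<in>carrier (mod_at (res_mod P q) x). \<theta> (f x (\<tau> q x a))))"


section \<open>Transporter and fusion categories\<close>

definition conj_closed_collection :: "('g, 't) monoid_scheme \<Rightarrow> 'g set set \<Rightarrow> bool" where
  "conj_closed_collection G \<H> \<longleftrightarrow> (\<forall>H\<in>\<H>. subgroup H G) \<and>
     (\<forall>H\<in>\<H>. \<forall>g\<in>carrier G. (g <#\<^bsub>G\<^esub> H) #>\<^bsub>G\<^esub> inv\<^bsub>G\<^esub> g \<in> \<H>)"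

definition transporter_set :: "('g, 't) monoid_scheme \<Rightarrow> 'g set \<Rightarrow> 'g set \<Rightarrow> 'g set" where
  "transporter_set G H K = {g \<in> carrier G. (g <#\<^bsub>G\<^esub> H) #>\<^bsub>G\<^esub> inv\<^bsub>G\<^esub> g \<subseteq> K}"

definition centralizer :: "('g, 't) monoid_scheme \<Rightarrow> 'g set \<Rightarrow> 'g set" where
  "centralizer G H = {g \<in> carrier G. \<forall>h\<in>H. g \<otimes>\<^bsub>G\<^esub> h = h \<otimes>\<^bsub>G\<^esub> g}"

definition transporter_category ::
    "('g, 't) monoid_scheme \<Rightarrow> 'g set set \<Rightarrow> ('g set, 'g) cat" where
  "transporter_category G \<H> =
     \<lparr>Obj = \<H>, Hom = transporter_set G, Id = (\<lambda>H. \<one>\<^bsub>G\<^esub>), Comp = (\<lambda>g f. g \<otimes>\<^bsub>G\<^esub> f)\<rparr>"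

text \<open>Composition is multiplication of representatives, which for these cosets agrees with the
  product of sets; see \<open>centralizer_coset_mult\<close> below.\<close>

definition fusion_category ::
    "('g, 't) monoid_scheme \<Rightarrow> 'g set set \<Rightarrow> ('g set, 'g set) cat" where
  "fusion_category G \<H> =
     \<lparr>Obj = \<H>, Hom = (\<lambda>H K. (\<lambda>g. g <#\<^bsub>G\<^esub> centralizer G H) ` transporter_set G H K),
      Id = centralizer G, Comp = (\<lambda>X Y. X <#>\<^bsub>G\<^esub> Y)\<rparr>"

lemma transporter_setD:
  assumes "group G" "subgroup H G" "g \<in> transporter_set G H K" "h \<in> H"
  shows "g \<in> carrier G" "g \<otimes>\<^bsub>G\<^esub> h \<otimes>\<^bsub>G\<^esub> inv\<^bsub>G\<^esub> g \<in> K"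
  using assms by (auto simp: transporter_set_def l_coset_def r_coset_def)

lemma transporter_setI:
  assumes "g \<in> carrier G" "\<And>h. h \<in> H \<Longrightarrow> g \<otimes>\<^bsub>G\<^esub> h \<otimes>\<^bsub>G\<^esub> inv\<^bsub>G\<^esub> g \<in> K"
  shows "g \<in> transporter_set G H K"
  using assms by (auto simp: transporter_set_def l_coset_def r_coset_def)

lemma transporter_set_mult:
  assumes "group G" "subgroup H G" "subgroup K G"
    and f: "f \<in> transporter_set G H K" and g: "g \<in> transporter_set G K L"
  shows "g \<otimes>\<^bsub>G\<^esub> f \<in> transporter_set G H L"
proof (rule transporter_setI)
  interpret group G by fact
  have c: "f \<in> carrier G" "g \<in> carrier G" using f g by (auto simp: transporter_set_def)
  then show "g \<otimes>\<^bsub>G\<^esub> f \<in> carrier G" by simp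
  fix h assume h: "h \<in> H"
  then have hc: "h \<in> carrier G" using assms(2) by (simp add: subgroup.mem_carrier)
  have "g \<otimes>\<^bsub>G\<^esub> (f \<otimes>\<^bsub>G\<^esub> h \<otimes>\<^bsub>G\<^esub> inv\<^bsub>G\<^esub> f) \<otimes>\<^bsub>G\<^esub> inv\<^bsub>G\<^esub> g \<in> L"
    using transporter_setD[OF assms(1,2) f h] transporter_setD[OF assms(1,3) g] by blast
  then show "g \<otimes>\<^bsub>G\<^esub> f \<otimes>\<^bsub>G\<^esub> h \<otimes>\<^bsub>G\<^esub> inv\<^bsub>G\<^esub> (g \<otimes>\<^bsub>G\<^esub> f) \<in> L"
    using c hc by (simp add: inv_mult_group m_assoc)
qed

lemma one_in_transporter_set:
  assumes "group G" "subgroup H G"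
  shows "\<one>\<^bsub>G\<^esub> \<in> transporter_set G H H"
proof (rule transporter_setI)
  interpret group G by fact
  show "\<one>\<^bsub>G\<^esub> \<in> carrier G" by simp
  show "\<one>\<^bsub>G\<^esub> \<otimes>\<^bsub>G\<^esub> h \<otimes>\<^bsub>G\<^esub> inv\<^bsub>G\<^esub> \<one>\<^bsub>G\<^esub> \<in> H" if "h \<in> H" for h
    using that assms(2) by (simp add: subgroup.mem_carrier)
qed

lemma category_transporter:
  assumes "group G" "conj_closed_collection G \<H>"
  shows "category (transporter_category G \<H>)"
proof -
  interpret group G by fact
  have sub: "subgroup H G" if "H \<in> \<H>" for H using assms(2) that
    by (simp add: conj_closed_collection_def)
  have car: "g \<in> carrier G" if "g \<in> transporter_set G H K" for g H K
    using that by (simp add: transporter_set_def)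
  show ?thesis
    unfolding category_def transporter_category_def
    by (auto simp: sub car m_assoc one_in_transporter_set[OF assms(1)]
        intro: transporter_set_mult[OF assms(1) sub sub])
qed

lemma subgroup_centralizer:
  assumes "group G" "H \<subseteq> carrier G"
  shows "subgroup (centralizer G H) G"
proof -
  interpret group G by fact
  show ?thesis
  proof (rule subgroupI)
    show "centralizer G H \<subseteq> carrier G" by (auto simp: centralizer_def)
    have "\<one>\<^bsub>G\<^esub> \<in> centralizer G H" using assms(2) by (auto simp: centralizer_def)
    then show "centralizer G H \<noteq> {}" by blast
  next
    fix a assume a: "a \<in> centralizer G H"
    have "inv\<^bsub>G\<^esub> a \<otimes>\<^bsub>G\<^esub> h = h \<otimes>\<^bsub>G\<^esub> inv\<^bsub>G\<^esub> a" if "h \<in> H" for h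
    proof -
      have c: "a \<in> carrier G" "h \<in> carrier G" "a \<otimes>\<^bsub>G\<^esub> h = h \<otimes>\<^bsub>G\<^esub> a"
        using a that assms(2) by (auto simp: centralizer_def)
      then have "h = a \<otimes>\<^bsub>G\<^esub> (h \<otimes>\<^bsub>G\<^esub> inv\<^bsub>G\<^esub> a)"
        by (metis inv_closed m_assoc r_inv r_one)
      then show ?thesis using c by (metis inv_solve_left inv_closed m_closed)
    qed
    then show "inv\<^bsub>G\<^esub> a \<in> centralizer G H" using a by (auto simp: centralizer_def)
  next
    fix a b assume "a \<in> centralizer G H" "b \<in> centralizer G H"
    then show "a \<otimes>\<^bsub>G\<^esub> b \<in> centralizer G H"
      using assms(2) by (auto simp: centralizer_def) (metis m_assoc subsetD)
  qed
qed

lemma conj_centralizer: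
  assumes "group G" "subgroup H G" "g \<in> transporter_set G H K" "c \<in> centralizer G K"
  shows "inv\<^bsub>G\<^esub> g \<otimes>\<^bsub>G\<^esub> c \<otimes>\<^bsub>G\<^esub> g \<in> centralizer G H"
proof -
  interpret group G by fact
  have c: "c \<in> carrier G" "g \<in> carrier G" using assms(3,4)
    by (auto simp: centralizer_def transporter_set_def)
  have "inv\<^bsub>G\<^esub> g \<otimes>\<^bsub>G\<^esub> c \<otimes>\<^bsub>G\<^esub> g \<otimes>\<^bsub>G\<^esub> h = h \<otimes>\<^bsub>G\<^esub> (inv\<^bsub>G\<^esub> g \<otimes>\<^bsub>G\<^esub> c \<otimes>\<^bsub>G\<^esub> g)" if h: "h \<in> H" for h
  proof -
    have hc: "h \<in> carrier G" using h assms(2) by (simp add: subgroup.mem_carrier)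
    let ?k = "g \<otimes>\<^bsub>G\<^esub> h \<otimes>\<^bsub>G\<^esub> inv\<^bsub>G\<^esub> g"
    have k: "c \<otimes>\<^bsub>G\<^esub> ?k = ?k \<otimes>\<^bsub>G\<^esub> c"
      using transporter_setD[OF assms(1,2,3) h] assms(4) by (simp add: centralizer_def)
    have "inv\<^bsub>G\<^esub> g \<otimes>\<^bsub>G\<^esub> c \<otimes>\<^bsub>G\<^esub> g \<otimes>\<^bsub>G\<^esub> h = inv\<^bsub>G\<^esub> g \<otimes>\<^bsub>G\<^esub> (c \<otimes>\<^bsub>G\<^esub> ?k) \<otimes>\<^bsub>G\<^esub> g"
      using c hc by (simp add: m_assoc)
    also have "\<dots> = inv\<^bsub>G\<^esub> g \<otimes>\<^bsub>G\<^esub> (?k \<otimes>\<^bsub>G\<^esub> c) \<otimes>\<^bsub>G\<^esub> g" by (simp only: k)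
    also have "\<dots> = h \<otimes>\<^bsub>G\<^esub> (inv\<^bsub>G\<^esub> g \<otimes>\<^bsub>G\<^esub> c \<otimes>\<^bsub>G\<^esub> g)"
      using c hc by (simp add: m_assoc[symmetric])
    finally show ?thesis .
  qed
  then show ?thesis using c by (simp add: centralizer_def)
qed

lemma centralizer_coset_mult:
  assumes "group G" "subgroup H G" "subgroup K G" "f \<in> transporter_set G H K" "g \<in> carrier G"
  shows "(g <#\<^bsub>G\<^esub> centralizer G K) <#>\<^bsub>G\<^esub> (f <#\<^bsub>G\<^esub> centralizer G H)
           = (g \<otimes>\<^bsub>G\<^esub> f) <#\<^bsub>G\<^esub> centralizer G H"
proof -
  interpret group G by fact
  have f: "f \<in> carrier G" using assms(4) by (simp add: transporter_set_def)
  have subH: "subgroup (centralizer G H) G" and subK: "subgroup (centralizer G K) G"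
    using assms subgroup.subset subgroup_centralizer by blast+
  note [simp] = subgroup.mem_carrier[OF subH] subgroup.mem_carrier[OF subK]
  show ?thesis
  proof (intro equalityI subsetI)
    fix x assume "x \<in> (g <#\<^bsub>G\<^esub> centralizer G K) <#>\<^bsub>G\<^esub> (f <#\<^bsub>G\<^esub> centralizer G H)"
    then obtain c d where cd: "c \<in> centralizer G K" "d \<in> centralizer G H"
      and x: "x = (g \<otimes>\<^bsub>G\<^esub> c) \<otimes>\<^bsub>G\<^esub> (f \<otimes>\<^bsub>G\<^esub> d)"
      by (auto simp: set_mult_def l_coset_def)
    let ?e = "inv\<^bsub>G\<^esub> f \<otimes>\<^bsub>G\<^esub> c \<otimes>\<^bsub>G\<^esub> f"
    have e: "?e \<in> centralizer G H" using conj_centralizer[OF assms(1,2,4) cd(1)] .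
    have "f \<otimes>\<^bsub>G\<^esub> ?e = c \<otimes>\<^bsub>G\<^esub> f" using f cd by (simp add: m_assoc[symmetric])
    then have "(g \<otimes>\<^bsub>G\<^esub> f) \<otimes>\<^bsub>G\<^esub> (?e \<otimes>\<^bsub>G\<^esub> d) = g \<otimes>\<^bsub>G\<^esub> (c \<otimes>\<^bsub>G\<^esub> f) \<otimes>\<^bsub>G\<^esub> d"
      using f cd e assms(5)
      by (smt (verit, best) \<open>\<And>x. x \<in> centralizer G H \<Longrightarrow> x \<in> carrier G\<close> m_assoc m_closed)
    then have "x = (g \<otimes>\<^bsub>G\<^esub> f) \<otimes>\<^bsub>G\<^esub> (?e \<otimes>\<^bsub>G\<^esub> d)"
      using f cd assms(5) x by (simp add: m_assoc)
    then show "x \<in> (g \<otimes>\<^bsub>G\<^esub> f) <#\<^bsub>G\<^esub> centralizer G H"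
      using subgroup.m_closed[OF subH e cd(2)] by (auto simp: l_coset_def)
  next
    fix x assume "x \<in> (g \<otimes>\<^bsub>G\<^esub> f) <#\<^bsub>G\<^esub> centralizer G H"
    then obtain d where d: "d \<in> centralizer G H" "x = (g \<otimes>\<^bsub>G\<^esub> f) \<otimes>\<^bsub>G\<^esub> d"
      by (auto simp: l_coset_def)
    then have "x = (g \<otimes>\<^bsub>G\<^esub> \<one>\<^bsub>G\<^esub>) \<otimes>\<^bsub>G\<^esub> (f \<otimes>\<^bsub>G\<^esub> d)" using f assms(5) by (simp add: m_assoc)
    then show "x \<in> (g <#\<^bsub>G\<^esub> centralizer G K) <#>\<^bsub>G\<^esub> (f <#\<^bsub>G\<^esub> centralizer G H)"
      using d(1) subgroup.one_closed[OF subK] unfolding set_mult_def l_coset_def by blast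
  qed
qed

lemma category_fusion:
  assumes "group G" "conj_closed_collection G \<H>"
  shows "category (fusion_category G \<H>)"
proof -
  interpret group G by fact
  have sub: "subgroup H G" if "H \<in> \<H>" for H using assms(2) that
    by (simp add: conj_closed_collection_def)
  have car: "g \<in> carrier G" if "g \<in> transporter_set G H K" for g H K
    using that by (simp add: transporter_set_def)
  have cc: "centralizer G H \<subseteq> carrier G" for H by (auto simp: centralizer_def)
  have one: "\<one>\<^bsub>G\<^esub> <#\<^bsub>G\<^esub> centralizer G H = centralizer G H" for H
    using cc by (force simp: l_coset_def)
  have mult: "(g <#\<^bsub>G\<^esub> centralizer G K) <#>\<^bsub>G\<^esub> (f <#\<^bsub>G\<^esub> centralizer G H)
      = (g \<otimes>\<^bsub>G\<^esub> f) <#\<^bsub>G\<^esub> centralizer G H"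
    if "H \<in> \<H>" "K \<in> \<H>" "f \<in> transporter_set G H K" "g \<in> carrier G" for H K f g
    using centralizer_coset_mult[OF assms(1)] sub that by blast
  have left: "centralizer G K <#>\<^bsub>G\<^esub> (f <#\<^bsub>G\<^esub> centralizer G H) = f <#\<^bsub>G\<^esub> centralizer G H"
    if "H \<in> \<H>" "K \<in> \<H>" "f \<in> transporter_set G H K" for H K f
    using mult[OF that one_closed] one[of K] car[OF that(3)] by simp
  have right: "(f <#\<^bsub>G\<^esub> centralizer G H) <#>\<^bsub>G\<^esub> centralizer G H = f <#\<^bsub>G\<^esub> centralizer G H"
    if "H \<in> \<H>" "f \<in> transporter_set G H K" for H K f
    using mult[OF that(1,1) one_in_transporter_set[OF assms(1) sub[OF that(1)]] car[OF that(2)]]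
      one[of H] car[OF that(2)] by simp
  have ident: "centralizer G H \<in> (\<lambda>g. g <#\<^bsub>G\<^esub> centralizer G H) ` transporter_set G H H"
    if "H \<in> \<H>" for H
    using one[of H] one_in_transporter_set[OF assms(1) sub[OF that]] by (metis image_eqI)
  have comp: "g \<otimes>\<^bsub>G\<^esub> f \<in> transporter_set G H L"
    if "H \<in> \<H>" "K \<in> \<H>" "f \<in> transporter_set G H K" "g \<in> transporter_set G K L" for H K L f g
    using transporter_set_mult[OF assms(1)] sub that by blast
  have assoc: "(h <#\<^bsub>G\<^esub> centralizer G K') <#>\<^bsub>G\<^esub> ((g \<otimes>\<^bsub>G\<^esub> f) <#\<^bsub>G\<^esub> centralizer G H)
      = (h \<otimes>\<^bsub>G\<^esub> g \<otimes>\<^bsub>G\<^esub> f) <#\<^bsub>G\<^esub> centralizer G H"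
    if "H \<in> \<H>" "K \<in> \<H>" "K' \<in> \<H>" "f \<in> transporter_set G H K" "g \<in> transporter_set G K K'"
      "h \<in> transporter_set G K' L" for H K K' L f g h
    using mult[OF that(1,3) comp[OF that(1,2,4,5)] car[OF that(6)]]
      car[OF that(4)] car[OF that(5)] car[OF that(6)] by (simp add: m_assoc)
  show ?thesis
    unfolding category_def fusion_category_def
    by (auto simp: left right ident mult car assoc intro!: imageI intro: comp)
qed

abbreviation centralizer_group :: "('g, 't) monoid_scheme \<Rightarrow> 'g set \<Rightarrow> ('g, 't) monoid_scheme" where
  "centralizer_group G H \<equiv> G\<lparr>carrier := centralizer G H\<rparr>"

text \<open>\<open>M(H)\<close> as a module over \<open>C\<^sub>G(H)\<close>.\<close>

definition centralizer_coeff ::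
    "('g set, 'g, 'r, 'a) rcmod \<Rightarrow> 'g set \<Rightarrow> (unit, 'g, 'r, 'a) rcmod" where
  "centralizer_coeff M H =
     \<lparr>mod_at = (\<lambda>_. mod_at M H), mod_map = (\<lambda>_ _ c. mod_map M H H c)\<rparr>"

text \<open>The map \<open>H\<^sup>q(C\<^sub>G(H); M(H)) \<rightarrow> H\<^sup>q(C\<^sub>G(K); M(K))\<close> induced by \<open>g\<close> in the transporter set.\<close>

definition centralizer_cohomology_map ::
    "('r, 's) ring_scheme \<Rightarrow> ('g, 't) monoid_scheme \<Rightarrow> ('g set, 'g, 'r, 'a) rcmod \<Rightarrow> nat
      \<Rightarrow> 'g set \<Rightarrow> 'g set \<Rightarrow> 'g
      \<Rightarrow> (unit \<Rightarrow> (unit, 'g, 'r, 'r) res_univ \<Rightarrow> 'a) set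
      \<Rightarrow> (unit \<Rightarrow> (unit, 'g, 'r, 'r) res_univ \<Rightarrow> 'a) set" where
  "centralizer_cohomology_map R G M q H K g =
     group_cohomology_map R (centralizer_group G K) (centralizer_group G H)
       (\<lambda>c. inv\<^bsub>G\<^esub> g \<otimes>\<^bsub>G\<^esub> c \<otimes>\<^bsub>G\<^esub> g) (centralizer_coeff M K) (mod_map M H K g) q"

text \<open>A morphism \<open>H \<rightarrow> K\<close> of the fusion category acts through any of its representatives: for
  \<open>c\<close> in \<open>C\<^sub>G(H)\<close>, the maps induced by \<open>g\<close> and \<open>g c\<close> agree, as inner automorphisms of \<open>C\<^sub>G(H)\<close>
  act trivially on its cohomology.\<close>

definition centralizer_cohomology ::
    "('r, 's) ring_scheme \<Rightarrow> ('g, 't) monoid_scheme \<Rightarrow> ('g set, 'g, 'r, 'a) rcmod \<Rightarrow> nat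
      \<Rightarrow> ('g set, 'g set, 'r, (unit \<Rightarrow> (unit, 'g, 'r, 'r) res_univ \<Rightarrow> 'a) set) rcmod" where
  "centralizer_cohomology R G M q =
     \<lparr>mod_at = (\<lambda>H. cat_cohomology (delooping (centralizer_group G H)) R (centralizer_coeff M H) q),
      mod_map = (\<lambda>H K X. centralizer_cohomology_map R G M q H K (SOME g. g \<in> X))\<rparr>"


section \<open>First quadrant cohomological spectral sequences\<close>

text \<open>\<open>E r p q\<close> is the entry of the \<open>r\<close>-th page (\<open>r \<ge> 2\<close>) in bidegree \<open>(p, q)\<close>, and
  \<open>d r p q : E r p q \<rightarrow> E r (p + r) (q - r + 1)\<close>.\<close>

definition spectral_sequence ::
    "('r, 's) ring_scheme \<Rightarrow> (nat \<Rightarrow> int \<Rightarrow> int \<Rightarrow> ('r, 'e) module)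
      \<Rightarrow> (nat \<Rightarrow> int \<Rightarrow> int \<Rightarrow> 'e \<Rightarrow> 'e) \<Rightarrow> bool" where
  "spectral_sequence R E d \<longleftrightarrow> (\<forall>r p q. 2 \<le> r \<longrightarrow>
     module R (E r p q) \<and>
     d r p q \<in> mod_hom R (E r p q) (E r (p + int r) (q - int r + 1)) \<and>
     (\<forall>x\<in>carrier (E r p q).
        d r (p + int r) (q - int r + 1) (d r p q x)
          = \<zero>\<^bsub>E r (p + 2 * int r) (q - 2 * int r + 2)\<^esub>) \<and>
     mod_iso R (E (Suc r) p q)
       (subquot (E r p q)
          (mod_ker (E r p q) (E r (p + int r) (q - int r + 1)) (d r p q))
          (d r (p - int r) (q + int r - 1) ` carrier (E r (p - int r) (q + int r - 1)))))"

definition first_quadrant :: "(nat \<Rightarrow> int \<Rightarrow> int \<Rightarrow> ('r, 'e) module) \<Rightarrow> bool" where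
  "first_quadrant E \<longleftrightarrow>
     (\<forall>r p q. 2 \<le> r \<longrightarrow> p < 0 \<or> q < 0 \<longrightarrow> carrier (E r p q) = {\<zero>\<^bsub>E r p q\<^esub>})"

text \<open>Convergence of a first quadrant spectral sequence.  In bidegree \<open>(p, q)\<close> the differentials
  out of and into the \<open>r\<close>-th page vanish as soon as \<open>r > q + 1\<close> and \<open>r > p\<close>, so from there on
  \<open>E r p q\<close> is \<open>E\<^sub>\<infinity>\<close>.\<close>

definition converges_to ::
    "('r, 's) ring_scheme \<Rightarrow> (nat \<Rightarrow> int \<Rightarrow> int \<Rightarrow> ('r, 'e) module)
      \<Rightarrow> (nat \<Rightarrow> ('r, 'h) module) \<Rightarrow> bool" where
  "converges_to R E A \<longleftrightarrow> (\<forall>n. \<exists>F :: nat \<Rightarrow> 'h set.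
     (\<forall>p. submodule (F p) R (A n) \<and> F (Suc p) \<subseteq> F p) \<and>
     F 0 = carrier (A n) \<and> F (Suc n) = {\<zero>\<^bsub>A n\<^esub>} \<and>
     (\<forall>p q r. p + q = n \<and> p < r \<and> q + 1 < r \<longrightarrow>
        mod_iso R (subquot (A n) (F p) (F (Suc p))) (E r (int p) (int q))))"

end

theory Submission
  imports Defs
begin

text \<open>For a module \<open>M\<close> over the transporter category let \<open>C\<^sup>k M\<close> be the module of functions
 \<open>G\<^sup>k \<rightarrow> M\<close>; the complex \<open>C\<^sup>0 M \<rightarrow> C\<^sup>1 M \<rightarrow> \<dots>\<close> is exact.  A projective resolution \<open>P\<close> of the constant module
 over the fusion category pulls back to a resolution over the transporter category.  It is no longer projective,
 but its morphisms to \<open>C\<^sup>1 B\<close> lift along epimorphisms \<open>A \<rightarrow> B\<close>, so \<open>Hom(-, C\<^sup>q\<^sup>+\<^sup>1 M)\<close> keeps it exact, and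
 \<open>Hom(P\<^sub>p, C\<^sup>q\<^sup>+\<^sup>1 M)\<close> is a double complex.  Its total cohomology is \<open>H\<^sup>*(\<T>; M)\<close>: the mapping cone of a
 comparison from a projective resolution over the transporter category to the pulled back one is exact, and so
 are the rows and columns it produces.  The pullback turns morphisms out of \<open>P\<close> into morphisms to the
 centralizer invariants, whose complexes compute \<open>H\<^sup>q(C\<^sub>G(H); M(H))\<close> by the same cone argument over the
 group \<open>C\<^sub>G(H)\<close>.  Hence filtering the double complex by \<open>p\<close> gives the spectral sequence.\<close>

text \<open>Only cochains of positive degree keep the pulled back resolution exact: functions on
  \<open>G^0\<close> are \<open>M\<close> itself, and on \<open>M\<close> exactness fails in
  general. So the cone complex is cut down in cochain degree 0 to morphisms that vanish on the
  pulled back resolution; this one complex then projects onto both complexes to be compared, each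
  time with acyclic kernel. One variable in \<open>G\<close> is enough for lifting because a
  centralizer acts freely on \<open>G\<close>: an equivariant function is an arbitrary function on
  coset representatives, whatever the orders of the centralizers are in \<open>R\<close>. The second
  obstacle is choice. Resolutions, comparison maps, cocycles and coset representatives are picked by
  \<open>SOME\<close>, so isomorphisms are derived from additive relations between cocycles that are
  total on both sides and match coboundaries. Functoriality of the centralizer cohomology is
  inherited from invariant cocycles, where it is visible, through a natural surjection onto classes.
  Finally, the second page has to be the given modules themselves, in their own type, so all pages
  are moved there.\<close>

abbreviation el :: "('o, 'm, 'r, 'a) rcmod => 'o => 'a set" where
 "el M x == carrier (mod_at M x)"

abbreviation (input) add_in (\<open>_ +'[_'] _\<close> [65, 0, 66] 65) where "x +[A] y == x \<oplus>\<^bsub>A\<^esub> y"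
abbreviation (input) minus_in (\<open>_ -'[_'] _\<close> [65, 0, 66] 65) where "x -[A] y == x \<ominus>\<^bsub>A\<^esub> y"
abbreviation (input) uminus_in (\<open>-'[_'] _\<close> [0, 81] 80) where "-[A] x == \<ominus>\<^bsub>A\<^esub> x"
abbreviation (input) smult_in (\<open>_ *'[_'] _\<close> [70, 0, 71] 70) where "r *[A] x == r \<odot>\<^bsub>A\<^esub> x"
abbreviation (input) zero_in (\<open>0'[_']\<close>) where "0[A] == \<zero>\<^bsub>A\<^esub>"
abbreviation (input) one_in (\<open>1'[_']\<close>) where "1[A] == \<one>\<^bsub>A\<^esub>"

section \<open>Modules\<close>

named_theorems ag

lemma module_ag: "module R A ==> abelian_group A"
 by (simp add: module_def)

lemma module_cring: "module R A ==> cring R"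
 by (simp add: module_def)

context abelian_group begin

lemma inv_zero: "\<ominus> \<zero> = \<zero>"
 using l_neg[OF zero_closed] a_inv_closed[OF zero_closed] by simp

lemmas ag_assoc = a_assoc
lemmas ag_comm = a_comm
lemmas ag_rules = a_closed zero_closed a_inv_closed minus_closed l_zero r_zero
 l_neg r_neg minus_minus inv_zero
end

lemmas [ag] = abelian_group.ag_rules

text \<open>Simplification does not cancel \<open>x\<close> against \<open>\<ominus>x\<close> in a long sum, as the term ordering does
 not make them adjacent.  It does so for the signed atoms \<open>sgn_at A x True\<close> and
 \<open>sgn_at A x False\<close>.\<close>

definition sgn_at :: "('a, 'm) ring_scheme => 'a => bool => 'a" where
 "sgn_at A x b = (if b then x else -[A] x)"

lemma ab_eqI: "sgn_at A s True = sgn_at A t True ==> s = t"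
 by (simp add: sgn_at_def)

context abelian_group begin

lemma sgn_at_rules:
 "x : carrier G ==> sgn_at G x b : carrier G"
 "x : carrier G ==> y : carrier G ==> sgn_at G (x \<oplus> y) b = sgn_at G x b \<oplus> sgn_at G y b"
 "x : carrier G ==> sgn_at G (\<ominus> x) b = sgn_at G x (~ b)"
 "x : carrier G ==> y : carrier G ==> sgn_at G (x \<ominus> y) b = sgn_at G x b \<oplus> sgn_at G y (~ b)"
 "sgn_at G \<zero> b = \<zero>"
 "x : carrier G ==> sgn_at G x True \<oplus> sgn_at G x False = \<zero>"
 "x : carrier G ==> sgn_at G x False \<oplus> sgn_at G x True = \<zero>"
 "x : carrier G ==> y : carrier G ==> sgn_at G x True \<oplus> (sgn_at G x False \<oplus> y) = y"
 "x : carrier G ==> y : carrier G ==> sgn_at G x False \<oplus> (sgn_at G x True \<oplus> y) = y"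
 by (auto simp: sgn_at_def a_minus_def minus_add inv_zero l_neg r_neg r_neg1 r_neg2)

lemmas ab_rules = sgn_at_rules a_closed zero_closed a_inv_closed minus_closed a_assoc l_zero r_zero
 a_comm a_lcomm

end

lemmas ab = abelian_group.ab_rules

lemma mod_homI:
 assumes "!!x. x : carrier A ==> f x : carrier B"
  and "!!x y. x : carrier A ==> y : carrier A ==> f (x +[A] y) = f x +[B] f y"
  and "!!r x. r : carrier R ==> x : carrier A ==> f (r *[A] x) = r *[B] f x"
 shows "f : mod_hom R A B"
 using assms by (auto simp: mod_hom_def)

lemma mod_homD:
 assumes "f : mod_hom R A B"
 shows "x : carrier A ==> f x : carrier B"
  and "x : carrier A ==> y : carrier A ==> f (x +[A] y) = f x +[B] f y"
  and "r : carrier R ==> x : carrier A ==> f (r *[A] x) = r *[B] f x"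
 using assms by (auto simp: mod_hom_def)

lemma mod_hom_zero:
 assumes "f : mod_hom R A B" "abelian_group A" "abelian_group B"
 shows "f 0[A] = 0[B]"
proof -
 interpret A: abelian_group A by fact
 interpret B: abelian_group B by fact
 have "f 0[A] +[B] f 0[A] = f 0[A]"
  using mod_homD(2)[OF assms(1), of "0[A]" "0[A]"] by simp
 then show ?thesis using mod_homD(1)[OF assms(1), of "0[A]"] by simp
qed

lemma mod_hom_inv:
 assumes "f : mod_hom R A B" "abelian_group A" "abelian_group B" "x : carrier A"
 shows "f (-[A] x) = -[B] f x"
proof -
 interpret A: abelian_group A by fact
 interpret B: abelian_group B by fact
 have "f (-[A] x) +[B] f x = 0[B]"
  using mod_homD(2)[OF assms(1), of "-[A] x" x] mod_hom_zero[OF assms(1-3)] assms(4)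
  by (simp add: A.l_neg)
 then show ?thesis using mod_homD(1)[OF assms(1)] assms(4)
  by (metis A.a_inv_closed B.minus_equality)
qed

lemma mod_hom_minus:
 assumes "f : mod_hom R A B" "abelian_group A" "abelian_group B" "x : carrier A" "y : carrier A"
 shows "f (x -[A] y) = f x -[B] f y"
 using mod_hom_inv[OF assms(1-3,5)] mod_homD(2)[OF assms(1)] assms
 by (simp add: a_minus_def abelian_group.a_inv_closed)

lemma submodI:
 assumes "module R A" "S <= carrier A" "0[A] : S"
  and "!!x y. x : S ==> y : S ==> x +[A] y : S"
  and "!!r x. r : carrier R ==> x : S ==> r *[A] x : S"
 shows "submodule S R A"
proof -
 interpret module R A by fact
 show ?thesis
 proof (rule submoduleI)
  fix a assume a: "a : S"
  then have "-[A] a = (-[R] 1[R]) *[A] a"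
   using assms(2) by (auto simp: smult_l_minus)
  then show "-[A] a : S" using assms(5) a by simp
 qed (use assms in auto)
qed

lemma submodD:
 assumes "submodule S R A" "module R A"
 shows "S <= carrier A" "x : S ==> x : carrier A" "0[A] : S"
  "x : S ==> y : S ==> x +[A] y : S" "x : S ==> -[A] x : S"
  "x : S ==> y : S ==> x -[A] y : S"
  "r : carrier R ==> x : S ==> r *[A] x : S"
proof -
 interpret module R A by fact
 show 1: "S <= carrier A" "x : S ==> y : S ==> x +[A] y : S" "x : S ==> -[A] x : S"
   "r : carrier R ==> x : S ==> r *[A] x : S" for x y
  using submoduleE[OF assms(1)] by auto
 show "0[A] : S" using subgroup.one_closed[OF submodule.axioms(1)[OF assms(1)]] by simp
 show "x : S ==> x : carrier A" using 1 by auto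
 show "x : S ==> y : S ==> x -[A] y : S" using 1 by (simp add: a_minus_def)
qed

lemma module_restrict:
 "submodule S R A ==> module R A ==> module R (A(|carrier := S|))"
 by (rule submodule.submodule_is_module)

lemma submodule_restrict:
 assumes "submodule S R A" "submodule T R A" "S <= T" "module R A"
 shows "submodule S R (A(|carrier := T|))"
 using submodD[OF assms(1,4)] assms(3) by (intro submodI module_restrict assms) auto

lemma submodule_carrier: "module R A ==> submodule (carrier A) R A"
 by (rule module.carrier_is_submodule)

lemma submodule_zero: "module R A ==> submodule {0[A]} R A"
 by (intro submodI) (auto simp: ag module_ag module.smult_r_null)

lemma submodule_vimage:
 assumes "module R A" "module R B" "f : mod_hom R A B" "submodule S R A" "submodule T R B"
 shows "submodule {x : S. f x : T} R A"
 using submodD[OF assms(4,1)] submodD[OF assms(5,2)] mod_homD[OF assms(3)]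
  mod_hom_zero[OF assms(3) module_ag[OF assms(1)] module_ag[OF assms(2)]]
 by (intro submodI assms) auto

lemma submodule_ker:
 assumes "module R A" "module R B" "f : mod_hom R A B"
 shows "submodule (mod_ker A B f) R A"
 using submodule_vimage[OF assms submodule_carrier submodule_zero] assms
 by (simp add: mod_ker_def)

lemma submodule_image:
 assumes "module R A" "module R B" "f : mod_hom R A B" "submodule S R A"
 shows "submodule (f ` S) R B"
proof (rule submodI[OF assms(2)])
 note s = submodD[OF assms(4,1)]
 note h = mod_homD[OF assms(3)]
 show "f ` S <= carrier B" using s(2) h(1) by auto
 show "0[B] : f ` S"
  using mod_hom_zero[OF assms(3) module_ag[OF assms(1)] module_ag[OF assms(2)]] s(3)
  by (metis image_eqI)
 show "x +[B] y : f ` S" if "x : f ` S" "y : f ` S" for x y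
  using that s h(2) by (auto simp: image_iff) (metis)
 show "r *[B] x : f ` S" if "r : carrier R" "x : f ` S" for r x
  using that s h(3) by (auto simp: image_iff) (metis)
qed

lemma submodule_sum:
 assumes "module R A" "submodule S R A" "submodule T R A"
 shows "submodule {s +[A] t | s t. s : S & t : T} R A"
proof (rule submodI[OF assms(1)])
 interpret module R A by fact
 note s = submodD[OF assms(2,1)] and t = submodD[OF assms(3,1)]
 show "{s +[A] t | s t. s : S & t : T} <= carrier A" using s t by auto
 show "0[A] : {s +[A] t | s t. s : S & t : T}" using s(3) t(3) by force
 show "x +[A] y : {s +[A] t | s t. s : S & t : T}"
  if xy: "x : {s +[A] t | s t. s : S & t : T}" "y : {s +[A] t | s t. s : S & t : T}" for x y
 proof -
  obtain a b c d where ab: "a : S" "b : T" "c : S" "d : T" "x = a +[A] b" "y = c +[A] d"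
   using xy by auto
  then have "x +[A] y = (a +[A] c) +[A] (b +[A] d)"
   using s(2) t(2) by (simp add: M.a_ac)
  then show ?thesis using ab s(4) t(4) by blast
 qed
 show "r *[A] x : {s +[A] t | s t. s : S & t : T}"
  if "r : carrier R" "x : {s +[A] t | s t. s : S & t : T}" for r x
  using that s(2,7) t(2,7) smult_r_distr by fastforce
qed

subsection \<open>Subquotients\<close>

lemma coset_mem_iff:
 assumes "module R A" "submodule B R A" "x : carrier A"
 shows "y : B +>\<^bsub>A\<^esub> x \<longleftrightarrow> y : carrier A & y -[A] x : B"
proof -
 interpret module R A by fact
 note b = submodD[OF assms(2,1)]
 show ?thesis
 proof
  assume "y : B +>\<^bsub>A\<^esub> x"
  then obtain b where bB: "b : B" "y = b +[A] x" by (auto simp: a_r_coset_def r_coset_def)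
  moreover from bB have "y -[A] x = b"
   using assms(3) b(2) by - (rule ab_eqI[of A], simp add: M.ab_rules)
  ultimately show "y : carrier A & y -[A] x : B" using assms(3) b(2) by simp
 next
  assume y: "y : carrier A & y -[A] x : B"
  then have "y = (y -[A] x) +[A] x" using assms(3)
   by - (rule ab_eqI[of A], simp add: M.ab_rules)
  then show "y : B +>\<^bsub>A\<^esub> x" using y by (auto simp: a_r_coset_def r_coset_def)
 qed
qed

lemma coset_eq_iff:
 assumes "module R A" "submodule B R A" "x : carrier A" "y : carrier A"
 shows "B +>\<^bsub>A\<^esub> x = B +>\<^bsub>A\<^esub> y \<longleftrightarrow> x -[A] y : B"
proof -
 interpret module R A by fact
 note b = submodD[OF assms(2,1)]
 show ?thesis
 proof
  have "x : B +>\<^bsub>A\<^esub> x" using coset_mem_iff[OF assms(1-3)] assms(3) b(3)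
   by (simp add: a_minus_def M.r_neg)
  moreover assume "B +>\<^bsub>A\<^esub> x = B +>\<^bsub>A\<^esub> y"
  ultimately show "x -[A] y : B" using coset_mem_iff[OF assms(1,2,4)] by simp
 next
  assume xy: "x -[A] y : B"
  have "z -[A] x : B \<longleftrightarrow> z -[A] y : B" if z: "z : carrier A" for z
  proof -
   have "z -[A] y = (z -[A] x) +[A] (x -[A] y)" "z -[A] x = (z -[A] y) -[A] (x -[A] y)"
    using z assms(3,4) by - (rule ab_eqI[of A], simp add: M.ab_rules)+
   then show ?thesis using b(4,6) xy by metis
  qed
  then show "B +>\<^bsub>A\<^esub> x = B +>\<^bsub>A\<^esub> y"
   using coset_mem_iff[OF assms(1-3)] coset_mem_iff[OF assms(1,2,4)] by blast
 qed
qed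

lemma coset_self:
 assumes "module R A" "submodule B R A" "x : carrier A"
 shows "x : B +>\<^bsub>A\<^esub> x"
 using coset_eq_iff[OF assms assms(3)] coset_mem_iff[OF assms] assms(3) by blast

lemma coset_zero:
 assumes "module R A" "submodule B R A" "x : carrier A"
 shows "B +>\<^bsub>A\<^esub> x = B \<longleftrightarrow> x : B"
proof -
 interpret module R A by fact
 have "B +>\<^bsub>A\<^esub> 0[A] = B" by (rule M.a_coset_add_zero[OF submodD(1)[OF assms(2,1)]])
 moreover have "x -[A] 0[A] = x" using assms(3) by - (rule ab_eqI[of A], simp add: M.ab_rules)
 ultimately show ?thesis using coset_eq_iff[OF assms M.zero_closed] by simp
qed

lemma coset_add:
 assumes "module R A" "submodule B R A" "x : carrier A" "y : carrier A"
 shows "(B +>\<^bsub>A\<^esub> x) <+>\<^bsub>A\<^esub> (B +>\<^bsub>A\<^esub> y) = B +>\<^bsub>A\<^esub> (x +[A] y)"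
proof -
 interpret module R A by fact
 interpret abelian_subgroup B A
  using submodule.axioms(1)[OF assms(2)]
  by (intro abelian_subgroupI3) (auto simp: additive_subgroup_def M.abelian_group_axioms)
 show ?thesis using a_rcos_sum assms by simp
qed

lemma coset_smult:
 assumes "module R A" "submodule B R A" "x : carrier A" "r : carrier R"
 shows "B <+>\<^bsub>A\<^esub> ((%x. r *[A] x) ` (B +>\<^bsub>A\<^esub> x)) = B +>\<^bsub>A\<^esub> (r *[A] x)"
proof -
 interpret module R A by fact
 note b = submodD[OF assms(2,1)]
 show ?thesis
 proof (intro equalityI subsetI)
  fix y assume "y : B <+>\<^bsub>A\<^esub> ((%x. r *[A] x) ` (B +>\<^bsub>A\<^esub> x))"
  then obtain c d where cd: "c : B" "d : B" "y = c +[A] r *[A] (d +[A] x)"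
   by (auto simp: set_add_def set_mult_def a_r_coset_def r_coset_def)
  then have "y = (c +[A] r *[A] d) +[A] r *[A] x"
   using assms(3,4) b(2) by (simp add: smult_r_distr M.a_assoc)
  moreover have "c +[A] r *[A] d : B" using cd b(4,7) assms(4) by simp
  ultimately show "y : B +>\<^bsub>A\<^esub> (r *[A] x)" by (auto simp: a_r_coset_def r_coset_def)
 next
  fix y assume "y : B +>\<^bsub>A\<^esub> (r *[A] x)"
  then obtain c where "c : B" "y = c +[A] r *[A] x"
   by (auto simp: a_r_coset_def r_coset_def)
  then show "y : B <+>\<^bsub>A\<^esub> ((%x. r *[A] x) ` (B +>\<^bsub>A\<^esub> x))"
   using coset_self[OF assms(1-3)] by (auto simp: set_add_def set_mult_def)
 qed
qed

lemma subquot_simps: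
 "carrier (subquot A Z B) = (%z. B +>\<^bsub>A\<^esub> z) ` Z" "0[subquot A Z B] = B"
 by (simp_all add: subquot_def)

lemma subquot_ops:
 assumes "module R A" "submodule B R A"
 shows "x : carrier A ==> y : carrier A ==>
   (B +>\<^bsub>A\<^esub> x) +[subquot A Z B] (B +>\<^bsub>A\<^esub> y) = B +>\<^bsub>A\<^esub> (x +[A] y)"
  and "r : carrier R ==> x : carrier A ==>
   r *[subquot A Z B] (B +>\<^bsub>A\<^esub> x) = B +>\<^bsub>A\<^esub> (r *[A] x)"
 using coset_add[OF assms] coset_smult[OF assms] by (simp_all add: subquot_def)

lemma module_subquot:
 assumes "module R A" "submodule Z R A" "submodule B R A" "B <= Z"
 shows "module R (subquot A Z B)"
proof -
 interpret module R A by fact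
 note z = submodD[OF assms(2,1)]
 have zero: "B = B +>\<^bsub>A\<^esub> 0[A]" using submodD(1)[OF assms(3,1)] by simp
 let ?Q = "subquot A Z B"
 note sm = z subquot_ops[OF assms(1,3)]
 have E: "EX a. a : Z & x = B +>\<^bsub>A\<^esub> a" if "x : carrier ?Q" for x
  using that unfolding subquot_simps(1) by blast
 have I: "B +>\<^bsub>A\<^esub> a : carrier ?Q" if "a : Z" for a
  using that unfolding subquot_simps(1) by blast
 show ?thesis
 proof (rule moduleI)
  show "cring R" by (rule R.cring_axioms)
  show "abelian_group ?Q"
  proof (rule abelian_groupI)
   show "0[?Q] : carrier ?Q" using zero I[OF z(3)] by (simp add: subquot_simps(2))
  next
   fix x y assume "x : carrier ?Q" "y : carrier ?Q"
   then obtain a b where ab: "a : Z" "x = B +>\<^bsub>A\<^esub> a" "b : Z" "y = B +>\<^bsub>A\<^esub> b" using E by metis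
   then show "x +[?Q] y : carrier ?Q" using I[OF z(4)[OF ab(1,3)]] by (simp add: sm(2) sm(8))
   show "x +[?Q] y = y +[?Q] x" using ab by (simp add: sm(2) sm(8) M.a_comm)
  next
   fix x y w assume "x : carrier ?Q" "y : carrier ?Q" "w : carrier ?Q"
   then obtain a b c where "a : Z" "x = B +>\<^bsub>A\<^esub> a" "b : Z" "y = B +>\<^bsub>A\<^esub> b" "c : Z" "w = B +>\<^bsub>A\<^esub> c"
    using E by metis
   then show "x +[?Q] y +[?Q] w = x +[?Q] (y +[?Q] w)" by (simp add: sm(2) sm(8) M.a_assoc)
  next
   fix x assume "x : carrier ?Q"
   then obtain a where a: "a : Z" "x = B +>\<^bsub>A\<^esub> a" using E by metis
   have z0: "0[?Q] = B +>\<^bsub>A\<^esub> 0[A]" using zero by (simp only: subquot_simps(2))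
   show "0[?Q] +[?Q] x = x" unfolding z0 using a by (simp add: sm(2) sm(8) del: M.a_coset_add_zero)
   have "(B +>\<^bsub>A\<^esub> (-[A] a)) +[?Q] x = 0[?Q]"
    unfolding z0 using a by (simp add: sm(2) sm(8) M.l_neg del: M.a_coset_add_zero)
   then show "EX y:carrier ?Q. y +[?Q] x = 0[?Q]" using I[OF z(5)[OF a(1)]] by blast
  qed
 next
  fix r t x assume r: "r : carrier R" "t : carrier R" "x : carrier ?Q"
  then obtain a where a: "a : Z" "x = B +>\<^bsub>A\<^esub> a" using E by metis
  show "(r +[R] t) *[?Q] x = r *[?Q] x +[?Q] t *[?Q] x"
   using a r by (simp add: sm(2) sm(8,9) smult_l_distr)
  show "(r \<otimes>\<^bsub>R\<^esub> t) *[?Q] x = r *[?Q] (t *[?Q] x)"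
   using a r by (simp add: sm(2) sm(8,9) smult_assoc1)
 next
  fix r x y assume r: "r : carrier R" "x : carrier ?Q" "y : carrier ?Q"
  then obtain a b where "a : Z" "x = B +>\<^bsub>A\<^esub> a" "b : Z" "y = B +>\<^bsub>A\<^esub> b" using E by metis
  then show "r *[?Q] (x +[?Q] y) = r *[?Q] x +[?Q] r *[?Q] y"
   using r by (simp add: sm(2) sm(8,9) smult_r_distr)
 next
  fix r x assume r: "r : carrier R" "x : carrier ?Q"
  then obtain a where a: "a : Z" "x = B +>\<^bsub>A\<^esub> a" using E by metis
  then show "r *[?Q] x : carrier ?Q" using I[OF z(7)[OF r(1) a(1)]] r by (simp add: sm(2) sm(9))
 next
  fix x assume r: "x : carrier ?Q"
  then obtain a where a: "a : Z" "x = B +>\<^bsub>A\<^esub> a" using E by metis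
  then show "1[R] *[?Q] x = x" by (simp add: sm(2) sm(9))
 qed
qed

lemma subquot_proj_hom:
 assumes "module R A" "submodule Z R A" "submodule B R A"
 shows "(%z. B +>\<^bsub>A\<^esub> z) : mod_hom R (A(|carrier := Z|)) (subquot A Z B)"
 using submodD[OF assms(2,1)] subquot_ops[OF assms(1,3)]
 by (intro mod_homI) (auto simp: subquot_simps)

text \<open>Isomorphisms of subquotients are given by additive relations; a chain of zigzags is
 a relation long before it is a map.\<close>

lemma subquot_iso_rel:
 assumes A: "module R A" "submodule Z R A" "submodule B R A"
  and A': "module R A'" "submodule Z' R A'" "submodule B' R A'"
  and sub: "!!z z'. S z z' ==> z : Z & z' : Z'"
  and add: "!!z z' y y'. S z z' ==> S y y' ==> S (z +[A] y) (z' +[A'] y')"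
  and smult: "!!r z z'. r : carrier R ==> S z z' ==> S (r *[A] z) (r *[A'] z')"
  and ex1: "!!z. z : Z ==> EX z'. S z z'" and ex2: "!!z'. z' : Z' ==> EX z. S z z'"
  and ker: "!!z z'. S z z' ==> z : B \<longleftrightarrow> z' : B'"
 shows "EX f:mod_hom R (subquot A Z B) (subquot A' Z' B').
   bij_betw f (carrier (subquot A Z B)) (carrier (subquot A' Z' B')) &
   (ALL z z'. S z z' --> f (B +>\<^bsub>A\<^esub> z) = B' +>\<^bsub>A'\<^esub> z')"
proof -
 interpret R: cring R using module_cring[OF A(1)] .
 note z = submodD[OF A(2,1)] and z' = submodD[OF A'(2,1)]
 \<comment> \<open>Differences come from sums and the scalar \<open>-1\<close>, which keeps the
   hypotheses on \<open>S\<close> down to sums and multiples.\<close>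
 have minus: "S (z -[A] y) (z' -[A'] y')" if "S z z'" "S y y'" for z z' y y'
 proof -
  have c: "y : carrier A" "y' : carrier A'" using sub[OF that(2)] z(2) z'(2) by blast+
  have "(-[R] 1[R]) *[A] y = -[A] y" "(-[R] 1[R]) *[A'] y' = -[A'] y'"
   using module.smult_l_minus[OF A(1) R.one_closed c(1)] module.smult_one[OF A(1) c(1)]
    module.smult_l_minus[OF A'(1) R.one_closed c(2)] module.smult_one[OF A'(1) c(2)] by metis+
  then show ?thesis
   using add[OF that(1) smult[OF R.a_inv_closed[OF R.one_closed] that(2)]]
   unfolding a_minus_def by metis
 qed
 define s where "s z = (SOME z'. S z z')" for z
 have s: "S z (s z)" if "z : Z" for z using someI_ex[OF ex1[OF that]] by (simp add: s_def)
 \<comment> \<open>Read from left to right this makes the map well defined, read from right to left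
   it makes it injective.\<close>
 have wd: "B +>\<^bsub>A\<^esub> z = B +>\<^bsub>A\<^esub> y \<longleftrightarrow> B' +>\<^bsub>A'\<^esub> z' = B' +>\<^bsub>A'\<^esub> y'" if "S z z'" "S y y'" for z z' y y'
  using coset_eq_iff[OF A(1,3)] coset_eq_iff[OF A'(1,3)] ker[OF minus[OF that]]
   sub[OF that(1)] sub[OF that(2)] z(2) z'(2) by simp
 define f where "f X = B' +>\<^bsub>A'\<^esub> s (SOME z. z : Z & X = B +>\<^bsub>A\<^esub> z)" for X
 have f: "f (B +>\<^bsub>A\<^esub> z) = B' +>\<^bsub>A'\<^esub> z'" if "S z z'" for z z'
 proof -
  let ?y = "SOME y. y : Z & B +>\<^bsub>A\<^esub> z = B +>\<^bsub>A\<^esub> y"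
  have "EX y. y : Z & B +>\<^bsub>A\<^esub> z = B +>\<^bsub>A\<^esub> y" using sub[OF that] by blast
  from someI_ex[OF this] have y: "?y : Z" "B +>\<^bsub>A\<^esub> z = B +>\<^bsub>A\<^esub> ?y" by (rule conjunct1, rule conjunct2)
  have "B' +>\<^bsub>A'\<^esub> z' = B' +>\<^bsub>A'\<^esub> s ?y" using wd[OF that s[OF y(1)]] y(2) by blast
  then show ?thesis by (simp only: f_def)
 qed
 have car: "carrier (subquot A Z B) = (%z. B +>\<^bsub>A\<^esub> z) ` Z"
  "carrier (subquot A' Z' B') = (%z. B' +>\<^bsub>A'\<^esub> z) ` Z'" by (simp_all add: subquot_simps)
 have fs: "f (B +>\<^bsub>A\<^esub> z) = B' +>\<^bsub>A'\<^esub> s z" if "z : Z" for z using f[OF s[OF that]] .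
 have sZ: "s z : Z'" if "z : Z" for z using sub[OF s[OF that]] by blast
 have "f : mod_hom R (subquot A Z B) (subquot A' Z' B')"
 proof (rule mod_homI)
  fix x y assume "x : carrier (subquot A Z B)" "y : carrier (subquot A Z B)"
  then obtain a b where ab: "a : Z" "b : Z" "x = B +>\<^bsub>A\<^esub> a" "y = B +>\<^bsub>A\<^esub> b" by (auto simp: car)
  then show "f (x +[subquot A Z B] y) = f x +[subquot A' Z' B'] f y"
   using f[OF add[OF s[OF ab(1)] s[OF ab(2)]]] z(2) z'(2) sZ
   by (simp add: subquot_ops[OF A(1,3)] subquot_ops[OF A'(1,3)] fs)
 next
  fix r x assume r: "r : carrier R" and "x : carrier (subquot A Z B)"
  then obtain a where ab: "a : Z" "x = B +>\<^bsub>A\<^esub> a" by (auto simp: car)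
  then show "f (r *[subquot A Z B] x) = r *[subquot A' Z' B'] f x"
   using f[OF smult[OF r s[OF ab(1)]]] z(2) z'(2) sZ r
   by (simp add: subquot_ops[OF A(1,3)] subquot_ops[OF A'(1,3)] fs)
 qed (auto simp: car fs sZ)
 moreover have "bij_betw f (carrier (subquot A Z B)) (carrier (subquot A' Z' B'))"
  unfolding bij_betw_def
 proof
  show "inj_on f (carrier (subquot A Z B))"
  proof (rule inj_onI)
   fix x y assume xy: "x : carrier (subquot A Z B)" "y : carrier (subquot A Z B)" "f x = f y"
   obtain a b where ab: "a : Z" "x = B +>\<^bsub>A\<^esub> a" "b : Z" "y = B +>\<^bsub>A\<^esub> b"
    using xy(1,2) unfolding car by blast
   then have "B' +>\<^bsub>A'\<^esub> s a = B' +>\<^bsub>A'\<^esub> s b" using xy(3) fs by metis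
   then show "x = y" using wd[OF s[OF ab(1)] s[OF ab(3)]] ab by blast
  qed
  show "f ` carrier (subquot A Z B) = carrier (subquot A' Z' B')"
  proof
   show "f ` carrier (subquot A Z B) <= carrier (subquot A' Z' B')" by (auto simp: car fs sZ)
   show "carrier (subquot A' Z' B') <= f ` carrier (subquot A Z B)"
   proof
    fix y assume "y : carrier (subquot A' Z' B')"
    then obtain y' where y: "y' : Z'" "y = B' +>\<^bsub>A'\<^esub> y'" by (auto simp: car)
    obtain x where x: "S x y'" using ex2[OF y(1)] by blast
    then show "y : f ` carrier (subquot A Z B)"
     using f[OF x] sub[OF x] y by (auto simp: car)
   qed
  qed
 qed
 ultimately show ?thesis using f by blast
qed

lemma mod_iso_subquot_rel:
 assumes "module R A" "submodule Z R A" "submodule B R A"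
  and "module R A'" "submodule Z' R A'" "submodule B' R A'"
  and "!!z z'. S z z' ==> z : Z & z' : Z'"
  and "!!z z' y y'. S z z' ==> S y y' ==> S (z +[A] y) (z' +[A'] y')"
  and "!!r z z'. r : carrier R ==> S z z' ==> S (r *[A] z) (r *[A'] z')"
  and "!!z. z : Z ==> EX z'. S z z'" and "!!z'. z' : Z' ==> EX z. S z z'"
  and "!!z z'. S z z' ==> z : B \<longleftrightarrow> z' : B'"
 shows "mod_iso R (subquot A Z B) (subquot A' Z' B')"
proof -
 have "EX f:mod_hom R (subquot A Z B) (subquot A' Z' B').
   bij_betw f (carrier (subquot A Z B)) (carrier (subquot A' Z' B')) &
   (ALL z z'. S z z' --> f (B +>\<^bsub>A\<^esub> z) = B' +>\<^bsub>A'\<^esub> z')"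
  by (rule subquot_iso_rel) (fact assms)+
 then show ?thesis unfolding mod_iso_def by blast
qed

lemma mod_hom_comp: "f : mod_hom R A B ==> g : mod_hom R B C ==> (%x. g (f x)) : mod_hom R A C"
 by (intro mod_homI) (auto simp: mod_homD)

lemma mod_iso_trans:
 assumes "mod_iso R A B" "mod_iso R B C"
 shows "mod_iso R A C"
proof -
 obtain f g where f: "f : mod_hom R A B" "bij_betw f (carrier A) (carrier B)"
  and g: "g : mod_hom R B C" "bij_betw g (carrier B) (carrier C)"
  using assms unfolding mod_iso_def by blast
 have "bij_betw (%x. g (f x)) (carrier A) (carrier C)"
  using bij_betw_trans[OF f(2) g(2)] by (simp add: comp_def)
 then show ?thesis using mod_hom_comp[OF f(1) g(1)] unfolding mod_iso_def by blast
qed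

lemma mod_hom_inverse:
 assumes f: "f : mod_hom R A B" "bij_betw f (carrier A) (carrier B)"
  and A: "module R A"
 shows "inv_into (carrier A) f : mod_hom R B A"
  "bij_betw (inv_into (carrier A) f) (carrier B) (carrier A)"
proof -
 interpret module R A by fact
 let ?g = "inv_into (carrier A) f"
 have g: "?g y : carrier A" "f (?g y) = y" if "y : carrier B" for y
  using that f(2) by (auto simp: bij_betw_def inv_into_into f_inv_into_f)
 have gf: "?g (f x) = x" if "x : carrier A" for x
  using that f(2) by (auto simp: bij_betw_def)
 show "bij_betw ?g (carrier B) (carrier A)" using f(2) by (rule bij_betw_inv_into)
 show "?g : mod_hom R B A"
 proof (rule mod_homI)
  show "?g (x +[B] y) = ?g x +[A] ?g y" if "x : carrier B" "y : carrier B" for x y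
   using gf[of "?g x +[A] ?g y"] g that by (simp add: mod_homD(2)[OF f(1)])
  show "?g (r *[B] x) = r *[A] ?g x" if "r : carrier R" "x : carrier B" for r x
   using gf[of "r *[A] ?g x"] g that by (simp add: mod_homD(3)[OF f(1)])
 qed (use g in auto)
qed

lemma mod_iso_sym: "mod_iso R A B ==> module R A ==> mod_iso R B A"
 unfolding mod_iso_def using mod_hom_inverse by blast

section \<open>Modules of functions and of morphisms\<close>

text \<open>Extensional functions, so that equality is equality of values. The fibre
  \<open>N i\<close> may vary: a constant family gives cochains, a varying one the total modules of
  a double complex.\<close>

definition fun_mod :: "'i set => ('i => ('r, 'a) module) => ('r, 'i => 'a) module" where
 "fun_mod I N = (|carrier = (\<Pi>\<^sub>E i\<in>I. carrier (N i)), monoid.mult = undefined, one = undefined,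
   zero = (\<lambda>i\<in>I. 0[N i]), add = (%f g. \<lambda>i\<in>I. f i +[N i] g i),
   smult = (%r f. \<lambda>i\<in>I. r *[N i] f i)|)"

lemma fun_mod_simps [simp]:
 "carrier (fun_mod I N) = (\<Pi>\<^sub>E i\<in>I. carrier (N i))"
 "0[fun_mod I N] = (\<lambda>i\<in>I. 0[N i])"
 "f +[fun_mod I N] g = (\<lambda>i\<in>I. f i +[N i] g i)"
 "r *[fun_mod I N] f = (\<lambda>i\<in>I. r *[N i] f i)"
 by (simp_all add: fun_mod_def)

lemma restrict_eqI: "f : extensional I ==> (!!i. i : I ==> g i = f i) ==> restrict g I = f"
 by (rule extensionalityI) auto

lemma module_fun_mod:
 assumes "cring R" and N: "!!i. i : I ==> module R (N i)"
 shows "module R (fun_mod I N)"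
proof -
 let ?F = "fun_mod I N"
 have c: "f i : carrier (N i)" if "f : carrier ?F" "i : I" for f i using that by auto
 have e: "f : extensional I" if "f : carrier ?F" for f using that by (auto simp: PiE_def)
 have in_F: "(\<lambda>i\<in>I. h i) : carrier ?F" if "!!i. i : I ==> h i : carrier (N i)" for h using that by auto
 note eqs = fun_mod_simps(2-4)
 note a = module_ag[OF N]
 show ?thesis
 proof (rule moduleI)
  show "cring R" by fact
  show "abelian_group ?F"
  proof (rule abelian_groupI)
   show "0[?F] : carrier ?F" unfolding eqs by (rule in_F) (simp add: ag a)
  next
   fix x y assume xy: "x : carrier ?F" "y : carrier ?F"
   show "x +[?F] y : carrier ?F" unfolding eqs by (rule in_F) (simp add: ag a c[OF xy(1)] c[OF xy(2)] xy)
   show "x +[?F] y = y +[?F] x" unfolding eqs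
    by (rule restrict_ext) (rule abelian_group.ag_comm[OF a c[OF xy(1)] c[OF xy(2)]])
  next
   fix x y z assume xy: "x : carrier ?F" "y : carrier ?F" "z : carrier ?F"
   show "x +[?F] y +[?F] z = x +[?F] (y +[?F] z)" unfolding eqs
    by (rule restrict_ext) (simp add: abelian_group.ag_assoc[OF a] c[OF xy(1)] c[OF xy(2)] c[OF xy(3)] xy)
  next
   fix x assume x: "x : carrier ?F"
   show "0[?F] +[?F] x = x" unfolding eqs
    by (rule restrict_eqI[OF e[OF x]]) (simp add: ag a c[OF x] x)
   have "(\<lambda>i\<in>I. -[N i] x i) +[?F] x = 0[?F]" unfolding eqs
    by (rule restrict_ext) (simp add: ag a c[OF x] x)
   moreover have "(\<lambda>i\<in>I. -[N i] x i) : carrier ?F" by (rule in_F) (simp add: ag a c[OF x] x)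
   ultimately show "EX y:carrier ?F. y +[?F] x = 0[?F]" by blast
  qed
 next
  fix r x assume x: "r : carrier R" "x : carrier ?F"
  show "r *[?F] x : carrier ?F" unfolding eqs
   by (rule in_F) (simp add: module.smult_closed[OF N] c[OF x(2)] x)
 next
  fix r t x assume x: "r : carrier R" "t : carrier R" "x : carrier ?F"
  show "(r +[R] t) *[?F] x = r *[?F] x +[?F] t *[?F] x" unfolding eqs
   by (rule restrict_ext) (simp add: module.smult_l_distr[OF N] c[OF x(3)] x)
  show "(r \<otimes>\<^bsub>R\<^esub> t) *[?F] x = r *[?F] (t *[?F] x)" unfolding eqs
   by (rule restrict_ext) (simp add: module.smult_assoc1[OF N] c[OF x(3)] x)
 next
  fix r x y assume x: "r : carrier R" "x : carrier ?F" "y : carrier ?F"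
  show "r *[?F] (x +[?F] y) = r *[?F] x +[?F] r *[?F] y" unfolding eqs
   by (rule restrict_ext) (simp add: module.smult_r_distr[OF N] c[OF x(2)] c[OF x(3)] x)
 next
  fix x assume x: "x : carrier ?F"
  show "1[R] *[?F] x = x" unfolding eqs
   by (rule restrict_eqI[OF e[OF x]]) (simp add: module.smult_one[OF N] c[OF x] x)
 qed
qed

lemma fun_mod_inv:
 assumes "cring R" and N: "!!i. i : I ==> module R (N i)" and f: "f : (\<Pi>\<^sub>E i\<in>I. carrier (N i))"
 shows "-[fun_mod I N] f = (\<lambda>i\<in>I. -[N i] f i)"
proof (rule abelian_group.minus_equality[OF module_ag[OF module_fun_mod[OF assms(1,2)]]])
 have fi: "f i : carrier (N i)" if "i : I" for i using f that by auto
 show "f : carrier (fun_mod I N)" using f by simp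
 show "(\<lambda>i\<in>I. -[N i] f i) : carrier (fun_mod I N)"
  unfolding fun_mod_simps(1) by (simp add: restrict_PiE_iff ag module_ag[OF N] fi)
 show "(\<lambda>i\<in>I. -[N i] f i) +[fun_mod I N] f = 0[fun_mod I N]"
  unfolding fun_mod_simps(2,3) by (rule restrict_ext) (simp add: ag module_ag[OF N] fi)
qed

lemma fun_mod_minus:
 assumes "cring R" and N: "!!i. i : I ==> module R (N i)"
  and f: "f : (\<Pi>\<^sub>E i\<in>I. carrier (N i))" "g : (\<Pi>\<^sub>E i\<in>I. carrier (N i))"
 shows "f -[fun_mod I N] g = (\<lambda>i\<in>I. f i -[N i] g i)"
proof -
 have "-[fun_mod I N] g = (\<lambda>i\<in>I. -[N i] g i)" by (rule fun_mod_inv[OF assms(1) N f(2)])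
 then show ?thesis unfolding a_minus_def by (auto intro!: restrict_ext)
qed

subsection \<open>Left modules\<close>

lemma left_moduleD:
 assumes "left_module C R M"
 shows "x : Obj C ==> module R (mod_at M x)"
  and "x : Obj C ==> y : Obj C ==> f : Hom C x y ==> mod_map M x y f : mod_hom R (mod_at M x) (mod_at M y)"
  and "x : Obj C ==> a : el M x ==> mod_map M x x (Id C x) a = a"
  and "x : Obj C ==> y : Obj C ==> z : Obj C ==> f : Hom C x y ==> g : Hom C y z ==>
   a : el M x ==> mod_map M x z (Comp C g f) a = mod_map M y z g (mod_map M x y f a)"
  and "x : Obj C ==> abelian_group (mod_at M x)"
  and "x : Obj C ==> y : Obj C ==> f : Hom C x y ==> a : el M x ==>
   mod_map M x y f a : el M y"
 using assms unfolding left_module_def by (blast intro: mod_homD(1) module_ag)+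

lemma left_moduleI:
 assumes "!!x. x : Obj C ==> module R (mod_at M x)"
  and "!!x y f. x : Obj C ==> y : Obj C ==> f : Hom C x y ==>
   mod_map M x y f : mod_hom R (mod_at M x) (mod_at M y)"
  and "!!x a. x : Obj C ==> a : el M x ==> mod_map M x x (Id C x) a = a"
  and "!!x y z f g a. x : Obj C ==> y : Obj C ==> z : Obj C ==> f : Hom C x y ==> g : Hom C y z ==>
   a : el M x ==> mod_map M x z (Comp C g f) a = mod_map M y z g (mod_map M x y f a)"
 shows "left_module C R M"
 using assms unfolding left_module_def by blast

lemma rc_homD:
 assumes "\<eta> : rc_hom C R M N"
 shows "x : Obj C ==> \<eta> x : mod_hom R (mod_at M x) (mod_at N x)"
  and "x : Obj C ==> y : Obj C ==> f : Hom C x y ==> a : el M x ==>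
    \<eta> y (mod_map M x y f a) = mod_map N x y f (\<eta> x a)"
  and "x : Obj C ==> a : el M x ==> \<eta> x a : el N x"
 using assms unfolding rc_hom_def by (blast intro: mod_homD(1))+

lemma rc_homI:
 assumes "!!x. x : Obj C ==> \<eta> x : mod_hom R (mod_at M x) (mod_at N x)"
  and "!!x y f a. x : Obj C ==> y : Obj C ==> f : Hom C x y ==> a : el M x ==>
    \<eta> y (mod_map M x y f a) = mod_map N x y f (\<eta> x a)"
 shows "\<eta> : rc_hom C R M N"
 using assms unfolding rc_hom_def by blast

lemma rc_hom_comp:
 assumes "\<eta> : rc_hom C R M N" "\<theta> : rc_hom C R N K"
 shows "(%x a. \<theta> x (\<eta> x a)) : rc_hom C R M K"
 by (intro rc_homI mod_hom_comp[OF rc_homD(1)[OF assms(1)] rc_homD(1)[OF assms(2)]])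
  (simp_all add: rc_homD(2,3)[OF assms(1)] rc_homD(2)[OF assms(2)])

lemma rc_hom_zero:
 assumes "left_module C R M" "left_module C R N"
 shows "(%x a. 0[mod_at N x]) : rc_hom C R M N"
proof -
 have "mod_map N x y f 0[mod_at N x] = 0[mod_at N y]"
  if "x : Obj C" "y : Obj C" "f : Hom C x y" for x y f
  using mod_hom_zero[OF left_moduleD(2)[OF assms(2)] left_moduleD(5)[OF assms(2)] left_moduleD(5)[OF assms(2)]] that by blast
 then show ?thesis
  by (intro rc_homI mod_homI)
   (auto simp: ag left_moduleD(5)[OF assms(2)] module.smult_r_null[OF left_moduleD(1)[OF assms(2)]])
qed

lemma rc_hom_add:
 assumes "left_module C R M" "left_module C R N" "\<eta> : rc_hom C R M N" "\<theta> : rc_hom C R M N"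
 shows "(%x a. \<eta> x a +[mod_at N x] \<theta> x a) : rc_hom C R M N"
proof (rule rc_homI)
 note h = mod_homD[OF rc_homD(1)[OF assms(3)]] mod_homD[OF rc_homD(1)[OF assms(4)]]
 note g = left_moduleD(5)[OF assms(2)]
 fix x assume x: "x : Obj C"
 interpret abelian_group "mod_at N x" by (rule g[OF x])
 show "(%a. \<eta> x a +[mod_at N x] \<theta> x a) : mod_hom R (mod_at M x) (mod_at N x)"
  by (rule mod_homI) (simp_all add: h x a_ac module.smult_r_distr[OF left_moduleD(1)[OF assms(2) x]])
next
 fix x y f a assume "x : Obj C" "y : Obj C" "f : Hom C x y" "a : el M x"
 then show "\<eta> y (mod_map M x y f a) +[mod_at N y] \<theta> y (mod_map M x y f a)
   = mod_map N x y f (\<eta> x a +[mod_at N x] \<theta> x a)"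
  using mod_homD(2)[OF left_moduleD(2)[OF assms(2)]] rc_homD(2,3)[OF assms(3)] rc_homD(2,3)[OF assms(4)]
  by simp
qed

lemma rc_hom_smult:
 assumes "left_module C R M" "left_module C R N" "\<eta> : rc_hom C R M N" "r : carrier R"
 shows "(%x a. r *[mod_at N x] \<eta> x a) : rc_hom C R M N"
proof (rule rc_homI)
 note h = mod_homD[OF rc_homD(1)[OF assms(3)]]
 fix x assume x: "x : Obj C"
 have N: "module R (mod_at N x)" by (rule left_moduleD(1)[OF assms(2) x])
 interpret R: cring R using module_cring[OF N] .
 show "(%a. r *[mod_at N x] \<eta> x a) : mod_hom R (mod_at M x) (mod_at N x)"
 proof (rule mod_homI)
  fix s a assume "s : carrier R" "a : el M x"
  then show "r *[mod_at N x] \<eta> x (s *[mod_at M x] a) = s *[mod_at N x] (r *[mod_at N x] \<eta> x a)"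
   using h x assms(4) module.smult_assoc1[OF N] R.m_comm by metis
 qed (simp_all add: h x assms(4) module.smult_closed[OF N] module.smult_r_distr[OF N])
next
 fix x y f a assume "x : Obj C" "y : Obj C" "f : Hom C x y" "a : el M x"
 then show "r *[mod_at N y] \<eta> y (mod_map M x y f a) = mod_map N x y f (r *[mod_at N x] \<eta> x a)"
  using mod_homD(3)[OF left_moduleD(2)[OF assms(2)]] rc_homD(2,3)[OF assms(3)] assms(4) by simp
qed

lemma rc_hom_cong:
 assumes "left_module C R M" "\<eta> : rc_hom C R M N"
  and "!!x a. x : Obj C ==> a : el M x ==> \<theta> x a = \<eta> x a"
 shows "\<theta> : rc_hom C R M N"
proof (rule rc_homI)
 fix x assume x: "x : Obj C"
 show "\<theta> x : mod_hom R (mod_at M x) (mod_at N x)"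
  by (rule mod_homI) (simp_all add: mod_homD[OF rc_homD(1)[OF assms(2) x]] assms(3) x
   ag left_moduleD(5)[OF assms(1)] module.smult_closed[OF left_moduleD(1)[OF assms(1)]])
qed (simp add: assms(3) left_moduleD(6)[OF assms(1)] rc_homD(2)[OF assms(2)])

text \<open>Morphisms are a restriction of an iterated function module, so the module axioms hold
  pointwise and only closure of the carrier is left to show.\<close>

lemma hom_module_eq:
 "hom_module C R P M = (fun_mod (Obj C) (%x. fun_mod (el P x) (%_. mod_at M x)))
   (|carrier := carrier (hom_module C R P M)|)"
 by (simp add: hom_module_def fun_mod_def)

lemma hom_module_simps:
 "0[hom_module C R P M] = (\<lambda>x\<in>Obj C. \<lambda>a\<in>el P x. 0[mod_at M x])"
 "\<eta> +[hom_module C R P M] \<theta> = (\<lambda>x\<in>Obj C. \<lambda>a\<in>el P x. \<eta> x a +[mod_at M x] \<theta> x a)"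
 "r *[hom_module C R P M] \<eta> = (\<lambda>x\<in>Obj C. \<lambda>a\<in>el P x. r *[mod_at M x] \<eta> x a)"
 by (simp_all add: hom_module_def)

text \<open>Normal form of a morphism: off the objects and elements where its values matter it
  becomes \<open>undefined\<close>, as \<open>hom_module\<close> demands of its elements.\<close>

definition rest :: "('o, 'm) cat => ('o, 'm, 'r, 'u) rcmod => ('o => 'u => 'a) => 'o => 'u => 'a" where
 "rest C P \<eta> = (\<lambda>x\<in>Obj C. \<lambda>a\<in>el P x. \<eta> x a)"

lemma rest_apply [simp]: "x : Obj C ==> a : el P x ==> rest C P \<eta> x a = \<eta> x a"
 by (simp add: rest_def)

lemma hom_moduleD:
 assumes "\<eta> : carrier (hom_module C R P M)"
 shows "\<eta> : rc_hom C R P M" "\<eta> : extensional (Obj C)"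
  "x : Obj C ==> \<eta> x : extensional (el P x)" "rest C P \<eta> = \<eta>"
proof -
 show 1: "\<eta> : rc_hom C R P M" "\<eta> : extensional (Obj C)"
  "!!x. x : Obj C ==> \<eta> x : extensional (el P x)"
  using assms by (auto simp: hom_module_def PiE_def)
 show "rest C P \<eta> = \<eta>" unfolding rest_def
  by (intro restrict_eqI 1) auto
qed

lemma rest_in_hom_module:
 assumes "left_module C R P" "\<eta> : rc_hom C R P M"
 shows "rest C P \<eta> : carrier (hom_module C R P M)"
 using rc_hom_cong[OF assms, of "rest C P \<eta>"] by (auto simp: hom_module_def rest_def)

lemma hom_module_eqI:
 assumes "\<eta> : carrier (hom_module C R P M)" "\<theta> : carrier (hom_module C R P M)"
  and "!!x a. x : Obj C ==> a : el P x ==> \<eta> x a = \<theta> x a"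
 shows "\<eta> = \<theta>"
proof -
 have "rest C P \<eta> = rest C P \<theta>" unfolding rest_def by (intro restrict_ext assms(3))
 then show ?thesis using hom_moduleD(4)[OF assms(1)] hom_moduleD(4)[OF assms(2)] by simp
qed

lemma rest_eqI:
 assumes "\<theta> : carrier (hom_module C R P M)"
  and "!!x a. x : Obj C ==> a : el P x ==> \<eta> x a = \<theta> x a"
 shows "rest C P \<eta> = \<theta>"
proof -
 have "rest C P \<eta> = rest C P \<theta>" unfolding rest_def by (intro restrict_ext assms(2))
 then show ?thesis using hom_moduleD(4)[OF assms(1)] by simp
qed

lemma rest_cong:
 "(!!x a. x : Obj C ==> a : el P x ==> \<eta> x a = \<theta> x a) ==> rest C P \<eta> = rest C P \<theta>"
 unfolding rest_def by (intro restrict_ext)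

lemma hom_module_ops:
 "0[hom_module C R P M] = rest C P (%x a. 0[mod_at M x])"
 "\<eta> +[hom_module C R P M] \<theta> = rest C P (%x a. \<eta> x a +[mod_at M x] \<theta> x a)"
 "r *[hom_module C R P M] \<eta> = rest C P (%x a. r *[mod_at M x] \<eta> x a)"
 by (simp_all add: hom_module_simps rest_def)

lemma module_hom_module:
 assumes "cring R" "left_module C R P" "left_module C R M"
 shows "module R (hom_module C R P M)"
proof (subst hom_module_eq, rule module_restrict)
 let ?F = "fun_mod (Obj C) (%x. fun_mod (el P x) (%_. mod_at M x))"
 show F: "module R ?F" by (intro module_fun_mod assms left_moduleD(1)[OF assms(3)])
 have eq: "0[?F] = 0[hom_module C R P M]" "add ?F = add (hom_module C R P M)"
  "smult ?F = smult (hom_module C R P M)"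
  by (simp_all add: hom_module_def fun_mod_def)
 show "submodule (carrier (hom_module C R P M)) R ?F"
 proof (rule submodI[OF F])
  show "carrier (hom_module C R P M) <= carrier ?F"
  proof
   fix \<eta> assume e: "\<eta> : carrier (hom_module C R P M)"
   show "\<eta> : carrier ?F" unfolding fun_mod_simps(1)
    using hom_moduleD(2,3)[OF e] rc_homD(3)[OF hom_moduleD(1)[OF e]] by (auto simp: PiE_iff)
  qed
  show "0[?F] : carrier (hom_module C R P M)"
   unfolding eq hom_module_ops by (intro rest_in_hom_module assms rc_hom_zero)
  fix \<eta> \<theta> assume "\<eta> : carrier (hom_module C R P M)" "\<theta> : carrier (hom_module C R P M)"
  then show "\<eta> +[?F] \<theta> : carrier (hom_module C R P M)"
   unfolding eq hom_module_ops by (intro rest_in_hom_module assms rc_hom_add hom_moduleD(1))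
 next
  fix r \<eta> assume "r : carrier R" "\<eta> : carrier (hom_module C R P M)"
  then show "r *[?F] \<eta> : carrier (hom_module C R P M)"
   unfolding eq hom_module_ops by (intro rest_in_hom_module assms rc_hom_smult hom_moduleD(1))
 qed
qed

lemma hom_module_precomp:
 assumes "left_module C R P" "left_module C R Q" "left_module C R M" "d : rc_hom C R Q P"
 shows "(%\<eta>. rest C Q (%x a. \<eta> x (d x a))) : mod_hom R (hom_module C R P M) (hom_module C R Q M)"
proof (rule mod_homI)
 show "rest C Q (%x a. \<eta> x (d x a)) : carrier (hom_module C R Q M)"
  if "\<eta> : carrier (hom_module C R P M)" for \<eta>
  using that by (intro rest_in_hom_module rc_hom_comp[OF assms(4)] assms hom_moduleD(1))
qed (simp_all add: hom_module_ops rc_homD(3)[OF assms(4)] cong: rest_cong)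

lemma hom_module_postcomp:
 assumes "left_module C R P" "left_module C R M" "left_module C R N" "e : rc_hom C R M N"
 shows "(%\<eta>. rest C P (%x a. e x (\<eta> x a))) : mod_hom R (hom_module C R P M) (hom_module C R P N)"
proof (rule mod_homI)
 note h = mod_homD[OF rc_homD(1)[OF assms(4)]]
 show "rest C P (%x a. e x (\<eta> x a)) : carrier (hom_module C R P N)"
  if "\<eta> : carrier (hom_module C R P M)" for \<eta>
  using that by (intro rest_in_hom_module rc_hom_comp[OF _ assms(4)] assms hom_moduleD(1))
qed (simp_all add: hom_module_ops rc_homD(3)[OF hom_moduleD(1)] mod_homD(2,3)[OF rc_homD(1)[OF assms(4)]] cong: rest_cong)

lemma left_module_constant:
 assumes "cring R" "category C"
 shows "left_module C R (constant_module R)"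
proof -
 interpret R: cring R by fact
 have "module R (|carrier = carrier R, monoid.mult = monoid.mult R, one = one R,
           zero = zero R, add = add R, smult = monoid.mult R|)"
  by (rule moduleI, rule assms(1), rule abelian_groupI)
   (auto simp: R.a_ac R.l_distr R.r_distr R.m_assoc intro: R.l_neg R.a_inv_closed)
 then show ?thesis by (intro left_moduleI) (auto simp: constant_module_def intro: mod_homI)
qed

section \<open>Free modules and transport of structure\<close>

text \<open>Functions on the whole type, zero off a finite subset of \<open>T\<close>: such a
  function is recovered from the finite list of its nonzero values, which is what
  \<open>inj_finsupp\<close> encodes.\<close>

definition free_mod :: "('r, 's) ring_scheme => 't set => ('r, 't => 'r) module" where
 "free_mod R T = (|carrier = {g. range g <= carrier R & finite {t. g t ~= 0[R]} & {t. g t ~= 0[R]} <= T},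
   monoid.mult = undefined, one = undefined, zero = (%_. 0[R]),
   add = (%g h t. g t +[R] h t), smult = (%r g t. r \<otimes>\<^bsub>R\<^esub> g t)|)"

definition delta :: "('r, 's) ring_scheme => 't => 't => 'r" where
 "delta R t = (%s. if s = t then 1[R] else 0[R])"

definition lin_ext :: "('r, 's) ring_scheme => ('r, 'a) module => ('t => 'a) => ('t => 'r) => 'a" where
 "lin_ext R N v g = finsum N (%t. g t *[N] v t) {t. g t ~= 0[R]}"

lemma free_mod_simps:
 "g : carrier (free_mod R T) \<longleftrightarrow> range g <= carrier R & finite {t. g t ~= 0[R]} & {t. g t ~= 0[R]} <= T"
 "0[free_mod R T] = (%_. 0[R])"
 "g +[free_mod R T] h = (%t. g t +[R] h t)"
 "r *[free_mod R T] g = (%t. r \<otimes>\<^bsub>R\<^esub> g t)"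
 by (simp_all add: free_mod_def)

lemma free_mod_range: "g : carrier (free_mod R T) ==> g t : carrier R"
 by (auto simp: free_mod_simps)

lemma module_free_mod:
 assumes "cring R"
 shows "module R (free_mod R T)"
proof -
 interpret R: cring R by fact
 let ?F = "free_mod R T"
 note eqs = free_mod_simps(2-4)
 note [simp] = free_mod_range
 have I: "g : carrier ?F" if "!!t. g t : carrier R" "finite U" "U <= T" "!!t. t \<notin> U ==> g t = 0[R]" for g U
  using that finite_subset[of "{t. g t ~= 0[R]}" U] unfolding free_mod_simps(1) by blast
 have D: "finite {t. g t ~= 0[R]}" "{t. g t ~= 0[R]} <= T" if "g : carrier ?F" for g
  using that unfolding free_mod_simps(1) by blast+
 show ?thesis
 proof (rule moduleI)
  show "cring R" by fact
  show "abelian_group ?F"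
  proof (rule abelian_groupI)
   show "0[?F] : carrier ?F" unfolding eqs by (rule I[of _ "{}"]) auto
  next
   fix x y assume xy: "x : carrier ?F" "y : carrier ?F"
   show "x +[?F] y : carrier ?F" unfolding eqs
    by (rule I[of _ "{t. x t ~= 0[R]} \<union> {t. y t ~= 0[R]}"])
     (use D[OF xy(1)] D[OF xy(2)] free_mod_range[OF xy(1)] free_mod_range[OF xy(2)] in auto)
   show "x +[?F] y = y +[?F] x" unfolding eqs
    by (rule ext) (rule R.a_comm[OF free_mod_range[OF xy(1)] free_mod_range[OF xy(2)]])
  next
   fix x y z assume xy: "x : carrier ?F" "y : carrier ?F" "z : carrier ?F"
   show "x +[?F] y +[?F] z = x +[?F] (y +[?F] z)" unfolding eqs
    by (rule ext) (simp add: R.a_assoc xy[THEN free_mod_range])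
  next
   fix x assume x: "x : carrier ?F"
   show "0[?F] +[?F] x = x" unfolding eqs by (rule ext) (simp add: free_mod_range[OF x])
   have "(%t. -[R] x t) +[?F] x = 0[?F]" unfolding eqs
    by (rule ext) (simp add: R.l_neg free_mod_range[OF x])
   moreover have "(%t. -[R] x t) : carrier ?F"
    by (rule I[of _ "{t. x t ~= 0[R]}"]) (use D[OF x] free_mod_range[OF x] in auto)
   ultimately show "EX y:carrier ?F. y +[?F] x = 0[?F]" by blast
  qed
 next
  fix r x assume x: "r : carrier R" "x : carrier ?F"
  show "r *[?F] x : carrier ?F" unfolding eqs
   by (rule I[of _ "{t. x t ~= 0[R]}"]) (use D[OF x(2)] free_mod_range[OF x(2)] x(1) in auto)
 next
  fix r t x assume x: "r : carrier R" "t : carrier R" "x : carrier ?F"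
  show "(r +[R] t) *[?F] x = r *[?F] x +[?F] t *[?F] x" unfolding eqs
   by (rule ext) (simp add: R.l_distr x free_mod_range[OF x(3)])
  show "(r \<otimes>\<^bsub>R\<^esub> t) *[?F] x = r *[?F] (t *[?F] x)" unfolding eqs
   by (rule ext) (simp add: R.m_assoc x free_mod_range[OF x(3)])
 next
  fix r x y assume x: "r : carrier R" "x : carrier ?F" "y : carrier ?F"
  show "r *[?F] (x +[?F] y) = r *[?F] x +[?F] r *[?F] y" unfolding eqs
   by (rule ext) (simp add: R.r_distr x free_mod_range[OF x(2)] free_mod_range[OF x(3)])
 next
  fix x assume x: "x : carrier ?F"
  show "1[R] *[?F] x = x" unfolding eqs by (rule ext) (simp add: free_mod_range[OF x])
 qed
qed

lemma delta_closed:
 assumes "cring R" "t : T"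
 shows "delta R t : carrier (free_mod R T)"
proof -
 interpret R: cring R by fact
 have "{s. delta R t s ~= 0[R]} <= {t}" by (auto simp: delta_def)
 then show ?thesis using assms(2) finite_subset[of _ "{t}"]
  unfolding free_mod_simps(1) by (auto simp: delta_def)
qed

context
 fixes R :: "('r, 's) ring_scheme" and N :: "('r, 'a) module" and T :: "'t set" and v :: "'t => 'a"
 assumes N: "module R N" and v: "!!t. t : T ==> v t : carrier N"
begin

interpretation N: module R N by (rule N)

text \<open>Two functions and their sum have different supports; over a common finite superset the
  three linear combinations can be compared termwise.\<close>

lemma lin_ext_support:
 assumes "finite U" "U <= T" "{t. g t ~= 0[R]} <= U" "g : carrier (free_mod R T)"
 shows "lin_ext R N v g = finsum N (%t. g t *[N] v t) U"
 unfolding lin_ext_def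
proof (rule N.M.add.finprod_mono_neutral_cong_left)
 show "g t *[N] v t = 0[N]" if "t : U - {t. g t ~= 0[R]}" for t
 proof -
  have "t : T" "g t = 0[R]" using that assms(2) by auto
  then show ?thesis using v by (simp add: N.smult_l_null)
 qed
 show "(%t. g t *[N] v t) : U \<rightarrow> carrier N"
  using assms(2) v free_mod_range[OF assms(4)] by (auto intro!: N.smult_closed)
qed (use assms in auto)

lemma lin_ext_hom: "lin_ext R N v : mod_hom R (free_mod R T) N"
proof (rule mod_homI)
 note r = free_mod_range
 have D: "finite {t. g t ~= 0[R]}" "{t. g t ~= 0[R]} <= T" if "g : carrier (free_mod R T)" for g
  using that unfolding free_mod_simps(1) by blast+
 have cl: "(%t. g t *[N] v t) : U \<rightarrow> carrier N" if "g : carrier (free_mod R T)" "U <= T" for g U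
  using that v r[OF that(1)] by (auto intro!: N.smult_closed)
 fix x assume x: "x : carrier (free_mod R T)"
 show "lin_ext R N v x : carrier N"
  unfolding lin_ext_def by (rule N.M.finsum_closed[OF cl[OF x D(2)[OF x]]])
 show "lin_ext R N v (a *[free_mod R T] x) = a *[N] lin_ext R N v x" if a: "a : carrier R" for a
 proof -
  have ax: "a *[free_mod R T] x : carrier (free_mod R T)"
   by (rule module.smult_closed[OF module_free_mod[OF module_cring[OF N]] a x])
  have "lin_ext R N v (a *[free_mod R T] x)
    = finsum N (%t. (a *[free_mod R T] x) t *[N] v t) {t. x t ~= 0[R]}"
   by (rule lin_ext_support[OF D[OF x] _ ax]) (use a in \<open>auto simp: free_mod_simps(4)\<close>)
  also have "\<dots> = finsum N (%t. a *[N] (x t *[N] v t)) {t. x t ~= 0[R]}"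
   by (rule N.M.finsum_cong') (use a cl[OF x D(2)[OF x]] v D(2)[OF x] r[OF x] in
    \<open>auto simp: free_mod_simps(4) N.smult_assoc1 intro!: N.smult_closed\<close>)
  also have "\<dots> = a *[N] lin_ext R N v x"
   unfolding lin_ext_def by (rule N.finsum_smult_ldistr[symmetric, OF D(1)[OF x] a cl[OF x D(2)[OF x]]])
  finally show ?thesis .
 qed
 fix y assume y: "y : carrier (free_mod R T)"
 let ?U = "{t. x t ~= 0[R]} \<union> {t. y t ~= 0[R]}"
 have U: "finite ?U" "?U <= T" using D[OF x] D[OF y] by auto
 have xy: "x +[free_mod R T] y : carrier (free_mod R T)"
  by (rule abelian_group.ag_rules(1)[OF module_ag[OF module_free_mod[OF module_cring[OF N]]] x y])
 have "lin_ext R N v (x +[free_mod R T] y) = finsum N (%t. (x +[free_mod R T] y) t *[N] v t) ?U"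
  by (rule lin_ext_support[OF U _ xy]) (auto simp: free_mod_simps(3))
 also have "\<dots> = finsum N (%t. x t *[N] v t +[N] y t *[N] v t) ?U"
  by (rule N.M.finsum_cong') (use U(2) v r[OF x] r[OF y] in
    \<open>auto simp: free_mod_simps(3) N.smult_l_distr subset_iff intro!: N.smult_closed\<close>)
 also have "\<dots> = lin_ext R N v x +[N] lin_ext R N v y"
  using N.M.finsum_addf[OF cl[OF x U(2)] cl[OF y U(2)]]
   lin_ext_support[OF U _ x] lin_ext_support[OF U _ y] by simp
 finally show "lin_ext R N v (x +[free_mod R T] y) = lin_ext R N v x +[N] lin_ext R N v y" .
qed

lemma lin_ext_delta:
 assumes "t : T"
 shows "lin_ext R N v (delta R t) = v t"
proof -
 have "lin_ext R N v (delta R t) = finsum N (%s. delta R t s *[N] v s) {t}"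
  by (rule lin_ext_support[OF _ _ _ delta_closed[OF module_cring[OF N] assms]])
   (use assms in \<open>auto simp: delta_def\<close>)
 also have "\<dots> = v t" using v[OF assms] by (simp add: delta_def N.smult_one)
 finally show ?thesis .
qed

end

lemma free_mod_hom_eqI:
 assumes "cring R" "abelian_group N" "f : mod_hom R (free_mod R T) N" "f' : mod_hom R (free_mod R T) N"
  and eq: "!!t. t : T ==> f (delta R t) = f' (delta R t)"
  and g: "g : carrier (free_mod R T)"
 shows "f g = f' g"
proof -
 interpret R: cring R by fact
 have F: "abelian_group (free_mod R T)" by (rule module_ag[OF module_free_mod[OF assms(1)]])
 \<comment> \<open>The induction is over a finite superset of the support, not the support itself,
   so that the statement survives when the coefficient at the new element is zero.\<close>
 have "f g = f' g" if "finite U" "{t. g t ~= 0[R]} <= U" "g : carrier (free_mod R T)" for U g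
  using that
 proof (induction U arbitrary: g rule: finite_induct)
  case empty
  then have "g = 0[free_mod R T]" unfolding free_mod_simps(2) by auto
  then show ?case using mod_hom_zero[OF assms(3) F assms(2)] mod_hom_zero[OF assms(4) F assms(2)] by simp
 next
  case (insert t U)
  show ?case
  proof (cases "g t = 0[R]")
   case True
   then have "{s. g s ~= 0[R]} <= U" using insert.prems(1) by auto
   then show ?thesis by (rule insert.IH[OF _ insert.prems(2)])
  next
   case False
   let ?h = "g(t := 0[R])"
   have fin: "finite {s. g s ~= 0[R]}" "{s. g s ~= 0[R]} <= T"
    using insert.prems(2) unfolding free_mod_simps(1) by blast+
   have "{s. ?h s ~= 0[R]} <= {s. g s ~= 0[R]}" by auto
   then have h: "?h : carrier (free_mod R T)"
    using free_mod_range[OF insert.prems(2)] fin finite_subset[OF _ fin(1)]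
    unfolding free_mod_simps(1) by auto
   have t: "t : T" using False fin(2) by auto
   have gt: "g t : carrier R" by (rule free_mod_range[OF insert.prems(2)])
   have d: "delta R t : carrier (free_mod R T)" by (rule delta_closed[OF assms(1) t])
   have gd: "g t *[free_mod R T] delta R t : carrier (free_mod R T)"
    by (rule module.smult_closed[OF module_free_mod[OF assms(1)] gt d])
   have eqg: "g = ?h +[free_mod R T] (g t *[free_mod R T] delta R t)"
    unfolding free_mod_simps(3,4) using free_mod_range[OF insert.prems(2)]
    by (auto simp: delta_def fun_eq_iff)
   have "{s. ?h s ~= 0[R]} <= U" using insert.prems(1) by auto
   then have "f ?h = f' ?h" by (rule insert.IH[OF _ h])
   then show ?thesis
    using mod_homD(2)[OF assms(3) h gd] mod_homD(2)[OF assms(4) h gd] eq[OF t]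
     mod_homD(3)[OF assms(3) gt d] mod_homD(3)[OF assms(4) gt d] eqg by metis
  qed
 qed
 moreover have "finite {t. g t ~= 0[R]}" using g unfolding free_mod_simps(1) by blast
 ultimately show ?thesis using g by blast
qed

text \<open>Moves a module along an injection into another type; resolutions and pages have to live
  in prescribed types.\<close>

definition transport :: "('a => 'b) => ('r, 'a) module => ('r, 'b) module" where
 "transport j A = (let i = inv_into (carrier A) j in
   (|carrier = j ` carrier A, monoid.mult = undefined, one = undefined, zero = j 0[A],
   add = (%x y. j (i x +[A] i y)), smult = (%r x. j (r *[A] i x))|))"

lemma transport_facts:
 assumes "module R A" "inj_on j (carrier A)"
 shows "module R (transport j A)" "j : mod_hom R A (transport j A)"
  "inv_into (carrier A) j : mod_hom R (transport j A) A"
  "bij_betw j (carrier A) (carrier (transport j A))"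
proof -
 interpret A: module R A by fact
 let ?B = "transport j A" and ?i = "inv_into (carrier A) j"
 have i: "?i (j x) = x" if "x : carrier A" for x using that assms(2) by simp
 have car: "carrier ?B = j ` carrier A" by (simp add: transport_def Let_def)
 have ops: "0[?B] = j 0[A]" "x : carrier A ==> y : carrier A ==> j x +[?B] j y = j (x +[A] y)"
  "x : carrier A ==> r *[?B] j x = j (r *[A] x)" for x y r
  by (simp_all add: transport_def Let_def i)
 show B: "module R ?B"
 proof (rule moduleI)
  show "cring R" by (rule A.R.cring_axioms)
  show "abelian_group ?B"
  proof (rule abelian_groupI)
   fix x assume "x : carrier ?B"
   then obtain a where a: "a : carrier A" "x = j a" unfolding car by blast
   have "j (-[A] a) +[?B] x = 0[?B]" using a by (simp add: ops A.M.l_neg)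
   then show "EX y:carrier ?B. y +[?B] x = 0[?B]" using a unfolding car by blast
  qed (auto simp: car ops A.M.a_ac)
 qed (auto simp: car ops A.smult_l_distr A.smult_r_distr A.smult_assoc1)
 show j: "j : mod_hom R A ?B" by (rule mod_homI) (auto simp: car ops)
 show b: "bij_betw j (carrier A) (carrier ?B)" using assms(2) by (auto simp: bij_betw_def car)
 show "?i : mod_hom R ?B A" by (rule mod_hom_inverse(1)[OF j b assms(1)])
qed

section \<open>Free left modules\<close>

text \<open>Generators at \<open>x\<close> of the direct sum, over all \<open>y\<close> and all
  \<open>u : S y\<close>, of the representable modules with basis \<open>Hom C y x\<close>. The
  triple records \<open>y\<close> since Hom-sets may overlap.\<close>

definition free_gens :: "('o, 'm) cat => ('o => 'k set) => 'o => ('o \<times> 'm \<times> 'k) set" where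
 "free_gens C S x = {(y, m, u). y : Obj C & m : Hom C y x & u : S y}"

definition free_left :: "('o, 'm) cat => ('r, 's) ring_scheme => ('o => 'k set)
  => ('o, 'm, 'r, 'o \<times> 'm \<times> 'k => 'r) rcmod" where
 "free_left C R S = (|mod_at = (%x. free_mod R (free_gens C S x)),
   mod_map = (%x z f. lin_ext R (free_mod R (free_gens C S z)) (%(y, m, u). delta R (y, Comp C f m, u)))|)"

lemma categoryD:
 assumes "category C"
 shows "x : Obj C ==> Id C x : Hom C x x"
  "x : Obj C ==> y : Obj C ==> z : Obj C ==> f : Hom C x y ==> g : Hom C y z ==> Comp C g f : Hom C x z"
  "x : Obj C ==> y : Obj C ==> f : Hom C x y ==> Comp C f (Id C x) = f"
  "x : Obj C ==> y : Obj C ==> f : Hom C x y ==> Comp C (Id C y) f = f"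
  "w : Obj C ==> x : Obj C ==> y : Obj C ==> z : Obj C ==> f : Hom C w x ==> g : Hom C x y ==>
   h : Hom C y z ==> Comp C h (Comp C g f) = Comp C (Comp C h g) f"
 using assms unfolding category_def by blast+

context
 fixes C :: "('o, 'm) cat" and R :: "('r, 's) ring_scheme"
 assumes C: "category C" and R: "cring R"
begin

lemma free_left_simps:
 "mod_at (free_left C R S) x = free_mod R (free_gens C S x)"
 by (simp add: free_left_def)

lemma free_left_map:
 assumes "x : Obj C" "z : Obj C" "f : Hom C x z"
 shows "mod_map (free_left C R S) x z f : mod_hom R (free_mod R (free_gens C S x)) (free_mod R (free_gens C S z))"
  "(y, m, u) : free_gens C S x ==>
   mod_map (free_left C R S) x z f (delta R (y, m, u)) = delta R (y, Comp C f m, u)"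
proof -
 have v: "(%(y, m, u). delta R (y, Comp C f m, u)) t : carrier (free_mod R (free_gens C S z))"
  if "t : free_gens C S x" for t
  using that categoryD(2)[OF C _ assms(1,2) _ assms(3)]
  by (auto simp: free_gens_def intro!: delta_closed[OF R])
 show "mod_map (free_left C R S) x z f : mod_hom R (free_mod R (free_gens C S x)) (free_mod R (free_gens C S z))"
  using lin_ext_hom[OF module_free_mod[OF R] v] by (simp add: free_left_def)
 show "(y, m, u) : free_gens C S x ==>
   mod_map (free_left C R S) x z f (delta R (y, m, u)) = delta R (y, Comp C f m, u)"
  using lin_ext_delta[where T = "free_gens C S x" and t = "(y, m, u)"
    and v = "%(y, m, u). delta R (y, Comp C f m, u)", OF module_free_mod[OF R] v]
  by (simp add: free_left_def)
qed

lemma free_gensD: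
 assumes "(y, m, u) : free_gens C S x"
 shows "y : Obj C" "m : Hom C y x" "u : S y"
 using assms by (auto simp: free_gens_def)

lemma left_module_free_left: "left_module C R (free_left C R S)"
proof (rule left_moduleI)
 note fm = free_left_map
 note ab = module_ag[OF module_free_mod[OF R]]
 fix x assume x: "x : Obj C"
 show "module R (mod_at (free_left C R S) x)" unfolding free_left_simps by (rule module_free_mod[OF R])
 show "mod_map (free_left C R S) x x (Id C x) a = a" if "a : el (free_left C R S) x" for a
 proof (rule free_mod_hom_eqI[OF R ab fm(1)[OF x x categoryD(1)[OF C x]], where f' = "%a. a"])
  show "(%a. a) : mod_hom R (free_mod R (free_gens C S x)) (free_mod R (free_gens C S x))"
   by (rule mod_homI) simp_all
  show "a : carrier (free_mod R (free_gens C S x))" using that unfolding free_left_simps .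
  fix t assume t: "t : free_gens C S x"
  obtain w m u where w: "t = (w, m, u)" by (cases t)
  show "mod_map (free_left C R S) x x (Id C x) (delta R t) = delta R t"
   using fm(2)[OF x x categoryD(1)[OF C x] t[unfolded w]] free_gensD[OF t[unfolded w]]
    categoryD(4)[OF C _ x] w by simp
 qed
next
 fix x y f assume "x : Obj C" "y : Obj C" "f : Hom C x y"
 then show "mod_map (free_left C R S) x y f : mod_hom R (mod_at (free_left C R S) x) (mod_at (free_left C R S) y)"
  unfolding free_left_simps by (rule free_left_map)
next
 note fm = free_left_map
 note ab = module_ag[OF module_free_mod[OF R]]
 fix x y z f g a assume x: "x : Obj C" and y: "y : Obj C" and z: "z : Obj C" and f: "f : Hom C x y" and g: "g : Hom C y z"
  and a: "a : el (free_left C R S) x"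
 note gf = categoryD(2)[OF C x y z f g]
 show "mod_map (free_left C R S) x z (Comp C g f) a = mod_map (free_left C R S) y z g (mod_map (free_left C R S) x y f a)"
 proof (rule free_mod_hom_eqI[OF R ab fm(1)[OF x z gf] mod_hom_comp[OF fm(1)[OF x y f] fm(1)[OF y z g]]])
  fix t assume t: "t : free_gens C S x"
  obtain w m u where w: "t = (w, m, u)" by (cases t)
  note t' = free_gensD[OF t[unfolded w]]
  have t2: "(w, Comp C f m, u) : free_gens C S y"
   using t' categoryD(2)[OF C t'(1) x y t'(2) f] by (auto simp: free_gens_def)
  then show "mod_map (free_left C R S) x z (Comp C g f) (delta R t)
    = mod_map (free_left C R S) y z g (mod_map (free_left C R S) x y f (delta R t))"
   using fm(2)[OF x z gf t[unfolded w]] fm(2)[OF x y f t[unfolded w]] fm(2)[OF y z g t2]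
    categoryD(5)[OF C t'(1) x y z t'(2) f g] w by simp
 next
  show "a : carrier (free_mod R (free_gens C S x))" using a unfolding free_left_simps .
 qed
qed

text \<open>The morphism that Yoneda's lemma attaches to images \<open>b y u\<close> of the
  generators \<open>(y, Id C y, u)\<close>.\<close>

definition free_left_ext :: "('o, 'm, 'r, 'a) rcmod => ('o => 'k => 'a) => 'o => ('o \<times> 'm \<times> 'k => 'r) => 'a" where
 "free_left_ext B b x = lin_ext R (mod_at B x) (%(y, m, u). mod_map B y x m (b y u))"

lemma free_left_ext:
 assumes B: "left_module C R B" and b: "!!y u. y : Obj C ==> u : S y ==> b y u : el B y"
 shows "free_left_ext B b : rc_hom C R (free_left C R S) B"
  "x : Obj C ==> (y, m, u) : free_gens C S x ==> free_left_ext B b x (delta R (y, m, u)) = mod_map B y x m (b y u)"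
proof -
 have v: "(%(y, m, u). mod_map B y x m (b y u)) t : el B x"
  if "x : Obj C" "t : free_gens C S x" for x t
 proof -
  obtain w m u where w: "t = (w, m, u)" by (cases t)
  note t' = free_gensD[OF that(2)[unfolded w]]
  show ?thesis using left_moduleD(6)[OF B t'(1) that(1) t'(2) b[OF t'(1,3)]] w by simp
 qed
 have h: "free_left_ext B b x : mod_hom R (free_mod R (free_gens C S x)) (mod_at B x)" if "x : Obj C" for x
  unfolding free_left_ext_def by (rule lin_ext_hom[OF left_moduleD(1)[OF B that] v[OF that]])
 show d: "free_left_ext B b x (delta R (y, m, u)) = mod_map B y x m (b y u)"
  if "x : Obj C" "(y, m, u) : free_gens C S x" for x y m u
  unfolding free_left_ext_def using lin_ext_delta[OF left_moduleD(1)[OF B that(1)] v[OF that(1)] that(2)] by simp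
 show "free_left_ext B b : rc_hom C R (free_left C R S) B"
 proof (rule rc_homI)
  fix x assume "x : Obj C"
  then show "free_left_ext B b x : mod_hom R (mod_at (free_left C R S) x) (mod_at B x)"
   unfolding free_left_simps by (rule h)
 next
  fix x z f a assume x: "x : Obj C" and z: "z : Obj C" and f: "f : Hom C x z" and a: "a : el (free_left C R S) x"
  show "free_left_ext B b z (mod_map (free_left C R S) x z f a) = mod_map B x z f (free_left_ext B b x a)"
  proof (rule free_mod_hom_eqI[OF R left_moduleD(5)[OF B z] mod_hom_comp[OF free_left_map(1)[OF x z f] h[OF z]]
    mod_hom_comp[OF h[OF x] left_moduleD(2)[OF B x z f]]])
   fix t assume t: "t : free_gens C S x"
   obtain w m u where w: "t = (w, m, u)" by (cases t)
   note t' = free_gensD[OF t[unfolded w]]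
   have t2: "(w, Comp C f m, u) : free_gens C S z"
    using t' categoryD(2)[OF C t'(1) x z t'(2) f] by (auto simp: free_gens_def)
   show "free_left_ext B b z (mod_map (free_left C R S) x z f (delta R t)) = mod_map B x z f (free_left_ext B b x (delta R t))"
    using free_left_map(2)[OF x z f t[unfolded w]] d[OF x t[unfolded w]] d[OF z t2]
     left_moduleD(4)[OF B t'(1) x z t'(2) f b[OF t'(1,3)]] w by simp
  next
   show "a : carrier (free_mod R (free_gens C S x))" using a unfolding free_left_simps .
  qed
 qed
qed

text \<open>The generator \<open>(y, m, u)\<close> is the image of \<open>(y, Id C y, u)\<close>
  under \<open>m\<close>, so by naturality the identity generators decide.\<close>

lemma free_left_hom_eqI:
 assumes B: "left_module C R B" and f: "f : rc_hom C R (free_left C R S) B" "g : rc_hom C R (free_left C R S) B"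
  and eq: "!!y u. y : Obj C ==> u : S y ==> f y (delta R (y, Id C y, u)) = g y (delta R (y, Id C y, u))"
  and x: "x : Obj C" and a: "a : el (free_left C R S) x"
 shows "f x a = g x a"
proof (rule free_mod_hom_eqI[where T = "free_gens C S x", OF R left_moduleD(5)[OF B x]])
 show "f x : mod_hom R (free_mod R (free_gens C S x)) (mod_at B x)" "g x : mod_hom R (free_mod R (free_gens C S x)) (mod_at B x)"
  using rc_homD(1)[OF f(1) x] rc_homD(1)[OF f(2) x] unfolding free_left_simps by auto
 show "a : carrier (free_mod R (free_gens C S x))" using a unfolding free_left_simps .
 fix t assume t: "t : free_gens C S x"
 obtain w m u where w: "t = (w, m, u)" by (cases t)
 note t' = free_gensD[OF t[unfolded w]]
 have t2: "(w, Id C w, u) : free_gens C S w" using t' categoryD(1)[OF C t'(1)] by (auto simp: free_gens_def)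
 have d: "delta R (w, Id C w, u) : el (free_left C R S) w"
  unfolding free_left_simps by (rule delta_closed[OF R t2])
 have "delta R t = mod_map (free_left C R S) w x m (delta R (w, Id C w, u))"
  using free_left_map(2)[OF t'(1) x t'(2) t2] categoryD(3)[OF C t'(1) x t'(2)] w by simp
 then show "f x (delta R t) = g x (delta R t)"
  using rc_homD(2)[OF f(1) t'(1) x t'(2) d] rc_homD(2)[OF f(2) t'(1) x t'(2) d] eq[OF t'(1,3)] by simp
qed

text \<open>It suffices that the values of \<open>f\<close> lie in the image of \<open>e\<close>. In
  this form exactness of a complex lifts cocycles directly, without a separate kernel
  module.\<close>

lemma free_left_lift:
 assumes A: "left_module C R A" and B: "left_module C R B" and e: "e : rc_hom C R A B"
  and f: "f : rc_hom C R (free_left C R S) B"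
  and im: "!!x a. x : Obj C ==> a : el (free_left C R S) x ==> f x a : e x ` el A x"
 shows "EX g:rc_hom C R (free_left C R S) A. ALL x:Obj C. ALL a:el (free_left C R S) x. e x (g x a) = f x a"
proof -
 let ?d = "%y u. delta R (y, Id C y, u)"
 have gen: "(y, Id C y, u) : free_gens C S y" if "y : Obj C" "u : S y" for y u
  using that categoryD(1)[OF C that(1)] by (auto simp: free_gens_def)
 have dc: "?d y u : el (free_left C R S) y" if "y : Obj C" "u : S y" for y u
  unfolding free_left_simps by (rule delta_closed[OF R gen[OF that]])
 define b where "b y u = (SOME b. b : el A y & e y b = f y (?d y u))" for y u
 have "EX b. b : el A y & e y b = f y (?d y u)" if "y : Obj C" "u : S y" for y u
  using im[OF that(1) dc[OF that]] by (auto simp: image_iff)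
 then have b: "b y u : el A y" "e y (b y u) = f y (?d y u)" if "y : Obj C" "u : S y" for y u
  using someI_ex[of "%b. b : el A y & e y b = f y (?d y u)"] that unfolding b_def by auto
 have E: "free_left_ext A b : rc_hom C R (free_left C R S) A" by (rule free_left_ext(1)[OF A b(1)])
 show ?thesis
 proof (intro bexI[OF _ E] ballI)
  fix x a assume x: "x : Obj C" and a: "a : el (free_left C R S) x"
  show "e x (free_left_ext A b x a) = f x a"
  proof (rule free_left_hom_eqI[OF B rc_hom_comp[OF E e] f _ x a])
   fix y u assume y: "y : Obj C" "u : S y"
   have "free_left_ext A b y (?d y u) = b y u"
    using free_left_ext(2)[where S=S and b=b, OF A b(1) y(1) gen[OF y]] left_moduleD(3)[OF A y(1) b(1)[OF y]] by simp
   then show "e y (free_left_ext A b y (?d y u)) = f y (?d y u)" using b(2)[OF y] by simp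
  qed
 qed
qed

end

section \<open>Projective resolutions\<close>

text \<open>The code of a list of functions: after an injection \<open>c\<close> of pairs into lists, the slots
 \<open>c (0, _)\<close> record the length and the slots \<open>c (i + 1, _)\<close> the \<open>i\<close>-th entry.\<close>

lemma inj_list_fun:
 assumes "z ~= (w::'r)"
 shows "EX e :: ('t list => 'r) list => ('t list => 'r). inj e"
proof -
 have inf: "infinite (UNIV :: 't list set)" by (rule infinite_UNIV_listI)
 have "EX f :: nat => 't list. inj f" using inf infinite_countable_subset by blast
 then obtain n :: "nat => 't list" where n: "inj n" by blast
 \<comment> \<open>An infinite set has as many pairs as elements; with the injection
   \<open>n\<close> of numbers this packs a slot number and a list into one list.\<close>
 have "EX c0 :: 't list \<times> 't list => 't list. bij_betw c0 (UNIV \<times> UNIV) UNIV"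
  using card_of_ordIso card_of_Times_same_infinite[OF inf] by blast
 then obtain c0 :: "'t list \<times> 't list => 't list" where "bij_betw c0 (UNIV \<times> UNIV) UNIV" by blast
 then have c0: "inj c0" by (simp add: bij_betw_def)
 define c where "c = (%(i, l). c0 (n i, l))"
 have c: "c (i, l) = c (j, m) \<longleftrightarrow> i = j & l = m" for i j l m
  using n c0 by (auto simp: c_def inj_eq)
 define e where "e us l = (if l : range c then (case inv_into UNIV c l of (0, m) => if m = n (length us) then w else z
   | (Suc i, m) => if i < length us then (us ! i) m else z) else z)" for us :: "('t list => 'r) list" and l
 have "inj c" by (rule injI) (metis c surj_pair)
 then have inv: "inv_into UNIV c (c p) = p" for p by simp
 have e0: "e us (c (0, m)) = (if m = n (length us) then w else z)"
  and e1: "e us (c (Suc i, m)) = (if i < length us then (us ! i) m else z)" for us m i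
  by (simp_all add: e_def inv)
 have "inj e"
 proof (rule injI)
  fix us vs assume eq: "e us = e vs"
  \<comment> \<open>Slot 0 takes the value \<open>w\<close> only at the code of the length, so it
    determines the length.\<close>
  have "e us (c (0, n (length us))) = w" by (simp add: e0)
  then have "n (length us) = n (length vs)" using assms eq e0[of vs] by (metis (full_types))
  then have len: "length us = length vs" using n by (simp add: inj_eq)
  have "(us ! i) m = (vs ! i) m" if "i < length us" for i m
   using e1[of us i m] e1[of vs i m] eq that len by simp
  then show "us = vs" using len by (intro nth_equalityI) auto
 qed
 then show ?thesis by blast
qed

text \<open>A finitely supported function is a finite list of argument-value pairs. Each component
  of a pair embeds into \<open>res_univ\<close>, objects and morphisms as indicators of one-entry
  lists, values as constant functions; \<open>inj_list_fun\<close> flattens first the four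
  components of a pair and then the list of pairs.\<close>

lemma inj_finsupp:
 fixes z w :: 'r and ik :: "'k => ('o, 'm, 'r, 'n) res_univ"
 assumes zw: "z ~= w" and ik: "inj ik"
 shows "EX j :: ('o \<times> 'm \<times> 'k => 'r) => ('o, 'm, 'r, 'n) res_univ. inj_on j {g. finite {t. g t ~= z}}"
proof -
 obtain e :: "('o, 'm, 'r, 'n) res_univ list => ('o, 'm, 'r, 'n) res_univ" where e: "inj e"
  using inj_list_fun[OF zw] by blast
 define io :: "'o => ('o, 'm, 'r, 'n) res_univ" where "io x = (%l. if map fst l = [x] then w else z)" for x
 define im :: "'m => ('o, 'm, 'r, 'n) res_univ" where "im x = (%l. if map (fst \<circ> snd) l = [x] then w else z)" for x
 define ir :: "'r => ('o, 'm, 'r, 'n) res_univ" where "ir x = (%_. x)" for x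
 have io: "inj io"
 proof (rule injI)
  fix x y assume "io x = io y"
  from fun_cong[OF this, of "[(x, undefined, undefined)]"] show "x = y"
   using zw by (auto simp: io_def split: if_splits)
 qed
 have im: "inj im"
 proof (rule injI)
  fix x y assume "im x = im y"
  from fun_cong[OF this, of "[(undefined, x, undefined)]"] show "x = y"
   using zw by (auto simp: im_def split: if_splits)
 qed
 have ir: "inj ir" by (rule injI) (auto simp: ir_def fun_eq_iff)
 define e4 where "e4 = (%((x, m, k), r). e [io x, im m, ik k, ir r])"
 have e4: "inj e4"
 proof (rule injI)
  fix s t assume st: "e4 s = e4 t"
  obtain x m k r x' m' k' r' where "s = ((x, m, k), r)" "t = ((x', m', k'), r')"
   by (metis surj_pair)
  then show "s = t" using st injD[OF e] injD[OF io] injD[OF im] injD[OF ik] injD[OF ir]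
   by (auto simp: e4_def dest!: injD[OF e])
 qed
 \<comment> \<open>Any enumeration of the graph will do, because the comparison below goes through
   the set of its entries.\<close>
 define lst where "lst g = (SOME xs. set xs = (%t. (t, g t)) ` {t. g t ~= z})" for g :: "'o \<times> 'm \<times> 'k => 'r"
 have lst: "set (lst g) = (%t. (t, g t)) ` {t. g t ~= z}" if "finite {t. g t ~= z}" for g
  unfolding lst_def by (rule someI_ex) (use that finite_list[of "(%t. (t, g t)) ` {t. g t ~= z}"] in auto)
 have "inj_on (%g. e (map e4 (lst g))) {g. finite {t. g t ~= z}}"
 proof (rule inj_onI)
  fix g h assume gh: "g : {g. finite {t. g t ~= z}}" "h : {g. finite {t. g t ~= z}}"
   and "e (map e4 (lst g)) = e (map e4 (lst h))"
  then have "map e4 (lst g) = map e4 (lst h)" using injD[OF e] by blast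
  then have "lst g = lst h" by (rule map_injective[OF _ e4])
  then have eq: "(%t. (t, g t)) ` {t. g t ~= z} = (%t. (t, h t)) ` {t. h t ~= z}"
   using lst[of g] lst[of h] gh by simp
  show "g = h"
  proof (rule ext)
   fix t
   have "g t = h t" if "g t ~= z"
   proof -
    have "(t, g t) : (%t. (t, h t)) ` {t. h t ~= z}" unfolding eq[symmetric] using that by blast
    then show ?thesis by blast
   qed
   moreover have "g t = h t" if "h t ~= z"
   proof -
    have "(t, h t) : (%t. (t, g t)) ` {t. g t ~= z}" unfolding eq using that by blast
    then show ?thesis by auto
   qed
   ultimately show "g t = h t" by metis
  qed
 qed
 then show ?thesis by blast
qed

definition transport_left :: "('a => 'b) => ('o, 'm, 'r, 'a) rcmod => ('o, 'm, 'r, 'b) rcmod" where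
 "transport_left j F = (|mod_at = (%x. transport j (mod_at F x)),
   mod_map = (%x y f a. j (mod_map F x y f (inv_into (el F x) j a)))|)"

lemma transport_left:
 assumes C: "category C" and F: "left_module C R F" and j: "!!x. x : Obj C ==> inj_on j (el F x)"
 shows "left_module C R (transport_left j F)" "(%x. j) : rc_hom C R F (transport_left j F)"
  "(%x. inv_into (el F x) j) : rc_hom C R (transport_left j F) F"
  "x : Obj C ==> b : el (transport_left j F) x ==> j (inv_into (el F x) j b) = b"
proof -
 let ?T = "transport_left j F" and ?i = "%x. inv_into (el F x) j"
 note tf = transport_facts[OF left_moduleD(1)[OF F] j]
 have at: "mod_at ?T x = transport j (mod_at F x)" for x by (simp add: transport_left_def)
 have car: "el ?T x = j ` el F x" for x by (simp add: at transport_def Let_def)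
 have mp: "mod_map ?T x y f a = j (mod_map F x y f (?i x a))" for x y f a by (simp add: transport_left_def)
 have ij: "?i x (j a) = a" if "x : Obj C" "a : el F x" for x a using j that by simp
 have mph: "mod_map ?T x y f : mod_hom R (mod_at ?T x) (mod_at ?T y)"
  if "x : Obj C" "y : Obj C" "f : Hom C x y" for x y f
 proof -
  have "(%a. j (mod_map F x y f (?i x a))) : mod_hom R (mod_at ?T x) (mod_at ?T y)"
   unfolding at by (rule mod_hom_comp[OF mod_hom_comp[OF tf(3)[OF that(1,1)] left_moduleD(2)[OF F that]] tf(2)[OF that(2,2)]])
  then show ?thesis by (simp add: mp[abs_def])
 qed
 show "left_module C R ?T"
 proof (rule left_moduleI)
  show "module R (mod_at ?T x)" if "x : Obj C" for x unfolding at by (rule tf(1)[OF that that])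
  show "mod_map ?T x x (Id C x) a = a" if "x : Obj C" "a : el ?T x" for x a
   using that left_moduleD(3)[OF F that(1)] by (auto simp: car mp ij)
  fix x y z f g a assume x: "x : Obj C" "y : Obj C" "z : Obj C" "f : Hom C x y" "g : Hom C y z"
   and "a : el ?T x"
  then obtain b where b: "a = j b" "b : el F x" by (auto simp: car)
  then show "mod_map ?T x z (Comp C g f) a = mod_map ?T y z g (mod_map ?T x y f a)"
   using left_moduleD(4)[OF F x b(2)] left_moduleD(6)[OF F x(1,2,4) b(2)] x by (simp add: mp ij)
 qed (rule mph)
 show "(%x. j) : rc_hom C R F ?T"
  by (rule rc_homI) (use tf(2) in \<open>auto simp: at mp ij\<close>)
 show "?i : rc_hom C R ?T F"
 proof (rule rc_homI)
  show "?i x : mod_hom R (mod_at ?T x) (mod_at F x)" if "x : Obj C" for x unfolding at by (rule tf(3)[OF that that])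
  fix x y f a assume x: "x : Obj C" "y : Obj C" "f : Hom C x y" and "a : el ?T x"
  then obtain b where b: "a = j b" "b : el F x" by (auto simp: car)
  then show "?i y (mod_map ?T x y f a) = mod_map F x y f (?i x a)"
   using left_moduleD(6)[OF F x b(2)] x by (simp add: mp ij)
 qed
 show "j (?i x b) = b" if "x : Obj C" "b : el ?T x" using that by (auto simp: car ij)
qed

text \<open>\<open>projective\<close> tests liftings in one type only. A retract of a free module
  lifts against modules in any types, which is how \<open>projective_lift\<close> passes from one
  type to all.\<close>

lemma free_retract_lift:
 fixes A :: "('o, 'm, 'r, 'a) rcmod" and B :: "('o, 'm, 'r, 'b) rcmod"
 assumes C: "category C" and R: "cring R"
  and i: "i : rc_hom C R P (free_left C R S)" and p: "p : rc_hom C R (free_left C R S) P"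
  and pi: "!!x a. x : Obj C ==> a : el P x ==> p x (i x a) = a"
  and A: "left_module C R A" and B: "left_module C R B" and e: "e : rc_hom C R A B"
  and f: "f : rc_hom C R P B"
  and im: "!!x a. x : Obj C ==> a : el P x ==> f x a : e x ` el A x"
 shows "EX g:rc_hom C R P A. ALL x:Obj C. ALL a:el P x. e x (g x a) = f x a"
proof -
 obtain g where g: "g : rc_hom C R (free_left C R S) A"
  "ALL x:Obj C. ALL a:el (free_left C R S) x. e x (g x a) = f x (p x a)"
  using free_left_lift[OF C R A B e rc_hom_comp[OF p f]] im rc_homD(3)[OF p] by blast
 then show ?thesis
  using rc_hom_comp[OF i g(1)] rc_homD(3)[OF i] pi by (intro bexI[of _ "%x a. g x (i x a)"]) auto
qed

text \<open>A retract of a free module rather than a free module, since the copy that lives in the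
  prescribed type is only isomorphic to functions on generators.\<close>

definition is_cover :: "('o, 'm) cat => ('r, 's) ring_scheme => ('o, 'm, 'r, 'k) rcmod
  => ('o, 'm, 'r, 'u) rcmod => ('o => 'u => 'k) => bool" where
 "is_cover C R N P \<epsilon> \<longleftrightarrow> left_module C R P & \<epsilon> : rc_hom C R P N &
   (ALL x:Obj C. \<epsilon> x ` el P x = el N x) &
   (EX (S :: 'o => 'k set) i p. i : rc_hom C R P (free_left C R S) & p : rc_hom C R (free_left C R S) P &
    (ALL x:Obj C. ALL a:el P x. p x (i x a) = a))"

text \<open>Settles \<open>0 = 1\<close>, where the coding of free modules lacks the two distinct
  ring elements it is built on.\<close>

lemma trivial_ring_module:
 assumes "module R A" "0[R] = 1[R]"
 shows "carrier A = {0[A]}"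
proof -
 interpret module R A by fact
 have "x = 0[A]" if "x : carrier A" for x
  using smult_one[OF that] smult_l_null[OF that] assms(2) by simp
 then show ?thesis by auto
qed

text \<open>The free module on all elements of \<open>N\<close>, copied by \<open>j\<close>. The
  injection \<open>ik\<close> is a parameter because a resolution starts at a module with elements
  in \<open>'n\<close> and goes on with kernels whose elements already lie in
  \<open>res_univ\<close>.\<close>

lemma cover_exists:
 fixes R :: "('r, 's) ring_scheme" and N :: "('o, 'm, 'r, 'k) rcmod" and ik :: "'k => ('o, 'm, 'r, 'n) res_univ"
 assumes C: "category C" and R: "cring R" and N: "left_module C R N" and nt: "0[R] ~= 1[R]" and ik: "inj ik"
 shows "EX (P :: ('o, 'm, 'r, ('o, 'm, 'r, 'n) res_univ) rcmod) \<epsilon>. is_cover C R N P \<epsilon>"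
proof -
 obtain j :: "('o \<times> 'm \<times> 'k => 'r) => ('o, 'm, 'r, 'n) res_univ" where j: "inj_on j {g. finite {t. g t ~= 0[R]}}"
  using inj_finsupp[OF nt ik] by blast
 let ?S = "%x. el N x"
 let ?F = "free_left C R ?S" and ?E = "free_left_ext R N (%y u. u)"
 note F = left_module_free_left[OF C R]
 have jF: "inj_on j (el ?F x)" for x
  by (rule inj_on_subset[OF j]) (simp add: free_left_def free_mod_def subset_iff)
 note tl = transport_left[OF C F jF]
 have E: "?E : rc_hom C R ?F N" by (rule free_left_ext(1)[OF C R N]) simp
 have surj: "EX a:el ?F x. ?E x a = u" if x: "x : Obj C" "u : ?S x" for x u
 proof -
  have g: "(x, Id C x, u) : free_gens C ?S x" using x categoryD(1)[OF C x(1)] by (simp add: free_gens_def)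
  have "?E x (delta R (x, Id C x, u)) = u"
   using free_left_ext(2)[where S = ?S and b = "%y u. u", OF C R N _ x(1) g] left_moduleD(3)[OF N x] by simp
  moreover have "delta R (x, Id C x, u) : el ?F x"
   using delta_closed[OF R g] by (simp add: free_left_def)
  ultimately show ?thesis by blast
 qed
 let ?i = "%x. inv_into (el ?F x) j"
 have eps: "(%x a. ?E x (?i x a)) : rc_hom C R (transport_left j ?F) N" by (rule rc_hom_comp[OF tl(3) E])
 have "(%a. ?E x (?i x a)) ` el (transport_left j ?F) x = ?S x" if x: "x : Obj C" for x
 proof
  show "(%a. ?E x (?i x a)) ` el (transport_left j ?F) x <= ?S x"
   using rc_homD(3)[OF eps x] by blast
  show "?S x <= (%a. ?E x (?i x a)) ` el (transport_left j ?F) x"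
  proof
   fix u assume "u : ?S x"
   then obtain a where a: "a : el ?F x" "?E x a = u" using surj[OF x] by blast
   then show "u : (%a. ?E x (?i x a)) ` el (transport_left j ?F) x"
    using a(2) inv_into_f_f[OF jF a(1)]
    by (intro image_eqI[of _ _ "j a"] rc_homD(3)[OF tl(2) x a(1)]) simp
  qed
 qed
 then have "is_cover C R N (transport_left j ?F) (%x a. ?E x (?i x a))"
  unfolding is_cover_def using tl(2-4)
  by (intro conjI tl(1) eps exI[of _ ?S] exI[of _ ?i] exI[of _ "%x. j"] ballI) simp_all
 then show ?thesis by (intro exI)
qed

lemma projectiveD:
 fixes P A B :: "('o, 'm, 'r, 'u) rcmod"
 assumes "projective C R P" "left_module C R A" "left_module C R B" "e : rc_hom C R A B"
  "ALL x:Obj C. e x ` el A x = el B x" "f : rc_hom C R P B"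
 shows "EX g:rc_hom C R P A. ALL x:Obj C. ALL a:el P x. e x (g x a) = f x a"
proof -
 note p = assms(1)[unfolded projective_def, THEN conjunct2]
 show ?thesis
  by (rule mp[OF spec[of _ f, OF spec[of _ e, OF spec[of _ B, OF spec[of _ A, OF p]]]]]) (intro conjI assms(2-6))
qed

text \<open>A cover of \<open>P\<close> exists in the type of \<open>P\<close> itself, and there the
  lifting property splits it. So \<open>P\<close> is a retract of a free module, and
  \<open>A\<close> and \<open>B\<close> may have any types. Over the zero ring all values are zero
  and the zero morphism lifts.\<close>

lemma projective_lift:
 fixes P :: "('o, 'm, 'r, ('o, 'm, 'r, 'n) res_univ) rcmod"
  and A :: "('o, 'm, 'r, 'a) rcmod" and B :: "('o, 'm, 'r, 'b) rcmod"
 assumes C: "category C" and R: "cring R" and P: "projective C R P"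
  and A: "left_module C R A" and B: "left_module C R B" and e: "e : rc_hom C R A B"
  and f: "f : rc_hom C R P B"
  and im: "!!x a. x : Obj C ==> a : el P x ==> f x a : e x ` el A x"
 shows "EX g:rc_hom C R P A. ALL x:Obj C. ALL a:el P x. e x (g x a) = f x a"
proof (cases "0[R] = 1[R]")
 case True
 have PL: "left_module C R P" using P by (simp add: projective_def)
 have "e x 0[mod_at A x] = f x a" if "x : Obj C" "a : el P x" for x a
  using trivial_ring_module[OF left_moduleD(1)[OF B that(1)] True] rc_homD(3)[OF f that]
   rc_homD(3)[OF e that(1), of "0[mod_at A x]"] left_moduleD(5)[OF A that(1)] by (simp add: ag)
 then show ?thesis by (intro bexI[OF _ rc_hom_zero[OF PL A]] ballI)
next
 case False
 have PL: "left_module C R P" using P by (simp add: projective_def)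
 obtain F :: "('o, 'm, 'r, ('o, 'm, 'r, 'n) res_univ) rcmod" and \<epsilon> where F: "is_cover C R P F \<epsilon>"
  using cover_exists[where ik = "%u :: ('o, 'm, 'r, 'n) res_univ. u", OF C R PL False inj_on_id2] by (elim exE)
 from F[unfolded is_cover_def] obtain S :: "'o => ('o, 'm, 'r, 'n) res_univ set" and i p
  where ip: "i : rc_hom C R F (free_left C R S)" "p : rc_hom C R (free_left C R S) F"
   "ALL x:Obj C. ALL a:el F x. p x (i x a) = a"
  and F': "left_module C R F" "\<epsilon> : rc_hom C R F P" "ALL x:Obj C. \<epsilon> x ` el F x = el P x"
  by - (elim conjE exE, rule that)
 have idP: "(%x a. a) : rc_hom C R P P" by (intro rc_homI mod_homI) simp_all
 have "EX s:rc_hom C R P F. ALL x:Obj C. ALL a:el P x. \<epsilon> x (s x a) = a"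
  by (rule projectiveD[OF P F'(1) PL F'(2,3) idP])
 then obtain s where s: "s : rc_hom C R P F" "ALL x:Obj C. ALL a:el P x. \<epsilon> x (s x a) = a" ..
 show ?thesis
 proof (rule free_retract_lift[OF C R rc_hom_comp[OF s(1) ip(1)] rc_hom_comp[OF ip(2) F'(2)] _ A B e f im])
  fix x a assume "x : Obj C" "a : el P x"
  then show "\<epsilon> x (p x (i x (s x a))) = a" using ip(3) s rc_homD(3)[OF s(1)] by simp
 qed
qed

definition sub_left :: "('o, 'm, 'r, 'a) rcmod => ('o => 'a set) => ('o, 'm, 'r, 'a) rcmod" where
 "sub_left N S = (|mod_at = (%x. (mod_at N x)(|carrier := S x|)), mod_map = mod_map N|)"

lemma left_module_sub_left:
 assumes N: "left_module C R N" and S: "!!x. x : Obj C ==> submodule (S x) R (mod_at N x)"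
  and st: "!!x y f a. x : Obj C ==> y : Obj C ==> f : Hom C x y ==> a : S x ==> mod_map N x y f a : S y"
 shows "left_module C R (sub_left N S)"
proof (rule left_moduleI)
 have sub: "a : el N x" if "x : Obj C" "a : S x" for x a
  using submodD(2)[OF S left_moduleD(1)[OF N]] that by blast
 show "module R (mod_at (sub_left N S) x)" if "x : Obj C" for x
  using module_restrict[OF S left_moduleD(1)[OF N]] that by (simp add: sub_left_def)
 show "mod_map (sub_left N S) x y f : mod_hom R (mod_at (sub_left N S) x) (mod_at (sub_left N S) y)"
  if "x : Obj C" "y : Obj C" "f : Hom C x y" for x y f
  using mod_homD[OF left_moduleD(2)[OF N that]] st[OF that] sub[OF that(1)]
  by (intro mod_homI) (auto simp: sub_left_def)
 show "mod_map (sub_left N S) x x (Id C x) a = a" if "x : Obj C" "a : el (sub_left N S) x" for x a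
  using left_moduleD(3)[OF N that(1)] sub[OF that(1)] that by (simp add: sub_left_def)
 show "mod_map (sub_left N S) x z (Comp C g f) a = mod_map (sub_left N S) y z g (mod_map (sub_left N S) x y f a)"
  if "x : Obj C" "y : Obj C" "z : Obj C" "f : Hom C x y" "g : Hom C y z" "a : el (sub_left N S) x"
  for x y z f g a
  using left_moduleD(4)[OF N that(1-5)] sub[OF that(1)] that by (simp add: sub_left_def)
qed

lemma left_module_ker:
 assumes P: "left_module C R P" and N: "left_module C R N" and d: "d : rc_hom C R P N"
 shows "left_module C R (sub_left P (%x. mod_ker (mod_at P x) (mod_at N x) (d x)))"
proof (rule left_module_sub_left[OF P])
 show "submodule (mod_ker (mod_at P x) (mod_at N x) (d x)) R (mod_at P x)" if "x : Obj C" for x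
  by (rule submodule_ker[OF left_moduleD(1)[OF P that] left_moduleD(1)[OF N that] rc_homD(1)[OF d that]])
 show "mod_map P x y f a : mod_ker (mod_at P y) (mod_at N y) (d y)"
  if "x : Obj C" "y : Obj C" "f : Hom C x y" "a : mod_ker (mod_at P x) (mod_at N x) (d x)" for x y f a
  using that rc_homD(2)[OF d that(1-3)] left_moduleD(6)[OF P that(1-3)]
   mod_hom_zero[OF left_moduleD(2)[OF N that(1-3)] left_moduleD(5)[OF N that(1)] left_moduleD(5)[OF N that(2)]]
  by (simp add: mod_ker_def)
qed

lemma projective_cover:
 fixes N :: "('o, 'm, 'r, 'k) rcmod"
 assumes C: "category C" and R: "cring R" and "is_cover C R N P \<epsilon>"
 shows "projective C R P"
proof -
 obtain S :: "'o => 'k set" and i p where ip: "i : rc_hom C R P (free_left C R S)" "p : rc_hom C R (free_left C R S) P"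
   "ALL x:Obj C. ALL a:el P x. p x (i x a) = a" and P: "left_module C R P"
  using assms(3) unfolding is_cover_def by - (elim conjE exE, rule that)
 show ?thesis unfolding projective_def
 proof (intro conjI P allI impI, elim conjE)
  fix A B e f assume A: "left_module C R A" and B: "left_module C R B" and e: "e : rc_hom C R A B"
   and s: "ALL x:Obj C. e x ` el A x = el B x" and f: "f : rc_hom C R P B"
  show "EX g:rc_hom C R P A. ALL x:Obj C. ALL a:el P x. e x (g x a) = f x a"
   by (rule free_retract_lift[OF C R ip(1,2) _ A B e f]) (use ip(3) s rc_homD(3)[OF f] in auto)
 qed
qed

text \<open>Covers of iterated kernels. With this the \<open>SOME\<close> in \<open>proj_res\<close>
  denotes an actual resolution, on which every later computation of Ext relies.\<close>

lemma projective_resolution_exists: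
 fixes N :: "('o, 'm, 'r, 'n) rcmod"
 assumes C: "category C" and R: "cring R" and N: "left_module C R N"
 shows "projective_resolution C R N (proj_res C R N)"
proof -
 have "EX P :: ('o, 'm, 'r, ('o, 'm, 'r, 'n) res_univ, 'n) resolution. projective_resolution C R N P"
 proof (cases "0[R] = 1[R]")
  case True
  define z :: "('o, 'm, 'r, 'n) res_univ" where "z = undefined"
  define Z :: "('o, 'm, 'r, ('o, 'm, 'r, 'n) res_univ) rcmod" where "Z = (|mod_at = (%_. (|carrier = {z}, monoid.mult = undefined, one = undefined, zero = z,
    add = (%_ _. z), smult = (%_ _. z)|)), mod_map = (%_ _ _ _. z)|)"
  have mZ: "module R (mod_at Z x)" for x
   unfolding Z_def by (rule moduleI, rule R, rule abelian_groupI) auto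
  have Z: "left_module C R Z" by (rule left_moduleI[OF mZ]) (auto simp: Z_def intro!: mod_homI)
  have c: "el N x = {0[mod_at N x]}" if "x : Obj C" for x
   by (rule trivial_ring_module[OF left_moduleD(1)[OF N that] True])
  have Zc: "el Z x = {z}" "0[mod_at Z x] = z" for x by (simp_all add: Z_def)
  have prj: "projective C R Z" unfolding projective_def
  proof (intro conjI Z allI impI, elim conjE)
   fix A B :: "('o, 'm, 'r, ('o, 'm, 'r, 'n) res_univ) rcmod" and e f
   assume A: "left_module C R A" and B: "left_module C R B" and e: "e : rc_hom C R A B"
    and f: "f : rc_hom C R Z B"
   have "e x 0[mod_at A x] = f x a" if "x : Obj C" "a : el Z x" for x a
    using trivial_ring_module[OF left_moduleD(1)[OF B that(1)] True] rc_homD(3)[OF f that]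
     rc_homD(3)[OF e that(1), of "0[mod_at A x]"] left_moduleD(5)[OF A that(1)] by (simp add: ag)
   then show "EX g:rc_hom C R Z A. ALL x:Obj C. ALL a:el Z x. e x (g x a) = f x a"
    by (intro bexI[OF _ rc_hom_zero[OF Z A]] ballI)
  qed
  have "projective_resolution C R N (|res_mod = (%_. Z), res_diff = (%_ _ _. z), res_aug = (%x _. 0[mod_at N x])|)"
   unfolding projective_resolution_def
   using prj rc_hom_zero[OF Z N] rc_hom_zero[OF Z Z] by (simp add: c Zc mod_ker_def)
  then show ?thesis by (intro exI)
 next
  case False
  have "inj (%(k::'n) (l :: ('o \<times> 'm \<times> 'n) list). if map (snd \<circ> snd) l = [k] then 1[R] else 0[R])"
  proof (rule injI)
   fix x y :: 'n assume "(%l :: ('o \<times> 'm \<times> 'n) list. if map (snd \<circ> snd) l = [x] then 1[R] else 0[R])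
    = (%l. if map (snd \<circ> snd) l = [y] then 1[R] else 0[R])"
   from fun_cong[OF this, of "[(undefined, undefined, x)]"] show "x = y" using False by (auto split: if_splits)
  qed
  from cover_exists[OF C R N False this] obtain P0 :: "('o, 'm, 'r, ('o, 'm, 'r, 'n) res_univ) rcmod" and \<epsilon>
   where P0: "is_cover C R N P0 \<epsilon>" by (elim exE)
  define cov :: "('o, 'm, 'r, ('o, 'm, 'r, 'n) res_univ) rcmod => ('o, 'm, 'r, ('o, 'm, 'r, 'n) res_univ) rcmod
    \<times> ('o => ('o, 'm, 'r, 'n) res_univ => ('o, 'm, 'r, 'n) res_univ)"
   where "cov K = (SOME p. is_cover C R K (fst p) (snd p))" for K
  have cov: "is_cover C R K (fst (cov K)) (snd (cov K))" if K: "left_module C R K" for K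
  proof -
   obtain P :: "('o, 'm, 'r, ('o, 'm, 'r, 'n) res_univ) rcmod" and e where "is_cover C R K P e"
    using cover_exists[where ik = "%u :: ('o, 'm, 'r, 'n) res_univ. u", OF C R K False inj_on_id2] by (elim exE)
   then have "is_cover C R K (fst (P, e)) (snd (P, e))" by simp
   from someI[of "%p. is_cover C R K (fst p) (snd p)", OF this] show ?thesis
    unfolding cov_def .
  qed
  define ker where "ker P (N' :: ('o, 'm, 'r, ('o, 'm, 'r, 'n) res_univ) rcmod) d
    = sub_left P (%x. mod_ker (mod_at P x) (mod_at N' x) (d x))"
   for P :: "('o, 'm, 'r, ('o, 'm, 'r, 'n) res_univ) rcmod" and N' d
  define K0 where "K0 = sub_left P0 (%x. mod_ker (mod_at P0 x) (mod_at N x) (\<epsilon> x))"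
  \<comment> \<open>\<open>K n\<close> is the kernel of the last map before the next cover. The
    recursion starts from the separately defined \<open>K0\<close> since the first cover maps to
    \<open>N\<close>, whose elements have another type.\<close>
  define K where "K n = rec_nat K0 (%_ K. ker (fst (cov K)) K (snd (cov K))) n" for n
  define P where "P n = (case n of 0 => P0 | Suc m => fst (cov (K m)))" for n
  define d where "d n = snd (cov (K n))" for n
  have KS: "K 0 = K0" "K (Suc n) = ker (P (Suc n)) (K n) (d n)" for n by (simp_all add: K_def P_def d_def)
  have P0L: "left_module C R P0" "\<epsilon> : rc_hom C R P0 N" using P0 by (auto simp: is_cover_def)
  have KL: "left_module C R (K n)" for n
  proof (induction n)
   case 0 then show ?case unfolding KS K0_def by (rule left_module_ker[OF P0L(1) N P0L(2)])
  next
   case (Suc n)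
   have "is_cover C R (K n) (P (Suc n)) (d n)" using cov[OF Suc] by (simp add: P_def d_def)
   then show ?case unfolding KS ker_def using left_module_ker[OF _ Suc] by (auto simp: is_cover_def)
  qed
  have cv: "is_cover C R (K n) (P (Suc n)) (d n)" for n using cov[OF KL] by (simp add: P_def d_def)
  have PL: "left_module C R (P n)" for n using cv P0L by (cases n) (auto simp: is_cover_def P_def)
  have prj: "projective C R (P n)" for n
   using projective_cover[OF C R cv] projective_cover[OF C R P0] by (cases n) (auto simp: P_def)
  have Ksub: "el (K n) x <= el (P n) x" for n x
   by (cases n) (auto simp: KS K0_def ker_def sub_left_def mod_ker_def P_def)
  have Kops: "add (mod_at (K n) x) = add (mod_at (P n) x)" "smult (mod_at (K n) x) = smult (mod_at (P n) x)"
   "zero (mod_at (K n) x) = zero (mod_at (P n) x)" "mod_map (K n) = mod_map (P n)" for n x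
   by (cases n; auto simp: KS K0_def ker_def sub_left_def P_def)+
  have dhom: "d n : rc_hom C R (P (Suc n)) (P n)" for n
  proof -
   have d: "d n : rc_hom C R (P (Suc n)) (K n)" using cv by (simp add: is_cover_def)
   show ?thesis
   proof (rule rc_homI)
    show "d n x : mod_hom R (mod_at (P (Suc n)) x) (mod_at (P n) x)" if "x : Obj C" for x
     using mod_homD[OF rc_homD(1)[OF d that]] Ksub[of n x] by (intro mod_homI) (auto simp: Kops)
    show "d n y (mod_map (P (Suc n)) x y f a) = mod_map (P n) x y f (d n x a)"
     if "x : Obj C" "y : Obj C" "f : Hom C x y" "a : el (P (Suc n)) x" for x y f a
     using rc_homD(2)[OF d that] by (simp add: Kops)
   qed
  qed
  have im: "d n x ` el (P (Suc n)) x = el (K n) x" if "x : Obj C" for n x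
   using cv that by (simp add: is_cover_def)
  have K0c: "el (K 0) x = mod_ker (mod_at (P 0) x) (mod_at N x) (\<epsilon> x)" for x
   by (simp add: KS K0_def sub_left_def P_def)
  have KSc: "el (K (Suc n)) x = mod_ker (mod_at (P (Suc n)) x) (mod_at (P n) x) (d n x)" for n x
   by (simp add: KS(2) ker_def sub_left_def mod_ker_def Kops(3))
  have eps: "\<epsilon> : rc_hom C R (P 0) N" "ALL x:Obj C. \<epsilon> x ` el (P 0) x = el N x"
   using P0 by (simp_all add: is_cover_def P_def)
  have "projective_resolution C R N (|res_mod = P, res_diff = d, res_aug = \<epsilon>|)"
   unfolding projective_resolution_def resolution.simps
   unfolding K0c[symmetric] KSc[symmetric] by (intro conjI allI ballI prj dhom eps eps(2)[rule_format] im)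
  then show ?thesis by (intro exI)
 qed
 then show ?thesis unfolding proj_res_def by (rule someI_ex)
qed

section \<open>Comparison of resolutions\<close>

lemma projective_resolutionD:
 assumes "projective_resolution C R N P"
 shows "projective C R (res_mod P n)" "left_module C R (res_mod P n)"
  "res_diff P n : rc_hom C R (res_mod P (Suc n)) (res_mod P n)"
  "res_aug P : rc_hom C R (res_mod P 0) N"
  "x : Obj C ==> res_aug P x ` el (res_mod P 0) x = el N x"
  "x : Obj C ==> res_diff P 0 x ` el (res_mod P (Suc 0)) x
     = mod_ker (mod_at (res_mod P 0) x) (mod_at N x) (res_aug P x)"
  "x : Obj C ==> res_diff P (Suc n) x ` el (res_mod P (Suc (Suc n))) x
     = mod_ker (mod_at (res_mod P (Suc n)) x) (mod_at (res_mod P n) x) (res_diff P n x)"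
proof -
 note a = assms[unfolded projective_resolution_def]
 show p: "projective C R (res_mod P n)" using conjunct1[OF a] by (rule spec)
 show "left_module C R (res_mod P n)" using p unfolding projective_def by (rule conjunct1)
qed (use assms[unfolded projective_resolution_def, THEN conjunct2] in simp_all)

lemma resolution_dd:
 assumes P: "projective_resolution C R N P" and x: "x : Obj C"
 shows "a : el (res_mod P (Suc 0)) x ==> res_aug P x (res_diff P 0 x a) = 0[mod_at N x]"
  "a : el (res_mod P (Suc (Suc n))) x ==>
   res_diff P n x (res_diff P (Suc n) x a) = 0[mod_at (res_mod P n) x]"
 using projective_resolutionD(6)[OF P x] projective_resolutionD(7)[OF P x, of n]
 by (auto simp: mod_ker_def)

lemma rc_hom_apply_zero:
 assumes "left_module C R M" "left_module C R N" "f : rc_hom C R M N" "x : Obj C"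
 shows "f x 0[mod_at M x] = 0[mod_at N x]"
 by (rule mod_hom_zero[OF rc_homD(1)[OF assms(3,4)] left_moduleD(5)[OF assms(1,4)] left_moduleD(5)[OF assms(2,4)]])

lemma rc_hom_apply_minus:
 assumes "left_module C R M" "left_module C R N" "f : rc_hom C R M N" "x : Obj C"
  "a : el M x" "b : el M x"
 shows "f x (a -[mod_at M x] b) = f x a -[mod_at N x] f x b"
 by (rule mod_hom_minus[OF rc_homD(1)[OF assms(3,4)] left_moduleD(5)[OF assms(1,4)] left_moduleD(5)[OF assms(2,4)] assms(5,6)])

lemma rc_hom_apply_add:
 assumes "f : rc_hom C R M N" "x : Obj C" "a : el M x" "b : el M x"
 shows "f x (a +[mod_at M x] b) = f x a +[mod_at N x] f x b"
 by (rule mod_homD(2)[OF rc_homD(1)[OF assms(1,2)] assms(3,4)])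

lemma rc_hom_uminus:
 assumes "left_module C R M" "left_module C R N" "f : rc_hom C R M N"
 shows "(%x a. -[mod_at N x] f x a) : rc_hom C R M N"
proof (rule rc_homI)
 fix x assume x: "x : Obj C"
 have N: "module R (mod_at N x)" by (rule left_moduleD(1)[OF assms(2) x])
 interpret abelian_group "mod_at N x" by (rule left_moduleD(5)[OF assms(2) x])
 show "(%a. -[mod_at N x] f x a) : mod_hom R (mod_at M x) (mod_at N x)"
  by (rule mod_homI) (simp_all add: rc_homD(3)[OF assms(3) x] mod_homD(2,3)[OF rc_homD(1)[OF assms(3) x]]
   minus_add module.smult_r_minus[OF N])
next
 fix x y f' a assume xy: "x : Obj C" "y : Obj C" "f' : Hom C x y" and a: "a : el M x"
 show "-[mod_at N y] f y (mod_map M x y f' a) = mod_map N x y f' (-[mod_at N x] f x a)"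
  using mod_hom_inv[OF left_moduleD(2)[OF assms(2) xy] left_moduleD(5)[OF assms(2) xy(1)]
   left_moduleD(5)[OF assms(2) xy(2)] rc_homD(3)[OF assms(3) xy(1) a]] rc_homD(2)[OF assms(3) xy a] by simp
qed

lemma rc_hom_minus:
 assumes "left_module C R M" "left_module C R N" "f : rc_hom C R M N" "g : rc_hom C R M N"
 shows "(%x a. f x a -[mod_at N x] g x a) : rc_hom C R M N"
 unfolding a_minus_def by (rule rc_hom_add[OF assms(1-3) rc_hom_uminus[OF assms(1,2,4)]])

text \<open>The comparison theorem, by dependent choice. The target only has to be exact, in any
  type: it is applied to pulled back and to restricted resolutions, whose terms are not known to be
  projective.\<close>

lemma chain_lift:
 fixes P :: "('o, 'm, 'r, ('o, 'm, 'r, 'n) res_univ, 'n) resolution" and Q :: "nat => ('o, 'm, 'r, 'b) rcmod"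
 assumes C: "category C" and R: "cring R" and P: "projective_resolution C R N P" and N: "left_module C R N"
  and Q: "!!n. left_module C R (Q n)" and d: "!!n. d n : rc_hom C R (Q (Suc n)) (Q n)"
  and a: "a : rc_hom C R (Q 0) N"
  and e0: "!!x. x : Obj C ==> a x ` el (Q 0) x = el N x"
  and e1: "!!x. x : Obj C ==> d 0 x ` el (Q (Suc 0)) x = mod_ker (mod_at (Q 0) x) (mod_at N x) (a x)"
  and e2: "!!x n. x : Obj C ==> d (Suc n) x ` el (Q (Suc (Suc n))) x
    = mod_ker (mod_at (Q (Suc n)) x) (mod_at (Q n) x) (d n x)"
 shows "EX \<tau>. (ALL n. \<tau> n : rc_hom C R (res_mod P n) (Q n)) &
  (ALL n. ALL x:Obj C. ALL b:el (res_mod P (Suc n)) x. \<tau> n x (res_diff P n x b) = d n x (\<tau> (Suc n) x b)) &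
  (ALL x:Obj C. ALL b:el (res_mod P 0) x. a x (\<tau> 0 x b) = res_aug P x b)"
proof -
 note p = projective_resolutionD[OF P]
 \<comment> \<open>\<open>good\<close> carries what the next lift needs: after the differential,
   \<open>t\<close> lands in the image of \<open>d n\<close>. In degree 0 this comes from the
   augmentation.\<close>
 define good where "good n t \<longleftrightarrow> t : rc_hom C R (res_mod P n) (Q n) &
  (ALL x:Obj C. ALL b:el (res_mod P (Suc n)) x. t x (res_diff P n x b) : d n x ` el (Q (Suc n)) x) &
  (n = 0 --> (ALL x:Obj C. ALL b:el (res_mod P 0) x. a x (t x b) = res_aug P x b))" for n t
 define step where "step n t t' \<longleftrightarrow> (ALL x:Obj C. ALL b:el (res_mod P (Suc n)) x. t x (res_diff P n x b) = d n x (t' x b))" for n t t'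
 have base: "EX t. good 0 t"
 proof -
  have "EX t:rc_hom C R (res_mod P 0) (Q 0). ALL x:Obj C. ALL b:el (res_mod P 0) x. a x (t x b) = res_aug P x b"
   by (rule projective_lift[OF C R p(1) Q N a p(4)]) (use e0 rc_homD(3)[OF p(4)] in auto)
  then obtain t where t: "t : rc_hom C R (res_mod P 0) (Q 0)"
   "ALL x:Obj C. ALL b:el (res_mod P 0) x. a x (t x b) = res_aug P x b" by blast
  have "t x (res_diff P 0 x b) : d 0 x ` el (Q (Suc 0)) x"
   if x: "x : Obj C" and b: "b : el (res_mod P (Suc 0)) x" for x b
   unfolding e1[OF x] mod_ker_def
   using rc_homD(3)[OF p(3) x b] rc_homD(3)[OF t(1) x] t(2) x resolution_dd(1)[OF P x b] by auto
  then show ?thesis using t unfolding good_def by (intro exI[of _ t] conjI ballI impI) simp_all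
 qed
 have next_step: "EX t'. good (Suc n) t' & step n t t'" if g: "good n t" for n t
 proof -
  have t: "t : rc_hom C R (res_mod P n) (Q n)" using g unfolding good_def by (rule conjunct1)
  note f = rc_hom_comp[OF p(3) t]
  have "EX t':rc_hom C R (res_mod P (Suc n)) (Q (Suc n)). ALL x:Obj C. ALL b:el (res_mod P (Suc n)) x.
    d n x (t' x b) = t x (res_diff P n x b)"
   by (rule projective_lift[OF C R p(1) Q Q d f]) (use g in \<open>simp add: good_def\<close>)
  then obtain t' where t': "t' : rc_hom C R (res_mod P (Suc n)) (Q (Suc n))"
   "ALL x:Obj C. ALL b:el (res_mod P (Suc n)) x. d n x (t' x b) = t x (res_diff P n x b)" by blast
  have "t' x (res_diff P (Suc n) x b) : d (Suc n) x ` el (Q (Suc (Suc n))) x"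
   if x: "x : Obj C" and b: "b : el (res_mod P (Suc (Suc n))) x" for x b
   unfolding e2[OF x] mod_ker_def
   using rc_homD(3)[OF p(3) x b] rc_homD(3)[OF t'(1) x] t'(2) x resolution_dd(2)[OF P x b]
    rc_hom_apply_zero[OF p(2) Q t x] by auto
  then show ?thesis using t' unfolding good_def step_def by (intro exI[of _ t'] conjI ballI impI) simp_all
 qed
 from dependent_nat_choice[of good step, OF base next_step]
 obtain \<tau> where \<tau>: "!!n. good n (\<tau> n)" "!!n. step n (\<tau> n) (\<tau> (Suc n))" by blast
 show ?thesis
  by (rule exI[of _ \<tau>]) (use \<tau> in \<open>simp add: good_def step_def\<close>)
qed

section \<open>Homogeneous cochains with values in a left module\<close>

definition tuples :: "('g, 't) monoid_scheme => nat => 'g list set" where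
 "tuples G k = {l. set l <= carrier G & length l = k}"

definition shift :: "('g, 't) monoid_scheme => 'g => 'g list => 'g list" where
 "shift G g l = map (%h. inv\<^bsub>G\<^esub> g \<otimes>\<^bsub>G\<^esub> h) l"

text \<open>Homogeneous cochains with the diagonal action: \<open>g\<close> sends
  \<open>\<phi>\<close> to the function with value \<open>g \<phi> (g^-1 l)\<close> at
  \<open>l\<close>. Degree 0 has the empty tuple as its only argument and is a copy of
  \<open>M\<close>.\<close>

definition coch :: "('g, 't) monoid_scheme => nat => ('o, 'g, 'r, 'a) rcmod => ('o, 'g, 'r, 'g list => 'a) rcmod" where
 "coch G k M = (|mod_at = (%x. fun_mod (tuples G k) (%_. mod_at M x)),
   mod_map = (%x y g \<phi>. \<lambda>l\<in>tuples G k. mod_map M x y g (\<phi> (shift G g l)))|)"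

text \<open>The alternating sum \<open>\<Sum>i. (-1)\<^sup>i \<phi> (l with entry i omitted)\<close>, by recursion on \<open>l\<close>.\<close>

primrec ldiff :: "('r, 'a) module => 'g list => ('g list => 'a) => 'a" where
 "ldiff A [] = (%\<phi>. 0[A])"
| "ldiff A (g # l) = (%\<phi>. \<phi> l -[A] ldiff A l (%l'. \<phi> (g # l')))"

definition cdiff :: "('g, 't) monoid_scheme => nat => ('o, 'g, 'r, 'a) rcmod => 'o => ('g list => 'a) => 'g list => 'a" where
 "cdiff G k M x \<phi> = (\<lambda>l\<in>tuples G (Suc k). ldiff (mod_at M x) l \<phi>)"

text \<open>Only lists shorter by one with entries in \<open>X\<close> are constrained, because a
  cochain is \<open>undefined\<close> off the tuples of its degree. The same form recurs in the
  lemmas that follow.\<close>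

lemma ldiff_closed:
 assumes "abelian_group A"
  and "!!l'. set l' <= X ==> Suc (length l') = length l ==> \<phi> l' : carrier A" "set l <= X"
 shows "ldiff A l \<phi> : carrier A"
 using assms(2,3)
proof (induction l arbitrary: \<phi>)
 case (Cons g l)
 have "ldiff A l (%l'. \<phi> (g # l')) : carrier A"
  by (rule Cons.IH) (use Cons.prems in auto)
 then show ?case using Cons.prems assms(1) by (simp add: ag)
qed (simp add: ag assms(1))

lemma ldiff_cong:
 assumes "!!l'. set l' <= X ==> Suc (length l') = length l ==> \<phi> l' = \<psi> l'" "set l <= X"
 shows "ldiff A l \<phi> = ldiff A l \<psi>"
 using assms
proof (induction l arbitrary: \<phi> \<psi>)
 case (Cons g l)
 have "ldiff A l (%l'. \<phi> (g # l')) = ldiff A l (%l'. \<psi> (g # l'))"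
  by (rule Cons.IH) (use Cons.prems in auto)
 then show ?case using Cons.prems by simp
qed simp

lemma ldiff_hom:
 assumes "abelian_group A" "abelian_group B" "f : mod_hom R A B"
  and "!!l'. set l' <= X ==> Suc (length l') = length l ==> \<phi> l' : carrier A" "set l <= X"
 shows "f (ldiff A l \<phi>) = ldiff B l (%l'. f (\<phi> l'))"
 using assms(4,5)
proof (induction l arbitrary: \<phi>)
 case Nil then show ?case using mod_hom_zero[OF assms(3,1,2)] by simp
next
 case (Cons g l)
 have c: "ldiff A l (%l'. \<phi> (g # l')) : carrier A"
  by (rule ldiff_closed[OF assms(1), of X]) (use Cons.prems in auto)
 have "f (ldiff A l (%l'. \<phi> (g # l'))) = ldiff B l (%l'. f (\<phi> (g # l')))"
  by (rule Cons.IH) (use Cons.prems in auto)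
 then show ?case using mod_hom_minus[OF assms(3,1,2) _ c] Cons.prems by simp
qed

lemma ldiff_add:
 assumes "abelian_group A"
  and "!!l'. set l' <= X ==> Suc (length l') = length l ==> \<phi> l' : carrier A"
  and "!!l'. set l' <= X ==> Suc (length l') = length l ==> \<psi> l' : carrier A" "set l <= X"
 shows "ldiff A l (%l'. \<phi> l' +[A] \<psi> l') = ldiff A l \<phi> +[A] ldiff A l \<psi>"
 using assms(2,3,4)
proof (induction l arbitrary: \<phi> \<psi>)
 case Nil then show ?case using assms(1) by (simp add: ag)
next
 case (Cons g l)
 have c: "ldiff A l (%l'. \<phi> (g # l')) : carrier A" "ldiff A l (%l'. \<psi> (g # l')) : carrier A" "\<phi> l : carrier A" "\<psi> l : carrier A"
  by (rule ldiff_closed[OF assms(1), of X], use Cons.prems in auto)+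
 have IH: "ldiff A l (%l'. \<phi> (g # l') +[A] \<psi> (g # l')) = ldiff A l (%l'. \<phi> (g # l')) +[A] ldiff A l (%l'. \<psi> (g # l'))"
  by (rule Cons.IH) (use Cons.prems in auto)
 show ?case unfolding ldiff.simps IH using c assms(1) by - (rule ab_eqI[of A], simp add: ab)
qed

lemma ldiff_minus:
 assumes "abelian_group A"
  and "!!l'. set l' <= X ==> Suc (length l') = length l ==> \<phi> l' : carrier A"
  and "!!l'. set l' <= X ==> Suc (length l') = length l ==> \<psi> l' : carrier A" "set l <= X"
 shows "ldiff A l (%l'. \<phi> l' -[A] \<psi> l') = ldiff A l \<phi> -[A] ldiff A l \<psi>"
proof -
 have c: "ldiff A l (%l'. \<phi> l' -[A] \<psi> l') : carrier A" "ldiff A l \<psi> : carrier A"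
  by (rule ldiff_closed[OF assms(1) _ assms(4)]; simp add: assms ag)+
 have "ldiff A l \<phi> = ldiff A l (%l'. (\<phi> l' -[A] \<psi> l') +[A] \<psi> l')"
 proof (rule ldiff_cong[OF _ assms(4)])
  fix l' assume l: "set l' <= X" "Suc (length l') = length l"
  show "\<phi> l' = (\<phi> l' -[A] \<psi> l') +[A] \<psi> l'"
   using assms(2,3)[OF l] assms(1) by - (rule ab_eqI[of A], simp add: ab)
 qed
 also have "\<dots> = ldiff A l (%l'. \<phi> l' -[A] \<psi> l') +[A] ldiff A l \<psi>"
  by (rule ldiff_add[OF assms(1) _ _ assms(4)]; simp add: assms ag)
 finally show ?thesis using c assms(1) by - (rule ab_eqI[of A], simp add: ab)
qed

lemma ldiff_map: "ldiff A (map s l) \<phi> = ldiff A l (%l'. \<phi> (map s l'))"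
 by (induction l arbitrary: \<phi>) simp_all

text \<open>Splitting off the first entry \<open>g\<close> leaves \<open>ldiff A l \<phi>\<close>
  twice with opposite signs, and a remainder that vanishes by induction for the function
  \<open>\<phi> (g # _)\<close>.\<close>

lemma ldiff_ldiff:
 assumes "abelian_group A"
  and "!!l'. set l' <= X ==> Suc (Suc (length l')) = length l ==> \<phi> l' : carrier A" "set l <= X"
 shows "ldiff A l (%l'. ldiff A l' \<phi>) = 0[A]"
 using assms(2,3)
proof (induction l arbitrary: \<phi>)
 case (Cons g l)
 have IH: "ldiff A l (%l'. ldiff A l' (%l''. \<phi> (g # l''))) = 0[A]"
  by (rule Cons.IH) (use Cons.prems in auto)
 have c1: "ldiff A l \<phi> : carrier A"
  by (rule ldiff_closed[OF assms(1), of X]) (use Cons.prems in auto)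
 have "ldiff A l (%l'. \<phi> l' -[A] ldiff A l' (%l''. \<phi> (g # l'')))
   = ldiff A l \<phi> -[A] ldiff A l (%l'. ldiff A l' (%l''. \<phi> (g # l'')))"
 proof (rule ldiff_minus[OF assms(1), of X])
  fix l' assume l: "set l' <= X" "Suc (length l') = length l"
  show "\<phi> l' : carrier A" using Cons.prems l by auto
  show "ldiff A l' (%l''. \<phi> (g # l'')) : carrier A"
   by (rule ldiff_closed[OF assms(1), of X]) (use Cons.prems l in auto)
 qed (use Cons.prems in auto)
 then show ?case unfolding ldiff.simps IH using c1 assms(1) by - (rule ab_eqI[of A], simp add: ab)
qed simp

text \<open>A category whose morphisms are elements of \<open>G\<close> composed by multiplication:
  the common frame of the transporter category and of \<open>C_G(H)\<close> as a category with one
  object. Cochains are functions on powers of \<open>G\<close> in both cases, which is why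
  invariants formed in the former compute cohomology of the latter.\<close>

locale graded_cat = group G for G :: "('g, 't) monoid_scheme" (structure) +
 fixes R :: "('r, 's) ring_scheme" and T :: "('o, 'g) cat"
 assumes R: "cring R" and T: "category T"
  and Hom_sub: "!!x y f. x : Obj T ==> y : Obj T ==> f : Hom T x y ==> f : carrier G"
  and Id_T: "!!x. x : Obj T ==> Id T x = \<one>"
  and Comp_T: "!!x y z f g. x : Obj T ==> y : Obj T ==> z : Obj T ==> f : Hom T x y ==> g : Hom T y z ==>
   Comp T g f = g \<otimes> f"
begin

lemma shift_tuples: "g : carrier G ==> l : tuples G k ==> shift G g l : tuples G k"
 by (auto simp: tuples_def shift_def)

lemma shift_one: "l : tuples G k ==> shift G \<one> l = l"
 unfolding shift_def by (rule map_idI) (auto simp: tuples_def)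

lemma shift_mult: "f : carrier G ==> g : carrier G ==> l : tuples G k ==> shift G (g \<otimes> f) l = shift G f (shift G g l)"
 by (auto simp: tuples_def shift_def inv_mult_group m_assoc)

lemma coch_at: "mod_at (coch G k M) x = fun_mod (tuples G k) (%_. mod_at M x)"
 by (simp add: coch_def)

lemma coch_car: "\<phi> : el (coch G k M) x \<longleftrightarrow> \<phi> : extensional (tuples G k) & (ALL l:tuples G k. \<phi> l : el M x)"
 by (auto simp: coch_at PiE_iff)

lemma coch_app: "\<phi> : el (coch G k M) x ==> l : tuples G k ==> \<phi> l : el M x"
 by (simp add: coch_car)

lemma coch_restrict: "(!!l. l : tuples G k ==> \<phi> l : el M x) ==> (\<lambda>l\<in>tuples G k. \<phi> l) : el (coch G k M) x"
 by (simp add: coch_car)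

lemma coch_ops:
 "0[mod_at (coch G k M) x] = (\<lambda>l\<in>tuples G k. 0[mod_at M x])"
 "\<phi> +[mod_at (coch G k M) x] \<psi> = (\<lambda>l\<in>tuples G k. \<phi> l +[mod_at M x] \<psi> l)"
 "r *[mod_at (coch G k M) x] \<phi> = (\<lambda>l\<in>tuples G k. r *[mod_at M x] \<phi> l)"
 by (simp_all add: coch_at)

lemma coch_map: "mod_map (coch G k M) x y g \<phi> = (\<lambda>l\<in>tuples G k. mod_map M x y g (\<phi> (shift G g l)))"
 by (simp add: coch_def)

lemma coch_eqI:
 assumes "\<phi> : el (coch G k M) x" "\<psi> : el (coch G k M) x"
  "!!l. l : tuples G k ==> \<phi> l = \<psi> l"
 shows "\<phi> = \<psi>"
 by (rule extensionalityI[of _ "tuples G k"]) (use assms in \<open>auto simp: coch_car\<close>)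

lemma left_module_coch:
 assumes M: "left_module T R M"
 shows "left_module T R (coch G k M)"
proof (rule left_moduleI)
 show "module R (mod_at (coch G k M) x)" if "x : Obj T" for x
  unfolding coch_at by (rule module_fun_mod[OF R left_moduleD(1)[OF M that]])
next
 fix x y f assume xy: "x : Obj T" "y : Obj T" "f : Hom T x y"
 note s = shift_tuples[OF Hom_sub[OF xy]]
 show "mod_map (coch G k M) x y f : mod_hom R (mod_at (coch G k M) x) (mod_at (coch G k M) y)"
 proof (rule mod_homI)
  fix \<phi> assume p: "\<phi> : el (coch G k M) x"
  show "mod_map (coch G k M) x y f \<phi> : el (coch G k M) y" unfolding coch_map
   by (rule coch_restrict) (rule left_moduleD(6)[OF M xy coch_app[OF p s]])
  show "mod_map (coch G k M) x y f (r *[mod_at (coch G k M) x] \<phi>) = r *[mod_at (coch G k M) y] mod_map (coch G k M) x y f \<phi>"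
   if "r : carrier R" for r unfolding coch_map coch_ops
   by (rule restrict_ext) (simp add: s mod_homD(3)[OF left_moduleD(2)[OF M xy] that coch_app[OF p]])
  fix \<psi> assume q: "\<psi> : el (coch G k M) x"
  show "mod_map (coch G k M) x y f (\<phi> +[mod_at (coch G k M) x] \<psi>)
    = mod_map (coch G k M) x y f \<phi> +[mod_at (coch G k M) y] mod_map (coch G k M) x y f \<psi>" unfolding coch_map coch_ops
   by (rule restrict_ext) (simp add: s mod_homD(2)[OF left_moduleD(2)[OF M xy] coch_app[OF p] coch_app[OF q]])
 qed
next
 fix x \<phi> assume x: "x : Obj T" and p: "\<phi> : el (coch G k M) x"
 show "mod_map (coch G k M) x x (Id T x) \<phi> = \<phi>" unfolding coch_map
  by (rule restrict_eqI)
   (use p x in \<open>simp_all add: coch_car Id_T shift_one left_moduleD(3)[OF M x, unfolded Id_T[OF x]]\<close>)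
next
 fix x y z f g \<phi> assume xyz: "x : Obj T" "y : Obj T" "z : Obj T" "f : Hom T x y" "g : Hom T y z"
  and p: "\<phi> : el (coch G k M) x"
 have fg: "f : carrier G" "g : carrier G" using Hom_sub xyz by blast+
 show "mod_map (coch G k M) x z (Comp T g f) \<phi> = mod_map (coch G k M) y z g (mod_map (coch G k M) x y f \<phi>)"
  unfolding coch_map
 proof (rule restrict_ext)
  fix l assume l: "l : tuples G k"
  note sl = shift_tuples[OF fg(2) l] shift_tuples[OF fg(1) shift_tuples[OF fg(2) l]]
  show "mod_map M x z (Comp T g f) (\<phi> (shift G (Comp T g f) l))
    = mod_map M y z g ((\<lambda>l\<in>tuples G k. mod_map M x y f (\<phi> (shift G f l))) (shift G g l))"
   using left_moduleD(4)[OF M xyz coch_app[OF p sl(2)]] sl by (simp add: Comp_T[OF xyz] shift_mult[OF fg l])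
 qed
qed

lemma cdiff_hom:
 assumes M: "left_module T R M"
 shows "cdiff G k M : rc_hom T R (coch G k M) (coch G (Suc k) M)"
proof (rule rc_homI)
 have v: "\<phi> l' : el M x" if "\<phi> : el (coch G k M) x" "l : tuples G (Suc k)"
  "set l' <= carrier G" "Suc (length l') = length l" for \<phi> l l' x
  using that by (auto simp: coch_car tuples_def)
 have sl: "set l <= carrier G" if "l : tuples G (Suc k)" for l using that by (simp add: tuples_def)
 fix x assume x: "x : Obj T"
 note a = left_moduleD(5)[OF M x]
 note m = left_moduleD(1)[OF M x]
 show "cdiff G k M x : mod_hom R (mod_at (coch G k M) x) (mod_at (coch G (Suc k) M) x)"
 proof (rule mod_homI)
  fix \<phi> assume p: "\<phi> : el (coch G k M) x"
  show "cdiff G k M x \<phi> : el (coch G (Suc k) M) x" unfolding cdiff_def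
   by (rule coch_restrict) (rule ldiff_closed[OF a v[OF p] sl])
  show "cdiff G k M x (r *[mod_at (coch G k M) x] \<phi>) = r *[mod_at (coch G (Suc k) M) x] cdiff G k M x \<phi>"
   if r: "r : carrier R" for r unfolding cdiff_def coch_ops
  proof (rule restrict_ext)
   fix l assume l: "l : tuples G (Suc k)"
   interpret Rr: cring R by (rule R)
   have "(%a. r *[mod_at M x] a) : mod_hom R (mod_at M x) (mod_at M x)"
   proof (rule mod_homI)
    fix s b assume sb: "s : carrier R" "b : el M x"
    then show "r *[mod_at M x] (s *[mod_at M x] b) = s *[mod_at M x] (r *[mod_at M x] b)"
     using module.smult_assoc1[OF m r sb] module.smult_assoc1[OF m sb(1) r sb(2)] Rr.m_comm[OF r sb(1)] by simp
   qed (simp_all add: r module.smult_closed[OF m] module.smult_r_distr[OF m])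
   from ldiff_hom[OF a a this v[OF p l] sl[OF l]]
   have "ldiff (mod_at M x) l (%l'. r *[mod_at M x] \<phi> l') = r *[mod_at M x] ldiff (mod_at M x) l \<phi>" by simp
   moreover have "ldiff (mod_at M x) l (\<lambda>l\<in>tuples G k. r *[mod_at M x] \<phi> l) = ldiff (mod_at M x) l (%l'. r *[mod_at M x] \<phi> l')"
    by (rule ldiff_cong[OF _ sl[OF l]]) (use l in \<open>simp add: tuples_def\<close>)
   ultimately show "ldiff (mod_at M x) l (\<lambda>l\<in>tuples G k. r *[mod_at M x] \<phi> l)
     = r *[mod_at M x] (\<lambda>l\<in>tuples G (Suc k). ldiff (mod_at M x) l \<phi>) l" using l by simp
  qed
  fix \<psi> assume q: "\<psi> : el (coch G k M) x"
  show "cdiff G k M x (\<phi> +[mod_at (coch G k M) x] \<psi>) = cdiff G k M x \<phi> +[mod_at (coch G (Suc k) M) x] cdiff G k M x \<psi>"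
   unfolding cdiff_def coch_ops
  proof (rule restrict_ext)
   fix l assume l: "l : tuples G (Suc k)"
   have "ldiff (mod_at M x) l (\<lambda>l\<in>tuples G k. \<phi> l +[mod_at M x] \<psi> l) = ldiff (mod_at M x) l (%l. \<phi> l +[mod_at M x] \<psi> l)"
    by (rule ldiff_cong[OF _ sl[OF l]]) (use l in \<open>simp add: tuples_def\<close>)
   then show "ldiff (mod_at M x) l (\<lambda>l\<in>tuples G k. \<phi> l +[mod_at M x] \<psi> l)
    = (\<lambda>l\<in>tuples G (Suc k). ldiff (mod_at M x) l \<phi>) l +[mod_at M x] (\<lambda>l\<in>tuples G (Suc k). ldiff (mod_at M x) l \<psi>) l"
    using ldiff_add[OF a v[OF p l] v[OF q l] sl[OF l]] l by simp
  qed
 qed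
next
 fix x y f \<phi> assume xy: "x : Obj T" "y : Obj T" "f : Hom T x y" and p: "\<phi> : el (coch G k M) x"
 note f = Hom_sub[OF xy]
 show "cdiff G k M y (mod_map (coch G k M) x y f \<phi>) = mod_map (coch G (Suc k) M) x y f (cdiff G k M x \<phi>)"
  unfolding cdiff_def coch_map
 proof (rule restrict_ext)
  fix l assume l: "l : tuples G (Suc k)"
  have sl: "set l <= carrier G" using l by (simp add: tuples_def)
  note l2 = shift_tuples[OF f l]
  have "ldiff (mod_at M y) l (\<lambda>l\<in>tuples G k. mod_map M x y f (\<phi> (shift G f l)))
    = ldiff (mod_at M y) l (%l. mod_map M x y f (\<phi> (shift G f l)))"
   by (rule ldiff_cong[OF _ sl]) (use l in \<open>simp add: tuples_def\<close>)
  also have "\<dots> = mod_map M x y f (ldiff (mod_at M x) l (%l. \<phi> (shift G f l)))"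
   by (rule ldiff_hom[OF left_moduleD(5)[OF M xy(1)] left_moduleD(5)[OF M xy(2)] left_moduleD(2)[OF M xy] _ sl, symmetric])
    (use coch_app[OF p shift_tuples[OF f]] l in \<open>simp add: tuples_def\<close>)
  also have "ldiff (mod_at M x) l (%l. \<phi> (shift G f l)) = ldiff (mod_at M x) (shift G f l) \<phi>"
   unfolding shift_def by (rule ldiff_map[symmetric])
  finally show "ldiff (mod_at M y) l (\<lambda>l\<in>tuples G k. mod_map M x y f (\<phi> (shift G f l)))
    = mod_map M x y f ((\<lambda>l\<in>tuples G (Suc k). ldiff (mod_at M x) l \<phi>) (shift G f l))"
   unfolding restrict_apply'[OF l2] .
 qed
qed

lemma cdiff_cdiff:
 assumes M: "left_module T R M" and x: "x : Obj T" and p: "\<phi> : el (coch G k M) x"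
 shows "cdiff G (Suc k) M x (cdiff G k M x \<phi>) = 0[mod_at (coch G (Suc (Suc k)) M) x]"
 unfolding coch_ops unfolding cdiff_def
proof (rule restrict_ext)
 fix l assume l: "l : tuples G (Suc (Suc k))"
 have sl: "set l <= carrier G" using l by (simp add: tuples_def)
 have "ldiff (mod_at M x) l (\<lambda>l\<in>tuples G (Suc k). ldiff (mod_at M x) l \<phi>) = ldiff (mod_at M x) l (%l. ldiff (mod_at M x) l \<phi>)"
  by (rule ldiff_cong[OF _ sl]) (use l in \<open>simp add: tuples_def\<close>)
 also have "\<dots> = 0[mod_at M x]"
  by (rule ldiff_ldiff[OF left_moduleD(5)[OF M x] _ sl]) (use l p in \<open>simp add: tuples_def coch_car\<close>)
 finally show "ldiff (mod_at M x) l (\<lambda>l\<in>tuples G (Suc k). ldiff (mod_at M x) l \<phi>) = 0[mod_at M x]" .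
qed

text \<open>Evaluating \<open>\<delta>\<phi> = 0\<close> on lists with first entry \<open>1\<close> exhibits \<open>\<phi>\<close> as a coboundary.\<close>

lemma cdiff_exact:
 assumes M: "left_module T R M" and x: "x : Obj T" and p: "\<phi> : el (coch G k M) x"
  and z: "cdiff G k M x \<phi> = 0[mod_at (coch G (Suc k) M) x]"
 shows "k = 0 ==> \<phi> = 0[mod_at (coch G k M) x]"
  "k = Suc k' ==> \<phi> : cdiff G k' M x ` el (coch G k' M) x"
proof -
 let ?A = "mod_at M x"
 have a: "abelian_group ?A" by (rule left_moduleD(5)[OF M x])
 have eq: "\<phi> l = ldiff ?A l (%l'. \<phi> (\<one> # l'))" if l: "l : tuples G k" for l
 proof -
  have sl: "set l <= carrier G" using l by (simp add: tuples_def)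
  have c: "ldiff ?A l (%l'. \<phi> (\<one> # l')) : carrier ?A"
   by (rule ldiff_closed[OF a _ sl]) (use l p in \<open>auto simp: coch_car tuples_def\<close>)
  have "\<one> # l : tuples G (Suc k)" using l by (simp add: tuples_def)
  then have "ldiff ?A (\<one> # l) \<phi> = 0[?A]" using fun_cong[OF z, of "\<one> # l"] by (simp add: cdiff_def coch_ops)
  then have z0: "\<phi> l -[?A] ldiff ?A l (%l'. \<phi> (\<one> # l')) = 0[?A]" by simp
  have "\<phi> l = (\<phi> l -[?A] ldiff ?A l (%l'. \<phi> (\<one> # l'))) +[?A] ldiff ?A l (%l'. \<phi> (\<one> # l'))"
   using c coch_app[OF p l] a by - (rule ab_eqI[of ?A], simp add: ab)
  then show ?thesis unfolding z0 using c a by (simp add: ag)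
 qed
 show "\<phi> = 0[mod_at (coch G k M) x]" if "k = 0"
 proof (rule coch_eqI[OF p])
  show "0[mod_at (coch G k M) x] : el (coch G k M) x"
   using left_moduleD(5)[OF left_module_coch[OF M] x] by (simp add: ag)
  show "\<phi> l = 0[mod_at (coch G k M) x] l" if "l : tuples G k" for l
   using eq[OF that] that \<open>k = 0\<close> by (simp add: coch_ops tuples_def)
 qed
 show "\<phi> : cdiff G k' M x ` el (coch G k' M) x" if k: "k = Suc k'"
 proof
  \<comment> \<open>Prefixing \<open>1\<close> is a contraction at each object but is not natural in
    \<open>x\<close>. Exactness is therefore objectwise, and columns of morphisms still need
    projectivity.\<close>
  let ?\<psi> = "\<lambda>l\<in>tuples G k'. \<phi> (\<one> # l)"
  show psi: "?\<psi> : el (coch G k' M) x"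
   by (rule coch_restrict, rule coch_app[OF p]) (simp add: tuples_def k)
  show "\<phi> = cdiff G k' M x ?\<psi>"
  proof (rule coch_eqI[OF p[unfolded k] rc_homD(3)[OF cdiff_hom[OF M] x psi]])
   fix l assume l: "l : tuples G (Suc k')"
   have "ldiff ?A l (%l'. \<phi> (\<one> # l')) = ldiff ?A l ?\<psi>"
    by (rule ldiff_cong[where X = "carrier G"]) (use l in \<open>auto simp: tuples_def\<close>)
   then show "\<phi> l = cdiff G k' M x ?\<psi> l" using eq[of l] l k by (simp add: cdiff_def)
  qed
 qed
qed

text \<open>For \<open>k = 1\<close> these constant families enter the contraction of an exact
  complex; for \<open>k = 0\<close> they identify \<open>M\<close> with the cochains of degree
  0.\<close>

lemma coch_const_hom:
 assumes M: "left_module T R M"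
 shows "(%x a. \<lambda>l\<in>tuples G k. a) : rc_hom T R M (coch G k M)"
proof (rule rc_homI)
 fix x assume "x : Obj T"
 show "(%a. \<lambda>l\<in>tuples G k. a) : mod_hom R (mod_at M x) (mod_at (coch G k M) x)"
  by (rule mod_homI) (auto simp: coch_ops coch_car intro!: restrict_ext)
next
 fix x y f a assume "x : Obj T" "y : Obj T" "f : Hom T x y"
 then show "(\<lambda>l\<in>tuples G k. mod_map M x y f a) = mod_map (coch G k M) x y f (\<lambda>l\<in>tuples G k. a)"
  using shift_tuples[OF Hom_sub] unfolding coch_map by (intro restrict_ext) simp
qed

lemma coch_map_hom:
 assumes M: "left_module T R M" and N: "left_module T R N" and e: "e : rc_hom T R M N"
 shows "(%x \<phi>. \<lambda>l\<in>tuples G k. e x (\<phi> l)) : rc_hom T R (coch G k M) (coch G k N)"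
proof (rule rc_homI)
 fix x assume x: "x : Obj T"
 show "(%\<phi>. \<lambda>l\<in>tuples G k. e x (\<phi> l)) : mod_hom R (mod_at (coch G k M) x) (mod_at (coch G k N) x)"
  using mod_homD[OF rc_homD(1)[OF e x]]
  by (intro mod_homI) (auto simp: coch_ops coch_car intro!: restrict_ext)
next
 fix x y f \<phi> assume xy: "x : Obj T" "y : Obj T" "f : Hom T x y" and p: "\<phi> : el (coch G k M) x"
 show "(\<lambda>l\<in>tuples G k. e y (mod_map (coch G k M) x y f \<phi> l)) = mod_map (coch G k N) x y f (\<lambda>l\<in>tuples G k. e x (\<phi> l))"
  unfolding coch_map
  by (rule restrict_ext) (simp add: shift_tuples[OF Hom_sub[OF xy]] rc_homD(2)[OF e xy coch_app[OF p]])
qed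

end

section \<open>Double complexes\<close>

text \<open>Degrees are integers: for negative \<open>n\<close> the antidiagonal is empty and the
  total module is zero, so \<open>n - 1\<close> needs no case distinction.\<close>

definition idx :: "int => (nat \<times> nat) set" where
 "idx n = {(i, j). int i + int j = n}"

definition tot :: "(nat => nat => ('r, 'k) module) => int => ('r, nat \<times> nat => 'k) module" where
 "tot D n = fun_mod (idx n) (%(i, j). D i j)"

definition hpart :: "(nat => nat => ('r, 'k) module) => (nat => nat => 'k => 'k) => (nat \<times> nat => 'k) => nat => nat => 'k" where
 "hpart D h w i j = (case i of 0 => 0[D i j] | Suc i' => h i' j (w (i', j)))"

definition vpart :: "(nat => nat => ('r, 'k) module) => (nat => nat => 'k => 'k) => (nat \<times> nat => 'k) => nat => nat => 'k" where
 "vpart D v w i j = (case j of 0 => 0[D i j] | Suc j' => v i j' (w (i, j')))"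

definition td :: "(nat => nat => ('r, 'k) module) => (nat => nat => 'k => 'k) => (nat => nat => 'k => 'k)
  => int => (nat \<times> nat => 'k) => nat \<times> nat => 'k" where
 "td D h v n w = (\<lambda>(i, j)\<in>idx (n + 1). hpart D h w i j +[D i j] vpart D v w i j)"

lemma idx_iff: "(i, j) : idx n \<longleftrightarrow> int i + int j = n"
 by (simp add: idx_def)

text \<open>The squares anticommute, so the total differential is a plain sum; in the complexes of
  morphisms the sign sits in the vertical maps \<open>homv\<close>.\<close>

locale double_complex =
 fixes R :: "('r, 's) ring_scheme" and D :: "nat => nat => ('r, 'k) module" and h v :: "nat => nat => 'k => 'k"
 assumes D: "!!i j. module R (D i j)"
  and h: "!!i j. h i j : mod_hom R (D i j) (D (Suc i) j)"
  and v: "!!i j. v i j : mod_hom R (D i j) (D i (Suc j))"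
  and hh: "!!i j x. x : carrier (D i j) ==> h (Suc i) j (h i j x) = 0[D (Suc (Suc i)) j]"
  and vv: "!!i j x. x : carrier (D i j) ==> v i (Suc j) (v i j x) = 0[D i (Suc (Suc j))]"
  and anti: "!!i j x. x : carrier (D i j) ==>
   h i (Suc j) (v i j x) +[D (Suc i) (Suc j)] v (Suc i) j (h i j x) = 0[D (Suc i) (Suc j)]"
begin

lemma ab_D: "abelian_group (D i j)"
 by (rule module_ag[OF D])

lemma R_cring: "cring R"
 by (rule module_cring[OF D])

lemma h0: "h i j 0[D i j] = 0[D (Suc i) j]"
 by (rule mod_hom_zero[OF h ab_D ab_D])

lemma v0: "v i j 0[D i j] = 0[D i (Suc j)]"
 by (rule mod_hom_zero[OF v ab_D ab_D])

lemma module_tot: "module R (tot D n)"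
 unfolding tot_def by (rule module_fun_mod[OF R_cring]) (auto intro: D)

lemma ab_tot: "abelian_group (tot D n)"
 by (rule module_ag[OF module_tot])

lemma tot_car: "w : carrier (tot D n) \<longleftrightarrow> w : extensional (idx n) & (ALL i j. int i + int j = n --> w (i, j) : carrier (D i j))"
 by (auto simp: tot_def PiE_iff idx_def)

lemma tot_app: "w : carrier (tot D n) ==> int i + int j = n ==> w (i, j) : carrier (D i j)"
 by (simp add: tot_car)

lemma tot_eqI:
 assumes "w : carrier (tot D n)" "w' : carrier (tot D n)"
  "!!i j. int i + int j = n ==> w (i, j) = w' (i, j)"
 shows "w = w'"
 by (rule extensionalityI[of _ "idx n"]) (use assms in \<open>auto simp: tot_car idx_def\<close>)

lemma tot_ops:
 assumes "int i + int j = n"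
 shows "0[tot D n] (i, j) = 0[D i j]"
  "(w +[tot D n] w') (i, j) = w (i, j) +[D i j] w' (i, j)"
  "(r *[tot D n] w) (i, j) = r *[D i j] w (i, j)"
 using assms by (simp_all add: tot_def idx_def)

lemma tot_minus:
 assumes "int i + int j = n" "w : carrier (tot D n)" "w' : carrier (tot D n)"
 shows "(w -[tot D n] w') (i, j) = w (i, j) -[D i j] w' (i, j)"
proof -
 have "(%w. w (i, j)) : mod_hom R (tot D n) (D i j)"
  by (rule mod_homI) (simp_all add: tot_ops assms(1) tot_app)
 from mod_hom_minus[OF this ab_tot ab_D assms(2,3)] show ?thesis .
qed

lemma hpart_closed: "w : carrier (tot D n) ==> int i + int j = n + 1 ==> hpart D h w i j : carrier (D i j)"
 by (cases i) (auto simp: hpart_def ag ab_D intro!: mod_homD(1)[OF h] tot_app)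

lemma vpart_closed: "w : carrier (tot D n) ==> int i + int j = n + 1 ==> vpart D v w i j : carrier (D i j)"
 by (cases j) (auto simp: vpart_def ag ab_D intro!: mod_homD(1)[OF v] tot_app)

lemma td_app: "int i + int j = n + 1 ==> td D h v n w (i, j) = hpart D h w i j +[D i j] vpart D v w i j"
 by (simp add: td_def idx_def)

lemma td_closed: "w : carrier (tot D n) ==> td D h v n w : carrier (tot D (n + 1))"
 unfolding tot_car by (auto simp: td_def idx_def ag ab_D hpart_closed[unfolded tot_car] vpart_closed[unfolded tot_car])

lemma td_hom: "td D h v n : mod_hom R (tot D n) (tot D (n + 1))"
proof (rule mod_homI)
 fix w assume w: "w : carrier (tot D n)"
 show "td D h v n w : carrier (tot D (n + 1))" by (rule td_closed[OF w])
 show "td D h v n (r *[tot D n] w) = r *[tot D (n + 1)] td D h v n w" if r: "r : carrier R" for r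
 proof (rule tot_eqI)
  fix i j assume ij: "int i + int j = n + 1"
  have "hpart D h (r *[tot D n] w) i j = r *[D i j] hpart D h w i j"
   using ij by (cases i) (simp_all add: hpart_def tot_ops mod_homD(3)[OF h r] tot_app[OF w] module.smult_r_null[OF D r])
  moreover have "vpart D v (r *[tot D n] w) i j = r *[D i j] vpart D v w i j"
   using ij by (cases j) (simp_all add: vpart_def tot_ops mod_homD(3)[OF v r] tot_app[OF w] module.smult_r_null[OF D r])
  ultimately show "td D h v n (r *[tot D n] w) (i, j) = (r *[tot D (n + 1)] td D h v n w) (i, j)"
   using module.smult_r_distr[OF D r hpart_closed[OF w ij] vpart_closed[OF w ij]] ij by (simp add: td_app tot_ops)
 qed (use module.smult_closed[OF module_tot r] w td_closed in blast)+
 fix u assume u: "u : carrier (tot D n)"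
 show "td D h v n (w +[tot D n] u) = td D h v n w +[tot D (n + 1)] td D h v n u"
 proof (rule tot_eqI)
  fix i j assume ij: "int i + int j = n + 1"
  have h1: "hpart D h (w +[tot D n] u) i j = hpart D h w i j +[D i j] hpart D h u i j"
   using ij by (cases i) (simp_all add: hpart_def tot_ops mod_homD(2)[OF h] tot_app[OF w] tot_app[OF u] ag ab_D)
  have v1: "vpart D v (w +[tot D n] u) i j = vpart D v w i j +[D i j] vpart D v u i j"
   using ij by (cases j) (simp_all add: vpart_def tot_ops mod_homD(2)[OF v] tot_app[OF w] tot_app[OF u] ag ab_D)
  show "td D h v n (w +[tot D n] u) (i, j) = (td D h v n w +[tot D (n + 1)] td D h v n u) (i, j)"
   unfolding td_app[OF ij] tot_ops[OF ij] h1 v1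
   by (rule ab_eqI[of "D i j"]) (simp add: ab ab_D hpart_closed[OF w ij] hpart_closed[OF u ij] vpart_closed[OF w ij] vpart_closed[OF u ij])
 qed (use abelian_group.ag_rules(1)[OF ab_tot] w u td_closed in blast)+
qed

lemma td_td:
 assumes w: "w : carrier (tot D n)"
 shows "td D h v (n + 1) (td D h v n w) = 0[tot D (n + 2)]"
proof (rule tot_eqI)
 show "td D h v (n + 1) (td D h v n w) : carrier (tot D (n + 2))"
  using td_closed[OF td_closed[OF w]] by (simp add: add.assoc)
 show "0[tot D (n + 2)] : carrier (tot D (n + 2))" by (simp add: ag ab_tot)
 fix i j assume ij: "int i + int j = n + 2"
 let ?u = "td D h v n w"
 have u: "?u : carrier (tot D (n + 1))" by (rule td_closed[OF w])
 have H: "hpart D h ?u i j = (case i of 0 => 0[D i j] | Suc i' => h i' j (vpart D v w i' j))"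
 proof (cases i)
  case (Suc i')
  have i': "int i' + int j = n + 1" using ij Suc by simp
  have "h i' j (hpart D h w i' j) = 0[D i j]"
   using i' Suc by (cases i') (simp_all add: hpart_def h0 hh tot_app[OF w])
  then show ?thesis
   using Suc mod_homD(2)[OF h hpart_closed[OF w i'] vpart_closed[OF w i']] mod_homD(1)[OF h vpart_closed[OF w i']]
   by (simp add: hpart_def[of D h ?u] td_app[OF i'] ag ab_D)
 qed (simp add: hpart_def)
 have V: "vpart D v ?u i j = (case j of 0 => 0[D i j] | Suc j' => v i j' (hpart D h w i j'))"
 proof (cases j)
  case (Suc j')
  have j': "int i + int j' = n + 1" using ij Suc by simp
  have "v i j' (vpart D v w i j') = 0[D i j]"
   using j' Suc by (cases j') (simp_all add: vpart_def v0 vv tot_app[OF w])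
  then show ?thesis
   using Suc mod_homD(2)[OF v hpart_closed[OF w j'] vpart_closed[OF w j']] mod_homD(1)[OF v hpart_closed[OF w j']]
   by (simp add: vpart_def[of D v ?u] td_app[OF j'] ag ab_D)
 qed (simp add: vpart_def)
 have "hpart D h ?u i j +[D i j] vpart D v ?u i j = 0[D i j]"
 proof (cases i; cases j)
  fix i' j' assume "i = Suc i'" "j = Suc j'"
  then show ?thesis unfolding H V using anti[of "w (i', j')" i' j'] tot_app[OF w, of i' j'] ij
   by (simp add: hpart_def vpart_def)
 qed (unfold H V, simp_all add: hpart_def vpart_def ag ab_D h0 v0)
 then show "td D h v (n + 1) ?u (i, j) = 0[tot D (n + 2)] (i, j)"
  using ij by (simp add: td_app tot_ops)
qed

text \<open>Testing \<open>a = i\<close> is enough, as the antidiagonal then determines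
  \<open>b\<close>.\<close>

definition single :: "nat => nat => 'k => nat \<times> nat => 'k" where
 "single i j y = (\<lambda>(a, b)\<in>idx (int i + int j). if a = i then y else 0[D a b])"

lemma single_closed: "y : carrier (D i j) ==> single i j y : carrier (tot D (int i + int j))"
 unfolding tot_car by (auto simp: single_def idx_def ag ab_D)

lemma single_app:
 assumes "int a + int b = int i + int j"
 shows "single i j y (a, b) = (if a = i then y else 0[D a b])"
 using assms by (simp add: single_def idx_def)

lemma td_single:
 assumes y: "y : carrier (D i j)" and ab: "int a + int b = int i + int j + 1"
 shows "td D h v (int i + int j) (single i j y) (a, b)
  = (if a = Suc i then h i j y else if a = i then v i j y else 0[D a b])"
proof -
 have H: "hpart D h (single i j y) a b = (if a = Suc i then h i j y else 0[D a b])"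
  using ab by (cases a) (auto simp: hpart_def single_app h0)
 have V: "vpart D v (single i j y) a b = (if a = i then v i j y else 0[D a b])"
  using ab by (cases b) (auto simp: vpart_def single_app v0)
 have e: "a = Suc i ==> b = j" "a = i ==> b = Suc j" using ab by auto
 show ?thesis unfolding td_app[OF ab] H V
  using e mod_homD(1)[OF h y] mod_homD(1)[OF v y] by (auto simp: ag ab_D)
qed

text \<open>Exactness of the rows kills a total cocycle from the highest first index downwards.\<close>

lemma tot_acyclic:
 assumes ex0: "!!j x. x : carrier (D 0 j) ==> h 0 j x = 0[D (Suc 0) j] ==> x = 0[D 0 j]"
  and ex: "!!i j x. x : carrier (D (Suc i) j) ==> h (Suc i) j x = 0[D (Suc (Suc i)) j] ==>
   EX y:carrier (D i j). h i j y = x"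
  and w: "w : carrier (tot D n)" and cyc: "td D h v n w = 0[tot D (n + 1)]"
 shows "EX u:carrier (tot D (n - 1)). td D h v (n - 1) u = w"
proof -
 have tdn: "td D h v (n - 1) u : carrier (tot D n)" if "u : carrier (tot D (n - 1))" for u
  using td_closed[OF that] by simp
 have "EX u:carrier (tot D (n - 1)). td D h v (n - 1) u = w"
  if "w : carrier (tot D n)" "td D h v n w = 0[tot D (n + 1)]"
   "!!i j. int i + int j = n ==> N <= i ==> w (i, j) = 0[D i j]" for N w
  using that
 proof (induction N arbitrary: w)
  case 0
  have "w = 0[tot D n]"
  proof (rule tot_eqI[OF 0(1)])
   show "0[tot D n] : carrier (tot D n)" by (simp add: ag ab_tot)
   show "w (i, j) = 0[tot D n] (i, j)" if "int i + int j = n" for i j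
    using 0(3)[OF that] that by (simp add: tot_ops)
  qed
  moreover have "td D h v (n - 1) 0[tot D (n - 1)] = 0[tot D n]"
   using mod_hom_zero[OF td_hom[of "n - 1"] ab_tot ab_tot] by simp
  ultimately show ?case by (intro bexI[of _ "0[tot D (n - 1)]"]) (simp_all add: ag ab_tot)
 next
  case (Suc N)
  note w = Suc.prems(1)
  show ?case
  proof (cases "ALL j. int N + int j = n --> w (N, j) = 0[D N j]")
   case True
   have "w (i, j) = 0[D i j]" if "int i + int j = n" "N <= i" for i j
    using True Suc.prems(3)[OF that(1)] that by (cases "i = N") auto
   from Suc.IH[OF w Suc.prems(2) this] show ?thesis .
  next
   case False
   then obtain j where j: "int N + int j = n" "w (N, j) ~= 0[D N j]" by blast
   have wN: "w (N, j) : carrier (D N j)" by (rule tot_app[OF w j(1)])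
   \<comment> \<open>Read the cocycle condition at \<open>(Suc N, j)\<close>: nothing vertical
     reaches this entry, since \<open>w\<close> vanishes from first index \<open>Suc N\<close> on.
     So the leading entry of \<open>w\<close> is a cocycle of its row.\<close>
   have "vpart D v w (Suc N) j = 0[D (Suc N) j]"
    using j(1) Suc.prems(3)[of "Suc N"] by (cases j) (simp_all add: vpart_def v0)
   then have hz: "h N j (w (N, j)) = 0[D (Suc N) j]"
    using fun_cong[OF Suc.prems(2), of "(Suc N, j)"] j(1) mod_homD(1)[OF h wN]
    by (simp add: td_app tot_ops hpart_def ag ab_D)
   obtain M where M: "N = Suc M" using ex0[of "w (N, j)" j] wN hz j(2) by (cases N) auto
   obtain y where y: "y : carrier (D M j)" "h M j y = w (N, j)"
    using ex[of "w (N, j)" M j] wN hz unfolding M by blast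
   have n: "n - 1 = int M + int j" "n = int M + int j + 1" using j(1) M by simp_all
   have s: "single M j y : carrier (tot D (n - 1))" unfolding n(1) by (rule single_closed[OF y(1)])
   \<comment> \<open>Subtracting the coboundary of \<open>single M j y\<close> clears the entry
     \<open>(N, j)\<close>; the only other entry that changes has first index \<open>M\<close>,
     below \<open>N\<close>.\<close>
   let ?w = "w -[tot D n] td D h v (n - 1) (single M j y)"
   have wc: "?w : carrier (tot D n)" using w tdn[OF s] by (simp add: ag ab_tot)
   have ts: "td D h v (n - 1) (single M j y) (a, b) = (if a = Suc M then h M j y else if a = M then v M j y else 0[D a b])"
    if "int a + int b = n" for a b
    using td_single[OF y(1), of a b] that n by simp
   have "td D h v n (td D h v (n - 1) (single M j y)) = 0[tot D (n + 1)]"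
    using td_td[OF s] by (simp add: add.commute)
   then have cw: "td D h v n ?w = 0[tot D (n + 1)]"
    using mod_hom_minus[OF td_hom ab_tot ab_tot w tdn[OF s]] Suc.prems(2) by (simp add: a_minus_def ag ab_tot)
   have "?w (a, b) = 0[D a b]" if ab: "int a + int b = n" "N <= a" for a b
   proof (cases "a = N")
    case True
    then have b: "b = j" using ab(1) j(1) by simp
    show ?thesis unfolding tot_minus[OF ab(1) w tdn[OF s]] ts[OF ab(1)]
     using True M b y wN by (simp add: a_minus_def ag ab_D)
   next
    case False
    then have "w (a, b) = 0[D a b]" using Suc.prems(3)[OF ab(1)] ab(2) by simp
    then show ?thesis unfolding tot_minus[OF ab(1) w tdn[OF s]] ts[OF ab(1)]
     using False M ab(2) by (simp add: a_minus_def ag ab_D)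
   qed
   from Suc.IH[OF wc cw this] obtain u where u: "u : carrier (tot D (n - 1))" "td D h v (n - 1) u = ?w" by blast
   have "td D h v (n - 1) (u +[tot D (n - 1)] single M j y) = ?w +[tot D n] td D h v (n - 1) (single M j y)"
    using mod_homD(2)[OF td_hom u(1) s] u(2) by simp
   also have "\<dots> = w" by (rule ab_eqI[of "tot D n"]) (simp add: ab ab_tot w tdn[OF s])
   finally show ?thesis using u(1) s by (intro bexI[of _ "u +[tot D (n - 1)] single M j y"]) (simp_all add: ag ab_tot)
  qed
 qed
 \<comment> \<open>First indices never exceed \<open>n\<close>, so with this bound the vanishing
   condition is vacuous.\<close>
 from this[OF w cyc, of "Suc (nat n)"] show ?thesis by simp
qed

lemma transpose: "double_complex R (%i j. D j i) (%i j. v j i) (%i j. h j i)"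
proof (rule double_complex.intro)
 fix i j x assume x: "x : carrier (D j i)"
 show "v (Suc j) i (h j i x) +[D (Suc j) (Suc i)] h j (Suc i) (v j i x) = 0[D (Suc j) (Suc i)]"
  using anti[OF x] abelian_group.ag_comm[OF ab_D mod_homD(1)[OF h mod_homD(1)[OF v x]] mod_homD(1)[OF v mod_homD(1)[OF h x]]]
  by simp
qed (use D h v hh vv in auto)

text \<open>The row version applied to the transposed complex; \<open>sw\<close> flips the
  antidiagonal.\<close>

lemma tot_acyclic_v:
 assumes ex0: "!!i x. x : carrier (D i 0) ==> v i 0 x = 0[D i (Suc 0)] ==> x = 0[D i 0]"
  and ex: "!!i j x. x : carrier (D i (Suc j)) ==> v i (Suc j) x = 0[D i (Suc (Suc j))] ==>
   EX y:carrier (D i j). v i j y = x"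
  and w: "w : carrier (tot D n)" and cyc: "td D h v n w = 0[tot D (n + 1)]"
 shows "EX u:carrier (tot D (n - 1)). td D h v (n - 1) u = w"
proof -
 interpret t: double_complex R "%i j. D j i" "%i j. v j i" "%i j. h j i" by (rule transpose)
 define sw where "sw n u = (\<lambda>(i, j)\<in>idx n. u (j, i))" for n and u :: "nat \<times> nat => 'k"
 have sw_app: "sw n u (i, j) = u (j, i)" if "int i + int j = n" for n u i j using that by (simp add: sw_def idx_def)
 have sw1: "sw n u : carrier (tot (%i j. D j i) n)" if "u : carrier (tot D n)" for n u
  using that unfolding t.tot_car by (auto simp: sw_def idx_def tot_car)
 have sw2: "sw n u : carrier (tot D n)" if "u : carrier (tot (%i j. D j i) n)" for n u
  using that unfolding tot_car by (auto simp: sw_def idx_def t.tot_car)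
 have td_sw: "td D h v n u (j, i) = td (%i j. D j i) (%i j. v j i) (%i j. h j i) n (sw n u) (i, j)"
  if u: "u : carrier (tot D n)" and ij: "int i + int j = n + 1" for n u i j
 proof -
  have ji: "int j + int i = n + 1" using ij by simp
  have "hpart (%i j. D j i) (%i j. v j i) (sw n u) i j = vpart D v u j i"
   using ij by (cases i) (simp_all add: hpart_def vpart_def sw_app)
  moreover have "vpart (%i j. D j i) (%i j. h j i) (sw n u) i j = hpart D h u j i"
   using ij by (cases j) (simp_all add: hpart_def vpart_def sw_app)
  ultimately show ?thesis unfolding td_app[OF ji] t.td_app[OF ij]
   using abelian_group.ag_comm[OF ab_D hpart_closed[OF u ji] vpart_closed[OF u ji]] by simp
 qed
 have cw: "td (%i j. D j i) (%i j. v j i) (%i j. h j i) n (sw n w) = 0[tot (%i j. D j i) (n + 1)]"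
 proof (rule t.tot_eqI[OF t.td_closed[OF sw1[OF w]]])
  show "0[tot (%i j. D j i) (n + 1)] : carrier (tot (%i j. D j i) (n + 1))" by (simp add: ag t.ab_tot)
  fix i j assume ij: "int i + int j = n + 1"
  then have ji: "int j + int i = n + 1" by simp
  show "td (%i j. D j i) (%i j. v j i) (%i j. h j i) n (sw n w) (i, j) = 0[tot (%i j. D j i) (n + 1)] (i, j)"
   using td_sw[OF w ij] cyc t.tot_ops(1)[OF ij] tot_ops(1)[OF ji] by simp
 qed
 have "EX u:carrier (tot (%i j. D j i) (n - 1)). td (%i j. D j i) (%i j. v j i) (%i j. h j i) (n - 1) u = sw n w"
  by (rule t.tot_acyclic[OF _ _ sw1[OF w] cw]) (use ex0 ex in auto)
 then obtain u where u: "u : carrier (tot (%i j. D j i) (n - 1))"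
  "td (%i j. D j i) (%i j. v j i) (%i j. h j i) (n - 1) u = sw n w" by blast
 note u' = sw2[OF u(1)]
 have su: "sw (n - 1) (sw (n - 1) u) = u"
  by (rule t.tot_eqI[OF sw1[OF u'] u(1)]) (simp add: sw_app)
 have "td D h v (n - 1) (sw (n - 1) u) = w"
 proof (rule tot_eqI[OF _ w])
  show "td D h v (n - 1) (sw (n - 1) u) : carrier (tot D n)" using td_closed[OF u'] by simp
  show "td D h v (n - 1) (sw (n - 1) u) (i, j) = w (i, j)" if "int i + int j = n" for i j
   using td_sw[OF u', of j i] that su u(2) by (simp add: sw_app)
 qed
 then show ?thesis using u' by blast
qed

lemma sub_complex:
 assumes S: "!!i j. submodule (S i j) R (D i j)"
  and hS: "!!i j x. x : S i j ==> h i j x : S (Suc i) j" and vS: "!!i j x. x : S i j ==> v i j x : S i (Suc j)"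
 shows "double_complex R (%i j. (D i j)(|carrier := S i j|)) h v"
proof (rule double_complex.intro)
 note sub = submodD(2)[OF S D]
 fix i j
 show "module R ((D i j)(|carrier := S i j|))" by (rule module_restrict[OF S D])
 show "h i j : mod_hom R ((D i j)(|carrier := S i j|)) ((D (Suc i) j)(|carrier := S (Suc i) j|))"
  by (rule mod_homI) (simp_all add: hS mod_homD(2,3)[OF h] sub)
 show "v i j : mod_hom R ((D i j)(|carrier := S i j|)) ((D i (Suc j))(|carrier := S i (Suc j)|))"
  by (rule mod_homI) (simp_all add: vS mod_homD(2,3)[OF v] sub)
qed (use hh vv anti submodD(2)[OF S D] in auto)

end

text \<open>Restricting carriers changes neither operations nor zeros, so one total differential
  serves a double complex and all its subcomplexes.\<close>

lemma td_restrict: "td (%i j. (D i j)(|carrier := S i j|)) h v = td D h v"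
 by (auto simp: td_def hpart_def vpart_def intro!: ext split: nat.split)

lemma tot_restrict_zero: "0[tot (%i j. (D i j)(|carrier := S i j|)) n] = 0[tot D n]"
 by (simp add: tot_def case_prod_beta cong: restrict_cong)

text \<open>A surjection \<open>r\<close> of complexes with acyclic kernel; \<open>K2\<close> is its kernel and \<open>Z\<close>, \<open>B\<close> the cocycles and coboundaries of its target.\<close>

lemma acyclic_kernel:
 assumes A: "module R A0" "module R A1" "module R A2" and A': "module R A'"
  and d0: "d0 : mod_hom R A0 A1" and d1: "d1 : mod_hom R A1 A2" and r: "r : mod_hom R A1 A'"
  and dd: "!!x. x : carrier A0 ==> d1 (d0 x) = 0[A2]"
  and surj: "!!z. z : Z ==> EX w:carrier A1. r w = z"
  and Z: "!!w. w : carrier A1 ==> r w : Z \<longleftrightarrow> d1 w : K2"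
  and B: "B = r ` d0 ` carrier A0"
  and ac1: "!!w. w : carrier A1 ==> r w = 0[A'] ==> d1 w = 0[A2] ==> EX u:carrier A0. d0 u = w"
  and ac2: "!!w. w : carrier A1 ==> d1 w : K2 ==> EX u:carrier A1. r u = 0[A'] & d1 u = d1 w"
 shows "z : Z ==> EX w:carrier A1. d1 w = 0[A2] & r w = z"
  "x : carrier A1 ==> d1 x = 0[A2] ==> r x : B \<longleftrightarrow> x : d0 ` carrier A0"
proof -
 note abg = module_ag[OF A(1)] module_ag[OF A(2)] module_ag[OF A(3)] module_ag[OF A']
 show "z : Z ==> EX w:carrier A1. d1 w = 0[A2] & r w = z"
 proof -
  assume z: "z : Z"
  \<comment> \<open>\<open>d1 w\<close> lies in the kernel and is a cocycle, so it is
    \<open>d1 u\<close> with \<open>u\<close> in the kernel; then \<open>w - u\<close> is a cocycle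
    over \<open>z\<close>.\<close>
  obtain w where w: "w : carrier A1" "r w = z" using surj[OF z] by blast
  then obtain u where u: "u : carrier A1" "r u = 0[A']" "d1 u = d1 w" using ac2 Z z by metis
  have "d1 (w -[A1] u) = 0[A2]" "r (w -[A1] u) = z"
   using mod_hom_minus[OF d1 abg(2,3) w(1) u(1)] mod_hom_minus[OF r abg(2,4) w(1) u(1)] u w
    mod_homD(1)[OF d1 w(1)] mod_homD(1)[OF r w(1)] by (simp_all add: a_minus_def ag abg)
  then show ?thesis using w u by (intro bexI[of _ "w -[A1] u"]) (simp_all add: ag abg)
 qed
 have "r w : B \<longleftrightarrow> w : d0 ` carrier A0" if w: "w : carrier A1" "d1 w = 0[A2]" for w
 proof
  show "w : d0 ` carrier A0 ==> r w : B" unfolding B by (rule imageI)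
  assume "r w : B"
  then obtain a where a: "a : carrier A0" "r w = r (d0 a)" unfolding B by blast
  note da = mod_homD(1)[OF d0 a(1)]
  have "r (w -[A1] d0 a) = 0[A']" "d1 (w -[A1] d0 a) = 0[A2]"
   using mod_hom_minus[OF d1 abg(2,3) w(1) da] mod_hom_minus[OF r abg(2,4) w(1) da] a w dd[OF a(1)]
    mod_homD(1)[OF r da] by (simp_all add: a_minus_def ag abg)
  then obtain u where u: "u : carrier A0" "d0 u = w -[A1] d0 a"
   using ac1[of "w -[A1] d0 a"] w(1) da by (auto simp: ag abg)
  have "d0 (u +[A0] a) = (w -[A1] d0 a) +[A1] d0 a" using mod_homD(2)[OF d0 u(1) a(1)] u(2) by simp
  also have "\<dots> = w" using w(1) da abg(2) by - (rule ab_eqI[of A1], simp add: ab)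
  finally show "w : d0 ` carrier A0" using u(1) a(1) by (intro image_eqI[of _ _ "u +[A0] a"]) (simp_all add: ag abg)
 qed
 then show "x : carrier A1 ==> d1 x = 0[A2] ==> r x : B \<longleftrightarrow> x : d0 ` carrier A0" .
qed

subsection \<open>Double complexes of morphisms\<close>

definition sg :: "('r, 's) ring_scheme => nat => 'r" where
 "sg R i = (if even i then 1[R] else -[R] 1[R])"

definition homD :: "('o, 'm) cat => ('r, 's) ring_scheme => (nat => ('o, 'm, 'r, 'u) rcmod) =>
  (nat => ('o, 'm, 'r, 'a) rcmod) => nat => nat => ('r, 'o => 'u => 'a) module" where
 "homD T R C E i j = hom_module T R (C i) (E j)"

definition homh :: "('o, 'm) cat => (nat => ('o, 'm, 'r, 'u) rcmod) => (nat => 'o => 'u => 'u) =>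
  nat => nat => ('o => 'u => 'a) => 'o => 'u => 'a" where
 "homh T C d i j f = rest T (C (Suc i)) (%x a. f x (d i x a))"

definition homv :: "('o, 'm) cat => ('r, 's) ring_scheme => (nat => ('o, 'm, 'r, 'u) rcmod) =>
  (nat => ('o, 'm, 'r, 'a) rcmod) => (nat => 'o => 'a => 'a) =>
  nat => nat => ('o => 'u => 'a) => 'o => 'u => 'a" where
 "homv T R C E e i j f = rest T (C i) (%x a. sg R i *[mod_at (E (Suc j)) x] e j x (f x a))"

lemma sg_facts:
 assumes "cring R"
 shows "sg R i : carrier R" "sg R 0 = 1[R]" "sg R i \<otimes>\<^bsub>R\<^esub> sg R i = 1[R]"
  "sg R i +[R] sg R (Suc i) = 0[R]"
proof -
 interpret R: cring R by fact
 show "sg R i : carrier R" "sg R 0 = 1[R]" "sg R i \<otimes>\<^bsub>R\<^esub> sg R i = 1[R]"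
  "sg R i +[R] sg R (Suc i) = 0[R]"
  by (auto simp: sg_def R.l_minus R.r_minus R.r_neg R.l_neg)
qed

lemma sg_smult:
 assumes "module R A" "y : carrier A"
 shows "sg R i *[A] y +[A] sg R (Suc i) *[A] y = 0[A]" "sg R i *[A] (sg R i *[A] y) = y"
  "sg R i *[A] y : carrier A" "sg R i *[A] y = 0[A] \<longleftrightarrow> y = 0[A]"
proof -
 interpret module R A by fact
 note s = sg_facts[OF R.cring_axioms]
 show 1: "sg R i *[A] y +[A] sg R (Suc i) *[A] y = 0[A]" "sg R i *[A] (sg R i *[A] y) = y"
  "sg R i *[A] y : carrier A"
  using smult_l_distr[OF s(1) s(1) assms(2), of i "Suc i"] smult_assoc1[OF s(1) s(1) assms(2), of i i] s assms(2)
  by (simp_all add: smult_one)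
 show "sg R i *[A] y = 0[A] \<longleftrightarrow> y = 0[A]"
  using 1(2) smult_r_null[OF s(1), of i] by metis
qed

lemma hom_double:
 assumes R: "cring R" and C: "!!i. left_module T R (C i)" and E: "!!j. left_module T R (E j)"
  and d: "!!i. d i : rc_hom T R (C (Suc i)) (C i)" and e: "!!j. e j : rc_hom T R (E j) (E (Suc j))"
  and dd: "!!i x a. x : Obj T ==> a : el (C (Suc (Suc i))) x ==> d i x (d (Suc i) x a) = 0[mod_at (C i) x]"
  and ee: "!!j x a. x : Obj T ==> a : el (E j) x ==> e (Suc j) x (e j x a) = 0[mod_at (E (Suc (Suc j))) x]"
 shows "double_complex R (homD T R C E) (homh T C d) (homv T R C E e)"
proof (rule double_complex.intro)
 have se: "(%x a. sg R i *[mod_at (E (Suc j)) x] e j x a) : rc_hom T R (E j) (E (Suc j))" for i j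
  by (rule rc_hom_smult[OF E E e sg_facts(1)[OF R]])
 fix i j
 show "module R (homD T R C E i j)" unfolding homD_def by (rule module_hom_module[OF R C E])
 show hh: "homh T C d i j : mod_hom R (homD T R C E i j) (homD T R C E (Suc i) j)"
  using hom_module_precomp[OF C C E d] by (simp add: homD_def homh_def[abs_def])
 show "homv T R C E e i j : mod_hom R (homD T R C E i j) (homD T R C E i (Suc j))"
  using hom_module_postcomp[OF C E E se] by (simp add: homD_def homv_def[abs_def])
 fix f assume f: "f : carrier (homD T R C E i j)"
 have fh: "f : rc_hom T R (C i) (E j)" using f unfolding homD_def by (rule hom_moduleD(1))
 show "homh T C d (Suc i) j (homh T C d i j f) = 0[homD T R C E (Suc (Suc i)) j]"
  unfolding homD_def hom_module_ops homh_def
  by (rule rest_cong) (simp add: rc_homD(3)[OF d] dd rc_hom_apply_zero[OF C E fh])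
 show "homv T R C E e i (Suc j) (homv T R C E e i j f) = 0[homD T R C E i (Suc (Suc j))]"
  unfolding homD_def hom_module_ops homv_def
 proof (rule rest_cong)
  fix x a assume x: "x : Obj T" "a : el (C i) x"
  note fx = rc_homD(3)[OF fh x]
  show "sg R i *[mod_at (E (Suc (Suc j))) x] e (Suc j) x (rest T (C i) (%x a. sg R i *[mod_at (E (Suc j)) x] e j x (f x a)) x a)
    = 0[mod_at (E (Suc (Suc j))) x]"
   using x mod_homD(3)[OF rc_homD(1)[OF e x(1)] sg_facts(1)[OF R] rc_homD(3)[OF e x(1) fx]] ee[OF x(1) fx]
   by (simp add: module.smult_r_null[OF left_moduleD(1)[OF E x(1)]] sg_facts(1)[OF R])
 qed
 show "homh T C d i (Suc j) (homv T R C E e i j f) +[homD T R C E (Suc i) (Suc j)] homv T R C E e (Suc i) j (homh T C d i j f)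
   = 0[homD T R C E (Suc i) (Suc j)]"
  unfolding homD_def hom_module_ops homh_def homv_def
 proof (rule rest_cong)
  fix x a assume x: "x : Obj T" "a : el (C (Suc i)) x"
  note da = rc_homD(3)[OF d x]
  show "rest T (C (Suc i)) (%x a. rest T (C i) (%x a. sg R i *[mod_at (E (Suc j)) x] e j x (f x a)) x (d i x a)) x a +[mod_at (E (Suc j)) x]
    rest T (C (Suc i)) (%x a. sg R (Suc i) *[mod_at (E (Suc j)) x] e j x (rest T (C (Suc i)) (%x a. f x (d i x a)) x a)) x a
    = 0[mod_at (E (Suc j)) x]"
   using x da sg_smult(1)[OF left_moduleD(1)[OF E x(1)] rc_homD(3)[OF e x(1) rc_homD(3)[OF fh x(1) da]]] by simp
 qed
qed

subsection \<open>Products of left modules\<close>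

definition prod_left :: "('o, 'm, 'r, 'a) rcmod => ('o, 'm, 'r, 'b) rcmod => ('o, 'm, 'r, 'a \<times> 'b) rcmod" where
 "prod_left A B = (|mod_at = (%x. (|carrier = el A x \<times> el B x,
    monoid.mult = undefined, one = undefined, zero = (0[mod_at A x], 0[mod_at B x]),
    add = (%p q. (fst p +[mod_at A x] fst q, snd p +[mod_at B x] snd q)),
    smult = (%r p. (r *[mod_at A x] fst p, r *[mod_at B x] snd p))|)),
   mod_map = (%x y f p. (mod_map A x y f (fst p), mod_map B x y f (snd p)))|)"

lemma prod_left_simps [simp]:
 "el (prod_left A B) x = el A x \<times> el B x"
 "0[mod_at (prod_left A B) x] = (0[mod_at A x], 0[mod_at B x])"
 "p +[mod_at (prod_left A B) x] q = (fst p +[mod_at A x] fst q, snd p +[mod_at B x] snd q)"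
 "r *[mod_at (prod_left A B) x] p = (r *[mod_at A x] fst p, r *[mod_at B x] snd p)"
 "mod_map (prod_left A B) x y f p = (mod_map A x y f (fst p), mod_map B x y f (snd p))"
 by (simp_all add: prod_left_def)

lemma left_module_prod:
 assumes A: "left_module T R A" and B: "left_module T R B"
 shows "left_module T R (prod_left A B)"
proof (rule left_moduleI)
 fix x assume x: "x : Obj T"
 note mA = left_moduleD(1)[OF A x] and mB = left_moduleD(1)[OF B x]
 interpret a: abelian_group "mod_at A x" by (rule module_ag[OF mA])
 interpret b: abelian_group "mod_at B x" by (rule module_ag[OF mB])
 show "module R (mod_at (prod_left A B) x)"
 proof (rule moduleI, rule module_cring[OF mA], rule abelian_groupI)
  fix p assume "p : el (prod_left A B) x"
  then show "EX q:el (prod_left A B) x. q +[mod_at (prod_left A B) x] p = 0[mod_at (prod_left A B) x]"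
   by (intro bexI[of _ "(-[mod_at A x] fst p, -[mod_at B x] snd p)"]) (auto simp: a.l_neg b.l_neg)
 qed (auto simp: a.a_ac b.a_ac module.smult_closed[OF mA] module.smult_closed[OF mB] module.smult_l_distr[OF mA]
   module.smult_l_distr[OF mB] module.smult_r_distr[OF mA] module.smult_r_distr[OF mB] module.smult_assoc1[OF mA]
   module.smult_assoc1[OF mB] module.smult_one[OF mA] module.smult_one[OF mB])
qed (auto intro!: mod_homI simp: left_moduleD(3,4,6)[OF A] left_moduleD(3,4,6)[OF B]
  mod_homD(2,3)[OF left_moduleD(2)[OF A]] mod_homD(2,3)[OF left_moduleD(2)[OF B]])

lemma prod_left_homs:
 assumes A: "left_module T R A" and B: "left_module T R B"
 shows "(%x. fst) : rc_hom T R (prod_left A B) A" "(%x. snd) : rc_hom T R (prod_left A B) B"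
  "(%x a. (a, 0[mod_at B x])) : rc_hom T R A (prod_left A B)"
  "(%x b. (0[mod_at A x], b)) : rc_hom T R B (prod_left A B)"
 by (intro rc_homI mod_homI; auto simp: ag left_moduleD(5)[OF A] left_moduleD(5)[OF B]
   module.smult_r_null[OF left_moduleD(1)[OF A]] module.smult_r_null[OF left_moduleD(1)[OF B]]
   mod_hom_zero[OF left_moduleD(2)[OF A] left_moduleD(5)[OF A] left_moduleD(5)[OF A]]
   mod_hom_zero[OF left_moduleD(2)[OF B] left_moduleD(5)[OF B] left_moduleD(5)[OF B]])+

text \<open>The zero submodule of \<open>A\<close> instead of an abstract zero module, which keeps
  the element type.\<close>

definition zero_left :: "('o, 'm, 'r, 'a) rcmod => ('o, 'm, 'r, 'a) rcmod" where
 "zero_left A = sub_left A (%x. {0[mod_at A x]})"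

lemma left_module_zero_left:
 assumes "left_module T R A"
 shows "left_module T R (zero_left A)"
 unfolding zero_left_def
 by (rule left_module_sub_left[OF assms submodule_zero[OF left_moduleD(1)[OF assms]]])
  (auto simp: mod_hom_zero[OF left_moduleD(2)[OF assms] left_moduleD(5)[OF assms] left_moduleD(5)[OF assms]])

lemma zero_left_simps:
 "el (zero_left A) x = {0[mod_at A x]}" "0[mod_at (zero_left A) x] = 0[mod_at A x]"
 by (simp_all add: zero_left_def sub_left_def)

section \<open>Modules that are projective relative to \<open>G\<close>\<close>

text \<open>\<open>X\<close> lifts \<open>G\<close>-indexed families \<open>f\<^sup>g : X \<rightarrow> B\<close> with \<open>f\<^bsup>y g\<^esup>(y a) = y f\<^sup>g(a)\<close>, that is, morphisms
 \<open>X \<rightarrow> Fun(G, B)\<close>, along epimorphisms onto their image.\<close>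

definition G_lifting :: "('g, 't) monoid_scheme => ('o, 'g) cat => ('r, 's) ring_scheme => ('o, 'g, 'r, 'u) rcmod => 'c itself => bool" where
 "G_lifting G T R X (t :: 'c itself) \<longleftrightarrow> (ALL (A :: ('o, 'g, 'r, 'c) rcmod) (B :: ('o, 'g, 'r, 'c) rcmod) e f.
   left_module T R A --> left_module T R B --> e : rc_hom T R A B --> f : rc_hom T R X (coch G 1 B) -->
   (ALL x:Obj T. ALL a:el X x. ALL l:tuples G 1. f x a l : e x ` el A x) -->
   (EX g:rc_hom T R X (coch G 1 A). ALL x:Obj T. ALL a:el X x. ALL l:tuples G 1. e x (g x a l) = f x a l))"

lemma G_liftingD:
 fixes A B :: "('o, 'g, 'r, 'c) rcmod"
 assumes "G_lifting G T R X TYPE('c)" "left_module T R A" "left_module T R B" "e : rc_hom T R A B" "f : rc_hom T R X (coch G 1 B)"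
  "!!x a l. x : Obj T ==> a : el X x ==> l : tuples G 1 ==> f x a l : e x ` el A x"
 obtains g where "g : rc_hom T R X (coch G 1 A)"
  "!!x a l. x : Obj T ==> a : el X x ==> l : tuples G 1 ==> e x (g x a l) = f x a l"
proof -
 have "EX g:rc_hom T R X (coch G 1 A). ALL x:Obj T. ALL a:el X x. ALL l:tuples G 1. e x (g x a l) = f x a l"
  using assms(1)[unfolded G_lifting_def, THEN spec[of _ A], THEN spec[of _ B], THEN spec[of _ e], THEN spec[of _ f]]
   assms(2-6) by simp
 then show thesis using that by blast
qed

context graded_cat
begin

text \<open>Each factor lifts on its own, and the lifts add up. In every degree a mapping cone is
  such a product.\<close>

lemma G_lifting_prod:
 assumes A: "left_module T R A" and B: "left_module T R B" and gA: "G_lifting G T R A TYPE('c)" and gB: "G_lifting G T R B TYPE('c)"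
 shows "G_lifting G T R (prod_left A B) TYPE('c)"
 unfolding G_lifting_def
proof (intro allI impI)
 fix K L :: "('o, 'g, 'r, 'c) rcmod" and e f
 assume K: "left_module T R K" and L: "left_module T R L" and e: "e : rc_hom T R K L"
  and f: "f : rc_hom T R (prod_left A B) (coch G 1 L)"
  and im: "ALL x:Obj T. ALL a:el (prod_left A B) x. ALL l:tuples G 1. f x a l : e x ` el K x"
 note hm = prod_left_homs[OF A B]
 note zA = abelian_group.ag_rules(2)[OF left_moduleD(5)[OF A]] and zB = abelian_group.ag_rules(2)[OF left_moduleD(5)[OF B]]
 obtain g1 where g1: "g1 : rc_hom T R A (coch G 1 K)"
  "!!x a l. x : Obj T ==> a : el A x ==> l : tuples G 1 ==> e x (g1 x a l) = f x (a, 0[mod_at B x]) l"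
  by (rule G_liftingD[OF gA K L e rc_hom_comp[OF hm(3) f]]) (use im zB in auto)
 obtain g2 where g2: "g2 : rc_hom T R B (coch G 1 K)"
  "!!x b l. x : Obj T ==> b : el B x ==> l : tuples G 1 ==> e x (g2 x b l) = f x (0[mod_at A x], b) l"
  by (rule G_liftingD[OF gB K L e rc_hom_comp[OF hm(4) f]]) (use im zA in auto)
 let ?g = "%x p. g1 x (fst p) +[mod_at (coch G 1 K) x] g2 x (snd p)"
 have g: "?g : rc_hom T R (prod_left A B) (coch G 1 K)"
  by (rule rc_hom_add[OF left_module_prod[OF A B] left_module_coch[OF K] rc_hom_comp[OF hm(1) g1(1)] rc_hom_comp[OF hm(2) g2(1)]])
 show "EX g:rc_hom T R (prod_left A B) (coch G 1 K). ALL x:Obj T. ALL a:el (prod_left A B) x. ALL l:tuples G 1. e x (g x a l) = f x a l"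
 proof (intro bexI[OF _ g] ballI)
  fix x p l assume x: "x : Obj T" and p: "p : el (prod_left A B) x" and l: "l : tuples G 1"
  obtain a b where ab: "p = (a, b)" "a : el A x" "b : el B x" using p by auto
  note c1 = coch_app[OF rc_homD(3)[OF g1(1) x ab(2)] l] and c2 = coch_app[OF rc_homD(3)[OF g2(1) x ab(3)] l]
  have eq: "f x (a, b) = f x (a, 0[mod_at B x]) +[mod_at (coch G 1 L) x] f x (0[mod_at A x], b)"
   using rc_hom_apply_add[OF f x, of "(a, 0[mod_at B x])" "(0[mod_at A x], b)"] ab zA[OF x] zB[OF x]
    left_moduleD(5)[OF A x] left_moduleD(5)[OF B x] by (simp add: ag)
  show "e x (?g x p l) = f x p l"
   unfolding ab(1) eq using l rc_hom_apply_add[OF e x c1 c2] g1(2)[OF x ab(2) l] g2(2)[OF x ab(3) l]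
   by (simp add: coch_ops)
 qed
qed

lemma G_lifting_zero:
 assumes A: "left_module T R A"
 shows "G_lifting G T R (zero_left A) TYPE('c)"
 unfolding G_lifting_def
proof (intro allI impI)
 fix K L :: "('o, 'g, 'r, 'c) rcmod" and e f
 assume K: "left_module T R K" and L: "left_module T R L" and e: "e : rc_hom T R K L"
  and f: "f : rc_hom T R (zero_left A) (coch G 1 L)"
 have "e x (0[mod_at (coch G 1 K) x] l) = f x a l" if "x : Obj T" "a : el (zero_left A) x" "l : tuples G 1" for x a l
  using that rc_hom_apply_zero[OF left_module_zero_left[OF A] left_module_coch[OF L] f that(1)] rc_hom_apply_zero[OF K L e that(1)]
  by (simp add: zero_left_simps coch_ops)
 then show "EX g:rc_hom T R (zero_left A) (coch G 1 K). ALL x:Obj T. ALL a:el (zero_left A) x. ALL l:tuples G 1. e x (g x a l) = f x a l"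
  by (intro bexI[OF _ rc_hom_zero[OF left_module_zero_left[OF A] left_module_coch[OF K]]] ballI)
qed

end

text \<open>\<open>C\<close> is exact up to and including \<open>C 0\<close>, without augmentation,
  and its terms lift families indexed by \<open>G\<close>. This is what remains of a contractible
  complex of projectives when one of the two resolutions in a cone is only relatively
  projective.\<close>

locale exact_G_lifting = graded_cat G R T for G :: "('g, 't) monoid_scheme" (structure) and R :: "('r, 's) ring_scheme" and T :: "('o, 'g) cat" +
 fixes C :: "nat => ('o, 'g, 'r, 'c) rcmod" and d
 assumes C: "!!m. left_module T R (C m)" and d: "!!m. d m : rc_hom T R (C (Suc m)) (C m)"
  and C_surj: "!!x. x : Obj T ==> d 0 x ` el (C (Suc 0)) x = el (C 0) x"
  and C_exact: "!!x m. x : Obj T ==> d (Suc m) x ` el (C (Suc (Suc m))) x = mod_ker (mod_at (C (Suc m)) x) (mod_at (C m) x) (d m x)"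
  and C_lifting: "!!m. G_lifting G T R (C m) TYPE('c)"
begin

text \<open>An exact complex of projectives ending in zero is contractible. Here only families can
  be lifted, so the contraction is a family \<open>s^g\<close>, equivariant in \<open>g\<close>,
  with \<open>d s^g + s^g d = 1\<close> for each \<open>g\<close> in positive degrees; the tuple
  \<open>[g]\<close> is the index.\<close>

lemma contraction:
 "EX s. ALL m. s m : rc_hom T R (C m) (coch G 1 (C (Suc m))) &
  (ALL x:Obj T. ALL a:el (C (Suc m)) x. ALL l:tuples G 1.
    d (Suc m) x (s (Suc m) x a l) = a -[mod_at (C (Suc m)) x] s m x (d m x a) l)"
proof -
 define good where "good m s \<longleftrightarrow> s : rc_hom T R (C m) (coch G 1 (C (Suc m))) &
  (ALL x:Obj T. ALL a:el (C (Suc m)) x. ALL l:tuples G 1. d m x (s x (d m x a) l) = d m x a)" for m s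
 define step where "step m s s' \<longleftrightarrow> (ALL x:Obj T. ALL a:el (C (Suc m)) x. ALL l:tuples G 1.
    d (Suc m) x (s' x a l) = a -[mod_at (C (Suc m)) x] s x (d m x a) l)" for m s s'
 have base: "EX s. good 0 s"
 proof -
  have im: "(\<lambda>l\<in>tuples G 1. a) l : d 0 x ` el (C (Suc 0)) x"
   if "x : Obj T" "a : el (C 0) x" "l : tuples G 1" for x a l
   unfolding C_surj[OF that(1)] using that by simp
  obtain s where s: "s : rc_hom T R (C 0) (coch G 1 (C (Suc 0)))"
   "!!x a l. x : Obj T ==> a : el (C 0) x ==> l : tuples G 1 ==> d 0 x (s x a l) = (\<lambda>l\<in>tuples G 1. a) l"
  proof (rule G_liftingD[OF C_lifting C C d[of 0] coch_const_hom[OF C] im])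
   fix g assume "g : rc_hom T R (C 0) (coch G 1 (C (Suc 0)))"
    "!!x a l. x : Obj T ==> a : el (C 0) x ==> l : tuples G 1 ==> d 0 x (g x a l) = (\<lambda>l\<in>tuples G 1. a) l"
   then show thesis by (rule that)
  qed
  then show ?thesis unfolding good_def by (intro exI[of _ s]) (simp add: rc_homD(3)[OF d])
 qed
 have nxt: "EX s'. good (Suc m) s' & step m s s'" if g: "good m s" for m s
 proof -
  have s: "s : rc_hom T R (C m) (coch G 1 (C (Suc m)))" and
   sd: "!!x a l. x : Obj T ==> a : el (C (Suc m)) x ==> l : tuples G 1 ==> d m x (s x (d m x a) l) = d m x a"
   using g by (simp_all add: good_def)
  let ?f = "%x a. (\<lambda>l\<in>tuples G 1. a) -[mod_at (coch G 1 (C (Suc m))) x] s x (d m x a)"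
  have f: "?f : rc_hom T R (C (Suc m)) (coch G 1 (C (Suc m)))"
   by (rule rc_hom_minus[OF C left_module_coch[OF C] coch_const_hom[OF C] rc_hom_comp[OF d s]])
  have fl: "?f x a l = a -[mod_at (C (Suc m)) x] s x (d m x a) l"
   if x: "x : Obj T" "a : el (C (Suc m)) x" "l : tuples G 1" for x a l
   using fun_mod_minus[OF R left_moduleD(1)[OF C x(1)], of _ "tuples G 1"]
    rc_homD(3)[OF coch_const_hom[OF C] x(1,2)] rc_homD(3)[OF s x(1) rc_homD(3)[OF d x(1,2)]] x(3)
   by (simp add: coch_at)
  have sc: "s x (d m x a) l : el (C (Suc m)) x"
   if x: "x : Obj T" "a : el (C (Suc m)) x" "l : tuples G 1" for x a l
   by (rule coch_app[OF rc_homD(3)[OF s x(1) rc_homD(3)[OF d x(1,2)]] x(3)])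
  \<comment> \<open>\<open>a - s (d a)\<close> is a cycle because the previous stage gives
    \<open>d s d = d\<close>.\<close>
  have im: "?f x a l : d (Suc m) x ` el (C (Suc (Suc m))) x"
   if x: "x : Obj T" "a : el (C (Suc m)) x" "l : tuples G 1" for x a l
   unfolding C_exact[OF x(1)] fl[OF x] mod_ker_def
   using rc_hom_apply_minus[OF C C d x(1,2) sc[OF x]] sd[OF x] left_moduleD(5)[OF C x(1)] x(2) sc[OF x] rc_homD(3)[OF d x(1,2)]
   by (simp add: ag a_minus_def)
  obtain s' where s': "s' : rc_hom T R (C (Suc m)) (coch G 1 (C (Suc (Suc m))))"
   "!!x a l. x : Obj T ==> a : el (C (Suc m)) x ==> l : tuples G 1 ==> d (Suc m) x (s' x a l) = ?f x a l"
  proof (rule G_liftingD[OF C_lifting C C d f im])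
   fix g assume "g : rc_hom T R (C (Suc m)) (coch G 1 (C (Suc (Suc m))))"
    "!!x a l. x : Obj T ==> a : el (C (Suc m)) x ==> l : tuples G 1 ==> d (Suc m) x (g x a l) = ?f x a l"
   then show thesis by (rule that)
  qed
  have "d (Suc m) x (s' x (d (Suc m) x a) l) = d (Suc m) x a"
   if x: "x : Obj T" "a : el (C (Suc (Suc m))) x" "l : tuples G 1" for x a l
  proof -
   note da = rc_homD(3)[OF d x(1,2)]
   have "d m x (d (Suc m) x a) = 0[mod_at (C m) x]" using C_exact[OF x(1), of m] x(2) by (auto simp: mod_ker_def)
   then have "s x (d m x (d (Suc m) x a)) l = 0[mod_at (C (Suc m)) x]"
    using rc_hom_apply_zero[OF C left_module_coch[OF C] s x(1)] x(3) by (simp add: coch_ops)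
   then show ?thesis using s'(2)[OF x(1) da x(3)] fl[OF x(1) da x(3)] left_moduleD(5)[OF C x(1)] da by (simp add: ag a_minus_def)
  qed
  then have "good (Suc m) s' & step m s s'" unfolding good_def step_def using s' fl by simp
  then show ?thesis by blast
 qed
 from dependent_nat_choice[of good step, OF base nxt]
 obtain s where s: "!!m. good m (s m)" "!!m. step m (s m) (s (Suc m))" by blast
 show ?thesis by (rule exI[of _ s]) (use s in \<open>simp add: good_def step_def\<close>)
qed

text \<open>The witness is \<open>h a l = f (s^g a) l\<close> with \<open>g\<close> the first entry
  of \<open>l\<close>. Letting the argument of the cochain select the contraction makes
  \<open>h\<close> natural, by equivariance of the family. A first entry must exist, hence the
  degree \<open>Suc k\<close>.\<close>

lemma row_exact:
 assumes M: "left_module T R M" and f: "f : rc_hom T R (C (Suc m)) (coch G (Suc k) M)"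
  and fd: "!!x a. x : Obj T ==> a : el (C (Suc (Suc m))) x ==> f x (d (Suc m) x a) = 0[mod_at (coch G (Suc k) M) x]"
 shows "EX h:rc_hom T R (C m) (coch G (Suc k) M). ALL x:Obj T. ALL a:el (C (Suc m)) x. h x (d m x a) = f x a"
proof -
 obtain s where s: "!!m. s m : rc_hom T R (C m) (coch G 1 (C (Suc m)))"
  "!!m x a l. x : Obj T ==> a : el (C (Suc m)) x ==> l : tuples G 1 ==>
    d (Suc m) x (s (Suc m) x a l) = a -[mod_at (C (Suc m)) x] s m x (d m x a) l"
  using contraction by blast
 let ?h = "%x a. \<lambda>l\<in>tuples G (Suc k). f x (s m x a [hd l]) l"
 have t1: "[hd l] : tuples G 1" if "l : tuples G (Suc k)" for l using that by (cases l) (auto simp: tuples_def)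
 have sc: "s m x a [hd l] : el (C (Suc m)) x"
  if "x : Obj T" "a : el (C m) x" "l : tuples G (Suc k)" for x a l
  by (rule coch_app[OF rc_homD(3)[OF s(1) that(1,2)] t1[OF that(3)]])
 have fc: "f x (s m x a [hd l]) : el (coch G (Suc k) M) x"
  if "x : Obj T" "a : el (C m) x" "l : tuples G (Suc k)" for x a l
  by (rule rc_homD(3)[OF f that(1) sc[OF that]])
 have h: "?h : rc_hom T R (C m) (coch G (Suc k) M)"
 proof (rule rc_homI)
  fix x assume x: "x : Obj T"
  show "?h x : mod_hom R (mod_at (C m) x) (mod_at (coch G (Suc k) M) x)"
  proof (rule mod_homI)
   fix a assume a: "a : el (C m) x"
   show "?h x a : el (coch G (Suc k) M) x" by (rule coch_restrict) (rule coch_app[OF fc[OF x a]])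
   show "?h x (r *[mod_at (C m) x] a) = r *[mod_at (coch G (Suc k) M) x] ?h x a" if r: "r : carrier R" for r
    unfolding coch_ops
    by (rule restrict_ext) (simp add: mod_homD(3)[OF rc_homD(1)[OF s(1) x] r a] coch_ops t1[simplified]
      mod_homD(3)[OF rc_homD(1)[OF f x] r sc[OF x a]])
   fix b assume b: "b : el (C m) x"
   show "?h x (a +[mod_at (C m) x] b) = ?h x a +[mod_at (coch G (Suc k) M) x] ?h x b"
    unfolding coch_ops
    by (rule restrict_ext) (simp add: mod_homD(2)[OF rc_homD(1)[OF s(1) x] a b] coch_ops t1[simplified]
      mod_homD(2)[OF rc_homD(1)[OF f x] sc[OF x a] sc[OF x b]])
  qed
 next
  fix x y g a assume xy: "x : Obj T" "y : Obj T" "g : Hom T x y" and a: "a : el (C m) x"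
  note g = Hom_sub[OF xy]
  show "?h y (mod_map (C m) x y g a) = mod_map (coch G (Suc k) M) x y g (?h x a)"
   unfolding coch_map
  proof (rule restrict_ext)
   fix l assume l: "l : tuples G (Suc k)"
   note sl = shift_tuples[OF g l]
   have hd: "shift G g [hd l] = [hd (shift G g l)]" using l by (cases l) (auto simp: tuples_def shift_def)
   have "s m y (mod_map (C m) x y g a) [hd l] = mod_map (C (Suc m)) x y g (s m x a [hd (shift G g l)])"
    unfolding rc_homD(2)[OF s(1) xy a] coch_map hd[symmetric] using t1[OF l] by simp
   then have "f y (s m y (mod_map (C m) x y g a) [hd l]) = mod_map (coch G (Suc k) M) x y g (f x (s m x a [hd (shift G g l)]))"
    using rc_homD(2)[OF f xy sc[OF xy(1) a sl]] by simp
   then show "f y (s m y (mod_map (C m) x y g a) [hd l]) l = mod_map M x y g ((\<lambda>l\<in>tuples G (Suc k). f x (s m x a [hd l]) l) (shift G g l))"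
    using l sl by (simp add: coch_map)
  qed
 qed
 show ?thesis
 proof (intro bexI[OF _ h] ballI)
  fix x a assume x: "x : Obj T" and a: "a : el (C (Suc m)) x"
  note da = rc_homD(3)[OF d x a]
  show "?h x (d m x a) = f x a"
  proof (rule coch_eqI[OF rc_homD(3)[OF h x da] rc_homD(3)[OF f x a]])
   fix l assume l: "l : tuples G (Suc k)"
   let ?A = "mod_at (C (Suc m)) x" and ?B = "mod_at (coch G (Suc k) M) x"
   note sl = sc[OF x da l]
   have ss: "s (Suc m) x a [hd l] : el (C (Suc (Suc m))) x"
    by (rule coch_app[OF rc_homD(3)[OF s(1) x a] t1[OF l]])
   have B: "abelian_group ?B" by (rule left_moduleD(5)[OF left_module_coch[OF M] x])
   have "0[?B] = f x a -[?B] f x (s m x (d m x a) [hd l])"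
    using fd[OF x ss] s(2)[OF x a t1[OF l]] rc_hom_apply_minus[OF C left_module_coch[OF M] f x a sl] by simp
   moreover have "f x a = (f x a -[?B] f x (s m x (d m x a) [hd l])) +[?B] f x (s m x (d m x a) [hd l])"
    using rc_homD(3)[OF f x a] rc_homD(3)[OF f x sl] B by - (rule ab_eqI[of ?B], simp add: ab)
   ultimately have "f x (s m x (d m x a) [hd l]) = f x a"
    using rc_homD(3)[OF f x sl] B by (metis abelian_group.ag_rules(5))
   then show "?h x (d m x a) l = f x a l" using l by simp
  qed
 qed
qed

end

section \<open>Comparing two resolutions through cochains\<close>

text \<open>\<open>Q\<close> is the projective resolution behind Ext, and its projectivity enters
  through \<open>col_Q\<close> and \<open>lifting_Q\<close>; \<open>P\<close> is a second resolution
  of \<open>N\<close>, possibly of another type, that lifts families only. The comparison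
  \<open>s\<close> anticommutes with the differentials, so that the cone needs no signs.
  Surjectivity of \<open>aP\<close> is contained in \<open>s_aug\<close> and
  \<open>Q_surj\<close>.\<close>

locale cone_data = graded_cat G R T for G :: "('g, 't) monoid_scheme" (structure) and R :: "('r, 's) ring_scheme" and T :: "('o, 'g) cat" +
 fixes M :: "('o, 'g, 'r, 'a) rcmod" and N :: "('o, 'g, 'r, 'n) rcmod"
  and Q :: "nat => ('o, 'g, 'r, 'u) rcmod" and dQ aQ and P :: "nat => ('o, 'g, 'r, 'v) rcmod" and dP aP s
 assumes M: "left_module T R M" and N: "left_module T R N" and Q: "!!n. left_module T R (Q n)" and P: "!!n. left_module T R (P n)"
  and dQ: "!!n. dQ n : rc_hom T R (Q (Suc n)) (Q n)" and dP: "!!n. dP n : rc_hom T R (P (Suc n)) (P n)"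
  and aQ: "aQ : rc_hom T R (Q 0) N" and aP: "aP : rc_hom T R (P 0) N" and s: "!!n. s n : rc_hom T R (Q n) (P n)"
  and s_anti: "!!n x b. x : Obj T ==> b : el (Q (Suc n)) x ==>
   dP n x (s (Suc n) x b) +[mod_at (P n) x] s n x (dQ n x b) = 0[mod_at (P n) x]"
  and s_aug: "!!x b. x : Obj T ==> b : el (Q 0) x ==> aP x (s 0 x b) = aQ x b"
  and Q_surj: "!!x. x : Obj T ==> aQ x ` el (Q 0) x = el N x"
  and Q_exact0: "!!x. x : Obj T ==> dQ 0 x ` el (Q (Suc 0)) x = mod_ker (mod_at (Q 0) x) (mod_at N x) (aQ x)"
  and Q_exact: "!!x n. x : Obj T ==> dQ (Suc n) x ` el (Q (Suc (Suc n))) x = mod_ker (mod_at (Q (Suc n)) x) (mod_at (Q n) x) (dQ n x)"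
  and P_exact0: "!!x. x : Obj T ==> dP 0 x ` el (P (Suc 0)) x = mod_ker (mod_at (P 0) x) (mod_at N x) (aP x)"
  and P_exact: "!!x n. x : Obj T ==> dP (Suc n) x ` el (P (Suc (Suc n))) x = mod_ker (mod_at (P (Suc n)) x) (mod_at (P n) x) (dP n x)"
  and col_Q: "!!n k f. f : rc_hom T R (Q n) (coch G (Suc k) M) ==>
   (!!x a. x : Obj T ==> a : el (Q n) x ==> cdiff G (Suc k) M x (f x a) = 0[mod_at (coch G (Suc (Suc k)) M) x]) ==>
   EX g:rc_hom T R (Q n) (coch G k M). ALL x:Obj T. ALL a:el (Q n) x. cdiff G k M x (g x a) = f x a"
  and lifting_Q: "!!n. G_lifting G T R (Q n) TYPE('u \<times> 'v)" and lifting_P: "!!n. G_lifting G T R (P n) TYPE('u \<times> 'v)"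
begin

text \<open>\<open>Q\<close> moved up by one degree, with zero at index 0, so that the cone is given
  by one formula in all degrees.\<close>

definition Qs :: "nat => ('o, 'g, 'r, 'u) rcmod" where
 "Qs m = (case m of 0 => zero_left (Q 0) | Suc m' => Q m')"

definition dQs :: "nat => 'o => 'u => 'u" where
 "dQs m = (case m of 0 => (%x b. 0[mod_at (Q 0) x]) | Suc m' => dQ m')"

definition C :: "nat => ('o, 'g, 'r, 'u \<times> 'v) rcmod" where
 "C m = prod_left (Qs m) (P m)"

definition dC :: "nat => 'o => 'u \<times> 'v => 'u \<times> 'v" where
 "dC m x p = (dQs m x (fst p), s m x (fst p) +[mod_at (P m) x] dP m x (snd p))"

lemma Qs_simps: "Qs (Suc m) = Q m" "el (Qs 0) x = {0[mod_at (Q 0) x]}" "0[mod_at (Qs 0) x] = 0[mod_at (Q 0) x]"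
 by (simp_all add: Qs_def zero_left_simps)

lemma Qs: "left_module T R (Qs m)"
 by (cases m) (simp_all add: Qs_def Q left_module_zero_left)

lemma dQs: "dQs m : rc_hom T R (Q m) (Qs m)"
proof (cases m)
 case 0
 show ?thesis using rc_hom_zero[OF Q[of 0] Qs[of 0]] by (simp add: 0 dQs_def Qs_simps)
qed (simp add: dQs_def Qs_def dQ)

lemma C: "left_module T R (C m)"
 unfolding C_def by (rule left_module_prod[OF Qs P])

lemma C_car: "el (C m) x = el (Qs m) x \<times> el (P m) x"
 by (simp add: C_def)

lemma dC: "dC m : rc_hom T R (C (Suc m)) (C m)"
proof -
 have CS: "C (Suc m) = prod_left (Q m) (P (Suc m))" by (simp add: C_def Qs_simps)
 have A: "(%x p. dQs m x (fst p)) : rc_hom T R (C (Suc m)) (Qs m)"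
  unfolding CS by (rule rc_hom_comp[OF prod_left_homs(1)[OF Q P] dQs])
 have B1: "(%x p. s m x (fst p)) : rc_hom T R (C (Suc m)) (P m)"
  unfolding CS by (rule rc_hom_comp[OF prod_left_homs(1)[OF Q P] s])
 have B2: "(%x p. dP m x (snd p)) : rc_hom T R (C (Suc m)) (P m)"
  unfolding C_def by (rule rc_hom_comp[OF prod_left_homs(2)[OF Qs P] dP])
 note B = rc_hom_add[OF C P B1 B2]
 show ?thesis
 proof (rule rc_homI)
  fix x assume x: "x : Obj T"
  show "dC m x : mod_hom R (mod_at (C (Suc m)) x) (mod_at (C m) x)"
   using mod_homD[OF rc_homD(1)[OF A x]] mod_homD[OF rc_homD(1)[OF B x]]
   by (intro mod_homI) (simp_all add: dC_def C_def)
 next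
  fix x y f p assume xy: "x : Obj T" "y : Obj T" "f : Hom T x y" and p: "p : el (C (Suc m)) x"
  show "dC m y (mod_map (C (Suc m)) x y f p) = mod_map (C m) x y f (dC m x p)"
   using rc_homD(2)[OF A xy p] rc_homD(2)[OF B xy p] by (simp add: dC_def C_def)
 qed
qed

lemma abP: "x : Obj T ==> abelian_group (mod_at (P m) x)"
 by (rule left_moduleD(5)[OF P])

lemma abQs: "x : Obj T ==> abelian_group (mod_at (Qs m) x)"
 by (rule left_moduleD(5)[OF Qs])

lemma zero_closed_cone: "x : Obj T ==> 0[mod_at (P m) x] : el (P m) x"
 "x : Obj T ==> 0[mod_at (Qs m) x] : el (Qs m) x"
 by (simp_all add: ag abP abQs)

lemma diff_split:
 assumes "abelian_group A" "a : carrier A" "b : carrier A" "a -[A] b = c"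
 shows "b +[A] c = a"
 unfolding assms(4)[symmetric] using assms(1-3) by - (rule ab_eqI[of A], simp add: ab)

lemma add_zero_neg:
 assumes "abelian_group A" "a : carrier A" "b : carrier A" "a +[A] b = 0[A]"
 shows "a = -[A] b"
proof -
 have "a = (a +[A] b) -[A] b" using assms(1-3) by - (rule ab_eqI[of A], simp add: ab)
 then show ?thesis unfolding assms(4) using assms(1-3) by (simp add: ag a_minus_def)
qed

text \<open>The usual diagram chase for the cone of a map between resolutions; the augmentations
  enter only at \<open>C 0\<close> and \<open>C (Suc 0)\<close>.\<close>

lemma exact_cone: "exact_G_lifting G R T C dC"
proof (rule exact_G_lifting.intro[OF graded_cat_axioms], rule exact_G_lifting_axioms.intro)
 show "left_module T R (C m)" for m by (rule C)
 show "dC m : rc_hom T R (C (Suc m)) (C m)" for m by (rule dC)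
 have "G_lifting G T R (Qs m) TYPE('u \<times> 'v)" for m
  by (cases m) (simp_all add: Qs_def lifting_Q G_lifting_zero[OF Q])
 then show "G_lifting G T R (C m) TYPE('u \<times> 'v)" for m
  unfolding C_def by (rule G_lifting_prod[OF Qs P _ lifting_P])
next
 fix x assume x: "x : Obj T"
 show "dC 0 x ` el (C (Suc 0)) x = el (C 0) x"
 proof
  show "dC 0 x ` el (C (Suc 0)) x <= el (C 0) x" using rc_homD(3)[OF dC x] by blast
  show "el (C 0) x <= dC 0 x ` el (C (Suc 0)) x"
  proof
   fix p assume "p : el (C 0) x"
   then obtain a where p: "p = (0[mod_at (Q 0) x], a)" and a: "a : el (P 0) x"
    by (auto simp: C_car Qs_simps)
   obtain b where b: "b : el (Q 0) x" "aQ x b = aP x a"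
    using Q_surj[OF x] rc_homD(3)[OF aP x a] by (metis imageE)
   note sb = rc_homD(3)[OF s x b(1)]
   have "aP x (a -[mod_at (P 0) x] s 0 x b) = 0[mod_at N x]"
    using rc_hom_apply_minus[OF P N aP x a sb] s_aug[OF x b(1)] b(2) rc_homD(3)[OF aP x a] left_moduleD(5)[OF N x]
    by (simp add: ag a_minus_def)
   then have "a -[mod_at (P 0) x] s 0 x b : dP 0 x ` el (P (Suc 0)) x"
    unfolding P_exact0[OF x] mod_ker_def using a sb abP[OF x] by (simp add: ag)
   then obtain a' where a': "a' : el (P (Suc 0)) x" "a -[mod_at (P 0) x] s 0 x b = dP 0 x a'" by blast
   have "dC 0 x (b, a') = p"
    using diff_split[OF abP[OF x] a sb a'(2)] by (simp add: dC_def dQs_def p)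
   then show "p : dC 0 x ` el (C (Suc 0)) x"
    using a'(1) b(1) by (intro image_eqI[of _ _ "(b, a')"]) (simp_all add: C_car Qs_simps)
  qed
 qed
next
 fix x m assume x: "x : Obj T"
 let ?Pm = "mod_at (P m) x" and ?PS = "mod_at (P (Suc m)) x"
 show "dC (Suc m) x ` el (C (Suc (Suc m))) x = mod_ker (mod_at (C (Suc m)) x) (mod_at (C m) x) (dC m x)"
 proof
  show "dC (Suc m) x ` el (C (Suc (Suc m))) x <= mod_ker (mod_at (C (Suc m)) x) (mod_at (C m) x) (dC m x)"
  proof
   fix p assume "p : dC (Suc m) x ` el (C (Suc (Suc m))) x"
   then obtain b a where p: "p = dC (Suc m) x (b, a)" and ba: "b : el (Q (Suc m)) x" "a : el (P (Suc (Suc m))) x"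
    by (auto simp: C_car Qs_simps)
   have pc: "p : el (C (Suc m)) x" unfolding p by (rule rc_homD(3)[OF dC x]) (simp add: C_car Qs_simps ba)
   have pe: "p = (dQ m x b, s (Suc m) x b +[?PS] dP (Suc m) x a)" by (simp add: p dC_def dQs_def)
   note db = rc_homD(3)[OF dQ x ba(1)] and sb = rc_homD(3)[OF s x ba(1)] and da = rc_homD(3)[OF dP x ba(2)]
   have z1: "dQs m x (dQ m x b) = 0[mod_at (Qs m) x]"
   proof (cases m)
    case (Suc m')
    then show ?thesis using Q_exact[OF x, of m'] ba(1) by (auto simp: dQs_def Qs_simps mod_ker_def)
   qed (simp add: dQs_def Qs_simps)
   have "dP m x (dP (Suc m) x a) = 0[?Pm]" using P_exact[OF x, of m] ba(2) by (auto simp: mod_ker_def)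
   then have "s m x (dQ m x b) +[?Pm] dP m x (s (Suc m) x b +[?PS] dP (Suc m) x a) = 0[?Pm]"
    using rc_hom_apply_add[OF dP x sb da] s_anti[OF x ba(1)] rc_homD(3)[OF s x db] rc_homD(3)[OF dP x sb] abP[OF x]
     abelian_group.ag_comm[OF abP[OF x] rc_homD(3)[OF s x db] rc_homD(3)[OF dP x sb]] by (simp add: ag)
   then have "dC m x p = 0[mod_at (C m) x]" using z1 by (simp add: dC_def pe C_def)
   then show "p : mod_ker (mod_at (C (Suc m)) x) (mod_at (C m) x) (dC m x)" using pc by (simp add: mod_ker_def)
  qed
  show "mod_ker (mod_at (C (Suc m)) x) (mod_at (C m) x) (dC m x) <= dC (Suc m) x ` el (C (Suc (Suc m))) x"
  proof
   fix p assume p: "p : mod_ker (mod_at (C (Suc m)) x) (mod_at (C m) x) (dC m x)"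
   obtain b a where ba: "p = (b, a)" "b : el (Q m) x" "a : carrier ?PS"
    using p by (auto simp: mod_ker_def C_car Qs_simps)
   have z: "dQs m x b = 0[mod_at (Qs m) x]" "s m x b +[?Pm] dP m x a = 0[?Pm]"
    using p by (simp_all add: mod_ker_def ba dC_def C_def)
   note sb = rc_homD(3)[OF s x ba(2)] and da = rc_homD(3)[OF dP x ba(3)]
   \<comment> \<open>For \<open>m = 0\<close> the first component of \<open>dC\<close> is zero and
     says nothing about \<open>b\<close>; that \<open>b\<close> is killed by \<open>aQ\<close>
     follows from \<open>aQ = aP s\<close> and the second component instead.\<close>
   have "b : dQ m x ` el (Q (Suc m)) x"
   proof (cases m)
    case 0
    have "aP x (dP m x a) = 0[mod_at N x]" using P_exact0[OF x] ba(3) 0 by (auto simp: mod_ker_def)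
    moreover have "aP x (s m x b) +[mod_at N x] aP x (dP m x a) = 0[mod_at N x]"
     using rc_hom_apply_add[OF aP x, of "s m x b" "dP m x a"] sb da z(2) rc_hom_apply_zero[OF P N aP x] 0 by simp
    moreover have "aP x (s m x b) : el N x" using rc_homD(3)[OF aP x] sb 0 by simp
    ultimately have "aQ x b = 0[mod_at N x]" using s_aug[OF x] ba(2) 0 left_moduleD(5)[OF N x] by (simp add: ag)
    then show ?thesis using Q_exact0[OF x] ba(2) 0 by (simp add: mod_ker_def)
   next
    case (Suc m')
    then show ?thesis using Q_exact[OF x, of m'] ba(2) z(1) by (simp add: mod_ker_def dQs_def Qs_simps)
   qed
   then obtain b' where b': "b' : el (Q (Suc m)) x" "b = dQ m x b'" by blast
   note sb' = rc_homD(3)[OF s x b'(1)]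
   have "dP m x (a -[?PS] s (Suc m) x b') = 0[?Pm]"
    using rc_hom_apply_minus[OF P P dP x ba(3) sb'] add_zero_neg[OF abP[OF x] sb da z(2)]
     add_zero_neg[OF abP[OF x] rc_homD(3)[OF dP x sb'] rc_homD(3)[OF s x ba(2)[unfolded b'(2)]] s_anti[OF x b'(1)]]
     da abP[OF x] b'(2) by (simp add: ag a_minus_def)
   then have "a -[?PS] s (Suc m) x b' : dP (Suc m) x ` el (P (Suc (Suc m))) x"
    unfolding P_exact[OF x] mod_ker_def using ba(3) sb' abP[OF x] by (simp add: ag)
   then obtain a' where a': "a' : el (P (Suc (Suc m))) x" "a -[?PS] s (Suc m) x b' = dP (Suc m) x a'" by blast
   have "dC (Suc m) x (b', a') = p"
    using diff_split[OF abP[OF x] ba(3) sb' a'(2)] b'(2) by (simp add: dC_def dQs_def ba)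
   then show "p : dC (Suc m) x ` el (C (Suc (Suc m))) x"
    using a'(1) b'(1) by (intro image_eqI[of _ _ "(b', a')"]) (simp_all add: C_car Qs_simps)
  qed
 qed
qed

abbreviation HD :: "nat => nat => ('r, 'o => 'u \<times> 'v => 'g list => 'a) module" where
 "HD \<equiv> homD T R C (%k. coch G k M)"
abbreviation "hC \<equiv> homh T C dC"
abbreviation "vC \<equiv> homv T R C (%k. coch G k M) (%k. cdiff G k M)"
abbreviation "XD \<equiv> homD T R P (%q. coch G (Suc q) M)"
abbreviation "hX \<equiv> homh T P dP"
abbreviation "vX \<equiv> homv T R P (%q. coch G (Suc q) M) (%q. cdiff G (Suc q) M)"

definition van :: "nat => ('o => 'u \<times> 'v => 'g list => 'a) => nat => bool" where
 "van i f k \<longleftrightarrow> (ALL x:Obj T. ALL a:el (P i) x. f x (0[mod_at (Qs i) x], a) = 0[mod_at (coch G k M) x])"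

text \<open>Three subcomplexes of the morphisms from the cone to cochains. \<open>SW\<close> is
  everything in positive cochain degree and, in degree 0, the morphisms out of \<open>Qs\<close>.
  \<open>SA\<close> drops degree 0 and leaves full rows, exact by \<open>row_exact\<close>;
  \<open>SB\<close> keeps the morphisms out of \<open>Qs\<close> in all degrees and has exact
  columns. The quotient of \<open>SW\<close> by \<open>SA\<close> is the complex that computes Ext,
  the quotient by \<open>SB\<close> is the double complex \<open>XD\<close>, each shifted by
  one.\<close>

abbreviation "SW i k \<equiv> {f : carrier (HD i k). k = 0 --> van i f k}"
abbreviation "SA i k \<equiv> {f : carrier (HD i k). k = 0 --> f = 0[HD i k]}"
abbreviation "SB i k \<equiv> {f : carrier (HD i k). van i f k}"
abbreviation "WD \<equiv> %i k. (HD i k)(|carrier := SW i k|)"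

lemma dcH: "double_complex R HD hC vC"
proof (rule hom_double)
 fix i x a assume x: "x : Obj T" and a: "a : el (C (Suc (Suc i))) x"
 then have "dC (Suc i) x a : mod_ker (mod_at (C (Suc i)) x) (mod_at (C i) x) (dC i x)"
  using exact_G_lifting.C_exact[OF exact_cone x, of i] by blast
 then show "dC i x (dC (Suc i) x a) = 0[mod_at (C i) x]" by (simp add: mod_ker_def)
qed (simp_all add: R C left_module_coch[OF M] dC cdiff_hom[OF M] cdiff_cdiff[OF M])

lemma dcX: "double_complex R XD hX vX"
proof (rule hom_double)
 fix i x a assume x: "x : Obj T" and a: "a : el (P (Suc (Suc i))) x"
 then show "dP i x (dP (Suc i) x a) = 0[mod_at (P i) x]" using P_exact[OF x, of i] by (auto simp: mod_ker_def)
qed (simp_all add: R P left_module_coch[OF M] dP cdiff_hom[OF M] cdiff_cdiff[OF M])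

definition rX :: "nat => nat => ('o => 'u \<times> 'v => 'g list => 'a) => 'o => 'v => 'g list => 'a" where
 "rX i k f = rest T (P i) (%x a. f x (0[mod_at (Qs i) x], a))"

text \<open>Evaluation at the empty tuple identifies \<open>coch G 0 M\<close> with
  \<open>M\<close>, so that row 0 of \<open>WD\<close> becomes the complex that computes
  Ext.\<close>

definition rZ :: "nat => ('o => 'u \<times> 'v => 'g list => 'a) => 'o => 'u => 'a" where
 "rZ n f = rest T (Q n) (%x b. f x (b, 0[mod_at (P (Suc n)) x]) [])"

lemma incl_homs:
 "(%x b. (0[mod_at (Qs i) x], b)) : rc_hom T R (P i) (C i)" "(%x b. (b, 0[mod_at (P i) x])) : rc_hom T R (Qs i) (C i)"
 unfolding C_def by (rule prod_left_homs(4)[OF Qs P], rule prod_left_homs(3)[OF Qs P])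

lemma proj_homs: "(%x. fst) : rc_hom T R (C i) (Qs i)" "(%x. snd) : rc_hom T R (C i) (P i)"
 unfolding C_def by (rule prod_left_homs(1)[OF Qs P], rule prod_left_homs(2)[OF Qs P])

lemma rX_hom: "rX i k : mod_hom R (HD i k) (hom_module T R (P i) (coch G k M))"
 using hom_module_precomp[OF C P left_module_coch[OF M] incl_homs(1)] by (simp add: homD_def rX_def[abs_def])

lemma ev0_hom: "(%x \<phi>. \<phi> []) : rc_hom T R (coch G 0 M) M"
proof (rule rc_homI)
 have e: "[] : tuples G 0" by (simp add: tuples_def)
 fix x assume x: "x : Obj T"
 show "(%\<phi>. \<phi> []) : mod_hom R (mod_at (coch G 0 M) x) (mod_at M x)"
  by (rule mod_homI) (simp_all add: coch_ops e coch_app)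
next
 fix x y f \<phi> assume "x : Obj T" "y : Obj T" "f : Hom T x y"
 show "mod_map (coch G 0 M) x y f \<phi> [] = mod_map M x y f (\<phi> [])" by (simp add: coch_map tuples_def shift_def)
qed

lemma rZ_hom: "rZ n : mod_hom R (HD (Suc n) 0) (hom_module T R (Q n) M)"
proof -
 have "(%f. rest T (Q n) (%x b. rest T (Q n) (%x b. f x (b, 0[mod_at (P (Suc n)) x])) x b [])) : mod_hom R (HD (Suc n) 0) (hom_module T R (Q n) M)"
  unfolding homD_def
  by (rule mod_hom_comp[OF hom_module_precomp[OF C Q left_module_coch[OF M] incl_homs(2)[of "Suc n", unfolded Qs_simps]]
    hom_module_postcomp[OF Q left_module_coch[OF M] M ev0_hom]])
 moreover have "rest T (Q n) (%x b. rest T (Q n) (%x b. f x (b, 0[mod_at (P (Suc n)) x])) x b []) = rZ n f" for f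
  unfolding rZ_def by (rule rest_cong) simp
 ultimately show ?thesis by simp
qed

lemma van_iff: "van i f k \<longleftrightarrow> rX i k f = 0[hom_module T R (P i) (coch G k M)]"
proof
 assume "van i f k"
 then show "rX i k f = 0[hom_module T R (P i) (coch G k M)]" unfolding rX_def hom_module_ops van_def
  by (intro rest_cong) blast
next
 assume r: "rX i k f = 0[hom_module T R (P i) (coch G k M)]"
 show "van i f k" unfolding van_def
 proof (intro ballI)
  fix x a assume "x : Obj T" "a : el (P i) x"
  then show "f x (0[mod_at (Qs i) x], a) = 0[mod_at (coch G k M) x]"
   using fun_cong[OF fun_cong[OF r, of x], of a] by (simp add: rX_def hom_module_ops)
 qed
qed

lemma mod_XP: "module R (hom_module T R (P i) (coch G k M))"
 by (rule module_hom_module[OF R P left_module_coch[OF M]])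

lemma mod_HD: "module R (HD i k)"
 by (rule double_complex.D[OF dcH])

lemma SB_eq: "SB i k = mod_ker (HD i k) (hom_module T R (P i) (coch G k M)) (rX i k)"
 by (simp add: mod_ker_def van_iff)

lemma sub_SB: "submodule (SB i k) R (HD i k)"
 unfolding SB_eq by (rule submodule_ker[OF mod_HD mod_XP rX_hom])

lemma sub_SW: "submodule (SW i k) R (HD i k)"
 using sub_SB[of i k] submodule_carrier[OF mod_HD, of i k] by (cases k) simp_all

lemma sub_SA: "submodule (SA i k) R (HD i k)"
proof (cases k)
 case 0
 have "SA i k = {0[HD i k]}" using 0 mod_HD[of i k, THEN module_ag] by (auto simp: ag)
 then show ?thesis using submodule_zero[OF mod_HD] by simp
qed (use submodule_carrier[OF mod_HD, of i k] in simp)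

lemma rX_h:
 assumes f: "f : carrier (HD i k)"
 shows "rX (Suc i) k (hC i k f) = homh T P dP i k (rX i k f)"
 unfolding rX_def homh_def
proof (rule rest_cong)
 fix x a assume x: "x : Obj T" and a: "a : el (P (Suc i)) x"
 have "dC i x (0[mod_at (Qs (Suc i)) x], a) = (0[mod_at (Qs i) x], dP i x a)"
  using rc_hom_apply_zero[OF Q Qs dQs x] rc_hom_apply_zero[OF Q P s x] rc_homD(3)[OF dP x a] abP[OF x]
  by (simp add: dC_def Qs_simps ag)
 then show "rest T (C (Suc i)) (%x a. f x (dC i x a)) x (0[mod_at (Qs (Suc i)) x], a)
   = rest T (P i) (%x a. f x (0[mod_at (Qs i) x], a)) x (dP i x a)"
  using x a zero_closed_cone[OF x] rc_homD(3)[OF dP x a] by (simp add: C_car)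
qed

lemma rX_v: "rX i (Suc k) (vC i k f) = rest T (P i) (%x a. sg R i *[mod_at (coch G (Suc k) M) x] cdiff G k M x (rX i k f x a))"
 unfolding rX_def homv_def
 by (rule rest_cong) (simp add: C_car zero_closed_cone)

lemma SB_stable:
 "f : SB i k ==> hC i k f : SB (Suc i) k" "f : SB i k ==> vC i k f : SB i (Suc k)"
proof -
 show "hC i k f : SB (Suc i) k" if f: "f : SB i k"
 proof -
  have fc: "f : carrier (HD i k)" using f by simp
  have "rX (Suc i) k (hC i k f) = 0[hom_module T R (P (Suc i)) (coch G k M)]"
   unfolding rX_h[OF fc] using f unfolding homh_def hom_module_ops
   by (intro rest_cong) (simp add: van_iff hom_module_ops rc_homD(3)[OF dP])
  then show ?thesis using mod_homD(1)[OF double_complex.h[OF dcH] fc] by (simp add: van_iff)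
 qed
 show "vC i k f : SB i (Suc k)" if f: "f : SB i k"
 proof -
  have fc: "f : carrier (HD i k)" using f by simp
  have "rX i (Suc k) (vC i k f) = 0[hom_module T R (P i) (coch G (Suc k) M)]"
   unfolding rX_v using f unfolding hom_module_ops
   by (intro rest_cong) (simp add: van_iff hom_module_ops rc_hom_apply_zero[OF left_module_coch[OF M] left_module_coch[OF M] cdiff_hom[OF M]]
    module.smult_r_null[OF left_moduleD(1)[OF left_module_coch[OF M]]] sg_facts(1)[OF R])
  then show ?thesis using mod_homD(1)[OF double_complex.v[OF dcH] fc] by (simp add: van_iff)
 qed
qed

lemma SW_stable: "f : SW i k ==> hC i k f : SW (Suc i) k" "f : SW i k ==> vC i k f : SW i (Suc k)"
 using SB_stable[of f i k] mod_homD(1)[OF double_complex.h[OF dcH], of f i k] mod_homD(1)[OF double_complex.v[OF dcH], of f i k]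
 by (cases k; simp)+

lemma SA_stable: "f : SA i k ==> hC i k f : SA (Suc i) k" "f : SA i k ==> vC i k f : SA i (Suc k)"
 using mod_homD(1)[OF double_complex.h[OF dcH], of f i k] mod_homD(1)[OF double_complex.v[OF dcH], of f i k] double_complex.h0[OF dcH, of i k]
 by (cases k; auto)+

lemma dcW: "double_complex R WD hC vC"
 by (rule double_complex.sub_complex[OF dcH sub_SW SW_stable])

lemma dcA: "double_complex R (%i k. (HD i k)(|carrier := SA i k|)) hC vC"
 by (rule double_complex.sub_complex[OF dcH sub_SA SA_stable])

lemma dcB: "double_complex R (%i k. (HD i k)(|carrier := SB i k|)) hC vC"
 by (rule double_complex.sub_complex[OF dcH sub_SB SB_stable])

end

section \<open>Comparison of Ext with the total complex of \<open>XD\<close>\<close>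

context cone_data
begin

abbreviation "AD \<equiv> %i k. (HD i k)(|carrier := SA i k|)"
abbreviation "BD \<equiv> %i k. (HD i k)(|carrier := SB i k|)"
abbreviation "tW n \<equiv> td WD hC vC n"
abbreviation "ZK n \<equiv> hom_module T R (Q n) M"

definition dZ :: "nat => ('o => 'u => 'a) => 'o => 'u => 'a" where
 "dZ n z = rest T (Q (Suc n)) (%x b. z x (dQ n x b))"

text \<open>Degree \<open>n + 1\<close> of the cone complex meets degree \<open>n\<close> at both
  ends: \<open>Q n\<close> sits in \<open>C (Suc n)\<close>, and \<open>XD\<close> begins with
  cochains of degree 1.\<close>

definition zpart :: "nat => (nat \<times> nat => 'o => 'u \<times> 'v => 'g list => 'a) => 'o => 'u => 'a" where
 "zpart n w = rZ n (w (Suc n, 0))"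

definition xpart :: "int => (nat \<times> nat => 'o => 'u \<times> 'v => 'g list => 'a) => nat \<times> nat => 'o => 'v => 'g list => 'a" where
 "xpart n w = (\<lambda>(p, q)\<in>idx n. rX p (Suc q) (w (p, Suc q)))"

lemma tdA: "td AD hC vC = td WD hC vC" and tdB: "td BD hC vC = td WD hC vC"
 by (simp_all only: td_restrict)

lemma zero_AW: "0[tot AD n] = 0[tot WD n]" and zero_BW: "0[tot BD n] = 0[tot WD n]"
 by (simp_all only: tot_restrict_zero)

lemma wH: "w : carrier (tot WD m) ==> int i + int j = m ==> w (i, j) : carrier (HD i j)"
 using double_complex.tot_app[OF dcW, of w m i j] by simp

lemma wV: "w : carrier (tot WD m) ==> int i = m ==> van i (w (i, 0)) 0"
 using double_complex.tot_app[OF dcW, of w m i 0] by simp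

lemma WD_ops: "add (WD i j) = add (HD i j)" "smult (WD i j) = smult (HD i j)" "0[WD i j] = 0[HD i j]"
 by simp_all

lemma module_ZK: "module R (ZK n)"
 by (rule module_hom_module[OF R Q M])

lemma zpart_hom: "zpart n : mod_hom R (tot WD (int n + 1)) (ZK n)"
proof (rule mod_homI)
 have i: "int (Suc n) + int 0 = int n + 1" by simp
 fix w assume w: "w : carrier (tot WD (int n + 1))"
 show "zpart n w : carrier (ZK n)" unfolding zpart_def by (rule mod_homD(1)[OF rZ_hom wH[OF w i]])
 show "zpart n (r *[tot WD (int n + 1)] w) = r *[ZK n] zpart n w" if r: "r : carrier R" for r
  unfolding zpart_def double_complex.tot_ops(3)[OF dcW i] WD_ops by (rule mod_homD(3)[OF rZ_hom r wH[OF w i]])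
 fix u assume u: "u : carrier (tot WD (int n + 1))"
 show "zpart n (w +[tot WD (int n + 1)] u) = zpart n w +[ZK n] zpart n u"
  unfolding zpart_def double_complex.tot_ops(2)[OF dcW i] WD_ops by (rule mod_homD(2)[OF rZ_hom wH[OF w i] wH[OF u i]])
qed

lemma XD_eq: "XD p q = hom_module T R (P p) (coch G (Suc q) M)"
 by (simp add: homD_def)

lemma xpart_app: "int p + int q = n ==> xpart n w (p, q) = rX p (Suc q) (w (p, Suc q))"
 by (simp add: xpart_def idx_def)

lemma xpart_closed: "w : carrier (tot WD (n + 1)) ==> xpart n w : carrier (tot XD n)"
 unfolding double_complex.tot_car[OF dcX] using mod_homD(1)[OF rX_hom wH[of w "n + 1"]]
 by (auto simp: xpart_def idx_def XD_eq)

lemma xpart_hom: "xpart n : mod_hom R (tot WD (n + 1)) (tot XD n)"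
proof (rule mod_homI)
 fix w assume w: "w : carrier (tot WD (n + 1))"
 show "xpart n w : carrier (tot XD n)" by (rule xpart_closed[OF w])
 show "xpart n (r *[tot WD (n + 1)] w) = r *[tot XD n] xpart n w" if r: "r : carrier R" for r
 proof (rule double_complex.tot_eqI[OF dcX xpart_closed])
  show "r *[tot WD (n + 1)] w : carrier (tot WD (n + 1))" by (rule module.smult_closed[OF double_complex.module_tot[OF dcW] r w])
  show "r *[tot XD n] xpart n w : carrier (tot XD n)" by (rule module.smult_closed[OF double_complex.module_tot[OF dcX] r xpart_closed[OF w]])
  fix p q assume pq: "int p + int q = n"
  then have pq1: "int p + int (Suc q) = n + 1" by simp
  show "xpart n (r *[tot WD (n + 1)] w) (p, q) = (r *[tot XD n] xpart n w) (p, q)"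
   unfolding double_complex.tot_ops(3)[OF dcX pq] xpart_app[OF pq] double_complex.tot_ops(3)[OF dcW pq1] WD_ops XD_eq
   by (rule mod_homD(3)[OF rX_hom r wH[OF w pq1]])
 qed
 fix u assume u: "u : carrier (tot WD (n + 1))"
 show "xpart n (w +[tot WD (n + 1)] u) = xpart n w +[tot XD n] xpart n u"
 proof (rule double_complex.tot_eqI[OF dcX xpart_closed])
  show "w +[tot WD (n + 1)] u : carrier (tot WD (n + 1))" by (rule abelian_group.ag_rules(1)[OF double_complex.ab_tot[OF dcW] w u])
  show "xpart n w +[tot XD n] xpart n u : carrier (tot XD n)"
   by (rule abelian_group.ag_rules(1)[OF double_complex.ab_tot[OF dcX] xpart_closed[OF w] xpart_closed[OF u]])
  fix p q assume pq: "int p + int q = n"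
  then have pq1: "int p + int (Suc q) = n + 1" by simp
  show "xpart n (w +[tot WD (n + 1)] u) (p, q) = (xpart n w +[tot XD n] xpart n u) (p, q)"
   unfolding double_complex.tot_ops(2)[OF dcX pq] xpart_app[OF pq] double_complex.tot_ops(2)[OF dcW pq1] WD_ops XD_eq
   by (rule mod_homD(2)[OF rX_hom wH[OF w pq1] wH[OF u pq1]])
 qed
qed

lemma xpart_td:
 assumes w: "w : carrier (tot WD (n + 1))"
 shows "xpart (n + 1) (tW (n + 1) w) = td XD hX vX n (xpart n w)"
proof (rule double_complex.tot_eqI[OF dcX])
 have tw: "tW (n + 1) w : carrier (tot WD (n + 1 + 1))" by (rule double_complex.td_closed[OF dcW w])
 show "xpart (n + 1) (tW (n + 1) w) : carrier (tot XD (n + 1))" by (rule xpart_closed[OF tw])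
 show "td XD hX vX n (xpart n w) : carrier (tot XD (n + 1))" by (rule double_complex.td_closed[OF dcX xpart_closed[OF w]])
 fix p q assume pq: "int p + int q = n + 1"
 then have pq1: "int p + int (Suc q) = n + 1 + 1" by simp
 have hc: "hpart WD hC w p (Suc q) : carrier (HD p (Suc q))" using double_complex.hpart_closed[OF dcW w pq1] by simp
 have vc: "vpart WD vC w p (Suc q) : carrier (HD p (Suc q))" using double_complex.vpart_closed[OF dcW w pq1] by simp
 have H: "rX p (Suc q) (hpart WD hC w p (Suc q)) = hpart XD hX (xpart n w) p q"
 proof (cases p)
  case 0
  then show ?thesis using mod_hom_zero[OF rX_hom module_ag[OF mod_HD] module_ag[OF mod_XP], of 0 "Suc q"]
   by (simp add: hpart_def XD_eq)
 next
  case (Suc p')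
  then have p': "int p' + int (Suc q) = n + 1" "int p' + int q = n" using pq by simp_all
  show ?thesis using rX_h[OF wH[OF w p'(1)]] by (simp add: Suc hpart_def xpart_app[OF p'(2)] homh_def)
 qed
 have V: "rX p (Suc q) (vpart WD vC w p (Suc q)) = vpart XD vX (xpart n w) p q"
 proof (cases q)
  case 0
  then have p: "int p = n + 1" "int p + int 0 = n + 1" using pq by simp_all
  \<comment> \<open>Row 0 is absent from \<open>XD\<close>; what it contributes to row 1 vanishes on
    \<open>P\<close> and is lost under restriction, so \<open>xpart\<close> commutes with the
    differentials.\<close>
  have "w (p, 0) : SB p 0" using wH[OF w p(2)] wV[OF w p(1)] by simp
  from SB_stable(2)[OF this] have "van p (vC p 0 (w (p, 0))) (Suc 0)" by simp
  then show ?thesis by (simp add: 0 vpart_def van_iff XD_eq)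
 next
  case (Suc q')
  then have q': "int p + int q' = n" using pq by simp
  have "rX p (Suc (Suc q')) (vC p (Suc q') (w (p, Suc q'))) = vX p q' (rX p (Suc q') (w (p, Suc q')))"
   unfolding rX_v by (simp only: homv_def)
  then show ?thesis by (simp add: Suc vpart_def xpart_app[OF q'])
 qed
 show "xpart (n + 1) (tW (n + 1) w) (p, q) = td XD hX vX n (xpart n w) (p, q)"
  unfolding xpart_app[OF pq] double_complex.td_app[OF dcX pq] double_complex.td_app[OF dcW pq1] WD_ops
   mod_homD(2)[OF rX_hom hc vc] H V XD_eq ..
qed

lemma zpart_td:
 assumes w: "w : carrier (tot WD (int n + 1))"
 shows "zpart (Suc n) (tW (int n + 1) w) = dZ n (zpart n w)"
proof -
 have i: "int (Suc n) + int 0 = int n + 1" "int (Suc (Suc n)) + int 0 = int n + 1 + 1" "int (Suc n) = int n + 1" by simp_all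
 let ?f = "w (Suc n, 0)"
 have f: "?f : carrier (HD (Suc n) 0)" by (rule wH[OF w i(1)])
 have fh: "?f : rc_hom T R (C (Suc n)) (coch G 0 M)" using f unfolding homD_def by (rule hom_moduleD(1))
 have hf: "hC (Suc n) 0 ?f : carrier (HD (Suc (Suc n)) 0)" by (rule mod_homD(1)[OF double_complex.h[OF dcH] f])
 have "tW (int n + 1) w (Suc (Suc n), 0) = hC (Suc n) 0 ?f"
  unfolding double_complex.td_app[OF dcW i(2)] using hf mod_HD[THEN module_ag]
  by (simp add: hpart_def vpart_def ag)
 then have "zpart (Suc n) (tW (int n + 1) w) = rZ (Suc n) (hC (Suc n) 0 ?f)" by (simp add: zpart_def)
 also have "\<dots> = dZ n (zpart n w)" unfolding zpart_def rZ_def dZ_def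
 proof (rule rest_cong)
  fix x b assume x: "x : Obj T" and b: "b : el (Q (Suc n)) x"
  note db = rc_homD(3)[OF dQ x b] and sb = rc_homD(3)[OF s x b]
  let ?z = "0[mod_at (P (Suc n)) x]" and ?y = "0[mod_at (Q n) x]"
  have zc: "?z : el (P (Suc n)) x" "?y : el (Q n) x"
   using zero_closed_cone(1)[OF x] left_moduleD(5)[OF Q x] by (simp_all add: ag)
  have e: "[] : tuples G 0" by (simp add: tuples_def)
  \<comment> \<open>Morphisms in row 0 vanish on \<open>P\<close>, so the comparison map
    \<open>s\<close> drops out of the differential and only \<open>dQ\<close> remains.\<close>
  have "?f x (?y, s (Suc n) x b) = 0[mod_at (coch G 0 M) x]"
   using wV[OF w i(3)] x sb by (simp add: van_def Qs_simps)
  moreover have "?f x (dQ n x b, s (Suc n) x b) = ?f x (dQ n x b, ?z) +[mod_at (coch G 0 M) x] ?f x (?y, s (Suc n) x b)"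
   using rc_hom_apply_add[OF fh x, of "(dQ n x b, ?z)" "(?y, s (Suc n) x b)"] db sb zc abP[OF x] left_moduleD(5)[OF Q x]
   by (simp add: C_def Qs_simps ag)
  moreover have "?f x (dQ n x b, ?z) : el (coch G 0 M) x"
   by (rule rc_homD(3)[OF fh x]) (simp add: C_car Qs_simps db zc)
  ultimately have eq: "?f x (dQ n x b, s (Suc n) x b) = ?f x (dQ n x b, ?z)"
   using left_moduleD(5)[OF left_module_coch[OF M] x] by (simp add: ag)
  have "dC (Suc n) x (b, 0[mod_at (P (Suc (Suc n))) x]) = (dQ n x b, s (Suc n) x b)"
   using rc_hom_apply_zero[OF P P dP x, of "Suc n"] sb abP[OF x] by (simp add: dC_def dQs_def ag)
  then show "hC (Suc n) 0 ?f x (b, 0[mod_at (P (Suc (Suc n))) x]) [] = rest T (Q n) (%x b. ?f x (b, 0[mod_at (P (Suc n)) x]) []) x (dQ n x b)"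
   using x b db zero_closed_cone(1)[OF x] eq by (simp add: homh_def C_car Qs_simps)
 qed
 finally show ?thesis .
qed

lemma zpart_surj:
 assumes z: "z : carrier (ZK n)"
 shows "EX w:carrier (tot WD (int n + 1)). zpart n w = z"
proof -
 let ?f = "rest T (C (Suc n)) (%x p. \<lambda>l\<in>tuples G 0. z x (fst p))"
 have pf: "(%x. fst) : rc_hom T R (C (Suc n)) (Q n)" using proj_homs(1)[of "Suc n"] by (simp only: Qs_simps)
 have "(%x p. \<lambda>l\<in>tuples G 0. z x (fst p)) : rc_hom T R (C (Suc n)) (coch G 0 M)"
  by (rule rc_hom_comp[OF rc_hom_comp[OF pf hom_moduleD(1)[OF z]] coch_const_hom[OF M]])
 then have f: "?f : carrier (HD (Suc n) 0)" unfolding homD_def by (rule rest_in_hom_module[OF C])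
 have v: "van (Suc n) ?f 0" unfolding van_def
  using zero_closed_cone(2)[of _ "Suc n"] rc_hom_apply_zero[OF Q M hom_moduleD(1)[OF z]]
  by (simp add: C_car Qs_simps coch_ops)
 have fW: "?f : carrier (WD (Suc n) 0)" using f v by simp
 interpret W: double_complex R WD hC vC by (rule dcW)
 have w: "W.single (Suc n) 0 ?f : carrier (tot WD (int n + 1))" using W.single_closed[OF fW] by (simp add: add.commute)
 have sg: "W.single (Suc n) 0 ?f (Suc n, 0) = ?f" by (simp only: W.single_app simp_thms if_True prod.inject refl)
 have "zpart n (W.single (Suc n) 0 ?f) = z"
  unfolding zpart_def rZ_def sg
  by (rule rest_eqI[OF z]) (use zero_closed_cone(1) in \<open>simp add: C_car Qs_simps tuples_def\<close>)
 then show ?thesis using w by blast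
qed

lemma xpart_surj:
 assumes x: "x : carrier (tot XD n)"
 shows "EX w:carrier (tot WD (n + 1)). xpart n w = x"
proof -
 \<comment> \<open>Morphisms out of \<open>P\<close> are extended by zero to the cone, and the entry
   in row 0 is set to zero.\<close>
 define w where "w = (\<lambda>(i, j)\<in>idx (n + 1). case j of 0 => 0[HD i 0] | Suc q => rest T (C i) (%y p. x (i, q) y (snd p)))"
 have xc: "x (i, q) : carrier (hom_module T R (P i) (coch G (Suc q) M))" if "int i + int q = n" for i q
  using double_complex.tot_app[OF dcX x that] by (simp add: XD_eq)
 have c: "rest T (C i) (%y p. x (i, q) y (snd p)) : carrier (HD i (Suc q))" if "int i + int q = n" for i q
  unfolding homD_def
  by (rule rest_in_hom_module[OF C rc_hom_comp[OF proj_homs(2) hom_moduleD(1)[OF xc[OF that]]]])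
 have zV: "0[HD i 0] : SW i 0" for i using submodD(3)[OF sub_SW mod_HD] .
 have wc: "w (i, j) : carrier (WD i j)" if "int i + int j = n + 1" for i j
  using that c[of i] zV[of i] by (cases j) (simp_all add: w_def idx_def)
 have w: "w : carrier (tot WD (n + 1))"
  unfolding double_complex.tot_car[OF dcW] using wc by (simp add: w_def)
 have "xpart n w = x"
 proof (rule double_complex.tot_eqI[OF dcX xpart_closed[OF w] x])
  fix p q assume pq: "int p + int q = n"
  then have e: "w (p, Suc q) = rest T (C p) (%y r. x (p, q) y (snd r))" by (simp add: w_def idx_def)
  show "xpart n w (p, q) = x (p, q)" unfolding xpart_app[OF pq] rX_def e
   by (rule rest_eqI[OF xc[OF pq]]) (simp add: C_car zero_closed_cone)
 qed
 then show ?thesis using w by blast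
qed

lemma zpart_zero:
 assumes w: "w : carrier (tot WD (int n + 1))" and z: "zpart n w = 0[ZK n]"
 shows "w : carrier (tot AD (int n + 1))"
proof -
 have i: "int (Suc n) + int 0 = int n + 1" "int (Suc n) = int n + 1" by simp_all
 let ?f = "w (Suc n, 0)"
 have f: "?f : carrier (hom_module T R (C (Suc n)) (coch G 0 M))" using wH[OF w i(1)] by (simp add: homD_def)
 note fh = hom_moduleD(1)[OF f]
 have "?f = 0[HD (Suc n) 0]" unfolding homD_def
 proof (rule hom_module_eqI[OF f])
  show "0[hom_module T R (C (Suc n)) (coch G 0 M)] : carrier (hom_module T R (C (Suc n)) (coch G 0 M))"
   using module_ag[OF mod_HD[of "Suc n" 0]] by (simp add: homD_def ag)
  fix x p assume x: "x : Obj T" and p: "p : el (C (Suc n)) x"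
  obtain b a where ba: "p = (b, a)" "b : el (Q n) x" "a : el (P (Suc n)) x"
   using p by (auto simp: C_car Qs_simps)
  let ?z = "0[mod_at (P (Suc n)) x]" and ?y = "0[mod_at (Q n) x]"
  have zc: "?z : el (P (Suc n)) x" "?y : el (Q n) x"
   using zero_closed_cone(1)[OF x] left_moduleD(5)[OF Q x] by (simp_all add: ag)
  have A: "abelian_group (mod_at (coch G 0 M) x)" by (rule left_moduleD(5)[OF left_module_coch[OF M] x])
  have c1: "?f x (b, ?z) : el (coch G 0 M) x" by (rule rc_homD(3)[OF fh x]) (simp add: C_car Qs_simps ba zc)
  have "?f x (b, ?z) = 0[mod_at (coch G 0 M) x]"
  proof (rule coch_eqI[OF c1])
   show "0[mod_at (coch G 0 M) x] : el (coch G 0 M) x" using A by (simp add: ag)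
   have "?f x (b, ?z) [] = 0[mod_at M x]"
    using fun_cong[OF fun_cong[OF z, of x], of b] x ba(2) by (simp add: zpart_def rZ_def hom_module_ops)
   then show "?f x (b, ?z) l = 0[mod_at (coch G 0 M) x] l" if "l : tuples G 0" for l
    using that by (simp add: tuples_def coch_ops)
  qed
  moreover have "?f x (?y, a) = 0[mod_at (coch G 0 M) x]" using wV[OF w i(2)] x ba(3) by (simp add: van_def Qs_simps)
  moreover have "?f x p = ?f x (b, ?z) +[mod_at (coch G 0 M) x] ?f x (?y, a)"
   using rc_hom_apply_add[OF fh x, of "(b, ?z)" "(?y, a)"] ba zc abP[OF x] left_moduleD(5)[OF Q x]
   by (simp add: C_def Qs_simps ag)
  ultimately show "?f x p = 0[hom_module T R (C (Suc n)) (coch G 0 M)] x p"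
   using A x p by (simp add: hom_module_ops ag)
 qed
 then have "w (i, j) : carrier (AD i j)" if "int i + int j = int n + 1" for i j
 proof (cases "j = 0")
  case True
  then have "i = Suc n" using that by linarith
  then show ?thesis using \<open>?f = \<zero>\<^bsub>HD (Suc n) 0\<^esub>\<close> wH[OF w that] True by simp
 qed (use wH[OF w that] in simp)
 then show ?thesis unfolding double_complex.tot_car[OF dcA] using w unfolding double_complex.tot_car[OF dcW] by blast
qed

lemma xpart_zero:
 assumes w: "w : carrier (tot WD (n + 1))" and z: "xpart n w = 0[tot XD n]"
 shows "w : carrier (tot BD (n + 1))"
proof -
 have "w (i, j) : carrier (BD i j)" if ij: "int i + int j = n + 1" for i j
 proof (cases j)
  case 0
  then show ?thesis using wH[OF w ij] wV[OF w, of i] ij by simp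
 next
  case (Suc q)
  then have iq: "int i + int q = n" using ij by simp
  have "rX i (Suc q) (w (i, Suc q)) = 0[XD i q]"
   using fun_cong[OF z, of "(i, q)"] by (simp only: xpart_app[OF iq] double_complex.tot_ops(1)[OF dcX iq])
  then show ?thesis using wH[OF w ij] by (simp add: Suc van_iff XD_eq)
 qed
 then show ?thesis unfolding double_complex.tot_car[OF dcB] using w unfolding double_complex.tot_car[OF dcW] by blast
qed

lemma sub_tot: "w : carrier (tot AD n) ==> w : carrier (tot WD n) & (n = int m + 1 --> zpart m w = 0[ZK m])"
 "u : carrier (tot BD n) ==> u : carrier (tot WD n) & xpart (n - 1) u = 0[tot XD (n - 1)]"
proof -
 assume w: "w : carrier (tot AD n)"
 have a: "w (i, j) : SA i j" if "int i + int j = n" for i j using double_complex.tot_app[OF dcA w that] by simp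
 have "w (i, j) : carrier (WD i j)" if "int i + int j = n" for i j
  using a[OF that] submodD(3)[OF sub_SW mod_HD, of i 0] by (cases j) simp_all
 then have wW: "w : carrier (tot WD n)" using w unfolding double_complex.tot_car[OF dcA] double_complex.tot_car[OF dcW] by blast
 moreover have "zpart m w = 0[ZK m]" if n: "n = int m + 1"
 proof -
  have "w (Suc m, 0) = 0[HD (Suc m) 0]" using a[of "Suc m" 0] n by simp
  then show ?thesis unfolding zpart_def using mod_hom_zero[OF rZ_hom module_ag[OF mod_HD] module_ag[OF module_ZK]] by simp
 qed
 ultimately show "w : carrier (tot WD n) & (n = int m + 1 --> zpart m w = 0[ZK m])" by blast
next
 assume u: "u : carrier (tot BD n)"
 have b: "u (i, j) : SB i j" if "int i + int j = n" for i j using double_complex.tot_app[OF dcB u that] by simp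
 have uW: "u : carrier (tot WD n)" using u b unfolding double_complex.tot_car[OF dcB] double_complex.tot_car[OF dcW] by simp
 moreover have "xpart (n - 1) u = 0[tot XD (n - 1)]"
 proof (rule double_complex.tot_eqI[OF dcX xpart_closed])
  show "u : carrier (tot WD (n - 1 + 1))" using uW by simp
  show "0[tot XD (n - 1)] : carrier (tot XD (n - 1))" using double_complex.ab_tot[OF dcX] by (simp add: ag)
  fix p q assume pq: "int p + int q = n - 1"
  then have "u (p, Suc q) : SB p (Suc q)" by (intro b) simp
  then show "xpart (n - 1) u (p, q) = 0[tot XD (n - 1)] (p, q)"
   unfolding xpart_app[OF pq] double_complex.tot_ops(1)[OF dcX pq] XD_eq by (simp add: van_iff)
 qed
 ultimately show "u : carrier (tot WD n) & xpart (n - 1) u = 0[tot XD (n - 1)]" by blast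
qed

text \<open>Rows of positive cochain degree consist of morphisms from the exact cone into
  \<open>coch G (Suc k) M\<close>, where \<open>row_exact\<close> applies; row 0 of
  \<open>SA\<close> is zero.\<close>

lemma acyclic_A:
 assumes w: "w : carrier (tot AD n)" and c: "tW n w = 0[tot WD (n + 1)]"
 shows "EX u:carrier (tot AD (n - 1)). tW (n - 1) u = w"
proof -
 have C_eq: "HD i k = hom_module T R (C i) (coch G k M)" for i k by (simp add: homD_def)
 have z: "0[AD i j] = rest T (C i) (%x a. 0[mod_at (coch G j M) x])" for i j by (simp add: C_eq hom_module_ops)
 have "EX u:carrier (tot AD (n - 1)). td AD hC vC (n - 1) u = w"
 proof (rule double_complex.tot_acyclic[OF dcA _ _ w])
  show "td AD hC vC n w = 0[tot AD (n + 1)]" unfolding tdA zero_AW by (rule c)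
  fix j f assume f: "f : carrier (AD 0 j)" and hf: "hC 0 j f = 0[AD (Suc 0) j]"
  have fH: "f : carrier (hom_module T R (C 0) (coch G j M))" using f by (simp add: C_eq)
  show "f = 0[AD 0 j]" unfolding z
  proof (rule rest_eqI[OF fH, symmetric])
   fix x a assume x: "x : Obj T" and "a : el (C 0) x"
   then obtain c where c: "c : el (C (Suc 0)) x" "a = dC 0 x c"
    using exact_G_lifting.C_surj[OF exact_cone x] by blast
   then show "0[mod_at (coch G j M) x] = f x a"
    using fun_cong[OF fun_cong[OF hf, of x], of c] x unfolding z by (simp add: homh_def)
  qed
 next
  fix i j f assume f: "f : carrier (AD (Suc i) j)" and hf: "hC (Suc i) j f = 0[AD (Suc (Suc i)) j]"
  have fH: "f : carrier (hom_module T R (C (Suc i)) (coch G j M))" using f by (simp add: C_eq)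
  show "EX y:carrier (AD i j). hC i j y = f"
  proof (cases j)
   case 0
   then show ?thesis using f double_complex.h0[OF dcA, of i j] module_ag[OF mod_HD[of i 0]]
    by (intro bexI[of _ "0[AD i j]"]) (simp_all add: ag)
  next
   case (Suc k)
   have fr: "f : rc_hom T R (C (Suc i)) (coch G (Suc k) M)" using hom_moduleD(1)[OF fH] Suc by simp
   have "EX g:rc_hom T R (C i) (coch G (Suc k) M). ALL x:Obj T. ALL a:el (C (Suc i)) x. g x (dC i x a) = f x a"
   proof (rule exact_G_lifting.row_exact[OF exact_cone M fr])
    fix x a assume "x : Obj T" "a : el (C (Suc (Suc i))) x"
    then show "f x (dC (Suc i) x a) = 0[mod_at (coch G (Suc k) M) x]"
     using fun_cong[OF fun_cong[OF hf, of x], of a] unfolding z by (simp add: homh_def Suc)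
   qed
   then obtain g where g: "g : rc_hom T R (C i) (coch G (Suc k) M)" "ALL x:Obj T. ALL a:el (C (Suc i)) x. g x (dC i x a) = f x a" by blast
   have "hC i j (rest T (C i) g) = f" unfolding homh_def
    by (rule rest_eqI[OF fH]) (simp add: rc_homD(3)[OF dC] g(2))
   moreover have "rest T (C i) g : carrier (AD i j)" using rest_in_hom_module[OF C g(1)] by (simp add: C_eq Suc)
   ultimately show ?thesis by blast
  qed
 qed
 then show ?thesis unfolding tdA .
qed

text \<open>The columns are morphisms from \<open>Qs i\<close> into the cochain complex. That
  complex is exact at each object, and \<open>col_Q\<close> carries this over to morphisms; at the
  bottom, cochains of degree 0 inject into those of degree 1.\<close>

lemma acyclic_B:
 assumes w: "w : carrier (tot BD n)" and c: "tW n w = 0[tot WD (n + 1)]"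
 shows "EX u:carrier (tot BD (n - 1)). tW (n - 1) u = w"
proof -
 have C_eq: "HD i k = hom_module T R (C i) (coch G k M)" for i k by (simp add: homD_def)
 have z: "0[BD i j] = rest T (C i) (%x a. 0[mod_at (coch G j M) x])" for i j by (simp add: C_eq hom_module_ops)
 have cz: "cdiff G j M x (f x a) = 0[mod_at (coch G (Suc j) M) x]"
  if f: "f : carrier (BD i j)" and vf: "vC i j f = 0[BD i (Suc j)]" and x: "x : Obj T" and a: "a : el (C i) x" for i j f x a
 proof -
  have fH: "f : carrier (hom_module T R (C i) (coch G j M))" using f by (simp add: C_eq)
  note fx = rc_homD(3)[OF cdiff_hom[OF M] x rc_homD(3)[OF hom_moduleD(1)[OF fH] x a]]
  have "sg R i *[mod_at (coch G (Suc j) M) x] cdiff G j M x (f x a) = 0[mod_at (coch G (Suc j) M) x]"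
   using fun_cong[OF fun_cong[OF vf, of x], of a] x a unfolding z by (simp add: homv_def)
  then show ?thesis using sg_smult(4)[OF left_moduleD(1)[OF left_module_coch[OF M] x] fx] by blast
 qed
 have "EX u:carrier (tot BD (n - 1)). td BD hC vC (n - 1) u = w"
 proof (rule double_complex.tot_acyclic_v[OF dcB _ _ w])
  show "td BD hC vC n w = 0[tot BD (n + 1)]" unfolding tdB zero_BW by (rule c)
  fix i f assume f: "f : carrier (BD i 0)" and vf: "vC i 0 f = 0[BD i (Suc 0)]"
  have fH: "f : carrier (hom_module T R (C i) (coch G 0 M))" using f by (simp add: C_eq)
  show "f = 0[BD i 0]" unfolding z
   by (rule rest_eqI[OF fH, symmetric])
    (rule cdiff_exact(1)[OF M _ rc_homD(3)[OF hom_moduleD(1)[OF fH]] cz[OF f vf] refl, symmetric])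
 next
  fix i k f assume f: "f : carrier (BD i (Suc k))" and vf: "vC i (Suc k) f = 0[BD i (Suc (Suc k))]"
  have fH: "f : carrier (hom_module T R (C i) (coch G (Suc k) M))" and van: "van i f (Suc k)" using f by (simp_all add: C_eq)
  note fr = hom_moduleD(1)[OF fH]
  have split: "f x (b, a) = f x (b, 0[mod_at (P i) x])"
   if x: "x : Obj T" and ba: "b : el (Qs i) x" "a : el (P i) x" for x b a
  proof -
   have "f x (b, a) = f x (b, 0[mod_at (P i) x]) +[mod_at (coch G (Suc k) M) x] f x (0[mod_at (Qs i) x], a)"
    using rc_hom_apply_add[OF fr x, of "(b, 0[mod_at (P i) x])" "(0[mod_at (Qs i) x], a)"] ba zero_closed_cone[OF x] abP[OF x] abQs[OF x]
    by (simp add: C_def ag)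
   moreover have "f x (b, 0[mod_at (P i) x]) : el (coch G (Suc k) M) x"
    by (rule rc_homD(3)[OF fr x]) (simp add: C_car ba zero_closed_cone[OF x])
   ultimately show ?thesis using van x ba left_moduleD(5)[OF left_module_coch[OF M] x] by (simp add: van_def ag)
  qed
  have "EX g:rc_hom T R (Qs i) (coch G k M). ALL x:Obj T. ALL b:el (Qs i) x. cdiff G k M x (g x b) = f x (b, 0[mod_at (P i) x])"
  proof (cases i)
   case 0
   have "cdiff G k M x 0[mod_at (coch G k M) x] = f x (b, 0[mod_at (P i) x])"
    if "x : Obj T" "b : el (Qs i) x" for x b
    using that van rc_hom_apply_zero[OF left_module_coch[OF M] left_module_coch[OF M] cdiff_hom[OF M] that(1)] zero_closed_cone(1)[OF that(1)]
    by (simp add: 0 Qs_simps van_def)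
   then show ?thesis by (intro bexI[OF _ rc_hom_zero[OF Qs left_module_coch[OF M]]] ballI)
  next
   case (Suc m)
   show ?thesis unfolding Suc Qs_simps
   proof (rule col_Q)
    show "(%x b. f x (b, 0[mod_at (P (Suc m)) x])) : rc_hom T R (Q m) (coch G (Suc k) M)"
     using rc_hom_comp[OF incl_homs(2)[of i] fr] by (simp add: Suc Qs_simps)
    fix x b assume x: "x : Obj T" and b: "b : el (Q m) x"
    show "cdiff G (Suc k) M x (f x (b, 0[mod_at (P (Suc m)) x])) = 0[mod_at (coch G (Suc (Suc k)) M) x]"
     by (rule cz[OF f vf x]) (simp add: Suc C_car Qs_simps b zero_closed_cone[OF x])
   qed
  qed
  then obtain g where g: "g : rc_hom T R (Qs i) (coch G k M)"
   "!!x b. x : Obj T ==> b : el (Qs i) x ==> cdiff G k M x (g x b) = f x (b, 0[mod_at (P i) x])" by blast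
  \<comment> \<open>\<open>vC\<close> multiplies by the sign \<open>sg R i\<close>; the preimage
    carries the same sign, whose square is 1.\<close>
  let ?y = "rest T (C i) (%x p. sg R i *[mod_at (coch G k M) x] g x (fst p))"
  have yr: "(%x p. sg R i *[mod_at (coch G k M) x] g x (fst p)) : rc_hom T R (C i) (coch G k M)"
   by (rule rc_hom_smult[OF C left_module_coch[OF M] rc_hom_comp[OF proj_homs(1) g(1)] sg_facts(1)[OF R]])
  have "van i ?y k" unfolding van_def
   using rc_hom_apply_zero[OF Qs left_module_coch[OF M] g(1)] module.smult_r_null[OF left_moduleD(1)[OF left_module_coch[OF M]] sg_facts(1)[OF R]]
   by (simp add: C_car zero_closed_cone)
  then have y: "?y : carrier (BD i k)" using rest_in_hom_module[OF C yr] by (simp add: C_eq)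
  have "vC i k ?y = f" unfolding homv_def
  proof (rule rest_eqI[OF fH])
   fix x p assume x: "x : Obj T" and p: "p : el (C i) x"
   obtain b a where ba: "p = (b, a)" "b : el (Qs i) x" "a : el (P i) x" using p by (auto simp: C_car)
   note gb = rc_homD(3)[OF g(1) x ba(2)]
   have "cdiff G k M x (sg R i *[mod_at (coch G k M) x] g x b) = sg R i *[mod_at (coch G (Suc k) M) x] cdiff G k M x (g x b)"
    by (rule mod_homD(3)[OF rc_homD(1)[OF cdiff_hom[OF M] x] sg_facts(1)[OF R] gb])
   then show "sg R i *[mod_at (coch G (Suc k) M) x] cdiff G k M x (?y x p) = f x p"
    using x p ba sg_smult(2)[OF left_moduleD(1)[OF left_module_coch[OF M] x] rc_homD(3)[OF cdiff_hom[OF M] x gb]] g(2)[OF x ba(2)] split[OF x ba(2,3)]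
    by simp
  qed
  then show "EX y:carrier (BD i k). vC i k y = f" using y by blast
 qed
 then show ?thesis unfolding tdB .
qed

text \<open>\<open>z\<close> and \<open>x\<close> are the two ends of a total cocycle of the cone complex.\<close>

definition rel :: "nat => ('o => 'u => 'a) => (nat \<times> nat => 'o => 'v => 'g list => 'a) => bool" where
 "rel n z x \<longleftrightarrow> (EX w:carrier (tot WD (int n + 1)). tW (int n + 1) w = 0[tot WD (int n + 1 + 1)] & zpart n w = z & xpart (int n) w = x)"

lemma rel_add:
 assumes "rel n z x" "rel n z' x'"
 shows "rel n (z +[ZK n] z') (x +[tot XD (int n)] x')"
proof -
 obtain w w' where w: "w : carrier (tot WD (int n + 1))" "tW (int n + 1) w = 0[tot WD (int n + 1 + 1)]" "zpart n w = z" "xpart (int n) w = x"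
  "w' : carrier (tot WD (int n + 1))" "tW (int n + 1) w' = 0[tot WD (int n + 1 + 1)]" "zpart n w' = z'" "xpart (int n) w' = x'"
  using assms unfolding rel_def by blast
 note A = double_complex.ab_tot[OF dcW]
 show ?thesis unfolding rel_def
  using mod_homD(2)[OF zpart_hom w(1,5)] mod_homD(2)[OF xpart_hom w(1,5)] mod_homD(2)[OF double_complex.td_hom[OF dcW] w(1,5)] w A
  by (intro bexI[of _ "w +[tot WD (int n + 1)] w'"]) (simp_all add: ag)
qed

lemma rel_smult:
 assumes r: "r : carrier R" and "rel n z x"
 shows "rel n (r *[ZK n] z) (r *[tot XD (int n)] x)"
proof -
 obtain w where w: "w : carrier (tot WD (int n + 1))" "tW (int n + 1) w = 0[tot WD (int n + 1 + 1)]" "zpart n w = z" "xpart (int n) w = x"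
  using assms unfolding rel_def by blast
 note A = double_complex.module_tot[OF dcW]
 show ?thesis unfolding rel_def
  using mod_homD(3)[OF zpart_hom r w(1)] mod_homD(3)[OF xpart_hom r w(1)] mod_homD(3)[OF double_complex.td_hom[OF dcW] r w(1)] w
   module.smult_closed[OF A r w(1)] module.smult_r_null[OF A r]
  by (intro bexI[of _ "r *[tot WD (int n + 1)] w"]) simp_all
qed

lemma tot_hom: "tW (int n) : mod_hom R (tot WD (int n)) (tot WD (int n + 1))" "tW (int n + 1) : mod_hom R (tot WD (int n + 1)) (tot WD (int n + 1 + 1))"
 by (rule double_complex.td_hom[OF dcW])+

lemma tot_dd: "w : carrier (tot WD n) ==> tW (n + 1) (tW n w) = 0[tot WD (n + 1 + 1)]"
 using double_complex.td_td[OF dcW, of w n] by (simp add: add.assoc)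

lemma cob_Z: "coboundaries ZK dZ n = zpart n ` tW (int n) ` carrier (tot WD (int n))"
proof (cases n)
 case 0
 \<comment> \<open>The only entry in total degree 0 is a morphism on \<open>C 0\<close>, the product
   of zero and \<open>P 0\<close>, that vanishes on \<open>P 0\<close>; hence it is zero. So total
   degree 0 yields no coboundaries, in agreement with \<open>coboundaries\<close> at 0.\<close>
 have "zpart 0 (tW 0 w) = 0[ZK 0]" if w: "w : carrier (tot WD 0)" for w
 proof -
  have f: "w (0, 0) : carrier (hom_module T R (C 0) (coch G 0 M))" using wH[OF w, of 0 0] by (simp add: homD_def)
  have "w (0, 0) = 0[hom_module T R (C 0) (coch G 0 M)]" unfolding hom_module_ops
   by (rule rest_eqI[OF f, symmetric]) (use wV[OF w, of 0] in \<open>auto simp: van_def C_car Qs_simps\<close>)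
  then have w00: "w (0, 0) = 0[HD 0 0]" by (simp add: homD_def)
  have "w (i, j) : carrier (AD i j)" if "int i + int j = 0" for i j
  proof -
   have "i = 0" "j = 0" using that by simp_all
   then show ?thesis using w00 wH[OF w that] by simp
  qed
  then have "w : carrier (tot AD 0)" using w unfolding double_complex.tot_car[OF dcA] double_complex.tot_car[OF dcW] by blast
  then have "td AD hC vC 0 w : carrier (tot AD (0 + 1))" by (rule double_complex.td_closed[OF dcA])
  then have "tW 0 w : carrier (tot AD (int 0 + 1))" unfolding tdA by simp
  then show ?thesis using sub_tot(1)[of "tW 0 w" "int 0 + 1" 0] by blast
 qed
 moreover have "0[tot WD 0] : carrier (tot WD 0)" using double_complex.ab_tot[OF dcW] by (simp add: ag)
 ultimately show ?thesis using 0 by (auto simp: coboundaries_def image_iff intro!: bexI[of _ "0[tot WD 0]"])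
next
 case (Suc m)
 have "dZ m ` carrier (ZK m) = zpart (Suc m) ` tW (int m + 1) ` carrier (tot WD (int m + 1))"
 proof (intro equalityI subsetI)
  fix y assume "y : dZ m ` carrier (ZK m)"
  then obtain z w where "y = dZ m z" "w : carrier (tot WD (int m + 1))" "zpart m w = z" using zpart_surj by blast
  then have "y = zpart (Suc m) (tW (int m + 1) w)" "w : carrier (tot WD (int m + 1))" using zpart_td[of w m] by simp_all
  then show "y : zpart (Suc m) ` tW (int m + 1) ` carrier (tot WD (int m + 1))" by blast
 next
  fix y assume "y : zpart (Suc m) ` tW (int m + 1) ` carrier (tot WD (int m + 1))"
  then obtain w where "w : carrier (tot WD (int m + 1))" "y = zpart (Suc m) (tW (int m + 1) w)" by blast
  then have "y = dZ m (zpart m w)" "zpart m w : carrier (ZK m)" using zpart_td[of w m] mod_homD(1)[OF zpart_hom, of w m] by simp_all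
  then show "y : dZ m ` carrier (ZK m)" by blast
 qed
 then show ?thesis using Suc by (simp add: coboundaries_def add.commute)
qed

lemma cob_X: "td XD hX vX (int n - 1) ` carrier (tot XD (int n - 1)) = xpart (int n) ` tW (int n) ` carrier (tot WD (int n))"
proof (intro equalityI subsetI)
 have e: "int n - 1 + 1 = int n" by simp
 fix y assume "y : td XD hX vX (int n - 1) ` carrier (tot XD (int n - 1))"
 then obtain x w where "y = td XD hX vX (int n - 1) x" "w : carrier (tot WD (int n))" "xpart (int n - 1) w = x"
  using xpart_surj[of _ "int n - 1"] unfolding e by blast
 then have "y = xpart (int n) (tW (int n) w)" "w : carrier (tot WD (int n))" using xpart_td[of w "int n - 1"] unfolding e by simp_all
 then show "y : xpart (int n) ` tW (int n) ` carrier (tot WD (int n))" by blast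
next
 have e: "int n - 1 + 1 = int n" by simp
 fix y assume "y : xpart (int n) ` tW (int n) ` carrier (tot WD (int n))"
 then obtain w where "w : carrier (tot WD (int n))" "y = xpart (int n) (tW (int n) w)" by blast
 then have "y = td XD hX vX (int n - 1) (xpart (int n - 1) w)" "xpart (int n - 1) w : carrier (tot XD (int n - 1))"
  using xpart_td[of w "int n - 1"] xpart_closed[of w "int n - 1"] unfolding e by simp_all
 then show "y : td XD hX vX (int n - 1) ` carrier (tot XD (int n - 1))" by blast
qed

text \<open>\<open>acyclic_kernel\<close> for \<open>zpart\<close>, whose kernel is the acyclic
  \<open>AD\<close>; the kernel one degree higher plays the role of \<open>K2\<close>.\<close>

lemma ker_Z:
 shows "z : mod_ker (ZK n) (ZK (Suc n)) (dZ n) ==> EX w:carrier (tot WD (int n + 1)). tW (int n + 1) w = 0[tot WD (int n + 1 + 1)] & zpart n w = z"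
  "w : carrier (tot WD (int n + 1)) ==> tW (int n + 1) w = 0[tot WD (int n + 1 + 1)] ==>
   zpart n w : coboundaries ZK dZ n \<longleftrightarrow> w : tW (int n) ` carrier (tot WD (int n))"
proof -
 note m = double_complex.module_tot[OF dcW]
 have em: "int n + 1 - 1 = int n" "int n + 1 + 1 - 1 = int n + 1" by simp_all
 have Zc: "zpart n w : mod_ker (ZK n) (ZK (Suc n)) (dZ n) \<longleftrightarrow> tW (int n + 1) w : {u. zpart (Suc n) u = 0[ZK (Suc n)]}"
  if "w : carrier (tot WD (int n + 1))" for w
  using zpart_td[OF that] mod_homD(1)[OF zpart_hom that] by (simp add: mod_ker_def)
 have ac1: "EX u:carrier (tot WD (int n)). tW (int n) u = w"
  if "w : carrier (tot WD (int n + 1))" "zpart n w = 0[ZK n]" "tW (int n + 1) w = 0[tot WD (int n + 1 + 1)]" for w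
  using acyclic_A[OF zpart_zero[OF that(1,2)] that(3)] sub_tot(1) unfolding em by blast
 have ac2: "EX u:carrier (tot WD (int n + 1)). zpart n u = 0[ZK n] & tW (int n + 1) u = tW (int n + 1) w"
  if w: "w : carrier (tot WD (int n + 1))" and k: "tW (int n + 1) w : {u. zpart (Suc n) u = 0[ZK (Suc n)]}" for w
 proof -
  have tw: "tW (int n + 1) w : carrier (tot WD (int (Suc n) + 1))" using double_complex.td_closed[OF dcW w] by (simp add: add.commute)
  have "tW (int n + 1) w : carrier (tot AD (int n + 1 + 1))" using zpart_zero[OF tw] k by (simp add: add.commute)
  from acyclic_A[OF this tot_dd[OF w]] obtain u where "u : carrier (tot AD (int n + 1))" "tW (int n + 1) u = tW (int n + 1) w" unfolding em by blast
  then show ?thesis using sub_tot(1)[of u "int n + 1" n] by blast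
 qed
 have sj: "EX w:carrier (tot WD (int n + 1)). zpart n w = z" if "z : mod_ker (ZK n) (ZK (Suc n)) (dZ n)" for z
  using zpart_surj[of z n] that by (simp add: mod_ker_def)
 show "z : mod_ker (ZK n) (ZK (Suc n)) (dZ n) ==> EX w:carrier (tot WD (int n + 1)). tW (int n + 1) w = 0[tot WD (int n + 1 + 1)] & zpart n w = z"
  by (rule acyclic_kernel(1)[OF m m m module_ZK tot_hom(1) tot_hom(2) zpart_hom tot_dd sj Zc cob_Z ac1 ac2])
 show "w : carrier (tot WD (int n + 1)) ==> tW (int n + 1) w = 0[tot WD (int n + 1 + 1)] ==>
   zpart n w : coboundaries ZK dZ n \<longleftrightarrow> w : tW (int n) ` carrier (tot WD (int n))"
  by (rule acyclic_kernel(2)[OF m m m module_ZK tot_hom(1) tot_hom(2) zpart_hom tot_dd sj Zc cob_Z ac1 ac2])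
qed

lemma ker_X:
 shows "x : mod_ker (tot XD (int n)) (tot XD (int n + 1)) (td XD hX vX (int n)) ==>
   EX w:carrier (tot WD (int n + 1)). tW (int n + 1) w = 0[tot WD (int n + 1 + 1)] & xpart (int n) w = x"
  "w : carrier (tot WD (int n + 1)) ==> tW (int n + 1) w = 0[tot WD (int n + 1 + 1)] ==>
   xpart (int n) w : td XD hX vX (int n - 1) ` carrier (tot XD (int n - 1)) \<longleftrightarrow> w : tW (int n) ` carrier (tot WD (int n))"
proof -
 note m = double_complex.module_tot[OF dcW]
 have em: "int n + 1 - 1 = int n" "int n + 1 + 1 - 1 = int n + 1" by simp_all
 have Xc: "xpart (int n) w : mod_ker (tot XD (int n)) (tot XD (int n + 1)) (td XD hX vX (int n))
   \<longleftrightarrow> tW (int n + 1) w : {u. xpart (int n + 1) u = 0[tot XD (int n + 1)]}"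
  if "w : carrier (tot WD (int n + 1))" for w
  using xpart_td[OF that] xpart_closed[OF that] by (simp add: mod_ker_def)
 have ac1: "EX u:carrier (tot WD (int n)). tW (int n) u = w"
  if "w : carrier (tot WD (int n + 1))" "xpart (int n) w = 0[tot XD (int n)]" "tW (int n + 1) w = 0[tot WD (int n + 1 + 1)]" for w
  using acyclic_B[OF xpart_zero[OF that(1,2)] that(3)] sub_tot(2) unfolding em by blast
 have ac2: "EX u:carrier (tot WD (int n + 1)). xpart (int n) u = 0[tot XD (int n)] & tW (int n + 1) u = tW (int n + 1) w"
  if w: "w : carrier (tot WD (int n + 1))" and k: "tW (int n + 1) w : {u. xpart (int n + 1) u = 0[tot XD (int n + 1)]}" for w
 proof -
  have tw: "tW (int n + 1) w : carrier (tot WD (int n + 1 + 1))" by (rule double_complex.td_closed[OF dcW w])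
  have "tW (int n + 1) w : carrier (tot BD (int n + 1 + 1))" using xpart_zero[OF tw] k by simp
  from acyclic_B[OF this tot_dd[OF w]] obtain u where "u : carrier (tot BD (int n + 1))" "tW (int n + 1) u = tW (int n + 1) w" unfolding em by blast
  then show ?thesis using sub_tot(2)[of u "int n + 1"] unfolding em by blast
 qed
 have sj: "EX w:carrier (tot WD (int n + 1)). xpart (int n) w = x" if "x : mod_ker (tot XD (int n)) (tot XD (int n + 1)) (td XD hX vX (int n))" for x
  using xpart_surj[of x "int n"] that by (simp add: mod_ker_def)
 note mX = double_complex.module_tot[OF dcX]
 show "x : mod_ker (tot XD (int n)) (tot XD (int n + 1)) (td XD hX vX (int n)) ==>
   EX w:carrier (tot WD (int n + 1)). tW (int n + 1) w = 0[tot WD (int n + 1 + 1)] & xpart (int n) w = x"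
  by (rule acyclic_kernel(1)[OF m m m mX tot_hom(1) tot_hom(2) xpart_hom tot_dd sj Xc cob_X ac1 ac2])
 show "w : carrier (tot WD (int n + 1)) ==> tW (int n + 1) w = 0[tot WD (int n + 1 + 1)] ==>
   xpart (int n) w : td XD hX vX (int n - 1) ` carrier (tot XD (int n - 1)) \<longleftrightarrow> w : tW (int n) ` carrier (tot WD (int n))"
  by (rule acyclic_kernel(2)[OF m m m mX tot_hom(1) tot_hom(2) xpart_hom tot_dd sj Xc cob_X ac1 ac2])
qed

text \<open>Both projections induce isomorphisms on cohomology, so a cocycle at either end extends
  to a total cocycle, and coboundaries correspond. Together with additivity these are the hypotheses
  of \<open>subquot_iso_rel\<close>.\<close>

lemma rel_facts:
 "rel n z x ==> z : mod_ker (ZK n) (ZK (Suc n)) (dZ n) & x : mod_ker (tot XD (int n)) (tot XD (int n + 1)) (td XD hX vX (int n))"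
 "z : mod_ker (ZK n) (ZK (Suc n)) (dZ n) ==> EX x. rel n z x"
 "x : mod_ker (tot XD (int n)) (tot XD (int n + 1)) (td XD hX vX (int n)) ==> EX z. rel n z x"
 "rel n z x ==> z : coboundaries ZK dZ n \<longleftrightarrow> x : td XD hX vX (int n - 1) ` carrier (tot XD (int n - 1))"
proof -
 show "rel n z x ==> z : mod_ker (ZK n) (ZK (Suc n)) (dZ n) & x : mod_ker (tot XD (int n)) (tot XD (int n + 1)) (td XD hX vX (int n))"
 proof -
  assume "rel n z x"
  then obtain w where w: "w : carrier (tot WD (int n + 1))" "tW (int n + 1) w = 0[tot WD (int n + 1 + 1)]" "zpart n w = z" "xpart (int n) w = x"
   unfolding rel_def by blast
  have z: "z : carrier (ZK n)" "x : carrier (tot XD (int n))" using mod_homD(1)[OF zpart_hom w(1)] xpart_closed[OF w(1)] w(3,4) by simp_all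
  have e: "zpart (Suc n) 0[tot WD (int n + 1 + 1)] = 0[ZK (Suc n)]" "xpart (int n + 1) 0[tot WD (int n + 1 + 1)] = 0[tot XD (int n + 1)]"
   using mod_hom_zero[OF zpart_hom[of "Suc n"] double_complex.ab_tot[OF dcW] module_ag[OF module_ZK]]
    mod_hom_zero[OF xpart_hom[of "int n + 1"] double_complex.ab_tot[OF dcW] double_complex.ab_tot[OF dcX]]
   by (simp_all add: add.commute)
  show ?thesis using z e zpart_td[OF w(1)] xpart_td[OF w(1)] w by (simp add: mod_ker_def)
 qed
 show "z : mod_ker (ZK n) (ZK (Suc n)) (dZ n) ==> EX x. rel n z x" using ker_Z(1) unfolding rel_def by blast
 show "x : mod_ker (tot XD (int n)) (tot XD (int n + 1)) (td XD hX vX (int n)) ==> EX z. rel n z x" using ker_X(1) unfolding rel_def by blast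
 show "rel n z x ==> z : coboundaries ZK dZ n \<longleftrightarrow> x : td XD hX vX (int n - 1) ` carrier (tot XD (int n - 1))"
  using ker_Z(2) ker_X(2) unfolding rel_def by blast
qed

end

section \<open>Transporter and fusion categories\<close>

context graded_cat
begin

text \<open>A family is a single morphism into \<open>coch G 1 B\<close>. Function values can be
  lifted one at a time, so \<open>coch G 1\<close> preserves the required surjectivity and ordinary
  lifting applies.\<close>

lemma projective_G_lifting:
 fixes Q :: "('o, 'g, 'r, ('o, 'g, 'r, 'n) res_univ) rcmod"
 assumes Q: "projective T R Q"
 shows "G_lifting G T R Q TYPE('c)"
 unfolding G_lifting_def
proof (intro allI impI)
 fix A B :: "('o, 'g, 'r, 'c) rcmod" and e f
 assume A: "left_module T R A" and B: "left_module T R B" and e: "e : rc_hom T R A B" and f: "f : rc_hom T R Q (coch G 1 B)"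
  and im: "ALL x:Obj T. ALL a:el Q x. ALL l:tuples G 1. f x a l : e x ` el A x"
 have "EX g:rc_hom T R Q (coch G 1 A). ALL x:Obj T. ALL a:el Q x. (\<lambda>l\<in>tuples G 1. e x (g x a l)) = f x a"
 proof (rule projective_lift[OF T R Q left_module_coch[OF A] left_module_coch[OF B] coch_map_hom[OF A B e] f])
  fix x a assume x: "x : Obj T" and a: "a : el Q x"
  let ?\<alpha> = "%l. inv_into (el A x) (e x) (f x a l)"
  have \<alpha>: "?\<alpha> l : el A x" "e x (?\<alpha> l) = f x a l" if "l : tuples G 1" for l
   using im x a that by (simp_all add: inv_into_into f_inv_into_f)
  note fx = rc_homD(3)[OF f x a]
  show "f x a : (%\<phi>. \<lambda>l\<in>tuples G 1. e x (\<phi> l)) ` el (coch G 1 A) x"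
  proof (rule image_eqI)
   show "(\<lambda>l\<in>tuples G 1. ?\<alpha> l) : el (coch G 1 A) x" by (rule coch_restrict) (rule \<alpha>(1))
   show "f x a = (\<lambda>l\<in>tuples G 1. e x ((\<lambda>l\<in>tuples G 1. ?\<alpha> l) l))"
    using fx[unfolded coch_car] \<alpha>(2) by (intro restrict_eqI[symmetric]) simp_all
  qed
 qed
 then obtain g where g: "g : rc_hom T R Q (coch G 1 A)"
  and eq: "!!x a. x : Obj T ==> a : el Q x ==> (\<lambda>l\<in>tuples G 1. e x (g x a l)) = f x a" by blast
 have "e x (g x a l) = f x a l" if "x : Obj T" "a : el Q x" "l : tuples G 1" for x a l
  using fun_cong[OF eq[OF that(1,2)], of l] that(3) by simp
 then show "EX g:rc_hom T R Q (coch G 1 A). ALL x:Obj T. ALL a:el Q x. ALL l:tuples G 1. e x (g x a l) = f x a l"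
  using g by blast
qed

text \<open>Projectivity turns exactness of the cochains at each object into exactness for
  morphisms; this supplies \<open>col_Q\<close>.\<close>

lemma projective_column:
 fixes Q :: "('o, 'g, 'r, ('o, 'g, 'r, 'n) res_univ) rcmod"
 assumes Q: "projective T R Q" and M: "left_module T R M" and f: "f : rc_hom T R Q (coch G (Suc k) M)"
  and z: "!!x a. x : Obj T ==> a : el Q x ==> cdiff G (Suc k) M x (f x a) = 0[mod_at (coch G (Suc (Suc k)) M) x]"
 shows "EX g:rc_hom T R Q (coch G k M). ALL x:Obj T. ALL a:el Q x. cdiff G k M x (g x a) = f x a"
proof (rule projective_lift[OF T R Q left_module_coch[OF M] left_module_coch[OF M] cdiff_hom[OF M] f])
 fix x a assume x: "x : Obj T" and a: "a : el Q x"
 show "f x a : cdiff G k M x ` el (coch G k M) x"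
  by (rule cdiff_exact(2)[OF M x rc_homD(3)[OF f x a] z[OF x a] refl])
qed

lemma tuples_1: "l : tuples G 1 \<longleftrightarrow> (EX h:carrier G. l = [h])"
 by (auto simp: tuples_def length_Suc_conv)

text \<open>An equivariant function on \<open>G\<close> is determined by its values on representatives of the
 right cosets of \<open>S\<close>, where they may be lifted arbitrarily.\<close>

lemma invariant_lift:
 assumes A: "left_module T R A" and B: "left_module T R B" and e: "e : rc_hom T R A B" and x: "x : Obj T"
  and S: "subgroup S G" "S <= Hom T x x"
  and \<phi>: "\<phi> : el (coch G 1 B) x" and fixed: "!!c. c : S ==> mod_map (coch G 1 B) x x c \<phi> = \<phi>"
  and im: "!!l. l : tuples G 1 ==> \<phi> l : e x ` el A x"
 shows "EX \<psi>:el (coch G 1 A) x. (ALL c:S. mod_map (coch G 1 A) x x c \<psi> = \<psi>) & (ALL l:tuples G 1. e x (\<psi> l) = \<phi> l)"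
proof -
 \<comment> \<open>\<open>\<rho>\<close> depends only on the coset \<open>S #> h\<close>, and
   \<open>h\<close> is \<open>s h\<close> times \<open>\<rho> h\<close> with \<open>s h\<close> in
   \<open>S\<close>. Preimages \<open>\<alpha>\<close> are chosen at the representatives and spread
   by the action of \<open>s h\<close>.\<close>
 define \<rho> where "\<rho> h = (SOME k. k : S #> h)" for h
 define s where "s h = h \<otimes> inv (\<rho> h)" for h
 define \<alpha> where "\<alpha> h = inv_into (el A x) (e x) (\<phi> [h])" for h
 define \<psi> where "\<psi> = (\<lambda>l\<in>tuples G 1. mod_map A x x (s (hd l)) (\<alpha> (\<rho> (hd l))))"
 have Sc: "c : carrier G" if "c : S" for c using that subgroup.mem_carrier[OF S(1)] by blast
 have \<rho>0: "\<rho> h : S #> h" if "h : carrier G" for h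
  unfolding \<rho>_def using rcos_self[OF that S(1)] by (rule someI)
 have \<rho>: "\<rho> h : carrier G" "s h : S" "inv (s h) \<otimes> h = \<rho> h" if h: "h : carrier G" for h
 proof -
  obtain t where t: "t : S" "\<rho> h = t \<otimes> h" using \<rho>0[OF h] by (auto simp: r_coset_def)
  have st: "s h = inv t" using t Sc[OF t(1)] h by (simp add: s_def inv_mult_group m_assoc[symmetric])
  show "\<rho> h : carrier G" "s h : S" "inv (s h) \<otimes> h = \<rho> h"
   unfolding st using t Sc[OF t(1)] h subgroup.m_inv_closed[OF S(1) t(1)] by simp_all
 qed
 have \<rho>c: "\<rho> (c \<otimes> h) = \<rho> h" if "c : S" "h : carrier G" for c h
 proof -
  have "S #> (c \<otimes> h) = S #> h"
   using coset_mult_assoc[OF subgroup.subset[OF S(1)] Sc[OF that(1)] that(2)] coset_join2[OF Sc[OF that(1)] S(1) that(1)] by simp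
  then show ?thesis by (simp add: \<rho>_def)
 qed
 have \<alpha>: "\<alpha> h : el A x" "e x (\<alpha> h) = \<phi> [h]" if "h : carrier G" for h
  using im[of "[h]"] that by (simp_all add: \<alpha>_def tuples_1[simplified] inv_into_into f_inv_into_f)
 have \<psi>h: "\<psi> [h] = mod_map A x x (s h) (\<alpha> (\<rho> h))" if "h : carrier G" for h
  using that tuples_1[of "[h]"] by (simp add: \<psi>_def)
 have ac: "mod_map A x x (s h) (\<alpha> (\<rho> h)) : el A x" if h: "h : carrier G" for h
  using left_moduleD(6)[OF A x x _ \<alpha>(1)[OF \<rho>(1)[OF h]]] \<rho>(2)[OF h] S(2) by blast
 have \<psi>: "\<psi> : el (coch G 1 A) x"
  unfolding \<psi>_def by (rule coch_restrict) (use ac tuples_1 in auto)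
 moreover have "e x (\<psi> l) = \<phi> l" if l: "l : tuples G 1" for l
 proof -
  obtain h where h: "h : carrier G" "l = [h]" using l tuples_1 by blast
  have sH: "s h : Hom T x x" using \<rho>(2)[OF h(1)] S(2) by blast
  have "e x (\<psi> l) = mod_map B x x (s h) (\<phi> [\<rho> h])"
   unfolding h(2) \<psi>h[OF h(1)] rc_homD(2)[OF e x x sH \<alpha>(1)[OF \<rho>(1)[OF h(1)]]] \<alpha>(2)[OF \<rho>(1)[OF h(1)]] ..
  also have "\<dots> = mod_map (coch G 1 B) x x (s h) \<phi> l"
   unfolding coch_map using l h by (simp add: shift_def \<rho>(3))
  also have "\<dots> = \<phi> l" by (simp only: fixed[OF \<rho>(2)[OF h(1)]])
  finally show ?thesis .
 qed
 moreover have "mod_map (coch G 1 A) x x c \<psi> = \<psi>" if c: "c : S" for c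
  unfolding coch_map
 proof (rule restrict_eqI)
  show "\<psi> : extensional (tuples G 1)" by (simp add: \<psi>_def)
  fix l assume l: "l : tuples G 1"
  obtain h where h: "h : carrier G" "l = [h]" using l tuples_1 by blast
  have ic: "inv c : S" "inv c \<otimes> h : carrier G" using subgroup.m_inv_closed[OF S(1) c] Sc[OF c] h by simp_all
  \<comment> \<open>Left translation by \<open>S\<close> does not move the representative, so
    \<open>s\<close> absorbs it; this makes \<open>\<psi>\<close> invariant.\<close>
  have sh: "s (inv c \<otimes> h) = inv c \<otimes> s h" using h(1) Sc[OF c] \<rho>(1)[OF h(1)] by (simp add: s_def \<rho>c[OF ic(1) h(1)] m_assoc)
  have H: "inv c \<otimes> s h : Hom T x x" "c : Hom T x x" using subgroup.m_closed[OF S(1) ic(1) \<rho>(2)[OF h(1)]] c S(2) by blast+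
  have "c \<otimes> (inv c \<otimes> s h) = s h" using Sc[OF c] Sc[OF \<rho>(2)[OF h(1)]] by (simp add: m_assoc[symmetric])
  then have "mod_map A x x c (mod_map A x x (inv c \<otimes> s h) (\<alpha> (\<rho> h))) = mod_map A x x (s h) (\<alpha> (\<rho> h))"
   using left_moduleD(4)[OF A x x x H \<alpha>(1)[OF \<rho>(1)[OF h(1)]]] Comp_T[OF x x x H] by simp
  then show "mod_map A x x c (\<psi> (shift G c l)) = \<psi> l"
   using h ic by (simp add: shift_def \<psi>h sh \<rho>c)
 qed
 ultimately show ?thesis by blast
qed

end

section \<open>Pullback to the transporter category and centralizer invariants\<close>

definition pull_left :: "('g, 't) monoid_scheme => ('g set, 'g set, 'r, 'a) rcmod => ('g set, 'g, 'r, 'a) rcmod" where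
 "pull_left G P = (|mod_at = mod_at P, mod_map = (%H K g. mod_map P H K (g <#\<^bsub>G\<^esub> centralizer G H))|)"

text \<open>The right adjoint of \<open>pull_left\<close>. A coset acts through an arbitrary
  representative; on invariants the choice does not matter.\<close>

definition inv_left :: "('g, 't) monoid_scheme => ('g set, 'g, 'r, 'a) rcmod => ('g set, 'g set, 'r, 'a) rcmod" where
 "inv_left G N = (|mod_at = (%H. (mod_at N H)(|carrier := {n : el N H. ALL c:centralizer G H. mod_map N H H c n = n}|)),
   mod_map = (%H K X. mod_map N H K (SOME g. g : X))|)"

lemma pull_left_simps [simp]: "mod_at (pull_left G P) = mod_at P"
 "mod_map (pull_left G P) H K g = mod_map P H K (g <#\<^bsub>G\<^esub> centralizer G H)"
 by (simp_all add: pull_left_def)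

lemma pull_left_constant: "pull_left G (constant_module R) = constant_module R"
 by (simp add: pull_left_def constant_module_def)

lemma inv_left_simps [simp]:
 "n : el (inv_left G N) H \<longleftrightarrow> n : el N H & (ALL c:centralizer G H. mod_map N H H c n = n)"
 "0[mod_at (inv_left G N) H] = 0[mod_at N H]" "add (mod_at (inv_left G N) H) = add (mod_at N H)"
 "smult (mod_at (inv_left G N) H) = smult (mod_at N H)"
 by (simp_all add: inv_left_def)

locale transporter_data = group G for G :: "('g, 't) monoid_scheme" (structure) +
 fixes R :: "('r, 's) ring_scheme" and \<H> :: "'g set set" and M :: "('g set, 'g, 'r, 'a) rcmod"
 assumes R: "cring R" and ccc: "conj_closed_collection G \<H>" and M: "left_module (transporter_category G \<H>) R M"
begin

abbreviation "T \<equiv> transporter_category G \<H>"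
abbreviation "F \<equiv> fusion_category G \<H>"
abbreviation "cz \<equiv> centralizer G"
abbreviation "D H \<equiv> delooping (centralizer_group G H)"

lemma sub: "H : \<H> ==> subgroup H G"
 using ccc by (simp add: conj_closed_collection_def)

lemma T_simps [simp]: "Obj T = \<H>" "Hom T = transporter_set G" "Id T H = \<one>" "Comp T g f = g \<otimes> f"
 by (simp_all add: transporter_category_def)

lemma F_simps [simp]: "Obj F = \<H>" "Hom F H K = (%g. g <# cz H) ` transporter_set G H K" "Id F = cz" "Comp F X Y = X <#> Y"
 by (simp_all add: fusion_category_def)

lemma D_simps [simp]: "Obj (D H) = UNIV" "Hom (D H) x y = cz H" "Id (D H) x = \<one>" "Comp (D H) g f = g \<otimes> f"
 by (simp_all add: delooping_def)

lemma catT: "category T" and catF: "category F"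
 using category_transporter category_fusion ccc is_group by blast+

lemma gT: "graded_cat G R T"
proof (rule graded_cat.intro[OF is_group graded_cat_axioms.intro])
 show "Comp T g f = g \<otimes> f" for f g by simp
qed (auto simp: R catT transporter_set_def)

lemma czH: "H : \<H> ==> subgroup (cz H) G"
 using subgroup_centralizer[OF is_group] sub subgroup.subset by blast

lemma cz_carrier: "c : cz H ==> c : carrier G"
 by (simp add: centralizer_def)

lemma cz_Hom: "H : \<H> ==> c : cz H ==> c : transporter_set G H H"
proof (rule transporter_setI)
 fix h assume "H : \<H>" "c : cz H" "h : H"
 then have "c \<otimes> h = h \<otimes> c" "c : carrier G" "h : carrier G" using subgroup.mem_carrier[OF sub] by (auto simp: centralizer_def)
 then show "c \<otimes> h \<otimes> inv c : H" using \<open>h \<in> H\<close> by (simp add: m_assoc)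
qed (simp add: cz_carrier)

lemma one_coset: "\<one> <# cz H = cz H"
 using cz_carrier by (force simp: l_coset_def)

lemma trans_carrier: "g : transporter_set G H K ==> g : carrier G"
 by (simp add: transporter_set_def)

lemma coset_cz:
 assumes "H : \<H>" "g : carrier G" "c : cz H"
 shows "(g \<otimes> c) <# cz H = g <# cz H"
 using lcos_m_assoc[OF subgroup.subset[OF czH[OF assms(1)]] assms(2) cz_carrier[OF assms(3)]]
  coset_join3[OF cz_carrier[OF assms(3)] czH[OF assms(1)] assms(3)] by simp

lemma some_coset:
 assumes "H : \<H>" "g : carrier G"
 obtains c where "c : cz H" "(SOME k. k : g <# cz H) = g \<otimes> c"
proof -
 have "g : g <# cz H" using subgroup.one_closed[OF czH[OF assms(1)]] assms(2) unfolding l_coset_def by force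
 then have "(SOME k. k : g <# cz H) : g <# cz H" by (rule someI)
 then show thesis using that by (auto simp: l_coset_def)
qed

lemma left_module_pull:
 assumes P: "left_module F R P"
 shows "left_module T R (pull_left G P)"
proof (rule left_moduleI)
 fix H a assume "H : Obj T" "a : el (pull_left G P) H"
 then show "mod_map (pull_left G P) H H (Id T H) a = a"
  using left_moduleD(3)[OF P, of H a] by (simp add: one_coset)
next
 fix H K L f g a assume a: "H : Obj T" "K : Obj T" "L : Obj T" "f : Hom T H K" "g : Hom T K L" "a : el (pull_left G P) H"
 have "(g <# cz K) <#> (f <# cz H) = (g \<otimes> f) <# cz H"
  using a by (intro centralizer_coset_mult[OF is_group sub sub]) (simp_all add: trans_carrier)
 then show "mod_map (pull_left G P) H L (Comp T g f) a = mod_map (pull_left G P) K L g (mod_map (pull_left G P) H K f a)"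
  using left_moduleD(4)[OF P, of H K L "f <# cz H" "g <# cz K" a] a by simp
qed (use left_moduleD(1,2)[OF P] in simp_all)

lemma pull_hom: "e : rc_hom F R P P' ==> e : rc_hom T R (pull_left G P) (pull_left G P')"
 by (rule rc_homI) (simp_all add: rc_homD(1,2))

text \<open>Representatives of a coset differ by an element of \<open>C_G(H)\<close>, which fixes
  \<open>n\<close>. The image is fixed by \<open>d\<close> in \<open>C_G(K)\<close> because
  \<open>d g = g (g^-1 d g)\<close> and conjugation takes \<open>d\<close> into
  \<open>C_G(H)\<close>.\<close>

lemma inv_left_map:
 assumes N: "left_module T R N" and HK: "H : \<H>" "K : \<H>" and g: "g : transporter_set G H K"
  and n: "n : el (inv_left G N) H"
 shows "mod_map (inv_left G N) H K (g <# cz H) n = mod_map N H K g n"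
  "mod_map N H K g n : el (inv_left G N) K"
proof -
 obtain c where c: "c : cz H" "(SOME k. k : g <# cz H) = g \<otimes> c" using some_coset[OF HK(1) trans_carrier[OF g]] .
 have nc: "n : el N H" using n by simp
 show "mod_map (inv_left G N) H K (g <# cz H) n = mod_map N H K g n"
  using left_moduleD(4)[OF N, of H H K c g n] HK cz_Hom[OF HK(1) c(1)] g n c by (simp add: inv_left_def)
 have "mod_map N K K d (mod_map N H K g n) = mod_map N H K g n" if d: "d : cz K" for d
 proof -
  let ?d = "inv g \<otimes> d \<otimes> g"
  have d': "?d : cz H" by (rule conj_centralizer[OF is_group sub[OF HK(1)] g d])
  have "d \<otimes> g = g \<otimes> ?d" using trans_carrier[OF g] cz_carrier[OF d] by (simp add: m_assoc[symmetric])
  then have "mod_map N K K d (mod_map N H K g n) = mod_map N H K (g \<otimes> ?d) n"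
   using left_moduleD(4)[OF N, of H K K g d n] HK cz_Hom[OF HK(2) d] g nc by simp
  also have "\<dots> = mod_map N H K g (mod_map N H H ?d n)"
   using left_moduleD(4)[OF N, of H H K ?d g n] HK cz_Hom[OF HK(1) d'] g nc by simp
  finally show ?thesis using n d' by simp
 qed
 then show "mod_map N H K g n : el (inv_left G N) K"
  using left_moduleD(6)[OF N, of H K g n] HK g nc by simp
qed

lemma inv_left_submodule:
 assumes N: "left_module T R N" and H: "H : \<H>"
 shows "submodule {n : el N H. ALL c:cz H. mod_map N H H c n = n} R (mod_at N H)"
proof -
 have Hm: "module R (mod_at N H)" using left_moduleD(1)[OF N] H by simp
 have m: "mod_map N H H c : mod_hom R (mod_at N H) (mod_at N H)" if "c : cz H" for c
  using left_moduleD(2)[OF N] H cz_Hom[OF H that] by simp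
 show ?thesis
  using mod_homD(2,3)[OF m] mod_hom_zero[OF m] module_ag[OF Hm]
  by (intro submodI[OF Hm]) (auto simp: ag module.smult_closed[OF Hm])
qed

lemma left_module_inv:
 assumes N: "left_module T R N"
 shows "left_module F R (inv_left G N)"
proof (rule left_moduleI)
 show "module R (mod_at (inv_left G N) H)" if "H : Obj F" for H
  using module_restrict[OF inv_left_submodule[OF N] left_moduleD(1)[OF N]] that by (simp add: inv_left_def)
 show "mod_map (inv_left G N) H K X : mod_hom R (mod_at (inv_left G N) H) (mod_at (inv_left G N) K)"
  if HK: "H : Obj F" "K : Obj F" "X : Hom F H K" for H K X
 proof -
  obtain g where g: "g : transporter_set G H K" "X = g <# cz H" using HK by auto
  have HK': "H : \<H>" "K : \<H>" using HK by simp_all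
  have gm: "mod_map N H K g : mod_hom R (mod_at N H) (mod_at N K)" using left_moduleD(2)[OF N] HK g by simp
  note im = inv_left_map[OF N HK' g(1)]
  have Hm: "module R (mod_at (inv_left G N) H)"
   using module_restrict[OF inv_left_submodule[OF N HK'(1)] left_moduleD(1)[OF N]] HK' by (simp add: inv_left_def)
  show ?thesis unfolding g(2)
  proof (rule mod_homI)
   fix n assume n: "n : el (inv_left G N) H"
   show "mod_map (inv_left G N) H K (g <# cz H) n : el (inv_left G N) K" unfolding im(1)[OF n] by (rule im(2)[OF n])
   show "mod_map (inv_left G N) H K (g <# cz H) (n +[mod_at (inv_left G N) H] n')
     = mod_map (inv_left G N) H K (g <# cz H) n +[mod_at (inv_left G N) K] mod_map (inv_left G N) H K (g <# cz H) n'"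
    if n': "n' : el (inv_left G N) H" for n'
    unfolding im(1)[OF n] im(1)[OF n'] im(1)[OF abelian_group.ag_rules(1)[OF module_ag[OF Hm] n n']]
    using mod_homD(2)[OF gm] n n' by simp
   show "mod_map (inv_left G N) H K (g <# cz H) (r *[mod_at (inv_left G N) H] n)
     = r *[mod_at (inv_left G N) K] mod_map (inv_left G N) H K (g <# cz H) n" if r: "r : carrier R" for r
    unfolding im(1)[OF n] im(1)[OF module.smult_closed[OF Hm r n]] using mod_homD(3)[OF gm r] n by simp
  qed
 qed
 fix H a assume H: "H : Obj F" and a: "a : el (inv_left G N) H"
 show "mod_map (inv_left G N) H H (Id F H) a = a"
  using inv_left_map(1)[OF N _ _ one_in_transporter_set[OF is_group sub] a] left_moduleD(3)[OF N, of H a] H a by (simp add: one_coset)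
next
 fix H K L X Y a assume HK: "H : Obj F" "K : Obj F" "L : Obj F" and X: "X : Hom F H K" and Y: "Y : Hom F K L"
  and a: "a : el (inv_left G N) H"
 obtain f g where f: "f : transporter_set G H K" "X = f <# cz H" and g: "g : transporter_set G K L" "Y = g <# cz K" using X Y by auto
 have HK': "H : \<H>" "K : \<H>" "L : \<H>" using HK by simp_all
 have "(g <# cz K) <#> (f <# cz H) = (g \<otimes> f) <# cz H"
  by (rule centralizer_coset_mult[OF is_group sub[OF HK'(1)] sub[OF HK'(2)] f(1) trans_carrier[OF g(1)]])
 moreover have gf: "g \<otimes> f : transporter_set G H L" by (rule transporter_set_mult[OF is_group sub[OF HK'(1)] sub[OF HK'(2)] f(1) g(1)])
 ultimately show "mod_map (inv_left G N) H L (Comp F Y X) a = mod_map (inv_left G N) K L Y (mod_map (inv_left G N) H K X a)"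
  using left_moduleD(4)[OF N, of H K L f g a] HK' f g a
  by (simp add: inv_left_map(1)[OF N HK'(1,3) gf a] inv_left_map(1)[OF N HK'(1,2) f(1) a]
    inv_left_map(1)[OF N HK'(2,3) g(1) inv_left_map(2)[OF N HK'(1,2) f(1) a]] del: inv_left_simps(1)) simp
qed

text \<open>Adjunction of pullback and invariants, with unchanged components: centralizers act
  trivially on a pulled back module, so every morphism out of it has invariant values.\<close>

lemma hom_pull_iff:
 assumes P: "left_module F R P" and N: "left_module T R N"
 shows "f : rc_hom T R (pull_left G P) N \<longleftrightarrow> f : rc_hom F R P (inv_left G N)"
proof
 assume f: "f : rc_hom T R (pull_left G P) N"
 have c: "f H a : el (inv_left G N) H" if H: "H : \<H>" and a: "a : el P H" for H a
 proof -
  have "mod_map N H H c (f H a) = f H a" if c: "c : cz H" for c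
   using rc_homD(2)[OF f, of H H c a] H a cz_Hom[OF H c] coset_cz[OF H one_closed c] cz_carrier[OF c]
    left_moduleD(3)[OF P, of H a] by (simp add: one_coset)
  then show ?thesis using rc_homD(3)[OF f, of H a] H a by simp
 qed
 show "f : rc_hom F R P (inv_left G N)"
 proof (rule rc_homI)
  fix H assume H: "H : Obj F"
  show "f H : mod_hom R (mod_at P H) (mod_at (inv_left G N) H)"
   using mod_homD(2,3)[OF rc_homD(1)[OF f]] c H by (intro mod_homI) (simp_all del: inv_left_simps(1))
 next
  fix H K X a assume HK: "H : Obj F" "K : Obj F" "X : Hom F H K" and a: "a : el P H"
  obtain g where g: "g : transporter_set G H K" "X = g <# cz H" using HK by auto
  show "f K (mod_map P H K X a) = mod_map (inv_left G N) H K X (f H a)"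
   using rc_homD(2)[OF f, of H K g a] inv_left_map(1)[OF N _ _ g(1) c[OF _ a]] HK g a by simp
 qed
next
 assume f: "f : rc_hom F R P (inv_left G N)"
 show "f : rc_hom T R (pull_left G P) N"
 proof (rule rc_homI)
  fix H assume H: "H : Obj T"
  then show "f H : mod_hom R (mod_at (pull_left G P) H) (mod_at N H)"
   using mod_homD[OF rc_homD(1)[OF f]] by (intro mod_homI) simp_all
 next
  fix H K g a assume HK: "H : Obj T" "K : Obj T" "g : Hom T H K" and a: "a : el (pull_left G P) H"
  have HK': "H : \<H>" "K : \<H>" "g : transporter_set G H K" "a : el P H" using HK a by simp_all
  have "f H a : el (inv_left G N) H" using rc_homD(3)[OF f] HK' by simp
  from inv_left_map(1)[OF N HK'(1-3) this]
  show "f K (mod_map (pull_left G P) H K g a) = mod_map N H K g (f H a)"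
   using rc_homD(2)[OF f, of H K "g <# cz H" a] HK' by simp
 qed
qed

lemma inv_left_hom:
 assumes N: "left_module T R N" and N': "left_module T R N'" and e: "e : rc_hom T R N N'"
 shows "e : rc_hom F R (inv_left G N) (inv_left G N')"
proof -
 have "e : rc_hom T R (pull_left G (inv_left G N)) N'"
 proof (rule rc_homI)
  fix H assume H: "H : Obj T"
  show "e H : mod_hom R (mod_at (pull_left G (inv_left G N)) H) (mod_at N' H)"
   using mod_homD[OF rc_homD(1)[OF e H]] by (intro mod_homI) simp_all
 next
  fix H K g a assume HK: "H : Obj T" "K : Obj T" "g : Hom T H K" and a: "a : el (pull_left G (inv_left G N)) H"
  have a': "a : el (inv_left G N) H" "a : el N H" using a by simp_all
  show "e K (mod_map (pull_left G (inv_left G N)) H K g a) = mod_map N' H K g (e H a)"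
   using inv_left_map(1)[OF N _ _ _ a'(1)] rc_homD(2)[OF e HK a'(2)] HK by simp
 qed
 then show ?thesis unfolding hom_pull_iff[OF left_module_inv[OF N] N'] .
qed

text \<open>By adjunction the family is a morphism over the fusion category into invariant functions
  on \<open>G\<close>. An invariant function with liftable values has an invariant lift by
  \<open>invariant_lift\<close>, so projectivity of \<open>P\<close> over the fusion category
  applies.\<close>

lemma pull_lifting:
 fixes P :: "('g set, 'g set, 'r, ('g set, 'g set, 'r, 'n) res_univ) rcmod"
 assumes P: "projective F R P"
 shows "G_lifting G T R (pull_left G P) TYPE('c)"
 unfolding G_lifting_def
proof (intro allI impI)
 have Pm: "left_module F R P" using P by (simp add: projective_def)
 fix A B :: "('g set, 'g, 'r, 'c) rcmod" and e f
 assume A: "left_module T R A" and B: "left_module T R B" and e: "e : rc_hom T R A B" and f: "f : rc_hom T R (pull_left G P) (coch G 1 B)"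
  and im: "ALL x:Obj T. ALL a:el (pull_left G P) x. ALL l:tuples G 1. f x a l : e x ` el A x"
 note cA = graded_cat.left_module_coch[OF gT A, of 1] and cB = graded_cat.left_module_coch[OF gT B, of 1]
 note ce = graded_cat.coch_map_hom[OF gT A B e, of 1]
 note fi = f[unfolded hom_pull_iff[OF Pm cB]]
 have "EX g:rc_hom F R P (inv_left G (coch G 1 A)). ALL x:Obj F. ALL a:el P x. (\<lambda>l\<in>tuples G 1. e x (g x a l)) = f x a"
 proof (rule projective_lift[OF catF R P left_module_inv[OF cA] left_module_inv[OF cB] inv_left_hom[OF cA cB ce] fi])
  fix x a assume x: "x : Obj F" and a: "a : el P x"
  have x': "x : \<H>" "x : Obj T" using x by simp_all
  have S: "cz x <= Hom T x x" using cz_Hom[OF x'(1)] by auto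
  have fx: "f x a : el (coch G 1 B) x" "!!c. c : cz x ==> mod_map (coch G 1 B) x x c (f x a) = f x a"
   using rc_homD(3)[OF fi x a] by simp_all
  have imx: "f x a l : e x ` el A x" if "l : tuples G 1" for l using im x' a that by simp
  obtain \<psi> where p: "\<psi> : el (coch G 1 A) x" "!!c. c : cz x ==> mod_map (coch G 1 A) x x c \<psi> = \<psi>" "!!l. l : tuples G 1 ==> e x (\<psi> l) = f x a l"
   using graded_cat.invariant_lift[OF gT A B e x'(2) czH[OF x'(1)] S fx imx] by blast
  show "f x a : (%\<phi>. \<lambda>l\<in>tuples G 1. e x (\<phi> l)) ` el (inv_left G (coch G 1 A)) x"
  proof (rule image_eqI)
   show "\<psi> : el (inv_left G (coch G 1 A)) x" using p(1,2) by simp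
   show "f x a = (\<lambda>l\<in>tuples G 1. e x (\<psi> l))"
    using fx(1)[unfolded graded_cat.coch_car[OF gT]] p(3) by (intro restrict_eqI[symmetric]) simp_all
  qed
 qed
 then obtain g where g: "g : rc_hom F R P (inv_left G (coch G 1 A))"
  and eq: "!!x a. x : \<H> ==> a : el P x ==> (\<lambda>l\<in>tuples G 1. e x (g x a l)) = f x a" by auto
 have "e x (g x a l) = f x a l" if "x : \<H>" "a : el P x" "l : tuples G 1" for x a l
  using fun_cong[OF eq[OF that(1,2)], of l] that(3) by simp
 then show "EX g:rc_hom T R (pull_left G P) (coch G 1 A). ALL x:Obj T. ALL a:el (pull_left G P) x. ALL l:tuples G 1. e x (g x a l) = f x a l"
  using g[folded hom_pull_iff[OF Pm cA]] by (intro bexI[of _ g]) simp_all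
qed

lemma gD:
 assumes H: "H : \<H>"
 shows "graded_cat G R (D H)"
proof (rule graded_cat.intro[OF is_group graded_cat_axioms.intro])
 show "category (D H)" unfolding category_def
  using subgroup.one_closed[OF czH[OF H]] subgroup.m_closed[OF czH[OF H]] cz_carrier by (auto simp: m_assoc)
 show "f : carrier G" if "f : Hom (D H) x y" for x y f using that cz_carrier by simp
qed (simp_all add: R)

text \<open>A morphism out of the constant module is the invariant element to which \<open>1\<close>
  goes, and \<open>invariant_lift\<close> with \<open>S = C_G(H)\<close> lifts it. So the constant
  module is admissible as its own resolution in the cone argument, even where it is not
  projective.\<close>

lemma constant_lifting:
 assumes H: "H : \<H>"
 shows "G_lifting G (D H) R (constant_module R) TYPE('c)"
 unfolding G_lifting_def
proof (intro allI impI)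
 interpret g: graded_cat G R "D H" by (rule gD[OF H])
 let ?R = "constant_module R :: (unit, 'g, 'r, 'r) rcmod"
 fix A B :: "(unit, 'g, 'r, 'c) rcmod" and e f
 assume A: "left_module (D H) R A" and B: "left_module (D H) R B" and e: "e : rc_hom (D H) R A B" and f: "f : rc_hom (D H) R ?R (coch G 1 B)"
  and im: "ALL x:Obj (D H). ALL a:el ?R x. ALL l:tuples G 1. f x a l : e x ` el A x"
 have o: "1[R] : el ?R ()" using cring.cring_simprules(6)[OF R] by (simp add: constant_module_def)
 have S: "cz H <= Hom (D H) () ()" "() : Obj (D H)" by simp_all
 have fx: "mod_map (coch G 1 B) () () c (f () 1[R]) = f () 1[R]" if "c : cz H" for c
  using rc_homD(2)[OF f, of "()" "()" c "1[R]"] o that by (simp add: constant_module_def)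
 have imx: "f () 1[R] l : e () ` el A ()" if "l : tuples G 1" for l using im o that by simp
 obtain \<psi> where p: "\<psi> : el (coch G 1 A) ()" "!!c. c : cz H ==> mod_map (coch G 1 A) () () c \<psi> = \<psi>"
  "!!l. l : tuples G 1 ==> e () (\<psi> l) = f () 1[R] l"
  using g.invariant_lift[OF A B e S(2) czH[OF H] S(1) rc_homD(3)[OF f S(2) o] fx imx] by blast
 note cA = g.left_module_coch[OF A, of 1]
 have mA: "module R (mod_at (coch G 1 A) ())" using left_moduleD(1)[OF cA S(2)] .
 let ?g = "%x a. a *[mod_at (coch G 1 A) ()] \<psi>"
 have g: "?g : rc_hom (D H) R ?R (coch G 1 A)"
 proof (rule rc_homI)
  fix x assume "x : Obj (D H)"
  show "?g x : mod_hom R (mod_at ?R x) (mod_at (coch G 1 A) x)"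
   using p(1) mA by (intro mod_homI) (simp_all add: constant_module_def module.smult_closed module.smult_l_distr module.smult_assoc1)
 next
  fix x y c a assume xy: "x : Obj (D H)" "y : Obj (D H)" "c : Hom (D H) x y" and a: "a : el ?R x"
  have "mod_map (coch G 1 A) () () c (a *[mod_at (coch G 1 A) ()] \<psi>) = a *[mod_at (coch G 1 A) ()] mod_map (coch G 1 A) () () c \<psi>"
   using mod_homD(3)[OF left_moduleD(2)[OF cA, of "()" "()" c]] xy a p(1) by (simp add: constant_module_def)
  then show "?g y (mod_map ?R x y c a) = mod_map (coch G 1 A) x y c (?g x a)"
   using p(2) xy by (simp add: constant_module_def)
 qed
 have "e x (?g x a l) = f x a l" if a: "a : carrier R" and l: "l : tuples G 1" for x a l
 proof -
  have m1: "a \<otimes>\<^bsub>R\<^esub> 1[R] = a" using monoid.r_one[OF ring.is_monoid[OF cring.axioms(1)[OF R]] a] .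
  have "e () (?g x a l) = a *[mod_at B ()] e () (\<psi> l)"
   using mod_homD(3)[OF rc_homD(1)[OF e S(2)] a g.coch_app[OF p(1) l]] l by (simp add: g.coch_ops)
  also have "\<dots> = (a *[mod_at (coch G 1 B) ()] f () 1[R]) l" using l p(3) by (simp add: g.coch_ops)
  also have "\<dots> = f () (a *[mod_at ?R ()] 1[R]) l" by (simp only: mod_homD(3)[OF rc_homD(1)[OF f S(2)] a o])
  also have "\<dots> = f x a l" using m1 by (simp add: constant_module_def)
  finally show ?thesis by simp
 qed
 then show "EX g:rc_hom (D H) R ?R (coch G 1 A). ALL x:Obj (D H). ALL a:el ?R x. ALL l:tuples G 1. e x (g x a l) = f x a l"
  using g by (intro bexI[of _ ?g]) (simp_all add: constant_module_def)
qed

end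

section \<open>The cohomology of the centralizers\<close>

text \<open>Serves to carry witnesses of \<open>rel\<close>, which are total cocycles, from one cone
  complex to another.\<close>

lemma tot_map:
 assumes D: "double_complex R D h v" and D': "double_complex R D' h' v'"
  and t: "!!i j. t i j : mod_hom R (D i j) (D' i j)"
  and th: "!!i j x. x : carrier (D i j) ==> t (Suc i) j (h i j x) = h' i j (t i j x)"
  and tv: "!!i j x. x : carrier (D i j) ==> t i (Suc j) (v i j x) = v' i j (t i j x)"
  and w: "w : carrier (tot D n)"
 shows "(\<lambda>(i, j)\<in>idx n. t i j (w (i, j))) : carrier (tot D' n)" (is "?w : _")
  "td D h v n w = 0[tot D (n + 1)] ==> td D' h' v' n (\<lambda>(i, j)\<in>idx n. t i j (w (i, j))) = 0[tot D' (n + 1)]"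
proof -
 interpret D: double_complex R D h v by fact
 interpret D': double_complex R D' h' v' by fact
 note t0 = mod_hom_zero[OF t D.ab_D D'.ab_D]
 have wa: "?w (i, j) = t i j (w (i, j))" if "int i + int j = n" for i j using that by (simp add: idx_iff)
 show wc: "?w : carrier (tot D' n)" unfolding D'.tot_car using D.tot_app[OF w] mod_homD(1)[OF t] by (auto simp: idx_iff)
 assume z: "td D h v n w = 0[tot D (n + 1)]"
 show "td D' h' v' n ?w = 0[tot D' (n + 1)]"
 proof (rule D'.tot_eqI[OF D'.td_closed[OF wc]])
  show "0[tot D' (n + 1)] : carrier (tot D' (n + 1))" using D'.ab_tot by (simp add: ag)
  fix i j assume ij: "int i + int j = n + 1"
  have H: "hpart D' h' ?w i j = t i j (hpart D h w i j)"
  proof (cases i)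
   case (Suc i')
   then have i': "int i' + int j = n" using ij by simp
   show ?thesis unfolding Suc hpart_def nat.case wa[OF i'] th[OF D.tot_app[OF w i']] ..
  qed (simp add: hpart_def t0)
  have V: "vpart D' v' ?w i j = t i j (vpart D v w i j)"
  proof (cases j)
   case (Suc j')
   then have j': "int i + int j' = n" using ij by simp
   show ?thesis unfolding Suc vpart_def nat.case wa[OF j'] tv[OF D.tot_app[OF w j']] ..
  qed (simp add: vpart_def t0)
  have "hpart D h w i j +[D i j] vpart D v w i j = 0[D i j]"
   using fun_cong[OF z, of "(i, j)"] unfolding D.td_app[OF ij] D.tot_ops(1)[OF ij] .
  then show "td D' h' v' n ?w (i, j) = 0[tot D' (n + 1)] (i, j)"
   unfolding D'.td_app[OF ij] D'.tot_ops(1)[OF ij] H V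
   using mod_homD(2)[OF t D.hpart_closed[OF w ij] D.vpart_closed[OF w ij]] t0 by simp
 qed
qed

text \<open>Functor laws descend along a natural surjection. This helps where the action on
  \<open>N\<close> is defined by choices, so that the laws cannot be read off from it.\<close>

lemma left_module_surjective:
 assumes Z: "left_module C R Z" and N: "!!x. x : Obj C ==> module R (mod_at N x)"
  and e: "!!x. x : Obj C ==> e x : mod_hom R (mod_at Z x) (mod_at N x)"
  and surj: "!!x. x : Obj C ==> e x ` el Z x = el N x"
  and nat: "!!x y f a. x : Obj C ==> y : Obj C ==> f : Hom C x y ==> a : el Z x ==>
   mod_map N x y f (e x a) = e y (mod_map Z x y f a)"
 assumes C: "category C"
 shows "left_module C R N" "e : rc_hom C R Z N"
proof -
 have ex: "EX a:el Z x. b = e x a" if "x : Obj C" "b : el N x" for x b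
  using surj[OF that(1)] that(2) by blast
 note zm = module_ag[OF left_moduleD(1)[OF Z]]
 show "left_module C R N"
 proof (rule left_moduleI)
  fix x y f assume xy: "x : Obj C" "y : Obj C" "f : Hom C x y"
  note m = mod_homD[OF left_moduleD(2)[OF Z xy]] and ex' = ex[OF xy(1)] and n = nat[OF xy]
  note hx = mod_homD[OF e[OF xy(1)]] and hy = mod_homD[OF e[OF xy(2)]]
  show "mod_map N x y f : mod_hom R (mod_at N x) (mod_at N y)"
  proof (rule mod_homI)
   fix b assume "b : el N x"
   then obtain a where a: "a : el Z x" "b = e x a" using ex' by blast
   show "mod_map N x y f b : el N y" unfolding a n[OF a(1)] by (rule hy(1)[OF m(1)[OF a(1)]])
   show "mod_map N x y f (r *[mod_at N x] b) = r *[mod_at N y] mod_map N x y f b" if r: "r : carrier R" for r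
    unfolding a hx(3)[OF r a(1), symmetric] n[OF module.smult_closed[OF left_moduleD(1)[OF Z xy(1)] r a(1)]] n[OF a(1)]
     m(3)[OF r a(1)] hy(3)[OF r m(1)[OF a(1)]] ..
   fix b' assume "b' : el N x"
   then obtain a' where a': "a' : el Z x" "b' = e x a'" using ex' by blast
   show "mod_map N x y f (b +[mod_at N x] b') = mod_map N x y f b +[mod_at N y] mod_map N x y f b'"
    unfolding a a' hx(2)[OF a(1) a'(1), symmetric] n[OF abelian_group.ag_rules(1)[OF zm[OF xy(1)] a(1) a'(1)]] n[OF a(1)] n[OF a'(1)]
     m(2)[OF a(1) a'(1)] hy(2)[OF m(1)[OF a(1)] m(1)[OF a'(1)]] ..
  qed
 next
  fix x b assume x: "x : Obj C" and "b : el N x"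
  then obtain a where a: "a : el Z x" "b = e x a" using ex by blast
  show "mod_map N x x (Id C x) b = b"
   unfolding a(2) nat[OF x x categoryD(1)[OF C x] a(1)] left_moduleD(3)[OF Z x a(1)] ..
 next
  fix x y z f g b assume xyz: "x : Obj C" "y : Obj C" "z : Obj C" and f: "f : Hom C x y" and g: "g : Hom C y z" and "b : el N x"
  then obtain a where a: "a : el Z x" "b = e x a" using ex by blast
  show "mod_map N x z (Comp C g f) b = mod_map N y z g (mod_map N x y f b)"
   unfolding a(2) nat[OF xyz(1,3) categoryD(2)[OF C xyz f g] a(1)] nat[OF xyz(1,2) f a(1)]
    nat[OF xyz(2,3) g left_moduleD(6)[OF Z xyz(1,2) f a(1)]] left_moduleD(4)[OF Z xyz f g a(1)] ..
 qed (rule N)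
 show "e : rc_hom C R Z N" by (rule rc_homI[OF e nat[symmetric]])
qed

text \<open>The constant module as a resolution of itself. With it in the role of \<open>P\<close>,
  the double complex \<open>XD\<close> shrinks to one column, the invariants of the
  cochains.\<close>

definition const_res :: "('r, 's) ring_scheme => nat => ('o, 'm, 'r, 'r) rcmod" where
 "const_res R n = (case n of 0 => constant_module R | Suc _ => zero_left (constant_module R))"

definition aug_map :: "('r, 's) ring_scheme => ('o => 'u => 'r) => nat => 'o => 'u => 'r" where
 "aug_map R a n = (case n of 0 => a | Suc _ => (%_ _. 0[R]))"

lemma const_res_simps: "const_res R 0 = constant_module R" "const_res R (Suc n) = zero_left (constant_module R)"
 "aug_map R a 0 = a" "aug_map R a (Suc n) x b = 0[R]"
 by (simp_all add: const_res_def aug_map_def)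

lemma constant_module_simps:
 "el (constant_module R) x = carrier R" "0[mod_at (constant_module R) x] = 0[R]"
 "r *[mod_at (constant_module R) x] a = r \<otimes>\<^bsub>R\<^esub> a" "add (mod_at (constant_module R) x) = add R" "mod_map (constant_module R) x y f a = a"
 by (simp_all add: constant_module_def)

context transporter_data
begin

abbreviation "MH \<equiv> centralizer_coeff M"
abbreviation cR :: "(unit, 'g, 'r, 'r) rcmod" where "cR \<equiv> constant_module R"
abbreviation "RP H \<equiv> proj_res (D H) R cR"
abbreviation "KF q \<equiv> inv_left G (coch G (Suc q) M)"
abbreviation "Kd q \<equiv> cdiff G (Suc q) M"
abbreviation "Ec H \<equiv> ext_cochains (D H) R cR (MH H)"
abbreviation "Ed H \<equiv> ext_coboundary (D H) R cR"

text \<open>Both kinds of cochains are functions on powers of the whole group \<open>G\<close>, not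
  of \<open>C_G(H)\<close>. So cochains over the one-object category of \<open>C_G(H)\<close> are
  the values at \<open>H\<close> of the cochains over the transporter category.\<close>

lemma coch_MH: "mod_at (coch G k (MH H)) x = mod_at (coch G k M) H" "mod_map (coch G k (MH H)) x y c = mod_map (coch G k M) H H c"
 "cdiff G k (MH H) x = cdiff G k M H"
 by (simp_all add: coch_def centralizer_coeff_def cdiff_def fun_eq_iff)

lemma catD: "H : \<H> ==> category (D H)"
 using graded_cat.T[OF gD] .

lemma left_module_MH: "H : \<H> ==> left_module (D H) R (MH H)"
 using left_moduleD[OF M] cz_Hom by (intro left_moduleI) (simp_all add: centralizer_coeff_def)

lemma left_module_cR: "H : \<H> ==> left_module (D H) R cR"
 by (rule left_module_constant[OF R catD])

lemma RP: "H : \<H> ==> projective_resolution (D H) R cR (RP H)"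
 by (rule projective_resolution_exists[OF catD R left_module_cR])

lemma left_module_const_res: "H : \<H> ==> left_module (D H) R (const_res R n)"
 using left_module_cR left_module_zero_left[OF left_module_cR] by (cases n) (simp_all add: const_res_simps)

lemma zero_const_res: "0[mod_at (const_res R n) x] = 0[R]" "el (const_res R (Suc n)) x = {0[R]}"
 by (cases n) (simp_all add: const_res_simps zero_left_simps constant_module_simps)

text \<open>The comparison is the augmentation in degree 0 and zero above. It needs no sign: the
  differential of \<open>const_res\<close> is zero and the augmentation kills boundaries.\<close>

lemma cone_centralizer:
 assumes H: "H : \<H>"
 shows "cone_data G R (D H) (MH H) cR (res_mod (RP H)) (res_diff (RP H)) (res_aug (RP H)) (const_res R) (%n x a. 0[R]) (%x a. a) (aug_map R (res_aug (RP H)))"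
proof (rule cone_data.intro[OF gD[OF H] cone_data_axioms.intro])
 interpret g: graded_cat G R "D H" by (rule gD[OF H])
 note P = projective_resolutionD[OF RP[OF H]] and cl = left_module_const_res[OF H]
 have z: "(%x a. 0[R]) : rc_hom (D H) R N (const_res R n)" if "left_module (D H) R N" for N :: "(unit, 'g, 'r, 'x) rcmod" and n
  using rc_hom_zero[OF that cl[of n]] by (simp add: zero_const_res)
 have z0: "0[R] +[mod_at (const_res R n :: (unit, 'g, 'r, 'r) rcmod) x] 0[R] = 0[R]" for n x
  using abelian_group.ag_rules(5)[OF left_moduleD(5)[OF cl[of n], of x] abelian_group.ag_rules(2)[OF left_moduleD(5)[OF cl[of n], of x]]]
  by (simp add: zero_const_res)
 show "left_module (D H) R (MH H)" by (rule left_module_MH[OF H])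
 show "left_module (D H) R cR" by (rule left_module_cR[OF H])
 show "left_module (D H) R (const_res R n)" for n by (rule cl)
 show "(%x a. 0[R]) : rc_hom (D H) R (const_res R (Suc n)) (const_res R n)" for n by (rule z[OF cl])
 show "(%x a. a) : rc_hom (D H) R (const_res R 0) cR"
  by (rule rc_homI) (auto simp: const_res_simps intro: mod_homI)
 show "aug_map R (res_aug (RP H)) n : rc_hom (D H) R (res_mod (RP H) n) (const_res R n)" for n
 proof (cases n)
  case (Suc m)
  have "aug_map R (res_aug (RP H)) n = (%x a. 0[R])" by (simp add: Suc aug_map_def fun_eq_iff)
  then show ?thesis using z[OF P(2), of n n] by simp
 qed (use P(4) in \<open>simp add: const_res_simps\<close>)
 show "0[R] +[mod_at (const_res R n :: (unit, 'g, 'r, 'r) rcmod) x] aug_map R (res_aug (RP H)) n x (res_diff (RP H) n x b) = 0[mod_at (const_res R n :: (unit, 'g, 'r, 'r) rcmod) x]"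
  if "x : Obj (D H)" "b : el (res_mod (RP H) (Suc n)) x" for n x b
 proof -
  have "aug_map R (res_aug (RP H)) n x (res_diff (RP H) n x b) = 0[R]"
   using resolution_dd(1)[OF RP[OF H] that(1)] that(2) by (cases n) (simp_all add: const_res_simps constant_module_simps)
  then show ?thesis by (simp add: z0 zero_const_res(1))
 qed
 show "aug_map R (res_aug (RP H)) 0 x b = res_aug (RP H) x b" for x :: unit and b by (simp add: const_res_simps)
 show "(%a. 0[R]) ` el (const_res R (Suc 0) :: (unit, 'g, 'r, 'r) rcmod) x = mod_ker (mod_at (const_res R 0 :: (unit, 'g, 'r, 'r) rcmod) x) (mod_at cR x) (%a. a)" if "x : Obj (D H)" for x
  using left_moduleD(5)[OF left_module_cR[OF H] that] abelian_group.ag_rules(2)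
  by (force simp: zero_const_res mod_ker_def const_res_simps constant_module_simps zero_left_simps)
 show "(%a. 0[R]) ` el (const_res R (Suc (Suc n)) :: (unit, 'g, 'r, 'r) rcmod) x
   = mod_ker (mod_at (const_res R (Suc n) :: (unit, 'g, 'r, 'r) rcmod) x) (mod_at (const_res R n :: (unit, 'g, 'r, 'r) rcmod) x) (%a. 0[R])" for n and x :: unit
  by (auto simp: zero_const_res mod_ker_def)
 show "G_lifting G (D H) R (const_res R n) TYPE((unit, 'g, 'r, 'r) res_univ \<times> 'r)" for n
  using constant_lifting[OF H] g.G_lifting_zero[OF left_module_cR[OF H]] by (cases n) (simp_all add: const_res_simps)
 show "G_lifting G (D H) R (res_mod (RP H) n) TYPE((unit, 'g, 'r, 'r) res_univ \<times> 'r)" for n by (rule g.projective_G_lifting[OF P(1)])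
 fix n k f assume f: "f : rc_hom (D H) R (res_mod (RP H) n) (coch G (Suc k) (MH H))"
  and fz: "!!x a. x : Obj (D H) ==> a : el (res_mod (RP H) n) x ==> cdiff G (Suc k) (MH H) x (f x a) = 0[mod_at (coch G (Suc (Suc k)) (MH H)) x]"
 show "EX g:rc_hom (D H) R (res_mod (RP H) n) (coch G k (MH H)). ALL x:Obj (D H). ALL a:el (res_mod (RP H) n) x. cdiff G k (MH H) x (g x a) = f x a"
  by (rule g.projective_column[OF P(1) left_module_MH[OF H] f fz])
next
 note P = projective_resolutionD[OF RP[OF H]]
 show "left_module (D H) R (res_mod (RP H) n)" "res_diff (RP H) n : rc_hom (D H) R (res_mod (RP H) (Suc n)) (res_mod (RP H) n)"
  "res_aug (RP H) : rc_hom (D H) R (res_mod (RP H) 0) cR" for n by (rule P(2), rule P(3), rule P(4))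
 fix x assume x: "x : Obj (D H)"
 show "res_aug (RP H) x ` el (res_mod (RP H) 0) x = el cR x"
  "res_diff (RP H) 0 x ` el (res_mod (RP H) (Suc 0)) x = mod_ker (mod_at (res_mod (RP H) 0) x) (mod_at cR x) (res_aug (RP H) x)"
  "res_diff (RP H) (Suc n) x ` el (res_mod (RP H) (Suc (Suc n))) x
   = mod_ker (mod_at (res_mod (RP H) (Suc n)) x) (mod_at (res_mod (RP H) n) x) (res_diff (RP H) n x)" for n
  by (rule P(5)[OF x], rule P(6)[OF x], rule P(7)[OF x])
qed

text \<open>Column 0 carries everything in \<open>x\<close>, and a morphism out of the constant
  module is its value at \<open>1\<close>, an invariant cochain. So this relates cocycles of Ext
  over \<open>C_G(H)\<close> to invariant cocycles at \<open>H\<close>.\<close>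

definition relH :: "'g set => nat => (unit => (unit, 'g, 'r, 'r) res_univ => 'a) => ('g list => 'a) => bool" where
 "relH H q z \<phi> \<longleftrightarrow> (EX x. cone_data.rel G R (D H) (MH H) (res_mod (RP H)) (res_diff (RP H)) (const_res R) (%n x a. 0[R])
   (aug_map R (res_aug (RP H))) q z x & x (0, q) () 1[R] = \<phi>)"

abbreviation "KZ q H \<equiv> mod_ker (mod_at (KF q) H) (mod_at (KF (Suc q)) H) (Kd q H)"
abbreviation "KB q H \<equiv> coboundaries (%q. mod_at (KF q) H) (%q. Kd q H) q"
abbreviation "EZ q H \<equiv> mod_ker (Ec H q) (Ec H (Suc q)) (Ed H q)"
abbreviation "EB q H \<equiv> coboundaries (Ec H) (Ed H) q"

lemma left_module_KF: "left_module F R (KF q)"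
 by (rule left_module_inv[OF graded_cat.left_module_coch[OF gT M]])

lemma Kd_hom: "Kd q : rc_hom F R (KF q) (KF (Suc q))"
 by (rule inv_left_hom[OF graded_cat.left_module_coch[OF gT M] graded_cat.left_module_coch[OF gT M] graded_cat.cdiff_hom[OF gT M]])

context
 fixes H assumes H: "H : \<H>"
begin

interpretation c: cone_data G R "D H" "MH H" cR "res_mod (RP H)" "res_diff (RP H)" "res_aug (RP H)" "const_res R" "%n x a. 0[R]" "%x a. a" "aug_map R (res_aug (RP H))"
 by (rule cone_centralizer[OF H])

lemma one_R: "1[R] : carrier R"
 using cring.cring_simprules(6)[OF R] .

lemma ZK_eq: "hom_module (D H) R (res_mod (RP H) n) (MH H) = Ec H n" "c.dZ = Ed H"
 by (simp_all add: fun_eq_iff ext_cochains_def c.dZ_def ext_coboundary_def rest_def)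

lemma xc:
 assumes x: "x : carrier (tot c.XD (int q))"
 shows "x (0, q) : carrier (hom_module (D H) R cR (coch G (Suc q) (MH H)))"
 using double_complex.tot_app[OF c.dcX x, of 0 q] by (simp add: homD_def const_res_simps)

lemma x_lin:
 assumes x: "x : carrier (tot c.XD (int q))" and r: "r : carrier R"
 shows "x (0, q) () r = r *[mod_at (coch G (Suc q) M) H] x (0, q) () 1[R]"
 using mod_homD(3)[OF rc_homD(1)[OF hom_moduleD(1)[OF xc[OF x]], of "()"] r, of "1[R]"] r one_R monoid.r_one[OF ring.is_monoid[OF cring.axioms(1)[OF R]] r]
 by (simp add: constant_module_simps coch_MH)

text \<open>The group acts trivially on the constant module, so naturality makes the image of
  \<open>1\<close> invariant. With the lemmas that follow, evaluation becomes an isomorphism from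
  the total complex to the complex of invariants.\<close>

lemma ev_closed:
 assumes x: "x : carrier (tot c.XD (int q))"
 shows "x (0, q) () 1[R] : el (KF q) H"
proof -
 note xr = hom_moduleD(1)[OF xc[OF x]]
 have "mod_map (coch G (Suc q) M) H H c (x (0, q) () 1[R]) = x (0, q) () 1[R]" if "c : cz H" for c
  using rc_homD(2)[OF xr, of "()" "()" c "1[R]"] that one_R by (simp add: constant_module_simps coch_MH)
 then show ?thesis using rc_homD(3)[OF xr, of "()" "1[R]"] one_R by (simp add: constant_module_simps coch_MH)
qed

lemma ev_inj:
 assumes x: "x : carrier (tot c.XD (int q))" "y : carrier (tot c.XD (int q))" and e: "x (0, q) () 1[R] = y (0, q) () 1[R]"
 shows "x = y"
proof (rule double_complex.tot_eqI[OF c.dcX x])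
 fix i j assume ij: "int i + int j = int q"
 show "x (i, j) = y (i, j)"
 proof (cases i)
  case 0
  then have [simp]: "j = q" using ij by simp
  show ?thesis unfolding 0 \<open>j = q\<close>
  proof (rule hom_module_eqI[OF xc[OF x(1)] xc[OF x(2)]])
   fix u r assume "r : el cR u"
   then show "x (0, q) u r = y (0, q) u r" using x_lin[OF x(1)] x_lin[OF x(2)] e by (simp add: constant_module_simps)
  qed
 next
  case (Suc i')
  have c: "w (i, j) : carrier (hom_module (D H) R (zero_left cR) (coch G (Suc j) (MH H)))" if "w : carrier (tot c.XD (int q))" for w
   using double_complex.tot_app[OF c.dcX that ij] by (simp add: homD_def const_res_simps Suc)
  show ?thesis
  proof (rule hom_module_eqI[OF c[OF x(1)] c[OF x(2)]])
   fix u r assume "r : el (zero_left cR) u"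
   then have r: "r = 0[mod_at (zero_left cR) u]" by (simp add: zero_left_simps)
   have z: "w (i, j) u r = 0[mod_at (coch G (Suc j) (MH H)) u]" if "w : carrier (tot c.XD (int q))" for w
    unfolding r by (rule rc_hom_apply_zero[OF left_module_zero_left[OF left_module_cR[OF H]] c.left_module_coch[OF c.M] hom_moduleD(1)[OF c[OF that]]]) simp
   show "x (i, j) u r = y (i, j) u r" unfolding z[OF x(1)] z[OF x(2)] ..
  qed
 qed
qed

lemma ev_surj:
 assumes f: "\<phi> : el (KF q) H"
 shows "EX x:carrier (tot c.XD (int q)). x (0, q) () 1[R] = \<phi>"
proof -
 let ?E = "coch G (Suc q) (MH H)"
 let ?y = "rest (D H) cR (%u r. r *[mod_at ?E ()] \<phi>)"
 have E: "left_module (D H) R ?E" by (rule c.left_module_coch[OF c.M])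
 have mE: "module R (mod_at ?E u)" for u using left_moduleD(1)[OF E] by simp
 have fE: "\<phi> : el ?E u" "c : cz H ==> mod_map ?E u u' c \<phi> = \<phi>" for u u' c using f by (simp_all add: coch_MH)
 have "(%u r. r *[mod_at ?E ()] \<phi>) : rc_hom (D H) R cR ?E"
 proof (rule rc_homI)
  fix u
  show "(%r. r *[mod_at ?E ()] \<phi>) : mod_hom R (mod_at cR u) (mod_at ?E u)"
   using module.smult_closed[OF mE] module.smult_l_distr[OF mE] module.smult_assoc1[OF mE] fE(1)
   by (intro mod_homI) (simp_all add: constant_module_simps)
 next
  fix u u' c r assume c: "c : Hom (D H) u u'" and r: "r : el cR u"
  show "mod_map cR u u' c r *[mod_at ?E ()] \<phi> = mod_map ?E u u' c (r *[mod_at ?E ()] \<phi>)"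
   using mod_homD(3)[OF left_moduleD(2)[OF E, of u u' c], of r \<phi>] fE c r by (simp add: constant_module_simps)
 qed
 then have y: "?y : carrier (c.XD 0 q)"
  unfolding homD_def const_res_simps by (rule rest_in_hom_module[OF left_module_cR[OF H]])
 have "double_complex.single c.XD 0 q ?y : carrier (tot c.XD (int q))" using double_complex.single_closed[OF c.dcX y] by simp
 moreover have "double_complex.single c.XD 0 q ?y (0, q) = ?y" by (simp only: double_complex.single_app[OF c.dcX] refl if_True)
 moreover have "?y () 1[R] = \<phi>" using module.smult_one[OF mE fE(1)] one_R by (simp add: constant_module_simps)
 ultimately show ?thesis by metis
qed

lemma ev_td:
 assumes x: "x : carrier (tot c.XD (int q))"
 shows "td c.XD c.hX c.vX (int q) x (0, Suc q) () 1[R] = Kd q H (x (0, q) () 1[R])"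
proof -
 have i: "int 0 + int (Suc q) = int q + 1" by simp
 note A = double_complex.ab_D[OF c.dcX] and xq = double_complex.tot_app[OF c.dcX x, of 0 q]
 have v: "c.vX 0 q (x (0, q)) : carrier (c.XD 0 (Suc q))" using mod_homD(1)[OF double_complex.v[OF c.dcX] xq] by simp
 have "td c.XD c.hX c.vX (int q) x (0, Suc q) = c.vX 0 q (x (0, q))"
  unfolding double_complex.td_app[OF c.dcX i] using v A[of 0 "Suc q"] by (simp add: hpart_def vpart_def ag)
 moreover have "Kd q H (x (0, q) () 1[R]) : el (coch G (Suc (Suc q)) M) H"
  using rc_homD(3)[OF Kd_hom _ ev_closed[OF x]] H by simp
 ultimately show ?thesis
  using module.smult_one[OF left_moduleD(1)[OF graded_cat.left_module_coch[OF gT M]], of H] H one_R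
  by (simp add: homv_def const_res_simps constant_module_simps sg_facts(2)[OF R] coch_MH)
qed

lemma ev_zero: "0[tot c.XD (int q)] (0, q) () 1[R] = 0[mod_at (KF q) H]"
 using one_R by (simp add: double_complex.tot_ops[OF c.dcX] homD_def const_res_simps hom_module_ops constant_module_simps coch_MH)

lemma tot_zero: "0[tot c.XD n] : carrier (tot c.XD n)"
 using double_complex.ab_tot[OF c.dcX] by (simp add: ag)

lemma ev_eq_zero:
 assumes x: "x : carrier (tot c.XD (int q))"
 shows "x (0, q) () 1[R] = 0[mod_at (KF q) H] \<longleftrightarrow> x = 0[tot c.XD (int q)]"
proof
 assume "x (0, q) () 1[R] = 0[mod_at (KF q) H]"
 then show "x = 0[tot c.XD (int q)]" by (intro ev_inj[OF x tot_zero]) (simp only: ev_zero)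
qed (simp only: ev_zero)

lemma ev_cocycle:
 assumes x: "x : carrier (tot c.XD (int q))"
 shows "x (0, q) () 1[R] : KZ q H \<longleftrightarrow> x : mod_ker (tot c.XD (int q)) (tot c.XD (int q + 1)) (td c.XD c.hX c.vX (int q))"
proof -
 have e: "int (Suc q) = int q + 1" by simp
 have tx: "td c.XD c.hX c.vX (int q) x : carrier (tot c.XD (int (Suc q)))" unfolding e by (rule double_complex.td_closed[OF c.dcX x])
 have "Kd q H (x (0, q) () 1[R]) = 0[mod_at (KF (Suc q)) H] \<longleftrightarrow> td c.XD c.hX c.vX (int q) x = 0[tot c.XD (int (Suc q))]"
  unfolding ev_td[OF x, symmetric] by (rule ev_eq_zero[OF tx])
 then show ?thesis unfolding mod_ker_def mem_Collect_eq e by (simp only: ev_closed[OF x] x simp_thms)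
qed

lemma ev_coboundary:
 assumes x: "x : carrier (tot c.XD (int q))"
 shows "x (0, q) () 1[R] : KB q H \<longleftrightarrow> x : td c.XD c.hX c.vX (int q - 1) ` carrier (tot c.XD (int q - 1))"
proof (cases q)
 case 0
 \<comment> \<open>Total degree -1 is empty, so zero is the only coboundary in degree 0, in
   agreement with \<open>coboundaries\<close>.\<close>
 have t: "td c.XD c.hX c.vX (int q - 1) w = 0[tot c.XD (int q)]" if w: "w : carrier (tot c.XD (int q - 1))" for w
 proof (rule double_complex.tot_eqI[OF c.dcX _ tot_zero])
  show "td c.XD c.hX c.vX (int q - 1) w : carrier (tot c.XD (int q))" using double_complex.td_closed[OF c.dcX w] by simp
  fix i j assume ij: "int i + int j = int q"
  then have z: "i = 0" "j = 0" using 0 by simp_all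
  have ij': "int i + int j = int q - 1 + 1" using ij by simp
  show "td c.XD c.hX c.vX (int q - 1) w (i, j) = 0[tot c.XD (int q)] (i, j)"
   unfolding double_complex.td_app[OF c.dcX ij'] double_complex.tot_ops(1)[OF c.dcX ij]
   unfolding z
   using double_complex.ab_D[OF c.dcX, of 0 0] by (simp add: hpart_def vpart_def ag)
 qed
 have "x : td c.XD c.hX c.vX (int q - 1) ` carrier (tot c.XD (int q - 1)) \<longleftrightarrow> x = 0[tot c.XD (int q)]"
 proof
  assume "x : td c.XD c.hX c.vX (int q - 1) ` carrier (tot c.XD (int q - 1))"
  then obtain w where "w : carrier (tot c.XD (int q - 1))" "x = td c.XD c.hX c.vX (int q - 1) w" by (rule imageE)
  then show "x = 0[tot c.XD (int q)]" by (simp only: t)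
 next
  assume "x = 0[tot c.XD (int q)]"
  then show "x : td c.XD c.hX c.vX (int q - 1) ` carrier (tot c.XD (int q - 1))"
   by (intro image_eqI[OF _ tot_zero[of "int q - 1"]]) (simp only: t[OF tot_zero])
 qed
 also have "\<dots> \<longleftrightarrow> x (0, q) () 1[R] = 0[mod_at (KF q) H]" by (rule ev_eq_zero[OF x, symmetric])
 finally show ?thesis unfolding coboundaries_def 0 by (simp only: nat.case singleton_iff)
next
 case (Suc m)
 have e: "int q - 1 = int m" "int m + 1 = int q" by (simp_all add: Suc)
 have t: "td c.XD c.hX c.vX (int m) w : carrier (tot c.XD (int q))" if "w : carrier (tot c.XD (int m))" for w
  using double_complex.td_closed[OF c.dcX that] unfolding e .
 have "x (0, q) () 1[R] : Kd m H ` el (KF m) H \<longleftrightarrow> x : td c.XD c.hX c.vX (int m) ` carrier (tot c.XD (int m))"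
 proof
  assume "x (0, q) () 1[R] : Kd m H ` el (KF m) H"
  then obtain \<psi> where p: "x (0, q) () 1[R] = Kd m H \<psi>" "\<psi> : el (KF m) H" by (rule imageE)
  obtain w where w: "w : carrier (tot c.XD (int m))" "w (0, m) () 1[R] = \<psi>" using ev_surj[OF p(2)] by (rule bexE)
  have "td c.XD c.hX c.vX (int m) w = x"
   by (rule ev_inj[OF t[OF w(1)] x]) (simp only: Suc ev_td[OF w(1)] w(2) p(1)[unfolded Suc])
  then show "x : td c.XD c.hX c.vX (int m) ` carrier (tot c.XD (int m))" by (rule image_eqI[OF sym w(1)])
 next
  assume "x : td c.XD c.hX c.vX (int m) ` carrier (tot c.XD (int m))"
  then obtain w where w: "x = td c.XD c.hX c.vX (int m) w" "w : carrier (tot c.XD (int m))" by (rule imageE)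
  show "x (0, q) () 1[R] : Kd m H ` el (KF m) H"
   by (rule image_eqI[OF _ ev_closed[OF w(2)]]) (simp only: w(1) Suc ev_td[OF w(2)])
 qed
 then show ?thesis unfolding e(1) by (simp only: Suc coboundaries_def nat.case)
qed

lemma relHE:
 assumes "relH H q z \<phi>"
 obtains x where "c.rel q z x" "x (0, q) () 1[R] = \<phi>"
 using assms unfolding relH_def by (elim exE conjE)

lemma relHI: "c.rel q z x ==> relH H q z (x (0, q) () 1[R])"
 unfolding relH_def by (rule exI conjI refl | assumption)+

text \<open>\<open>rel_facts\<close> and the additivity of \<open>rel\<close>, carried over along
  evaluation.\<close>

lemma relH_facts:
 "relH H q z \<phi> ==> z : EZ q H & \<phi> : KZ q H"
 "z : EZ q H ==> EX \<phi>. relH H q z \<phi>"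
 "\<phi> : KZ q H ==> EX z. relH H q z \<phi>"
 "relH H q z \<phi> ==> z : EB q H \<longleftrightarrow> \<phi> : KB q H"
 "relH H q z \<phi> ==> relH H q z' \<phi>' ==> relH H q (z +[Ec H q] z') (\<phi> +[mod_at (KF q) H] \<phi>')"
 "r : carrier R ==> relH H q z \<phi> ==> relH H q (r *[Ec H q] z) (r *[mod_at (KF q) H] \<phi>)"
proof -
 note f = c.rel_facts[unfolded ZK_eq]
 show "z : EZ q H & \<phi> : KZ q H" if "relH H q z \<phi>"
 proof -
  obtain x where x: "c.rel q z x" "x (0, q) () 1[R] = \<phi>" using \<open>relH H q z \<phi>\<close> by (rule relHE)
  note k = conjunct1[OF f(1)[OF x(1)]] conjunct2[OF f(1)[OF x(1)]]
  have xt: "x : carrier (tot c.XD (int q))" using k(2) by (simp only: mod_ker_def mem_Collect_eq)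
  show ?thesis by (rule conjI[OF k(1) iffD2[OF ev_cocycle[OF xt] k(2), unfolded x(2)]])
 qed
 show "EX \<phi>. relH H q z \<phi>" if "z : EZ q H" using f(2)[OF that] relHI by (meson)
 show "EX z. relH H q z \<phi>" if "\<phi> : KZ q H"
 proof -
  have "\<phi> : el (KF q) H" using that by (simp only: mod_ker_def mem_Collect_eq)
  then obtain x where x: "x : carrier (tot c.XD (int q))" "x (0, q) () 1[R] = \<phi>" using ev_surj by (metis (no_types))
  have "x : mod_ker (tot c.XD (int q)) (tot c.XD (int q + 1)) (td c.XD c.hX c.vX (int q))" by (rule iffD1[OF ev_cocycle[OF x(1)]]) (simp only: x(2) that)
  from f(3)[OF this] obtain z where z: "c.rel q z x" by (rule exE)
  show ?thesis by (rule exI[of _ z], rule relHI[OF z, unfolded x(2)])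
 qed
 show "z : EB q H \<longleftrightarrow> \<phi> : KB q H" if "relH H q z \<phi>"
 proof -
  obtain x where x: "c.rel q z x" "x (0, q) () 1[R] = \<phi>" using \<open>relH H q z \<phi>\<close> by (rule relHE)
  have xt: "x : carrier (tot c.XD (int q))" using conjunct2[OF f(1)[OF x(1)]] by (simp only: mod_ker_def mem_Collect_eq)
  show ?thesis unfolding f(4)[OF x(1)] ev_coboundary[OF xt, unfolded x(2)] ..
 qed
 have i: "int 0 + int q = int q" by simp
 show "relH H q (z +[Ec H q] z') (\<phi> +[mod_at (KF q) H] \<phi>')" if "relH H q z \<phi>" "relH H q z' \<phi>'"
 proof -
  obtain x where x: "c.rel q z x" "x (0, q) () 1[R] = \<phi>" using \<open>relH H q z \<phi>\<close> by (rule relHE)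
  obtain x' where x': "c.rel q z' x'" "x' (0, q) () 1[R] = \<phi>'" using \<open>relH H q z' \<phi>'\<close> by (rule relHE)
  have "(x +[tot c.XD (int q)] x') (0, q) () 1[R] = \<phi> +[mod_at (KF q) H] \<phi>'"
   unfolding double_complex.tot_ops(2)[OF c.dcX i] homD_def const_res_simps hom_module_ops using one_R x(2) x'(2)
   by (simp add: constant_module_simps coch_MH)
  from relHI[OF c.rel_add[OF x(1) x'(1)], unfolded this ZK_eq] show ?thesis .
 qed
 show "relH H q (r *[Ec H q] z) (r *[mod_at (KF q) H] \<phi>)" if r: "r : carrier R" and "relH H q z \<phi>"
 proof -
  obtain x where x: "c.rel q z x" "x (0, q) () 1[R] = \<phi>" using \<open>relH H q z \<phi>\<close> by (rule relHE)
  have "(r *[tot c.XD (int q)] x) (0, q) () 1[R] = r *[mod_at (KF q) H] \<phi>"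
   unfolding double_complex.tot_ops(3)[OF c.dcX i] homD_def const_res_simps hom_module_ops using one_R x(2)
   by (simp add: constant_module_simps coch_MH)
  from relHI[OF c.rel_smult[OF r x(1)], unfolded this ZK_eq] show ?thesis .
 qed
qed

end

end

section \<open>Naturality in the object: conjugation maps between centralizers\<close>

lemma restrict_along_simps [simp]: "mod_at (restrict_along \<phi> N) = mod_at N" "mod_map (restrict_along \<phi> N) x y c = mod_map N x y (\<phi> c)"
 by (simp_all add: restrict_along_def)

context transporter_data
begin

lemma conj_mult:
 assumes "g : carrier G" "c : carrier G" "d : carrier G"
 shows "inv g \<otimes> (c \<otimes> d) \<otimes> g = (inv g \<otimes> c \<otimes> g) \<otimes> (inv g \<otimes> d \<otimes> g)" "g \<otimes> (inv g \<otimes> c \<otimes> g) = c \<otimes> g"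
proof -
 have e: "g \<otimes> (inv g \<otimes> x) = x" if "x : carrier G" for x using assms that by (simp add: m_assoc[symmetric])
 show "inv g \<otimes> (c \<otimes> d) \<otimes> g = (inv g \<otimes> c \<otimes> g) \<otimes> (inv g \<otimes> d \<otimes> g)" "g \<otimes> (inv g \<otimes> c \<otimes> g) = c \<otimes> g"
  using assms by (simp_all add: m_assoc e)
qed

abbreviation cst :: "nat => (unit, 'g, 'r, 'r) rcmod" where "cst \<equiv> const_res R"

context
 fixes H K g
 assumes H: "H : \<H>" and K: "K : \<H>" and g: "g : transporter_set G H K"
begin

abbreviation "\<kappa> \<equiv> %c. inv g \<otimes> c \<otimes> g"

lemma \<kappa>: "c : cz K ==> \<kappa> c : cz H" "c : cz K ==> g \<otimes> \<kappa> c = c \<otimes> g"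
 using conj_centralizer[OF is_group sub[OF H] g] conj_mult(2)[OF trans_carrier[OF g]] cz_carrier by blast+

lemma restrict_left_module:
 assumes N: "left_module (D H) R N"
 shows "left_module (D K) R (restrict_along \<kappa> N)"
 using left_moduleD(1,2)[OF N] left_moduleD(3)[OF N, of "()"] left_moduleD(4)[OF N, of "()" "()" "()"] \<kappa>(1)
  trans_carrier[OF g] cz_carrier conj_mult(1)
 by (intro left_moduleI) simp_all

lemma restrict_hom: "f : rc_hom (D H) R N N' ==> f : rc_hom (D K) R (restrict_along \<kappa> N) (restrict_along \<kappa> N')"
 by (rule rc_homI) (simp_all add: rc_homD(1,2) \<kappa>(1))

text \<open>The target of a comparison has to be exact only, and restriction along
  \<open>\<kappa>\<close> preserves exactness. So the \<open>SOME\<close> in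
  \<open>group_cohomology_map\<close> denotes a comparison map.\<close>

lemma comparison_exists: "EX \<tau>. is_comparison R (centralizer_group G K) (centralizer_group G H) \<kappa> \<tau>"
proof -
 note P = projective_resolutionD[OF RP[OF H]]
 have "res_aug (RP H) : rc_hom (D K) R (restrict_along \<kappa> (res_mod (RP H) 0)) (restrict_along \<kappa> cR)" by (rule restrict_hom[OF P(4)])
 moreover have "restrict_along \<kappa> cR = cR" by (simp add: restrict_along_def constant_module_def)
 ultimately have a: "res_aug (RP H) : rc_hom (D K) R (restrict_along \<kappa> (res_mod (RP H) 0)) cR" by simp
 show ?thesis unfolding is_comparison_def Let_def
  using chain_lift[OF catD[OF K] R RP[OF K] left_module_cR[OF K] restrict_left_module[OF P(2)] restrict_hom[OF P(3)] a] P(5-7)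
  by (simp add: eq_commute)
qed

context
 fixes \<tau>
 assumes cmp: "is_comparison R (centralizer_group G K) (centralizer_group G H) \<kappa> \<tau>"
begin

interpretation h: cone_data G R "D H" "MH H" cR "res_mod (RP H)" "res_diff (RP H)" "res_aug (RP H)" "const_res R" "%n x a. 0[R]" "%x a. a" "aug_map R (res_aug (RP H))"
 by (rule cone_centralizer[OF H])
interpretation k: cone_data G R "D K" "MH K" cR "res_mod (RP K)" "res_diff (RP K)" "res_aug (RP K)" "const_res R" "%n x a. 0[R]" "%x a. a" "aug_map R (res_aug (RP K))"
 by (rule cone_centralizer[OF K])

lemma tau: "\<tau> n : rc_hom (D K) R (res_mod (RP K) n) (restrict_along \<kappa> (res_mod (RP H) n))"
 "a : el (res_mod (RP K) (Suc n)) x ==> \<tau> n x (res_diff (RP K) n x a) = res_diff (RP H) n x (\<tau> (Suc n) x a)"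
 "a : el (res_mod (RP K) 0) x ==> res_aug (RP H) x (\<tau> 0 x a) = res_aug (RP K) x a"
 using cmp by (simp_all add: is_comparison_def Let_def)

lemma tau_zero: "\<tau> n x 0[mod_at (res_mod (RP K) n) x] = 0[mod_at (res_mod (RP H) n) x]"
 using rc_hom_apply_zero[OF k.Q restrict_left_module[OF h.Q] tau(1)] by simp

text \<open>\<open>\<tau>\<close> with the degree shift of \<open>Qs\<close>; at index 0 it only
  meets the zero element.\<close>

definition tS :: "nat => unit => (unit, 'g, 'r, 'r) res_univ => (unit, 'g, 'r, 'r) res_univ" where
 "tS i = (case i of 0 => \<tau> 0 | Suc m => \<tau> m)"

abbreviation "tp i x p \<equiv> (tS i x (fst p), snd p)"

lemma tS: "b : el (k.Qs i) x ==> tS i x b : el (h.Qs i) x"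
 "tS i : rc_hom (D K) R (k.Qs i) (restrict_along \<kappa> (h.Qs i))" "tS i x 0[mod_at (k.Qs i) x] = 0[mod_at (h.Qs i) x]"
proof -
 show c: "tS i x b : el (h.Qs i) x" if "b : el (k.Qs i) x" for x b
  using that rc_homD(3)[OF tau(1), of x b] by (cases i) (simp_all add: tS_def h.Qs_simps k.Qs_simps tau_zero)
 show "tS i x 0[mod_at (k.Qs i) x] = 0[mod_at (h.Qs i) x]" by (cases i) (simp_all add: tS_def h.Qs_simps k.Qs_simps tau_zero)
 show "tS i : rc_hom (D K) R (k.Qs i) (restrict_along \<kappa> (h.Qs i))"
 proof (cases i)
  case 0
  note t = rc_homD[OF tau(1)[of 0]]
  have q: "mod_at (k.Qs 0) x = (mod_at (res_mod (RP K) 0) x)(|carrier := {0[mod_at (res_mod (RP K) 0) x]}|)"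
   "mod_at (h.Qs 0) x = (mod_at (res_mod (RP H) 0) x)(|carrier := {0[mod_at (res_mod (RP H) 0) x]}|)"
   "mod_map (k.Qs 0) = mod_map (res_mod (RP K) 0)" "mod_map (h.Qs 0) = mod_map (res_mod (RP H) 0)" for x
   by (simp_all add: h.Qs_def k.Qs_def zero_left_def sub_left_def)
  have z: "0[mod_at (res_mod (RP K) 0) x] : el (res_mod (RP K) 0) x" for x
   using left_moduleD(5)[OF k.Q, of x] by (simp add: ag)
  show ?thesis unfolding 0
  proof (rule rc_homI)
   fix x
   show "tS 0 x : mod_hom R (mod_at (k.Qs 0) x) (mod_at (restrict_along \<kappa> (h.Qs 0)) x)"
    using mod_homD(2,3)[OF t(1)] z by (intro mod_homI) (simp_all add: q tS_def tau_zero)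
  qed (use t(2) z in \<open>simp add: q tS_def\<close>)
 qed (use tau(1) in \<open>simp add: tS_def h.Qs_simps k.Qs_simps\<close>)
qed

lemma tp_closed: "p : el (k.C i) x ==> tp i x p : el (h.C i) x"
 using tS(1) by (auto simp: h.C_car k.C_car)

lemma tp_hom: "(%x p. tp i x p) : rc_hom (D K) R (k.C i) (restrict_along \<kappa> (h.C i))"
proof (rule rc_homI)
 have m: "mod_map (cst i) x y c a = a" for x y c a
  by (cases i) (simp_all add: const_res_simps zero_left_def sub_left_def constant_module_simps)
 show "(%p. tp i x p) : mod_hom R (mod_at (k.C i) x) (mod_at (restrict_along \<kappa> (h.C i)) x)" for x
  using mod_homD[OF rc_homD(1)[OF tS(2), of x]] by (intro mod_homI) (simp_all add: h.C_def k.C_def mem_Times_iff)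
 fix x y c p assume "c : Hom (D K) x y" "p : el (k.C i) x"
 then show "tp i y (mod_map (k.C i) x y c p) = mod_map (restrict_along \<kappa> (h.C i)) x y c (tp i x p)"
  using rc_homD(2)[OF tS(2), of x y c "fst p"] by (simp add: h.C_def k.C_def mem_Times_iff m)
qed

lemma tp_dC:
 assumes p: "p : el (k.C (Suc i)) x"
 shows "tp i x (k.dC i x p) = h.dC i x (tp (Suc i) x p)"
proof -
 have b: "fst p : el (res_mod (RP K) i) x" using p by (auto simp: k.C_car k.Qs_simps)
 have "aug_map R (res_aug (RP H)) i x (\<tau> i x (fst p)) = aug_map R (res_aug (RP K)) i x (fst p)"
  using tau(3) b by (cases i) (simp_all add: const_res_simps)
 moreover have "tS i x (k.dQs i x (fst p)) = h.dQs i x (\<tau> i x (fst p))"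
  using tau(2) tau_zero b by (cases i) (simp_all add: tS_def h.dQs_def k.dQs_def)
 ultimately show ?thesis by (simp add: h.dC_def k.dC_def tS_def)
qed

abbreviation "\<Theta> j \<equiv> mod_map (coch G j M) H K g"

lemma left_module_cochM: "left_module T R (coch G j M)"
 by (rule graded_cat.left_module_coch[OF gT M])

lemma Theta: "\<Theta> j : mod_hom R (mod_at (coch G j M) H) (mod_at (coch G j M) K)"
 using left_moduleD(2)[OF left_module_cochM, of H K g] H K g by simp

lemma Theta_zero: "\<Theta> j 0[mod_at (coch G j M) H] = 0[mod_at (coch G j M) K]"
 using mod_hom_zero[OF Theta left_moduleD(5)[OF left_module_cochM] left_moduleD(5)[OF left_module_cochM]] H K by simp

text \<open>By \<open>g (g^-1 c g) = c g\<close>, the map induced by \<open>g\<close> takes the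
  restricted action of \<open>C_G(K)\<close> on values at \<open>H\<close> to its action on values
  at \<open>K\<close>.\<close>

lemma Theta_hom: "(%x. \<Theta> j) : rc_hom (D K) R (restrict_along \<kappa> (coch G j (MH H))) (coch G j (MH K))"
proof (rule rc_homI)
 fix x y c \<psi> assume c: "c : Hom (D K) x y" and p: "\<psi> : el (restrict_along \<kappa> (coch G j (MH H))) x"
 have c': "c : cz K" using c by simp
 have p': "\<psi> : el (coch G j M) H" using p by (simp add: coch_MH)
 have "\<Theta> j (mod_map (coch G j M) H H (\<kappa> c) \<psi>) = mod_map (coch G j M) H K (g \<otimes> \<kappa> c) \<psi>"
  using left_moduleD(4)[OF left_module_cochM, of H H K "\<kappa> c" g \<psi>] H K g cz_Hom[OF H \<kappa>(1)[OF c']] p' by simp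
 also have "\<dots> = mod_map (coch G j M) K K c (\<Theta> j \<psi>)" unfolding \<kappa>(2)[OF c']
  using left_moduleD(4)[OF left_module_cochM, of H K K g c \<psi>] H K g cz_Hom[OF K c'] p' by simp
 finally show "\<Theta> j (mod_map (restrict_along \<kappa> (coch G j (MH H))) x y c \<psi>) = mod_map (coch G j (MH K)) x y c (\<Theta> j \<psi>)"
  by (simp only: restrict_along_simps coch_MH)
qed (simp add: coch_MH Theta)

text \<open>The map that \<open>g\<close> induces between the cone complexes of \<open>H\<close> and
  \<open>K\<close>: the cones are compared by \<open>\<tau>\<close> on the resolution and by the
  identity on the constant part, the values by \<open>g\<close>.\<close>

definition Tr :: "nat => nat => (unit => (unit, 'g, 'r, 'r) res_univ \<times> 'r => 'g list => 'a) => unit => (unit, 'g, 'r, 'r) res_univ \<times> 'r => 'g list => 'a" where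
 "Tr i j f = rest (D K) (k.C i) (%x p. \<Theta> j (f x (tp i x p)))"

lemma f_closed:
 assumes "f : carrier (h.HD i j)" "p : el (h.C i) x"
 shows "f x p : el (coch G j M) H"
 using rc_homD(3)[OF hom_moduleD(1)[OF assms(1)[unfolded homD_def]] _ assms(2)] by (simp add: coch_MH)

lemma Tr_hom: "Tr i j : mod_hom R (h.HD i j) (k.HD i j)"
proof (rule mod_homI)
 fix f assume f: "f : carrier (h.HD i j)"
 have "(%x p. \<Theta> j (f x (tp i x p))) : rc_hom (D K) R (k.C i) (coch G j (MH K))"
  by (rule rc_hom_comp[OF rc_hom_comp[OF tp_hom restrict_hom[OF hom_moduleD(1)[OF f[unfolded homD_def]]]] Theta_hom])
 then show "Tr i j f : carrier (k.HD i j)" unfolding Tr_def homD_def by (rule rest_in_hom_module[OF k.C])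
 show "Tr i j (r *[h.HD i j] f) = r *[k.HD i j] Tr i j f" if r: "r : carrier R" for r
  unfolding Tr_def homD_def hom_module_ops
  by (rule rest_cong) (simp add: tp_closed coch_MH mod_homD(3)[OF Theta r f_closed[OF f]])
 fix f' assume f': "f' : carrier (h.HD i j)"
 show "Tr i j (f +[h.HD i j] f') = Tr i j f +[k.HD i j] Tr i j f'"
  unfolding Tr_def homD_def hom_module_ops
  by (rule rest_cong) (simp add: tp_closed coch_MH mod_homD(2)[OF Theta f_closed[OF f] f_closed[OF f']])
qed

lemma Tr_app: "p : el (k.C i) x ==> Tr i j f x p = \<Theta> j (f x (tp i x p))"
 by (simp add: Tr_def)

lemma Tr_W: "Tr i j : mod_hom R (h.WD i j) (k.WD i j)"
proof (rule mod_homI)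
 fix f assume f: "f : carrier (h.WD i j)"
 then have fc: "f : carrier (h.HD i j)" by simp
 have "k.van i (Tr i j f) j" if "h.van i f j" unfolding k.van_def
 proof (intro ballI)
  fix x a assume a: "a : el (cst i) x"
  then have p: "(0[mod_at (k.Qs i) x], a) : el (k.C i) x" by (simp add: k.C_car k.zero_closed_cone)
  show "Tr i j f x (0[mod_at (k.Qs i) x], a) = 0[mod_at (coch G j (MH K)) x]"
  proof -
   have "f x (0[mod_at (h.Qs i) x], a) = 0[mod_at (coch G j (MH H)) x]"
    using that a unfolding h.van_def by simp
   then show ?thesis unfolding Tr_app[OF p] fst_conv snd_conv tS(3) coch_MH by (simp only: Theta_zero)
  qed
 qed
 then show "Tr i j f : carrier (k.WD i j)" using f mod_homD(1)[OF Tr_hom fc] by (cases j; simp)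
 show "Tr i j (r *[h.WD i j] f) = r *[k.WD i j] Tr i j f" if r: "r : carrier R" for r
  unfolding h.WD_ops k.WD_ops by (rule mod_homD(3)[OF Tr_hom r fc])
 fix f' assume "f' : carrier (h.WD i j)"
 then have f'c: "f' : carrier (h.HD i j)" by simp
 show "Tr i j (f +[h.WD i j] f') = Tr i j f +[k.WD i j] Tr i j f'"
  unfolding h.WD_ops k.WD_ops by (rule mod_homD(2)[OF Tr_hom fc f'c])
qed

lemma Tr_h: "f : carrier (h.WD i j) ==> Tr (Suc i) j (h.hC i j f) = k.hC i j (Tr i j f)"
 unfolding Tr_def homh_def
 by (rule rest_cong) (simp add: tp_closed rc_homD(3)[OF k.dC] tp_dC)

lemma Tr_v:
 assumes "f : carrier (h.WD i j)"
 shows "Tr i (Suc j) (h.vC i j f) = k.vC i j (Tr i j f)"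
 unfolding Tr_def homv_def
proof (rule rest_cong)
 have f: "f : carrier (h.HD i j)" using assms by simp
 fix x p assume p: "p : el (k.C i) x"
 note fx = f_closed[OF f tp_closed[OF p]]
 have d: "cdiff G j M H (f x (tp i x p)) : el (coch G (Suc j) M) H"
  using rc_homD(3)[OF graded_cat.cdiff_hom[OF gT M] _ fx] H by simp
 have "cdiff G j M K (\<Theta> j (f x (tp i x p))) = \<Theta> (Suc j) (cdiff G j M H (f x (tp i x p)))"
  using rc_homD(2)[OF graded_cat.cdiff_hom[OF gT M], of H K g] fx H K g by simp
 then show "\<Theta> (Suc j) (rest (D H) (h.C i) (%x a. sg R i *[mod_at (coch G (Suc j) (MH H)) x] cdiff G j (MH H) x (f x a)) x (tp i x p))
   = sg R i *[mod_at (coch G (Suc j) (MH K)) x] cdiff G j (MH K) x (rest (D K) (k.C i) (%x p. \<Theta> j (f x (tp i x p))) x p)"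
  by (simp only: rest_apply[OF _ tp_closed[OF p]] rest_apply[OF _ p] coch_MH mod_homD(3)[OF Theta sg_facts(1)[OF R] d] D_simps UNIV_I)
qed

text \<open>\<open>Tr\<close> carries the whole total cocycle that witnesses the relation at
  \<open>H\<close> to one at \<open>K\<close>, and then both ends are read off. The Ext end is the
  formula by which \<open>group_cohomology_map\<close> acts on cocycles, for an arbitrary comparison
  map.\<close>

lemma relH_natural:
 assumes "relH H q z \<phi>"
 shows "relH K q (\<lambda>x\<in>UNIV. \<lambda>a\<in>el (res_mod (RP K) q) x. mod_map M H K g (z x (\<tau> q x a))) (\<Theta> (Suc q) \<phi>)"
proof -
 obtain x where x: "h.rel q z x" "x (0, q) () 1[R] = \<phi>" using relHE[OF H assms] .
 obtain w where w0: "w : carrier (tot h.WD (int q + 1))"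
  and w1: "h.tW (int q + 1) w = 0[tot h.WD (int q + 1 + 1)] & h.zpart q w = z & h.xpart (int q) w = x"
  using x(1)[unfolded h.rel_def] by (rule bexE)
 note w = w0 conjunct1[OF w1] conjunct1[OF conjunct2[OF w1]] conjunct2[OF conjunct2[OF w1]]
 let ?w = "\<lambda>(i, j)\<in>idx (int q + 1). Tr i j (w (i, j))"
 have w': "?w : carrier (tot k.WD (int q + 1))" "k.tW (int q + 1) ?w = 0[tot k.WD (int q + 1 + 1)]"
 proof -
  note tm = tot_map[where t = Tr, OF h.dcW k.dcW Tr_W]
  show "?w : carrier (tot k.WD (int q + 1))" by (rule tm(1)[OF Tr_h Tr_v w(1)])
  show "k.tW (int q + 1) ?w = 0[tot k.WD (int q + 1 + 1)]" by (rule tm(2)[OF Tr_h Tr_v w(1,2)])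
 qed
 have rel: "k.rel q (k.zpart q ?w) (k.xpart (int q) ?w)" unfolding k.rel_def by (rule bexI[OF _ w'(1)]) (simp only: w'(2) simp_thms)
 have e: "?w (Suc q, 0) = Tr (Suc q) 0 (w (Suc q, 0))" "?w (0, Suc q) = Tr 0 (Suc q) (w (0, Suc q))"
  by (simp_all add: idx_iff)
 have Z: "k.zpart q ?w = (\<lambda>x\<in>UNIV. \<lambda>a\<in>el (res_mod (RP K) q) x. mod_map M H K g (z x (\<tau> q x a)))"
 proof -
  have "k.zpart q ?w = rest (D K) (res_mod (RP K) q) (%x a. mod_map M H K g (z x (\<tau> q x a)))"
   unfolding k.zpart_def k.rZ_def e
  proof (rule rest_cong)
   fix x b assume b: "b : el (res_mod (RP K) q) x"
   have p: "(b, 0[mod_at (cst (Suc q)) x]) : el (k.C (Suc q)) x"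
    using b k.zero_closed_cone(1)[of x "Suc q"] by (simp add: k.C_car k.Qs_simps)
   have tb: "\<tau> q x b : el (res_mod (RP H) q) x" using rc_homD(3)[OF tau(1) _ b] by simp
   show "Tr (Suc q) 0 (w (Suc q, 0)) x (b, 0[mod_at (cst (Suc q)) x]) [] = mod_map M H K g (z x (\<tau> q x b))"
    unfolding Tr_app[OF p] w(3)[symmetric] h.zpart_def h.rZ_def using tb
    by (simp add: tS_def h.coch_map tuples_def shift_def)
  qed
  then show ?thesis by (simp add: rest_def)
 qed
 have X: "k.xpart (int q) ?w (0, q) () 1[R] = \<Theta> (Suc q) \<phi>"
 proof -
  have i: "int 0 + int q = int q" by simp
  have o: "1[R] : el (cst 0) ()" using one_R[OF H] by (simp add: const_res_simps constant_module_simps)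
  have p: "(0[mod_at (k.Qs 0) ()], 1[R]) : el (k.C 0) ()" using o by (simp add: k.C_car k.zero_closed_cone)
  have "k.xpart (int q) ?w (0, q) () 1[R] = Tr 0 (Suc q) (w (0, Suc q)) () (0[mod_at (k.Qs 0) ()], 1[R])"
   unfolding k.xpart_app[OF i] k.rX_def e using o by simp
  also have "\<dots> = \<Theta> (Suc q) (w (0, Suc q) () (0[mod_at (h.Qs 0) ()], 1[R]))"
   unfolding Tr_app[OF p] fst_conv snd_conv tS(3) ..
  also have "w (0, Suc q) () (0[mod_at (h.Qs 0) ()], 1[R]) = \<phi>"
   unfolding x(2)[symmetric] w(4)[symmetric] h.xpart_app[OF i] h.rX_def using o by simp
  finally show ?thesis .
 qed
 have "relH K q (k.zpart q ?w) (k.xpart (int q) ?w (0, q) () 1[R])" by (rule relHI[OF K rel])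
 then show ?thesis by (simp only: X Z)
qed

end

end

end

section \<open>Classes of invariant cocycles in the centralizer cohomology\<close>

lemma cochain_complex:
 assumes K: "!!n. module R (K n)" and d: "!!n. d n : mod_hom R (K n) (K (Suc n))"
  and dd: "!!n x. x : carrier (K n) ==> d (Suc n) (d n x) = 0[K (Suc (Suc n))]"
 shows "submodule (mod_ker (K n) (K (Suc n)) (d n)) R (K n)" "submodule (coboundaries K d n) R (K n)"
  "coboundaries K d n <= mod_ker (K n) (K (Suc n)) (d n)" "module R (cohomology K d n)"
proof -
 show z: "submodule (mod_ker (K n) (K (Suc n)) (d n)) R (K n)" by (rule submodule_ker[OF K K d])
 show b: "submodule (coboundaries K d n) R (K n)"
 proof (cases n)
  case (Suc m)
  show ?thesis unfolding Suc coboundaries_def nat.case by (rule submodule_image[OF K K d submodule_carrier[OF K]])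
 qed (simp add: coboundaries_def submodule_zero[OF K])
 show s: "coboundaries K d n <= mod_ker (K n) (K (Suc n)) (d n)"
 proof (cases n)
  case 0
  show ?thesis unfolding 0 coboundaries_def nat.case mod_ker_def
   using mod_hom_zero[OF d[of 0] module_ag[OF K] module_ag[OF K]] module_ag[OF K[of 0]] by (simp add: ag)
 next
  case (Suc m)
  show ?thesis unfolding Suc coboundaries_def nat.case mod_ker_def using dd mod_homD(1)[OF d] by blast
 qed
 show "module R (cohomology K d n)" unfolding cohomology_def by (rule module_subquot[OF K z b s])
qed

lemma ext_complex:
 assumes C: "category C" and R: "cring R" and N: "left_module C R N" and M: "left_module C R M"
 shows "module R (ext_cochains C R N M n)"
  "ext_coboundary C R N n : mod_hom R (ext_cochains C R N M n) (ext_cochains C R N M (Suc n))"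
  "x : carrier (ext_cochains C R N M n) ==> ext_coboundary C R N (Suc n) (ext_coboundary C R N n x) = 0[ext_cochains C R N M (Suc (Suc n))]"
proof -
 note res = projective_resolution_exists[OF C R N]
 note P = projective_resolutionD[OF res]
 have e: "ext_coboundary C R N n f = rest C (res_mod (proj_res C R N) (Suc n)) (%x a. f x (res_diff (proj_res C R N) n x a))"
  for n and f :: "_ => _ => 'x"
  by (simp add: ext_coboundary_def rest_def)
 show "module R (ext_cochains C R N M n)" unfolding ext_cochains_def by (rule module_hom_module[OF R P(2) M])
 show "ext_coboundary C R N n : mod_hom R (ext_cochains C R N M n) (ext_cochains C R N M (Suc n))"
  unfolding ext_cochains_def e[abs_def] by (rule hom_module_precomp[OF P(2) P(2) M P(3)])
 assume x: "x : carrier (ext_cochains C R N M n)"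
 show "ext_coboundary C R N (Suc n) (ext_coboundary C R N n x) = 0[ext_cochains C R N M (Suc (Suc n))]"
  unfolding e ext_cochains_def hom_module_ops
 proof (rule rest_cong)
  fix y a assume y: "y : Obj C" and a: "a : el (res_mod (proj_res C R N) (Suc (Suc n))) y"
  show "rest C (res_mod (proj_res C R N) (Suc n)) (%y a. x y (res_diff (proj_res C R N) n y a)) y (res_diff (proj_res C R N) (Suc n) y a) = 0[mod_at M y]"
   unfolding rest_apply[OF y rc_homD(3)[OF P(3) y a]] resolution_dd(2)[OF res y a]
   by (rule rc_hom_apply_zero[OF P(2) M hom_moduleD(1)[OF x[unfolded ext_cochains_def]] y])
 qed
qed

context transporter_data
begin

abbreviation "HQ \<equiv> centralizer_cohomology R G M"

text \<open>The class in Ext over \<open>C_G(H)\<close> that an invariant cocycle represents. By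
  \<open>ec_rel\<close> every related \<open>z\<close> gives the same coset.\<close>

definition ec :: "nat => 'g set => ('g list => 'a) => (unit => (unit, 'g, 'r, 'r) res_univ => 'a) set" where
 "ec q H \<phi> = EB q H +>\<^bsub>Ec H q\<^esub> (SOME z. relH H q z \<phi>)"

lemma HQ_at: "mod_at (HQ q) H = subquot (Ec H q) (EZ q H) (EB q H)"
 by (simp add: centralizer_cohomology_def Ext_def cohomology_def)

lemma Ec_facts:
 assumes H: "H : \<H>"
 shows "module R (Ec H q)" "submodule (EZ q H) R (Ec H q)" "submodule (EB q H) R (Ec H q)" "EB q H <= EZ q H" "module R (mod_at (HQ q) H)"
proof -
 note e = ext_complex[OF catD[OF H] R left_module_cR[OF H] left_module_MH[OF H]]
 note c = cochain_complex[of R "Ec H" "Ed H", OF e]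
 show "module R (Ec H q)" by (rule e(1))
 show "submodule (EZ q H) R (Ec H q)" "submodule (EB q H) R (Ec H q)" "EB q H <= EZ q H"
  by (rule c(1), assumption, rule c(2), assumption, rule c(3))
 show "module R (mod_at (HQ q) H)" unfolding HQ_at by (rule c(4)[unfolded cohomology_def])
qed

lemma KF_facts:
 assumes H: "H : \<H>"
 shows "module R (mod_at (KF q) H)" "submodule (KZ q H) R (mod_at (KF q) H)" "submodule (KB q H) R (mod_at (KF q) H)" "KB q H <= KZ q H"
proof -
 have HF: "H : Obj F" "H : Obj T" using H by simp_all
 note m = left_moduleD(1)[OF left_module_KF HF(1)]
 have dd: "Kd (Suc q) H (Kd q H \<phi>) = 0[mod_at (KF (Suc (Suc q))) H]" if "\<phi> : el (KF q) H" for q \<phi>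
  using graded_cat.cdiff_cdiff[OF gT M HF(2)] that by simp
 note c = cochain_complex[of R "%q. mod_at (KF q) H" "%q. Kd q H", OF m rc_homD(1)[OF Kd_hom HF(1)] dd]
 show "module R (mod_at (KF q) H)" by (rule m)
 show "submodule (KZ q H) R (mod_at (KF q) H)" "submodule (KB q H) R (mod_at (KF q) H)" "KB q H <= KZ q H"
  by (rule c(1), assumption, rule c(2), assumption, rule c(3))
qed

text \<open>An additive relation that matches coboundaries induces a map on cosets, so two cocycles
  related to one cochain are cohomologous.\<close>

lemma ec_rel:
 assumes H: "H : \<H>" and rel: "relH H q z \<phi>"
 shows "ec q H \<phi> = EB q H +>\<^bsub>Ec H q\<^esub> z"
proof -
 note K = KF_facts[OF H] and E = Ec_facts[OF H] and r = relH_facts[OF H]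
 have "EX f:mod_hom R (subquot (mod_at (KF q) H) (KZ q H) (KB q H)) (subquot (Ec H q) (EZ q H) (EB q H)).
   bij_betw f (carrier (subquot (mod_at (KF q) H) (KZ q H) (KB q H))) (carrier (subquot (Ec H q) (EZ q H) (EB q H))) &
   (ALL \<phi> z. relH H q z \<phi> --> f (KB q H +>\<^bsub>mod_at (KF q) H\<^esub> \<phi>) = EB q H +>\<^bsub>Ec H q\<^esub> z)"
 proof (rule subquot_iso_rel[OF K(1-3) E(1-3)])
  show "\<phi> : KZ q H & z : EZ q H" if "relH H q z \<phi>" for \<phi> z using r(1)[OF that] by (simp only: simp_thms conj_commute)
  show "relH H q (z +[Ec H q] z') (\<phi> +[mod_at (KF q) H] \<phi>')" if "relH H q z \<phi>" "relH H q z' \<phi>'" for \<phi> z \<phi>' z' by (rule r(5)[OF that])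
  show "relH H q (c *[Ec H q] z) (c *[mod_at (KF q) H] \<phi>)" if "c : carrier R" "relH H q z \<phi>" for c \<phi> z by (rule r(6)[OF that])
  show "EX z. relH H q z \<phi>" if "\<phi> : KZ q H" for \<phi> by (rule r(3)[OF that])
  show "EX \<phi>. relH H q z \<phi>" if "z : EZ q H" for z by (rule r(2)[OF that])
  show "\<phi> : KB q H \<longleftrightarrow> z : EB q H" if "relH H q z \<phi>" for \<phi> z by (rule r(4)[OF that, symmetric])
 qed
 then obtain f where f0: "ALL \<phi> z. relH H q z \<phi> --> f (KB q H +>\<^bsub>mod_at (KF q) H\<^esub> \<phi>) = EB q H +>\<^bsub>Ec H q\<^esub> z" by (elim bexE conjE)
 note f = f0[rule_format]
 have "relH H q (SOME z. relH H q z \<phi>) \<phi>" using rel by (rule someI[of "%z. relH H q z \<phi>"])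
 from f[OF this] f[OF rel] show ?thesis unfolding ec_def by simp
qed

lemma ec_hom:
 assumes H: "H : \<H>"
 shows "ec q H : mod_hom R ((mod_at (KF q) H)(|carrier := KZ q H|)) (mod_at (HQ q) H)"
proof (rule mod_homI)
 note E = Ec_facts[OF H] and r = relH_facts[OF H]
 note o = subquot_ops[OF E(1,3)]
 fix \<phi> assume "\<phi> : carrier ((mod_at (KF q) H)(|carrier := KZ q H|))"
 then have p: "\<phi> : KZ q H" by simp
 obtain z where z: "relH H q z \<phi>" using r(3)[OF p] by (rule exE)
 have zc: "z : EZ q H" "z : carrier (Ec H q)" using r(1)[OF z] by (simp_all add: mod_ker_def)
 show "ec q H \<phi> : el (HQ q) H" unfolding ec_rel[OF H z] HQ_at subquot_simps using zc(1) by (rule imageI)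
 show "ec q H (c *[(mod_at (KF q) H)(|carrier := KZ q H|)] \<phi>) = c *[mod_at (HQ q) H] ec q H \<phi>" if c: "c : carrier R" for c
  using ec_rel[OF H r(6)[OF c z]] o(2)[OF c zc(2)] by (simp add: ec_rel[OF H z] HQ_at)
 fix \<phi>' assume "\<phi>' : carrier ((mod_at (KF q) H)(|carrier := KZ q H|))"
 then have p': "\<phi>' : KZ q H" by simp
 obtain z' where z': "relH H q z' \<phi>'" using r(3)[OF p'] by (rule exE)
 have zc': "z' : carrier (Ec H q)" using r(1)[OF z'] by (simp add: mod_ker_def)
 show "ec q H (\<phi> +[(mod_at (KF q) H)(|carrier := KZ q H|)] \<phi>') = ec q H \<phi> +[mod_at (HQ q) H] ec q H \<phi>'"
  using ec_rel[OF H r(5)[OF z z']] o(1)[OF zc(2) zc'] by (simp add: ec_rel[OF H z] ec_rel[OF H z'] HQ_at)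
qed

lemma ec_surj:
 assumes H: "H : \<H>"
 shows "ec q H ` KZ q H = el (HQ q) H"
proof (intro equalityI subsetI)
 fix X assume "X : ec q H ` KZ q H"
 then obtain \<phi> where "X = ec q H \<phi>" "\<phi> : KZ q H" by (rule imageE)
 then show "X : el (HQ q) H" using mod_homD(1)[OF ec_hom[OF H], of \<phi> q] by simp
next
 fix X assume "X : el (HQ q) H"
 then obtain z where z: "X = EB q H +>\<^bsub>Ec H q\<^esub> z" "z : EZ q H" unfolding HQ_at subquot_simps by (rule imageE)
 obtain \<phi> where p: "relH H q z \<phi>" using relH_facts(2)[OF H z(2)] by (rule exE)
 show "X : ec q H ` KZ q H" by (rule image_eqI[OF _ conjunct2[OF relH_facts(1)[OF H p]]]) (simp only: z(1) ec_rel[OF H p])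
qed

lemma ec_zero:
 assumes H: "H : \<H>" and p: "\<phi> : KZ q H"
 shows "ec q H \<phi> = 0[mod_at (HQ q) H] \<longleftrightarrow> \<phi> : KB q H"
proof -
 obtain z where z: "relH H q z \<phi>" using relH_facts(3)[OF H p] by (rule exE)
 have zc: "z : carrier (Ec H q)" using relH_facts(1)[OF H z] by (simp add: mod_ker_def)
 show ?thesis unfolding ec_rel[OF H z] HQ_at subquot_simps coset_zero[OF Ec_facts(1,3)[OF H] zc] by (rule relH_facts(4)[OF H z])
qed

context
 fixes H K X
 assumes H: "H : \<H>" and K: "K : \<H>" and X: "X : Hom F H K"
begin

lemma some_trans: "(SOME g. g : X) : transporter_set G H K"
proof -
 obtain g where g: "g : transporter_set G H K" "X = g <# cz H" using X by auto
 obtain c where "c : cz H" "(SOME g. g : X) = g \<otimes> c" using some_coset[OF H trans_carrier[OF g(1)]] unfolding g(2) .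
 then show ?thesis using transporter_set_mult[OF is_group sub[OF H] sub[OF H] cz_Hom[OF H] g(1)] by simp
qed

lemma KF_map:
 "\<phi> : el (KF q) H ==> mod_map (KF q) H K X \<phi> : el (KF q) K"
 "\<phi> : KZ q H ==> mod_map (KF q) H K X \<phi> : KZ q K" "\<phi> : KB q H ==> mod_map (KF q) H K X \<phi> : KB q K"
proof -
 have HK: "H : Obj F" "K : Obj F" using H K by simp_all
 note m = left_moduleD(2)[OF left_module_KF HK X] and n = rc_homD(2)[OF Kd_hom HK X]
 have z: "mod_map (KF q) H K X 0[mod_at (KF q) H] = 0[mod_at (KF q) K]" for q
  by (rule mod_hom_zero[OF m module_ag[OF KF_facts(1)[OF H]] module_ag[OF KF_facts(1)[OF K]]])
 show c: "mod_map (KF q) H K X \<phi> : el (KF q) K" if "\<phi> : el (KF q) H" for q \<phi> by (rule mod_homD(1)[OF m that])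
 show "mod_map (KF q) H K X \<phi> : KZ q K" if p: "\<phi> : KZ q H"
 proof -
  have p': "\<phi> : el (KF q) H" "Kd q H \<phi> = 0[mod_at (KF (Suc q)) H]" using p by (simp_all only: mod_ker_def mem_Collect_eq)
  show ?thesis unfolding mod_ker_def mem_Collect_eq n[OF p'(1)] p'(2) using c[OF p'(1)] z by (rule conjI)
 qed
 show "mod_map (KF q) H K X \<phi> : KB q K" if p: "\<phi> : KB q H"
 proof (cases q)
  case 0
  then show ?thesis using p z[of 0] by (simp only: coboundaries_def nat.case singleton_iff)
 next
  case (Suc m)
  obtain \<psi> where s: "\<phi> = Kd m H \<psi>" "\<psi> : el (KF m) H" using p unfolding Suc coboundaries_def nat.case by (rule imageE)
  show ?thesis unfolding Suc coboundaries_def nat.case s(1) n[OF s(2), symmetric] by (rule imageI[OF c[OF s(2)]])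
 qed
qed

text \<open>The action on cohomology picks some \<open>f\<close> in the class and some comparison
  map. \<open>f\<close> differs from \<open>z\<close> by a coboundary, to which an invariant
  coboundary \<open>\<beta>\<close> is related; \<open>relH_natural\<close> for
  \<open>\<beta> + \<phi>\<close> then gives the claim up to the class of the image of
  \<open>\<beta>\<close>, which is zero.\<close>

lemma ec_natural:
 assumes p: "\<phi> : KZ q H"
 shows "mod_map (HQ q) H K X (ec q H \<phi>) = ec q K (mod_map (KF q) H K X \<phi>)"
proof -
 let ?g = "SOME g. g : X"
 note E = Ec_facts[OF H] and r = relH_facts[OF H]
 note g = some_trans
 \<comment> \<open>Invariants and cohomology act through the same chosen representative of
   \<open>X\<close>, so no change of representative has to be followed.\<close>
 have \<Theta>: "mod_map (coch G (Suc q) M) H K ?g \<psi> = mod_map (KF q) H K X \<psi>" for \<psi> by (simp add: inv_left_def)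
 define \<tau> where "\<tau> = (SOME \<tau>. is_comparison R (centralizer_group G K) (centralizer_group G H) (%c. inv ?g \<otimes> c \<otimes> ?g) \<tau>)"
 have cmp: "is_comparison R (centralizer_group G K) (centralizer_group G H) (%c. inv ?g \<otimes> c \<otimes> ?g) \<tau>"
  unfolding \<tau>_def by (rule someI_ex[OF comparison_exists[OF H K g]])
 obtain z where z: "relH H q z \<phi>" using r(3)[OF p] by (rule exE)
 have zc: "z : carrier (Ec H q)" using r(1)[OF z] by (simp add: mod_ker_def)
 define f where "f = (SOME f. f : ec q H \<phi>)"
 have "z : ec q H \<phi>" unfolding ec_rel[OF H z] by (rule coset_self[OF E(1,3) zc])
 then have "f : ec q H \<phi>" unfolding f_def by (rule someI[of "%f. f : ec q H \<phi>"])
 then have fb: "f : carrier (Ec H q)" "f -[Ec H q] z : EB q H" unfolding ec_rel[OF H z] coset_mem_iff[OF E(1,3) zc] by simp_all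
 let ?b = "f -[Ec H q] z"
 have feq: "?b +[Ec H q] z = f"
  using module_ag[OF E(1)] fb(1) zc by - (rule ab_eqI[of "Ec H q"], simp add: ab)
 obtain \<beta> where b: "relH H q ?b \<beta>" using r(2)[OF subsetD[OF E(4) fb(2)]] by (rule exE)
 have bK: "\<beta> : KB q H" using r(4)[OF b] fb(2) by simp
 have bc: "\<beta> : KZ q H" "\<beta> : el (KF q) H" "\<phi> : el (KF q) H"
  using r(1)[OF b] p by (simp_all add: mod_ker_def)
 have rf: "relH H q f (\<beta> +[mod_at (KF q) H] \<phi>)" using r(5)[OF b z] unfolding feq .
 note nat = relH_natural[OF H K g cmp rf, unfolded \<Theta>]
 have HK: "H : Obj F" "K : Obj F" using H K by simp_all
 have "mod_map (KF q) H K X (\<beta> +[mod_at (KF q) H] \<phi>) = mod_map (KF q) H K X \<beta> +[mod_at (KF q) K] mod_map (KF q) H K X \<phi>"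
  by (rule mod_homD(2)[OF left_moduleD(2)[OF left_module_KF HK X] bc(2,3)])
 then have "ec q K (mod_map (KF q) H K X (\<beta> +[mod_at (KF q) H] \<phi>))
   = ec q K (mod_map (KF q) H K X \<beta>) +[mod_at (HQ q) K] ec q K (mod_map (KF q) H K X \<phi>)"
  using mod_homD(2)[OF ec_hom[OF K, of q], of "mod_map (KF q) H K X \<beta>" "mod_map (KF q) H K X \<phi>"] KF_map(2)[OF bc(1)] KF_map(2)[OF p] by simp
 also have "ec q K (mod_map (KF q) H K X \<beta>) = 0[mod_at (HQ q) K]"
  using ec_zero[OF K KF_map(2)[OF bc(1)]] KF_map(3)[OF bK] by blast
 also have "\<dots> +[mod_at (HQ q) K] ec q K (mod_map (KF q) H K X \<phi>) = ec q K (mod_map (KF q) H K X \<phi>)"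
  using mod_homD(1)[OF ec_hom[OF K, of q], of "mod_map (KF q) H K X \<phi>"] KF_map(2)[OF p]
  by (intro abelian_group.ag_rules(5)[OF module_ag[OF Ec_facts(5)[OF K]]]) simp
 finally have "ec q K (mod_map (KF q) H K X \<phi>) = EB q K +>\<^bsub>Ec K q\<^esub>
   (\<lambda>x\<in>UNIV. \<lambda>a\<in>el (res_mod (RP K) q) x. mod_map M H K ?g (f x (\<tau> q x a)))"
  unfolding ec_rel[OF K nat] by (rule sym)
 then show ?thesis
  by (simp only: centralizer_cohomology_def centralizer_cohomology_map_def group_cohomology_map_def Let_def \<tau>_def f_def rcmod.simps)
qed

end

abbreviation "ZKF q \<equiv> sub_left (KF q) (%H. KZ q H)"

lemma left_module_ZKF: "left_module F R (ZKF q)"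
 by (rule left_module_ker[OF left_module_KF left_module_KF Kd_hom])

lemma ZKF_at: "mod_at (ZKF q) H = (mod_at (KF q) H)(|carrier := KZ q H|)" "mod_map (ZKF q) = mod_map (KF q)"
 by (simp_all add: sub_left_def)

text \<open>The functor laws pass from invariant cocycles to classes. Independence of the
  representative is thus settled on invariants, on which centralizers act trivially, rather than
  through inner automorphisms acting on cohomology.\<close>

lemma HQ_facts: "left_module F R (HQ q)" "ec q : rc_hom F R (ZKF q) (HQ q)"
proof -
 have a: "module R (mod_at (HQ q) H)" "ec q H : mod_hom R (mod_at (ZKF q) H) (mod_at (HQ q) H)"
  "ec q H ` el (ZKF q) H = el (HQ q) H" if "H : Obj F" for H
  using that Ec_facts(5) ec_hom ec_surj by (simp_all add: ZKF_at)
 have n: "mod_map (HQ q) H K X (ec q H \<phi>) = ec q K (mod_map (ZKF q) H K X \<phi>)"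
  if "H : Obj F" "K : Obj F" "X : Hom F H K" "\<phi> : el (ZKF q) H" for H K X \<phi>
  using ec_natural[of H K X \<phi> q] that unfolding ZKF_at by simp
 show "left_module F R (HQ q)"
  by (rule left_module_surjective(1)[where Z = "ZKF q" and e = "ec q"])
   (rule left_module_ZKF catF | (rule a(1) a(2) a(3), assumption) | (rule n, assumption+))+
 show "ec q : rc_hom F R (ZKF q) (HQ q)"
  by (rule left_module_surjective(2)[where Z = "ZKF q" and e = "ec q"])
   (rule left_module_ZKF catF | (rule a(1) a(2) a(3), assumption) | (rule n, assumption+))+
qed

end

section \<open>The spectral sequence of a filtered complex\<close>

text \<open>Degrees are linked by premises like \<open>m = n + 1\<close>, so that the rules match
  integer expressions of any shape. \<open>Fi_low\<close> and \<open>Fi_high\<close> make the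
  filtration finite in each degree and put the spectral sequence into the first quadrant.\<close>

locale filtered_complex =
 fixes R :: "('r, 's) ring_scheme" and A :: "int => ('r, 'k) module" and \<delta> :: "int => 'k => 'k" and Fi :: "int => int => 'k set"
 assumes A: "!!n. module R (A n)" and \<delta>: "!!n m. m = n + 1 ==> \<delta> n : mod_hom R (A n) (A m)"
  and \<delta>\<delta>: "!!n m k x. x : carrier (A n) ==> m = n + 1 ==> k = n + 2 ==> \<delta> m (\<delta> n x) = 0[A k]"
  and Fi: "!!n p. submodule (Fi n p) R (A n)" and Fi_mono: "!!n p p'. p <= p' ==> Fi n p' <= Fi n p"
  and Fi_stable: "!!n m p x. x : Fi n p ==> m = n + 1 ==> \<delta> n x : Fi m p"
  and Fi_low: "!!n p. p <= 0 ==> Fi n p = carrier (A n)" and Fi_high: "!!n p. n < p ==> Fi n p = {0[A n]}"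
begin

text \<open>With \<open>Br\<close> these are the standard terms \<open>Z_r\<close> and
  \<open>B_r\<close> of a filtered complex, in total degree \<open>n\<close> and filtration degree
  \<open>p\<close>; integer indices keep \<open>p - r + 1\<close> meaningful below zero.\<close>

definition Zr :: "int => int => int => 'k set" where
 "Zr r n p = {x : Fi n p. \<delta> n x : Fi (n + 1) (p + r)}"

definition Br :: "int => int => int => 'k set" where
 "Br r n p = {x +[A n] y | x y. x : Zr (r - 1) n (p + 1) & y : \<delta> (n - 1) ` Zr (r - 1) (n - 1) (p - r + 1)}"

definition EE :: "int => int => int => ('r, 'k set) module" where
 "EE r n p = subquot (A n) (Zr r n p) (Br r n p)"

definition dd :: "int => int => int => 'k set => 'k set" where
 "dd r n p X = Br r (n + 1) (p + r) +>\<^bsub>A (n + 1)\<^esub> \<delta> n (SOME x. x : X)"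

lemma abA: "abelian_group (A n)"
 by (rule module_ag[OF A])

lemma \<delta>0: "m = n + 1 ==> \<delta> n 0[A n] = 0[A m]"
 by (rule mod_hom_zero[OF \<delta> abA abA])

lemma Fi_car: "x : Fi n p ==> x : carrier (A n)"
 by (rule submodD(2)[OF Fi A])

lemma Zr_iff: "m = n + 1 ==> k = p + r ==> x : Zr r n p \<longleftrightarrow> x : Fi n p & \<delta> n x : Fi m k"
 by (simp add: Zr_def)

lemma Zr_car: "x : Zr r n p ==> x : carrier (A n)"
 by (auto simp: Zr_def intro: Fi_car)

lemma submodule_Zr: "submodule (Zr r n p) R (A n)"
 unfolding Zr_def by (rule submodule_vimage[OF A A \<delta> Fi Fi]) simp

lemma submodule_Br: "submodule (Br r n p) R (A n)"
 unfolding Br_def by (rule submodule_sum[OF A submodule_Zr submodule_image[OF A A \<delta> submodule_Zr]]) simp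

lemma Br_I:
 assumes "x : Zr (r - 1) n k" "k = p + 1" "y : Zr (r - 1) m l" "n = m + 1" "l = p - r + 1"
 shows "x +[A n] \<delta> m y : Br r n p"
proof -
 have m: "m = n - 1" using assms(4) by simp
 show ?thesis unfolding Br_def using assms(1,3) unfolding assms(2,5) m by blast
qed

lemma Br_E:
 assumes "x : Br r n p" "n = m + 1"
 obtains u v where "u : Zr (r - 1) n (p + 1)" "v : Zr (r - 1) m (p - r + 1)" "x = u +[A n] \<delta> m v"
proof -
 have m: "n - 1 = m" using assms(2) by simp
 from assms(1) obtain u y where u: "u : Zr (r - 1) n (p + 1)" "y : \<delta> m ` Zr (r - 1) m (p - r + 1)" "x = u +[A n] y"
  unfolding Br_def m by blast
 from u(2) obtain v where "y = \<delta> m v" "v : Zr (r - 1) m (p - r + 1)" by (rule imageE)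
 then show thesis using that u by blast
qed

lemma zero_Zr: "0[A n] : Zr r n p"
 by (rule submodD(3)[OF submodule_Zr A])

lemma Br_I1:
 assumes "x : Zr (r - 1) n (p + 1)"
 shows "x : Br r n p"
 using Br_I[OF assms refl zero_Zr[of "n - 1" "r - 1" "p - r + 1"]] \<delta>0[of n "n - 1"] Zr_car[OF assms] abA by (simp add: ag)

lemma Br_I2:
 assumes "y : Zr (r - 1) m l" "n = m + 1" "l = p - r + 1"
 shows "\<delta> m y : Br r n p"
 using Br_I[OF zero_Zr refl assms] mod_homD(1)[OF \<delta>[OF assms(2)] Zr_car[OF assms(1)]] abA by (simp add: ag)

text \<open>A coboundary has differential zero, which lies in every step of the filtration; hence
  the free \<open>r'\<close>.\<close>

lemma \<delta>_Zr:
 assumes x: "x : Zr r n p" and m: "m = n + 1" and k: "k = p + r"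
 shows "\<delta> n x : Zr r' m k"
proof -
 have "\<delta> m (\<delta> n x) = 0[A (m + 1)]" by (rule \<delta>\<delta>[OF Zr_car[OF x] m]) (simp add: m)
 then show ?thesis using x[unfolded Zr_iff[OF m k]] submodD(3)[OF Fi A] unfolding Zr_def by simp
qed

lemma Zr_shift: "x : Zr (r - 1) n (p + 1) ==> x : Zr r n p"
 using Fi_mono[of p "p + 1" n] by (auto simp: Zr_def)

lemma Br_sub: "Br r n p <= Zr r n p"
proof
 fix x assume "x : Br r n p"
 then obtain u v where uv: "u : Zr (r - 1) n (p + 1)" "v : Zr (r - 1) (n - 1) (p - r + 1)" "x = u +[A n] \<delta> (n - 1) v"
  using Br_E[of x r n p "n - 1"] by auto
 have "\<delta> (n - 1) v : Zr r n p" by (rule \<delta>_Zr[OF uv(2)]) simp_all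
 then show "x : Zr r n p" unfolding uv(3) using submodD(4)[OF submodule_Zr A Zr_shift[OF uv(1)]] by blast
qed

lemma module_EE: "module R (EE r n p)"
 unfolding EE_def by (rule module_subquot[OF A submodule_Zr submodule_Br Br_sub])

lemma \<delta>_Br:
 assumes x: "x : Br r n p" and m: "m = n + 1" and k: "k = p + r"
 shows "\<delta> n x : Br r m k"
proof -
 obtain u v where uv: "u : Zr (r - 1) n (p + 1)" "v : Zr (r - 1) (n - 1) (p - r + 1)" "x = u +[A n] \<delta> (n - 1) v"
  using Br_E[OF x, of "n - 1"] by auto
 have dv: "\<delta> (n - 1) v : carrier (A n)" "\<delta> n (\<delta> (n - 1) v) = 0[A m]"
  using mod_homD(1)[OF \<delta>[of n "n - 1"] Zr_car[OF uv(2)]] \<delta>\<delta>[OF Zr_car[OF uv(2)], of n m] m by simp_all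
 have "\<delta> n x = \<delta> n u"
  unfolding uv(3) mod_homD(2)[OF \<delta>[OF m] Zr_car[OF uv(1)] dv(1)] dv(2)
  using mod_homD(1)[OF \<delta>[OF m] Zr_car[OF uv(1)]] abA by (simp add: ag)
 then show ?thesis using Br_I2[OF uv(1) m, of k] k by simp
qed

lemma dd_coset:
 assumes z: "z : Zr r n p" and m: "m = n + 1" and k: "k = p + r"
 shows "dd r n p (Br r n p +>\<^bsub>A n\<^esub> z) = Br r m k +>\<^bsub>A m\<^esub> \<delta> n z"
proof -
 note zc = Zr_car[OF z]
 let ?f = "SOME x. x : Br r n p +>\<^bsub>A n\<^esub> z"
 have "?f : Br r n p +>\<^bsub>A n\<^esub> z" using coset_self[OF A submodule_Br zc] by (rule someI)
 then have f: "?f : carrier (A n)" "?f -[A n] z : Br r n p" unfolding coset_mem_iff[OF A submodule_Br zc] by simp_all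
 note dm = \<delta>[OF m]
 have "\<delta> n ?f -[A m] \<delta> n z : Br r m k"
  using \<delta>_Br[OF f(2) m k] unfolding mod_hom_minus[OF dm abA abA f(1) zc] .
 then show ?thesis unfolding dd_def m[symmetric] k[symmetric]
  using coset_eq_iff[OF A submodule_Br mod_homD(1)[OF dm f(1)] mod_homD(1)[OF dm zc]] by blast
qed

lemma EE_E:
 assumes "X : carrier (EE r n p)"
 obtains z where "z : Zr r n p" "X = Br r n p +>\<^bsub>A n\<^esub> z"
 using assms unfolding EE_def subquot_simps by (elim imageE) (rule that)

lemma EE_I: "z : Zr r n p ==> Br r n p +>\<^bsub>A n\<^esub> z : carrier (EE r n p)"
 unfolding EE_def subquot_simps by (rule imageI)

lemma EE_zero: "0[EE r n p] = Br r n p"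
 by (simp add: EE_def subquot_simps)

lemma EE_ops:
 assumes "x : Zr r n p"
 shows "y : Zr r n p ==> (Br r n p +>\<^bsub>A n\<^esub> x) +[EE r n p] (Br r n p +>\<^bsub>A n\<^esub> y) = Br r n p +>\<^bsub>A n\<^esub> (x +[A n] y)"
  "c : carrier R ==> c *[EE r n p] (Br r n p +>\<^bsub>A n\<^esub> x) = Br r n p +>\<^bsub>A n\<^esub> (c *[A n] x)"
 unfolding EE_def using subquot_ops[OF A submodule_Br] Zr_car[OF assms] Zr_car by blast+

lemma dd_hom:
 assumes m: "m = n + 1" and k: "k = p + r"
 shows "dd r n p : mod_hom R (EE r n p) (EE r m k)"
proof (rule mod_homI)
 fix X assume "X : carrier (EE r n p)"
 then obtain x where x: "x : Zr r n p" "X = Br r n p +>\<^bsub>A n\<^esub> x" by (rule EE_E)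
 note dx = \<delta>_Zr[OF x(1) m k]
 show "dd r n p X : carrier (EE r m k)" unfolding x(2) dd_coset[OF x(1) m k] by (rule EE_I[OF dx])
 show "dd r n p (c *[EE r n p] X) = c *[EE r m k] dd r n p X" if c: "c : carrier R" for c
  unfolding x(2) EE_ops(2)[OF x(1) c] dd_coset[OF x(1) m k] dd_coset[OF submodD(7)[OF submodule_Zr A c x(1)] m k]
   EE_ops(2)[OF dx c] mod_homD(3)[OF \<delta>[OF m] c Zr_car[OF x(1)]] ..
 fix Y assume "Y : carrier (EE r n p)"
 then obtain y where y: "y : Zr r n p" "Y = Br r n p +>\<^bsub>A n\<^esub> y" by (rule EE_E)
 note dy = \<delta>_Zr[OF y(1) m k]
 show "dd r n p (X +[EE r n p] Y) = dd r n p X +[EE r m k] dd r n p Y"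
  unfolding x(2) y(2) EE_ops(1)[OF x(1) y(1)] dd_coset[OF x(1) m k] dd_coset[OF y(1) m k] dd_coset[OF submodD(4)[OF submodule_Zr A x(1) y(1)] m k]
   EE_ops(1)[OF dx dy] mod_homD(2)[OF \<delta>[OF m] Zr_car[OF x(1)] Zr_car[OF y(1)]] ..
qed

lemma dd_dd:
 assumes X: "X : carrier (EE r n p)" and m: "m = n + 1" "m' = n + 2" and k: "k = p + r" "k' = p + 2 * r"
 shows "dd r m k (dd r n p X) = 0[EE r m' k']"
proof -
 obtain x where x: "x : Zr r n p" "X = Br r n p +>\<^bsub>A n\<^esub> x" using X by (rule EE_E)
 have m': "m' = m + 1" "k' = k + r" using m k by simp_all
 show ?thesis
  unfolding x(2) dd_coset[OF x(1) m(1) k(1)] dd_coset[OF \<delta>_Zr[OF x(1) m(1) k(1)] m'] \<delta>\<delta>[OF Zr_car[OF x(1)] m] EE_zero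
  using coset_zero[OF A submodule_Br submodD(3)[OF submodule_carrier[OF A] A]] submodD(3)[OF submodule_Br A] by blast
qed

text \<open>The relation takes an element of \<open>Zr (r + 1) n p\<close> to its class on page
  \<open>r\<close>. The work is to find such a representative for every class in the kernel of the
  differential, and to match \<open>Br (r + 1) n p\<close> with the image.\<close>

lemma EE_step:
 assumes m: "m = n + 1" and k: "k = p + r" and m': "n = m' + 1" and k': "p = k' + r"
 shows "mod_iso R (EE (r + 1) n p) (subquot (EE r n p) (mod_ker (EE r n p) (EE r m k) (dd r n p)) (dd r m' k' ` carrier (EE r m' k')))"
  (is "mod_iso R _ (subquot _ ?Ker ?Im)")
 unfolding EE_def[of "r + 1"]
proof (rule mod_iso_subquot_rel[where S = "%z c. z : Zr (r + 1) n p & c = Br r n p +>\<^bsub>A n\<^esub> z", OF A submodule_Zr submodule_Br module_EE])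
 have Z1: "z : Zr r n p" if "z : Zr (r + 1) n p" for z
  using that Fi_mono[of "p + r" "p + r + 1" "n + 1"] by (auto simp: Zr_def add.assoc)
 show "submodule ?Ker R (EE r n p)" by (rule submodule_ker[OF module_EE module_EE dd_hom[OF m k]])
 show "submodule ?Im R (EE r n p)" by (rule submodule_image[OF module_EE module_EE dd_hom[OF m' k'] submodule_carrier[OF module_EE]])
 have ker: "Br r n p +>\<^bsub>A n\<^esub> x : ?Ker \<longleftrightarrow> \<delta> n x : Br r m k" if x: "x : Zr r n p" for x
  unfolding mod_ker_def mem_Collect_eq EE_zero dd_coset[OF x m k]
   coset_zero[OF A submodule_Br Zr_car[OF \<delta>_Zr[OF x m k, of r]]] using EE_I[OF x] by blast
 show "z : Zr (r + 1) n p & c : ?Ker" if "z : Zr (r + 1) n p & c = Br r n p +>\<^bsub>A n\<^esub> z" for z c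
 proof -
  have "\<delta> n z : Zr (r - 1) m (k + 1)" using \<delta>_Zr[of z "r + 1" n p m "k + 1" "r - 1"] that m k by simp
  then show ?thesis using ker[OF Z1] that Br_I1 by blast
 qed
 show "z +[A n] y : Zr (r + 1) n p & c +[EE r n p] c' = Br r n p +>\<^bsub>A n\<^esub> (z +[A n] y)"
  if "z : Zr (r + 1) n p & c = Br r n p +>\<^bsub>A n\<^esub> z" "y : Zr (r + 1) n p & c' = Br r n p +>\<^bsub>A n\<^esub> y" for z c y c'
  using that EE_ops(1)[OF Z1 Z1] submodD(4)[OF submodule_Zr A] by blast
 show "a *[A n] z : Zr (r + 1) n p & a *[EE r n p] c = Br r n p +>\<^bsub>A n\<^esub> (a *[A n] z)"
  if "a : carrier R" "z : Zr (r + 1) n p & c = Br r n p +>\<^bsub>A n\<^esub> z" for a z c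
  using that EE_ops(2)[OF Z1] submodD(7)[OF submodule_Zr A] by blast
 show "EX c. z : Zr (r + 1) n p & c = Br r n p +>\<^bsub>A n\<^esub> z" if "z : Zr (r + 1) n p" for z using that by blast
 show "EX z. z : Zr (r + 1) n p & c = Br r n p +>\<^bsub>A n\<^esub> z" if c: "c : ?Ker" for c
 proof -
  have "c : carrier (EE r n p)" using c by (simp add: mod_ker_def)
  then obtain x where x: "x : Zr r n p" "c = Br r n p +>\<^bsub>A n\<^esub> x" by (rule EE_E)
  have "\<delta> n x : Br r m k" using ker[OF x(1)] c x(2) by blast
  then obtain u y where uy: "u : Zr (r - 1) m (k + 1)" "y : Zr (r - 1) n (k - r + 1)" "\<delta> n x = u +[A m] \<delta> n y" using Br_E[OF _ m] by blast
  have y: "y : Zr (r - 1) n (p + 1)" using uy(2) k by simp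
  \<comment> \<open>\<open>\<delta> n x\<close> is \<open>u\<close> plus
    \<open>\<delta> n y\<close>. Removing \<open>y\<close> does not change the class and leaves the
    differential \<open>u\<close>, which lies one step deeper in the filtration.\<close>
  let ?z = "x -[A n] y"
  note xc = Zr_car[OF x(1)] and yc = Zr_car[OF y] and uc = Zr_car[OF uy(1)]
  have dy: "\<delta> n y : carrier (A m)" by (rule mod_homD(1)[OF \<delta>[OF m] yc])
  have "\<delta> n ?z = u"
   unfolding mod_hom_minus[OF \<delta>[OF m] abA abA xc yc] uy(3) using abA uc dy by - (rule ab_eqI[of "A m"], simp add: ab)
  moreover have "u : Fi m (k + 1)" using uy(1) by (simp add: Zr_def)
  moreover have "?z : Fi n p" using submodD(6)[OF Fi A] x(1) Zr_shift[OF y] by (simp add: Zr_def)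
  ultimately have z: "?z : Zr (r + 1) n p" using m k by (simp add: Zr_def add.assoc)
  have "x -[A n] ?z = y" using abA xc yc by - (rule ab_eqI[of "A n"], simp add: ab)
  then have "Br r n p +>\<^bsub>A n\<^esub> x = Br r n p +>\<^bsub>A n\<^esub> ?z"
   using coset_eq_iff[OF A submodule_Br xc Zr_car[OF z]] Br_I1[OF y] by simp
  then show ?thesis using z x(2) by blast
 qed
 show "z : Br (r + 1) n p \<longleftrightarrow> c : ?Im" if S: "z : Zr (r + 1) n p & c = Br r n p +>\<^bsub>A n\<^esub> z" for z c
 proof
  have z: "z : Zr (r + 1) n p" and c: "c = Br r n p +>\<^bsub>A n\<^esub> z" using S by simp_all
  note zc = Zr_car[OF z]
  have k'': "k' = p - r" using k' by simp
  {
   assume "z : Br (r + 1) n p"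
   then obtain u y where uy: "u : Zr (r + 1 - 1) n (p + 1)" "y : Zr (r + 1 - 1) m' (p - (r + 1) + 1)" "z = u +[A n] \<delta> m' y" using Br_E[OF _ m'] by blast
   have y: "y : Zr r m' k'" using uy(2) k'' by simp
   have "u : Zr (r - 1) n (p + 1)" using uy(1) Fi_mono[of "p + r" "p + 1 + r" "n + 1"] by (auto simp: Zr_def)
   from Br_I1[OF this] have uB: "u : Br r n p" .
   have uc: "u : carrier (A n)" and dy: "\<delta> m' y : carrier (A n)" using Zr_car[OF uy(1)] mod_homD(1)[OF \<delta>[OF m'] Zr_car[OF y]] by simp_all
   have "z -[A n] \<delta> m' y = u" unfolding uy(3) using abA uc dy by - (rule ab_eqI[of "A n"], simp add: ab)
   then have "c = Br r n p +>\<^bsub>A n\<^esub> \<delta> m' y" unfolding c using coset_eq_iff[OF A submodule_Br zc dy] uB by simp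
   then show "c : ?Im" using dd_coset[OF y m' k'] EE_I[OF y] by blast
  next
   assume "c : ?Im"
   then obtain Y where Y: "c = dd r m' k' Y" "Y : carrier (EE r m' k')" by (rule imageE)
   obtain y where y1: "y : Zr r m' k'" "Y = Br r m' k' +>\<^bsub>A m'\<^esub> y" using Y(2) by (rule EE_E)
   have y: "y : Zr r m' k'" "c = Br r n p +>\<^bsub>A n\<^esub> \<delta> m' y"
    using y1(1) Y(1) unfolding y1(2) dd_coset[OF y1(1) m' k'] by simp_all
   note yc = Zr_car[OF y(1)]
   have dy: "\<delta> m' y : carrier (A n)" by (rule mod_homD(1)[OF \<delta>[OF m'] yc])
   have "z -[A n] \<delta> m' y : Br r n p" by (rule iffD1[OF coset_eq_iff[OF A submodule_Br zc dy]]) (rule trans[OF c[symmetric] y(2)])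
   then obtain u v where uv: "u : Zr (r - 1) n (p + 1)" "v : Zr (r - 1) m' (p - r + 1)" "z -[A n] \<delta> m' y = u +[A n] \<delta> m' v"
    using Br_E[OF _ m'] by blast
   note uc = Zr_car[OF uv(1)] and vc = Zr_car[OF uv(2)]
   have dv: "\<delta> m' v : carrier (A n)" by (rule mod_homD(1)[OF \<delta>[OF m'] vc])
   let ?y = "v +[A m'] y"
   have v: "v : Zr r m' k'" using Zr_shift[of v r m' k'] uv(2) k'' by simp
   have yv: "?y : Zr r m' k'" by (rule submodD(4)[OF submodule_Zr A v y(1)])
   have dyv: "\<delta> m' ?y = \<delta> m' v +[A n] \<delta> m' y" by (rule mod_homD(2)[OF \<delta>[OF m'] vc yc])
   have "z = (z -[A n] \<delta> m' y) +[A n] \<delta> m' y" using abA zc dy by - (rule ab_eqI[of "A n"], simp add: ab)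
   then have z_eq: "z = u +[A n] \<delta> m' ?y" unfolding uv(3) dyv using abelian_group.ag_assoc[OF abA uc dv dy] by simp
   have ddy: "\<delta> n (\<delta> m' ?y) = 0[A m]" using \<delta>\<delta>[OF Zr_car[OF yv], of n m] m m' by simp
   have dyc: "\<delta> m' ?y : carrier (A n)" by (rule mod_homD(1)[OF \<delta>[OF m'] Zr_car[OF yv]])
   \<comment> \<open>So far \<open>u\<close> is a cycle for \<open>r - 1\<close> only. As its
     differential is that of \<open>z\<close>, which lies one step deeper, \<open>u\<close> is a
     cycle for \<open>r\<close>, as \<open>Br (r + 1)\<close> demands.\<close>
   have "\<delta> n z = \<delta> n u"
    using mod_homD(2)[OF \<delta>[OF m] uc dyc] ddy mod_homD(1)[OF \<delta>[OF m] uc] abA unfolding z_eq by (simp add: ag)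
   moreover have "\<delta> n z : Fi m (p + 1 + r)" using z m by (simp add: Zr_def algebra_simps)
   ultimately have u: "u : Zr (r + 1 - 1) n (p + 1)" using uv(1) m by (simp add: Zr_def)
   show "z : Br (r + 1) n p" unfolding z_eq by (rule Br_I[OF u refl _ m']) (use yv k'' in simp_all)
  }
 qed
qed

definition Er :: "nat => int => int => ('r, 'k set) module" where
 "Er r p q = EE (int r) (p + q) p"

definition dr :: "nat => int => int => 'k set => 'k set" where
 "dr r p q = dd (int r) (p + q) p"

lemma spectral: "spectral_sequence R Er dr"
 unfolding spectral_sequence_def Er_def dr_def
proof (intro allI impI conjI ballI)
 fix r :: nat and p q :: int
 show "module R (EE (int r) (p + q) p)" by (rule module_EE)
 show "dd (int r) (p + q) p : mod_hom R (EE (int r) (p + q) p) (EE (int r) (p + int r + (q - int r + 1)) (p + int r))"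
  by (rule dd_hom) simp_all
 show "dd (int r) (p + int r + (q - int r + 1)) (p + int r) (dd (int r) (p + q) p x)
   = 0[EE (int r) (p + 2 * int r + (q - 2 * int r + 2)) (p + 2 * int r)]" if "x : carrier (EE (int r) (p + q) p)" for x
  by (rule dd_dd[OF that]) simp_all
 have S: "int (Suc r) = int r + 1" by simp
 show "mod_iso R (EE (int (Suc r)) (p + q) p) (subquot (EE (int r) (p + q) p)
   (mod_ker (EE (int r) (p + q) p) (EE (int r) (p + int r + (q - int r + 1)) (p + int r)) (dd (int r) (p + q) p))
   (dd (int r) (p - int r + (q + int r - 1)) (p - int r) ` carrier (EE (int r) (p - int r + (q + int r - 1)) (p - int r))))"
  unfolding S by (rule EE_step) simp_all
qed

text \<open>For \<open>p < 0\<close> the steps \<open>p\<close> and \<open>p + 1\<close> of the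
  filtration are both the whole module, so every cycle is already counted in \<open>Br\<close>; for
  \<open>q < 0\<close> the step \<open>p\<close> exceeds the total degree and is zero.\<close>

lemma first_quadrant_Er: "first_quadrant Er"
 unfolding first_quadrant_def Er_def
proof (intro allI impI)
 fix r :: nat and p q :: int assume "p < 0 \<or> q < 0"
 have "Zr (int r) (p + q) p <= Br (int r) (p + q) p"
 proof (cases "p < 0")
  case True
  then show ?thesis using Fi_low[of p "p + q"] Fi_low[of "p + 1" "p + q"] by (intro subsetI Br_I1) (auto simp: Zr_def)
 next
  case False
  then have "Fi (p + q) p = {0[A (p + q)]}" using \<open>p < 0 \<or> q < 0\<close> by (intro Fi_high) simp
  then show ?thesis using submodD(3)[OF submodule_Br A] by (auto simp: Zr_def)
 qed
 then have c: "Br (int r) (p + q) p +>\<^bsub>A (p + q)\<^esub> z = Br (int r) (p + q) p" if "z : Zr (int r) (p + q) p" for z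
  using coset_zero[OF A submodule_Br Zr_car[OF that]] that by blast
 have "(%z. Br (int r) (p + q) p +>\<^bsub>A (p + q)\<^esub> z) ` Zr (int r) (p + q) p = {Br (int r) (p + q) p}"
 proof (intro equalityI subsetI)
  fix X assume "X : (%z. Br (int r) (p + q) p +>\<^bsub>A (p + q)\<^esub> z) ` Zr (int r) (p + q) p"
  then show "X : {Br (int r) (p + q) p}" by (rule imageE) (simp add: c)
 next
  fix X assume "X : {Br (int r) (p + q) p}"
  then show "X : (%z. Br (int r) (p + q) p +>\<^bsub>A (p + q)\<^esub> z) ` Zr (int r) (p + q) p"
   by (intro image_eqI[OF _ zero_Zr]) (simp add: c[OF zero_Zr])
 qed
 then show "carrier (EE (int r) (p + q) p) = {0[EE (int r) (p + q) p]}" by (simp add: EE_def subquot_simps)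
qed

definition Hc :: "nat => ('r, 'k set) module" where
 "Hc n = subquot (A (int n)) (mod_ker (A (int n)) (A (int n + 1)) (\<delta> (int n))) (\<delta> (int n - 1) ` carrier (A (int n - 1)))"

lemma submodule_image_\<delta>: "m = n + 1 ==> submodule (\<delta> n ` carrier (A n)) R (A m)"
 by (rule submodule_image[OF A A \<delta> submodule_carrier[OF A]])

lemma module_Hc: "module R (Hc n)"
 unfolding Hc_def
proof (rule module_subquot[OF A])
 show "submodule (mod_ker (A (int n)) (A (int n + 1)) (\<delta> (int n))) R (A (int n))" by (rule submodule_ker[OF A A \<delta>]) simp
 show "submodule (\<delta> (int n - 1) ` carrier (A (int n - 1))) R (A (int n))" by (rule submodule_image_\<delta>) simp
 show "\<delta> (int n - 1) ` carrier (A (int n - 1)) <= mod_ker (A (int n)) (A (int n + 1)) (\<delta> (int n))"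
 proof
  fix x assume "x : \<delta> (int n - 1) ` carrier (A (int n - 1))"
  then obtain y where y: "x = \<delta> (int n - 1) y" "y : carrier (A (int n - 1))" by (rule imageE)
  show "x : mod_ker (A (int n)) (A (int n + 1)) (\<delta> (int n))"
   unfolding mod_ker_def mem_Collect_eq y(1) using mod_homD(1)[OF \<delta>[of "int n" "int n - 1"] y(2)] \<delta>\<delta>[OF y(2), of "int n" "int n + 1"] by simp
 qed
qed

lemma converges: "converges_to R Er Hc"
 unfolding converges_to_def
proof (intro allI)
 fix n
 let ?n = "int n"
 let ?Z = "mod_ker (A ?n) (A (?n + 1)) (\<delta> ?n)" and ?B = "\<delta> (?n - 1) ` carrier (A (?n - 1))"
 let ?Zp = "%p. {x : Fi ?n (int p). \<delta> ?n x : {0[A (?n + 1)]}}"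
 \<comment> \<open>The usual filtration of cohomology: classes with a representing cocycle in step
   \<open>p\<close> of the complex.\<close>
 define Fp where "Fp p = (%z. ?B +>\<^bsub>A ?n\<^esub> z) ` ?Zp p" for p
 have dm: "\<delta> ?n : mod_hom R (A ?n) (A (?n + 1))" "\<delta> (?n - 1) : mod_hom R (A (?n - 1)) (A ?n)" by (rule \<delta>, simp)+
 have Z: "submodule ?Z R (A ?n)" by (rule submodule_ker[OF A A dm(1)])
 have B: "submodule ?B R (A ?n)" by (rule submodule_image[OF A A dm(2) submodule_carrier[OF A]])
 have BZ: "?B <= ?Z"
 proof
  fix x assume "x : ?B"
  then obtain y where y: "x = \<delta> (?n - 1) y" "y : carrier (A (?n - 1))" by (rule imageE)
  show "x : ?Z" unfolding mod_ker_def mem_Collect_eq y(1) using mod_homD(1)[OF dm(2) y(2)] \<delta>\<delta>[OF y(2), of ?n "?n + 1"] by simp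
 qed
 have Hm: "module R (Hc n)" unfolding Hc_def by (rule module_subquot[OF A Z B BZ])
 have Zp: "submodule (?Zp p) R (A ?n)" for p by (rule submodule_vimage[OF A A dm(1) Fi submodule_zero[OF A]])
 have ZpZ: "?Zp p <= ?Z" for p using Fi_car by (auto simp: mod_ker_def)
 have ZpS: "?Zp (Suc p) <= ?Zp p" for p using Fi_mono[of "int p" "int (Suc p)" ?n] by auto
 have sub: "submodule (Fp p) R (Hc n)" for p
  unfolding Fp_def Hc_def
  by (rule submodule_image[OF module_restrict[OF Z A] module_subquot[OF A Z B BZ] subquot_proj_hom[OF A Z B] submodule_restrict[OF Zp Z ZpZ A]])
 have mono: "Fp (Suc p) <= Fp p" for p unfolding Fp_def using ZpS by (rule image_mono)
 have F0: "Fp 0 = carrier (Hc n)" unfolding Fp_def Hc_def subquot_simps using Fi_low[of 0 ?n] by (simp add: mod_ker_def)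
 have "?Zp (Suc n) = {0[A ?n]}" using Fi_high[of ?n "int (Suc n)"] \<delta>0[of "?n + 1" ?n] by auto
 then have Fn: "Fp (Suc n) = {0[Hc n]}" unfolding Fp_def Hc_def subquot_simps
  using coset_zero[OF A B submodD(3)[OF submodule_carrier[OF A] A]] submodD(3)[OF B A] by simp
 have iso: "mod_iso R (subquot (Hc n) (Fp p) (Fp (Suc p))) (Er r (int p) (int q))" if pq: "p + q = n" and r: "p < r" "q + 1 < r" for p q r
 proof -
  have npq: "int p + int q = ?n" using pq by simp
  \<comment> \<open>As \<open>q + 1 < r\<close>, the step \<open>p + r\<close> exceeds
    \<open>n + 1\<close> and is zero, so cycles for \<open>r\<close> are true cocycles.\<close>
  have ZZ: "Zr (int r) ?n (int p) = ?Zp p"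
   using Fi_high[of "?n + 1" "int p + int r"] r pq by (auto simp: Zr_def)
  have ZZ1: "Zr (int r - 1) ?n (int p + 1) = ?Zp (Suc p)"
   using Fi_high[of "?n + 1" "int p + int r"] r pq by (auto simp: Zr_def add.commute)
  \<comment> \<open>As \<open>p < r\<close>, the step \<open>p - r + 1\<close> is the whole module
    in degree \<open>n - 1\<close>, so every coboundary that lies in step \<open>p\<close> is
    counted in \<open>Br\<close>.\<close>
  have BB: "x : Br (int r) ?n (int p) \<longleftrightarrow> (EX u:?Zp (Suc p). EX w:carrier (A (?n - 1)). x = u +[A ?n] \<delta> (?n - 1) w)" if x: "x : ?Zp p" for x
  proof
   assume "x : Br (int r) ?n (int p)"
   then obtain u v where "u : Zr (int r - 1) ?n (int p + 1)" "v : Zr (int r - 1) (?n - 1) (int p - int r + 1)" "x = u +[A ?n] \<delta> (?n - 1) v"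
    using Br_E[of x "int r" ?n "int p" "?n - 1"] by auto
   then show "EX u:?Zp (Suc p). EX w:carrier (A (?n - 1)). x = u +[A ?n] \<delta> (?n - 1) w" using Zr_car unfolding ZZ1 by blast
  next
   assume "EX u:?Zp (Suc p). EX w:carrier (A (?n - 1)). x = u +[A ?n] \<delta> (?n - 1) w"
   then obtain u w where u: "u : ?Zp (Suc p)" "w : carrier (A (?n - 1))" "x = u +[A ?n] \<delta> (?n - 1) w" by blast
   have uc: "u : carrier (A ?n)" "u : Fi ?n (int p)" using u(1) ZpS[of p] Fi_car by auto
   have dw: "\<delta> (?n - 1) w : carrier (A ?n)" by (rule mod_homD(1)[OF dm(2) u(2)])
   have "\<delta> (?n - 1) w = x -[A ?n] u" unfolding u(3) using abA uc dw by - (rule ab_eqI[of "A ?n"], simp add: ab)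
   then have "\<delta> (?n - 1) w : Fi ?n (int p)" using submodD(6)[OF Fi A] x uc(2) by simp
   then have "w : Zr (int r - 1) (?n - 1) (int p - int r + 1)"
    using u(2) Fi_low[of "int p - int r + 1" "?n - 1"] r by (simp add: Zr_def)
   then show "x : Br (int r) ?n (int p)" unfolding u(3) using u(1)[folded ZZ1] by (intro Br_I) simp_all
  qed
  show ?thesis unfolding Er_def EE_def npq
  proof (rule mod_iso_subquot_rel[where S = "%c x. x : ?Zp p & c = ?B +>\<^bsub>A ?n\<^esub> x", OF Hm sub sub A submodule_Zr submodule_Br])
   have c: "x : carrier (A ?n)" if "x : ?Zp p" for x using that by (auto intro: Fi_car)
   show "c : Fp p & x : Zr (int r) ?n (int p)" if "x : ?Zp p & c = ?B +>\<^bsub>A ?n\<^esub> x" for c x using that unfolding ZZ Fp_def by blast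
   show "x +[A ?n] x' : ?Zp p & c +[Hc n] c' = ?B +>\<^bsub>A ?n\<^esub> (x +[A ?n] x')"
    if "x : ?Zp p & c = ?B +>\<^bsub>A ?n\<^esub> x" "x' : ?Zp p & c' = ?B +>\<^bsub>A ?n\<^esub> x'" for c x c' x'
   proof -
    note x = conjunct1[OF that(1)] conjunct1[OF that(2)]
    show ?thesis unfolding conjunct2[OF that(1)] conjunct2[OF that(2)] Hc_def subquot_ops(1)[OF A B c[OF x(1)] c[OF x(2)]]
     by (rule conjI[OF submodD(4)[OF Zp A x] refl])
   qed
   show "a *[A ?n] x : ?Zp p & a *[Hc n] c = ?B +>\<^bsub>A ?n\<^esub> (a *[A ?n] x)"
    if "a : carrier R" "x : ?Zp p & c = ?B +>\<^bsub>A ?n\<^esub> x" for a c x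
   proof -
    note x = conjunct1[OF that(2)]
    show ?thesis unfolding conjunct2[OF that(2)] Hc_def subquot_ops(2)[OF A B that(1) c[OF x]]
     by (rule conjI[OF submodD(7)[OF Zp A that(1) x] refl])
   qed
   show "EX x. x : ?Zp p & c = ?B +>\<^bsub>A ?n\<^esub> x" if "c : Fp p" for c using that unfolding Fp_def by blast
   show "EX c. x : ?Zp p & c = ?B +>\<^bsub>A ?n\<^esub> x" if "x : Zr (int r) ?n (int p)" for x using that unfolding ZZ by blast
   show "c : Fp (Suc p) \<longleftrightarrow> x : Br (int r) ?n (int p)" if S: "x : ?Zp p & c = ?B +>\<^bsub>A ?n\<^esub> x" for c x
   proof -
    have x: "x : ?Zp p" "c = ?B +>\<^bsub>A ?n\<^esub> x" using S by simp_all
    have "c : Fp (Suc p) \<longleftrightarrow> (EX u:?Zp (Suc p). x -[A ?n] u : ?B)"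
     unfolding Fp_def x(2) image_iff using coset_eq_iff[OF A B c[OF x(1)] c[OF subsetD[OF ZpS]]] by blast
    also have "\<dots> \<longleftrightarrow> (EX u:?Zp (Suc p). EX w:carrier (A (?n - 1)). x = u +[A ?n] \<delta> (?n - 1) w)"
    proof (rule bex_cong[OF refl])
     fix u assume "u : ?Zp (Suc p)"
     then have uc: "u : carrier (A ?n)" using c ZpS by blast
     have "x -[A ?n] u = \<delta> (?n - 1) w \<longleftrightarrow> x = u +[A ?n] \<delta> (?n - 1) w" if w: "w : carrier (A (?n - 1))" for w
     proof
      have dw: "\<delta> (?n - 1) w : carrier (A ?n)" by (rule mod_homD(1)[OF dm(2) w])
      show "x = u +[A ?n] \<delta> (?n - 1) w" if e: "x -[A ?n] u = \<delta> (?n - 1) w"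
       unfolding e[symmetric] using abA uc c[OF x(1)] by - (rule ab_eqI[of "A ?n"], simp add: ab)
      show "x -[A ?n] u = \<delta> (?n - 1) w" if e: "x = u +[A ?n] \<delta> (?n - 1) w"
       unfolding e using abA uc dw by - (rule ab_eqI[of "A ?n"], simp add: ab)
     qed
     then show "x -[A ?n] u : ?B \<longleftrightarrow> (EX w:carrier (A (?n - 1)). x = u +[A ?n] \<delta> (?n - 1) w)" unfolding image_iff by (rule bex_cong[OF refl])
    qed
    also have "\<dots> \<longleftrightarrow> x : Br (int r) ?n (int p)" by (rule BB[OF x(1), symmetric])
    finally show ?thesis .
   qed
  qed
 qed
 show "EX F. (ALL p. submodule (F p) R (Hc n) & F (Suc p) <= F p) & F 0 = carrier (Hc n) & F (Suc n) = {0[Hc n]} &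
   (ALL p q r. p + q = n & p < r & q + 1 < r --> mod_iso R (subquot (Hc n) (F p) (F (Suc p))) (Er r (int p) (int q)))"
  using sub mono F0 Fn iso by (intro exI[of _ Fp]) simp
qed

end

section \<open>Moving a spectral sequence onto given modules\<close>

text \<open>A subquotient is no larger than the module: send a class to the image of one
  representative.\<close>

lemma inj_on_representatives:
 assumes j: "inj_on j C" and Z: "Z <= C" and f: "bij_betw f X (c ` Z)"
 shows "inj_on (%x. j (inv_into Z c (f x))) X"
proof (rule inj_onI)
 fix x y assume xy: "x : X" "y : X" and e: "j (inv_into Z c (f x)) = j (inv_into Z c (f y))"
 have i: "f x : c ` Z" "f y : c ` Z" using bij_betwE[OF f] xy by blast+
 have "inv_into Z c (f x) = inv_into Z c (f y)" by (rule inj_onD[OF j e subsetD[OF Z inv_into_into[OF i(1)]] subsetD[OF Z inv_into_into[OF i(2)]]])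
 then have "f x = f y" using inv_into_injective[of Z c "f x" "f y"] i by blast
 then show "x = y" using inj_onD[OF bij_betw_imp_inj_on[OF f]] xy by blast
qed

text \<open>The pages are moved along bijections to the type of the given second page: by induction
 each page is no larger than the previous one.\<close>

lemma spectral_transport:
 fixes E :: "nat => int => int => ('r, 'k) module" and E2 :: "nat => nat => ('r, 'e) module"
 assumes SS: "spectral_sequence R E d" and FQ: "first_quadrant E" and CV: "converges_to R E A"
  and E2: "!!p q. module R (E2 p q)" "!!p q. mod_iso R (E 2 (int p) (int q)) (E2 p q)"
  and A: "!!n. module R (A n)" "!!n. module R (A' n)" "!!n. mod_iso R (A n) (A' n)"
 shows "EX E' d'. spectral_sequence R E' d' & first_quadrant E' & (ALL p q. E' 2 (int p) (int q) = E2 p q) & converges_to R E' A'"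
proof -
 have S: "module R (E r p q)" "d r p q : mod_hom R (E r p q) (E r (p + int r) (q - int r + 1))"
  "x : carrier (E r p q) ==> d r (p + int r) (q - int r + 1) (d r p q x) = 0[E r (p + 2 * int r) (q - 2 * int r + 2)]"
  "mod_iso R (E (Suc r) p q) (subquot (E r p q) (mod_ker (E r p q) (E r (p + int r) (q - int r + 1)) (d r p q))
     (d r (p - int r) (q + int r - 1) ` carrier (E r (p - int r) (q + int r - 1))))" if "2 <= r" for r p q x
 proof -
  note c = mp[OF spec[OF spec[OF spec[OF SS[unfolded spectral_sequence_def], of r], of p], of q] that]
  show "module R (E r p q)" by (rule conjunct1[OF c])
  show "d r p q : mod_hom R (E r p q) (E r (p + int r) (q - int r + 1))" by (rule conjunct1[OF conjunct2[OF c]])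
  show "d r (p + int r) (q - int r + 1) (d r p q x) = 0[E r (p + 2 * int r) (q - 2 * int r + 2)]" if "x : carrier (E r p q)"
   by (rule bspec[OF conjunct1[OF conjunct2[OF conjunct2[OF c]]] that])
  show "mod_iso R (E (Suc r) p q) (subquot (E r p q) (mod_ker (E r p q) (E r (p + int r) (q - int r + 1)) (d r p q))
     (d r (p - int r) (q + int r - 1) ` carrier (E r (p - int r) (q + int r - 1))))"
   by (rule conjunct2[OF conjunct2[OF conjunct2[OF c]]])
 qed
 have inj: "EX j :: 'k => 'e. inj_on j (carrier (E r p q))" if "2 <= r" for r p q
  using that
 proof (induction r arbitrary: p q rule: dec_induct)
  case base
  show ?case
  proof (cases "0 <= p & 0 <= q")
   case True
   then have "mod_iso R (E 2 p q) (E2 (nat p) (nat q))" using E2(2)[of "nat p" "nat q"] by simp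
   then obtain f where "bij_betw f (carrier (E 2 p q)) (carrier (E2 (nat p) (nat q)))" unfolding mod_iso_def by (rule bexE)
   then show ?thesis by (intro exI[of _ f] bij_betw_imp_inj_on)
  next
   case False
   then have "carrier (E 2 p q) = {0[E 2 p q]}" using FQ[unfolded first_quadrant_def, rule_format, of 2 p q] by auto
   then show ?thesis by simp
  qed
 next
  case (step r)
  obtain j :: "'k => 'e" where j: "inj_on j (carrier (E r p q))" using step.IH by blast
  let ?Z = "mod_ker (E r p q) (E r (p + int r) (q - int r + 1)) (d r p q)"
  let ?c = "%z. (d r (p - int r) (q + int r - 1) ` carrier (E r (p - int r) (q + int r - 1))) +>\<^bsub>E r p q\<^esub> z"
  obtain f where f: "bij_betw f (carrier (E (Suc r) p q)) (?c ` ?Z)"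
   using S(4)[OF step.hyps(1), of p q] unfolding mod_iso_def subquot_simps by (rule bexE)
  have "?Z <= carrier (E r p q)" unfolding mod_ker_def by (rule Collect_subset)
  from inj_on_representatives[OF j this f] show ?case by - (rule exI, assumption)
 qed
 \<comment> \<open>A pair consists of the new module and an isomorphism onto it. On the second page
   in the first quadrant the module is forced to be the prescribed one; elsewhere any copy in the
   right type will do.\<close>
 define Pr where "Pr r p q W \<longleftrightarrow> module R (fst W) & snd W : mod_hom R (E r p q) (fst W) & bij_betw (snd W) (carrier (E r p q)) (carrier (fst W)) &
  (r = 2 & 0 <= p & 0 <= q --> fst W = E2 (nat p) (nat q))" for r p q and W :: "('r, 'e) module \<times> ('k => 'e)"
 have ex: "EX W. Pr r p q W" if r: "2 <= r" for r p q
 proof (cases "r = 2 & 0 <= p & 0 <= q")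
  case True
  then have "mod_iso R (E r p q) (E2 (nat p) (nat q))" using E2(2)[of "nat p" "nat q"] by simp
  then obtain f where "f : mod_hom R (E r p q) (E2 (nat p) (nat q))" "bij_betw f (carrier (E r p q)) (carrier (E2 (nat p) (nat q)))"
   unfolding mod_iso_def by (rule bexE)
  then show ?thesis using E2(1) by (intro exI[of _ "(E2 (nat p) (nat q), f)"]) (simp add: Pr_def)
 next
  case False
  obtain j :: "'k => 'e" where j: "inj_on j (carrier (E r p q))" using inj[OF r] by blast
  note t = transport_facts(1,2,4)[OF S(1)[OF r] j]
  show ?thesis by (rule exI[of _ "(transport j (E r p q), j)"]) (simp only: Pr_def fst_conv snd_conv t False simp_thms)
 qed
 define W where "W r p q = (SOME W. Pr r p q W)" for r p q
 have W: "Pr r p q (W r p q)" if "2 <= r" for r p q using someI_ex[OF ex[OF that]] unfolding W_def .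
 define E' where "E' r p q = fst (W r p q)" for r p q
 define \<phi> where "\<phi> r p q = snd (W r p q)" for r p q
 define \<psi> where "\<psi> r p q = inv_into (carrier (E r p q)) (\<phi> r p q)" for r p q
 define d' where "d' r p q x = \<phi> r (p + int r) (q - int r + 1) (d r p q (\<psi> r p q x))" for r p q x
 have \<phi>: "module R (E' r p q)" "\<phi> r p q : mod_hom R (E r p q) (E' r p q)" "bij_betw (\<phi> r p q) (carrier (E r p q)) (carrier (E' r p q))" if "2 <= r" for r p q
  using W[OF that, of p q] by (simp_all add: Pr_def E'_def \<phi>_def)
 have \<psi>: "\<psi> r p q : mod_hom R (E' r p q) (E r p q)" if "2 <= r" for r p q
  unfolding \<psi>_def by (rule mod_hom_inverse(1)[OF \<phi>(2,3)[OF that] S(1)[OF that]])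
 have \<psi>\<phi>: "\<psi> r p q (\<phi> r p q x) = x" if "2 <= r" "x : carrier (E r p q)" for r p q x
  unfolding \<psi>_def using \<phi>(3)[OF that(1)] that(2) unfolding bij_betw_def by (intro inv_into_f_f) simp_all
 have \<phi>\<psi>: "\<phi> r p q (\<psi> r p q y) = y" if "2 <= r" "y : carrier (E' r p q)" for r p q y
  unfolding \<psi>_def using \<phi>(3)[OF that(1), of p q] that(2) unfolding bij_betw_def by (intro f_inv_into_f) simp
 have \<phi>0: "\<phi> r p q x = 0[E' r p q] \<longleftrightarrow> x = 0[E r p q]" if "2 <= r" "x : carrier (E r p q)" for r p q x
 proof -
  have z: "\<phi> r p q 0[E r p q] = 0[E' r p q]" by (rule mod_hom_zero[OF \<phi>(2)[OF that(1)] module_ag[OF S(1)[OF that(1)]] module_ag[OF \<phi>(1)[OF that(1)]]])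
  have "0[E r p q] : carrier (E r p q)" using module_ag[OF S(1)[OF that(1)]] by (simp add: ag)
  then show ?thesis unfolding z[symmetric] by (rule inj_on_eq_iff[OF bij_betw_imp_inj_on[OF \<phi>(3)[OF that(1)]] that(2)])
 qed
 have isoE: "mod_iso R (E r p q) (E' r p q)" if "2 <= r" for r p q unfolding mod_iso_def by (rule bexI[where x = "\<phi> r p q"]) (rule \<phi>(3)[OF that], rule \<phi>(2)[OF that])
 have "spectral_sequence R E' d'"
  unfolding spectral_sequence_def
 proof (intro allI impI conjI ballI)
  fix r :: nat and p q :: int assume r: "2 <= r"
  let ?p = "p + int r" and ?q = "q - int r + 1" and ?p' = "p - int r" and ?q' = "q + int r - 1"
  show "module R (E' r p q)" by (rule \<phi>(1)[OF r])
  show d'h: "d' r p q : mod_hom R (E' r p q) (E' r ?p ?q)"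
   unfolding d'_def[abs_def] by (rule mod_hom_comp[OF mod_hom_comp[OF \<psi>[OF r] S(2)[OF r]] \<phi>(2)[OF r]])
  have e: "?p + int r = p + 2 * int r" "?q - int r + 1 = q - 2 * int r + 2" "?p' + int r = p" "?q' - int r + 1 = q" by simp_all
  show "d' r ?p ?q (d' r p q x) = 0[E' r (p + 2 * int r) (q - 2 * int r + 2)]" if x: "x : carrier (E' r p q)" for x
  proof -
   have px: "\<psi> r p q x : carrier (E r p q)" by (rule mod_homD(1)[OF \<psi>[OF r] x])
   have dx: "d r p q (\<psi> r p q x) : carrier (E r ?p ?q)" by (rule mod_homD(1)[OF S(2)[OF r] px])
   have z: "0[E r (p + 2 * int r) (q - 2 * int r + 2)] : carrier (E r (p + 2 * int r) (q - 2 * int r + 2))" using module_ag[OF S(1)[OF r]] by (simp add: ag)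
   show ?thesis unfolding d'_def \<psi>\<phi>[OF r dx] S(3)[OF r px] e using \<phi>0[OF r z] by simp
  qed
  let ?Z = "mod_ker (E r p q) (E r ?p ?q) (d r p q)" and ?B = "d r ?p' ?q' ` carrier (E r ?p' ?q')"
  let ?Z' = "mod_ker (E' r p q) (E' r ?p ?q) (d' r p q)" and ?B' = "d' r ?p' ?q' ` carrier (E' r ?p' ?q')"
  have dB: "d r ?p' ?q' : mod_hom R (E r ?p' ?q') (E r p q)" using S(2)[OF r, of ?p' ?q'] unfolding e .
  have dB': "d' r ?p' ?q' : mod_hom R (E' r ?p' ?q') (E' r p q)"
   using mod_hom_comp[OF mod_hom_comp[OF \<psi>[OF r] S(2)[OF r]] \<phi>(2)[OF r], of ?p' ?q'] unfolding d'_def[abs_def] e .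
  have iso: "mod_iso R (subquot (E r p q) ?Z ?B) (subquot (E' r p q) ?Z' ?B')"
  proof (rule mod_iso_subquot_rel[where S = "%x y. x : ?Z & y = \<phi> r p q x"])
   show "module R (E r p q)" "module R (E' r p q)" by (rule S(1)[OF r], rule \<phi>(1)[OF r])
   show sZ: "submodule ?Z R (E r p q)" by (rule submodule_ker[OF S(1)[OF r] S(1)[OF r] S(2)[OF r]])
   show "submodule ?B R (E r p q)" by (rule submodule_image[OF S(1)[OF r] S(1)[OF r] dB submodule_carrier[OF S(1)[OF r]]])
   show "submodule ?Z' R (E' r p q)" by (rule submodule_ker[OF \<phi>(1)[OF r] \<phi>(1)[OF r] d'h])
   show "submodule ?B' R (E' r p q)" by (rule submodule_image[OF \<phi>(1)[OF r] \<phi>(1)[OF r] dB' submodule_carrier[OF \<phi>(1)[OF r]]])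
   have Zc: "x : carrier (E r p q)" if "x : ?Z" for x using that by (simp add: mod_ker_def)
   have ZZ: "\<phi> r p q x : ?Z' \<longleftrightarrow> x : ?Z" if x: "x : carrier (E r p q)" for x
    using mod_homD(1)[OF \<phi>(2)[OF r] x] \<phi>0[OF r mod_homD(1)[OF S(2)[OF r] x]] x
    by (simp add: mod_ker_def d'_def \<psi>\<phi>[OF r x])
   show "x : ?Z & y : ?Z'" if "x : ?Z & y = \<phi> r p q x" for x y using that ZZ[OF Zc] by blast
   show "x +[E r p q] x' : ?Z & y +[E' r p q] y' = \<phi> r p q (x +[E r p q] x')"
    if "x : ?Z & y = \<phi> r p q x" "x' : ?Z & y' = \<phi> r p q x'" for x y x' y'
    using that submodD(4)[OF sZ S(1)[OF r], of x x'] mod_homD(2)[OF \<phi>(2)[OF r] Zc[OF conjunct1[OF that(1)]] Zc[OF conjunct1[OF that(2)]]] by simp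
   show "c *[E r p q] x : ?Z & c *[E' r p q] y = \<phi> r p q (c *[E r p q] x)" if "c : carrier R" "x : ?Z & y = \<phi> r p q x" for c x y
    using that submodD(7)[OF sZ S(1)[OF r], of c x] mod_homD(3)[OF \<phi>(2)[OF r] that(1) Zc[OF conjunct1[OF that(2)]]] by simp
   show "EX y. x : ?Z & y = \<phi> r p q x" if "x : ?Z" for x using that by blast
   show "EX x. x : ?Z & y = \<phi> r p q x" if y: "y : ?Z'" for y
   proof -
    have yc: "y : carrier (E' r p q)" using y by (simp add: mod_ker_def)
    have "\<psi> r p q y : ?Z" using ZZ[OF mod_homD(1)[OF \<psi>[OF r] yc]] y unfolding \<phi>\<psi>[OF r yc] by blast
    then show ?thesis using \<phi>\<psi>[OF r yc] by (intro exI[of _ "\<psi> r p q y"]) simp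
   qed
   show "x : ?B \<longleftrightarrow> y : ?B'" if xy: "x : ?Z & y = \<phi> r p q x" for x y
   proof
    assume "x : ?B"
    then obtain w where w: "x = d r ?p' ?q' w" "w : carrier (E r ?p' ?q')" by (rule imageE)
    have "y = d' r ?p' ?q' (\<phi> r ?p' ?q' w)" unfolding d'_def \<psi>\<phi>[OF r w(2)] e using xy w(1) by simp
    then show "y : ?B'" using mod_homD(1)[OF \<phi>(2)[OF r] w(2)] by (rule image_eqI)
   next
    assume "y : ?B'"
    then obtain w where w: "y = d' r ?p' ?q' w" "w : carrier (E' r ?p' ?q')" by (rule imageE)
    have pw: "\<psi> r ?p' ?q' w : carrier (E r ?p' ?q')" by (rule mod_homD(1)[OF \<psi>[OF r] w(2)])
    have "\<phi> r p q x = \<phi> r p q (d r ?p' ?q' (\<psi> r ?p' ?q' w))" using w(1) xy unfolding d'_def e by simp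
    then have "x = d r ?p' ?q' (\<psi> r ?p' ?q' w)"
     by (rule inj_onD[OF bij_betw_imp_inj_on[OF \<phi>(3)[OF r]] _ Zc[OF conjunct1[OF xy]] mod_homD(1)[OF dB pw]])
    then show "x : ?B" using pw by (rule image_eqI)
   qed
  qed
  have r': "2 <= Suc r" using r by simp
  show "mod_iso R (E' (Suc r) p q) (subquot (E' r p q) ?Z' ?B')"
   by (rule mod_iso_trans[OF mod_iso_trans[OF mod_iso_sym[OF isoE[OF r'] S(1)[OF r']] S(4)[OF r]] iso])
 qed
 moreover have "first_quadrant E'" unfolding first_quadrant_def
 proof (intro allI impI)
  fix r :: nat and p q :: int assume r: "2 <= r" and pq: "p < 0 \<or> q < 0"
  have z: "carrier (E r p q) = {0[E r p q]}" using FQ r pq unfolding first_quadrant_def by blast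
  have "carrier (E' r p q) = \<phi> r p q ` {0[E r p q]}" using \<phi>(3)[OF r, of p q] unfolding bij_betw_def z by simp
  then show "carrier (E' r p q) = {0[E' r p q]}" using \<phi>0[OF r, of "0[E r p q]" p q] z by simp
 qed
 moreover have "E' 2 (int p) (int q) = E2 p q" for p q using W[of 2 "int p" "int q"] by (simp add: Pr_def E'_def)
 moreover have "converges_to R E' A'" unfolding converges_to_def
 proof
  fix n
  obtain F where F0: "(ALL p. submodule (F p) R (A n) & F (Suc p) <= F p) & F 0 = carrier (A n) & F (Suc n) = {0[A n]} &
   (ALL p q r. p + q = n & p < r & q + 1 < r --> mod_iso R (subquot (A n) (F p) (F (Suc p))) (E r (int p) (int q)))"
   using spec[OF CV[unfolded converges_to_def], of n] by (rule exE)
  have F: "submodule (F p) R (A n)" "F (Suc p) <= F p" "F 0 = carrier (A n)" "F (Suc n) = {0[A n]}"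
   "p + q = n ==> p < r ==> q + 1 < r ==> mod_iso R (subquot (A n) (F p) (F (Suc p))) (E r (int p) (int q))" for p q r
   using F0 by simp_all
  obtain f where f: "f : mod_hom R (A n) (A' n)" "bij_betw f (carrier (A n)) (carrier (A' n))" using A(3)[of n] unfolding mod_iso_def by (rule bexE)
  have Fc: "x : carrier (A n)" if "x : F p" for x p by (rule submodD(2)[OF F(1) A(1) that])
  have fin: "f x = f y \<longleftrightarrow> x = y" if "x : carrier (A n)" "y : carrier (A n)" for x y using f(2) that unfolding bij_betw_def inj_on_def by blast
  have sub: "submodule (f ` F p) R (A' n)" for p by (rule submodule_image[OF A(1,2) f(1) F(1)])
  have iso: "mod_iso R (subquot (A' n) (f ` F p) (f ` F (Suc p))) (E' r (int p) (int q))" if "p + q = n" "p < r" "q + 1 < r" for p q r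
  proof -
   \<comment> \<open>\<open>q + 1 < r\<close> leaves only \<open>r >= 2\<close>, the pages that were
     moved.\<close>
   have r: "2 <= r \<or> r = 1" "r = 1 ==> False" using that by auto
   have "mod_iso R (subquot (A n) (F p) (F (Suc p))) (subquot (A' n) (f ` F p) (f ` F (Suc p)))"
   proof (rule mod_iso_subquot_rel[where S = "%x y. x : F p & y = f x", OF A(1) F(1) F(1) A(2) sub sub])
    show "x : F (Suc p) \<longleftrightarrow> y : f ` F (Suc p)" if "x : F p & y = f x" for x y
     unfolding image_iff using that fin[OF Fc Fc] by blast
    show "x +[A n] x' : F p & y +[A' n] y' = f (x +[A n] x')" if "x : F p & y = f x" "x' : F p & y' = f x'" for x y x' y'
     using that submodD(4)[OF F(1) A(1), of x p x'] mod_homD(2)[OF f(1) Fc[OF conjunct1[OF that(1)]] Fc[OF conjunct1[OF that(2)]]] by simp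
    show "c *[A n] x : F p & c *[A' n] y = f (c *[A n] x)" if "c : carrier R" "x : F p & y = f x" for c x y
     using that submodD(7)[OF F(1) A(1), of c x p] mod_homD(3)[OF f(1) that(1) Fc[OF conjunct1[OF that(2)]]] by simp
   qed blast+
   from mod_iso_trans[OF mod_iso_sym[OF this module_subquot[OF A(1) F(1) F(1) F(2)]] mod_iso_trans[OF F(5)[OF that] isoE]]
   show ?thesis using r by blast
  qed
  have fz: "f 0[A n] = 0[A' n]" by (rule mod_hom_zero[OF f(1) module_ag[OF A(1)] module_ag[OF A(2)]])
  have f0: "f ` carrier (A n) = carrier (A' n)" using f(2) unfolding bij_betw_def by simp
  show "EX F. (ALL p. submodule (F p) R (A' n) & F (Suc p) <= F p) & F 0 = carrier (A' n) & F (Suc n) = {0[A' n]} &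
    (ALL p q r. p + q = n & p < r & q + 1 < r --> mod_iso R (subquot (A' n) (F p) (F (Suc p))) (E' r (int p) (int q)))"
  proof (intro exI[of _ "%p. f ` F p"] conjI allI impI)
   show "submodule (f ` F p) R (A' n)" "f ` F (Suc p) <= f ` F p" for p by (rule sub, rule image_mono[OF F(2)])
   show "f ` F 0 = carrier (A' n)" "f ` F (Suc n) = {0[A' n]}" by (simp_all only: F(3,4) f0 image_insert image_empty fz)
   show "mod_iso R (subquot (A' n) (f ` F p) (f ` F (Suc p))) (E' r (int p) (int q))" if "p + q = n & p < r & q + 1 < r" for p q r
    by (rule iso[OF conjunct1[OF that] conjunct1[OF conjunct2[OF that]] conjunct2[OF conjunct2[OF that]]])
  qed
 qed
 ultimately show ?thesis by (intro exI[of _ E'] exI[of _ d'] conjI allI)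
qed

section \<open>The filtration of a double complex by the first index, and its second page\<close>

context double_complex
begin

definition tF :: "int => int => (nat \<times> nat => 'k) set" where
 "tF n p = {w : carrier (tot D n). ALL i j. int i + int j = n --> int i < p --> w (i, j) = 0[D i j]}"

lemma tF_app: "w : tF n p ==> int i + int j = n ==> int i < p ==> w (i, j) = 0[D i j]"
 by (simp add: tF_def)

lemma tF_car: "w : tF n p ==> w : carrier (tot D n)"
 by (simp add: tF_def)

lemma tF_hpart:
 assumes w: "w : tF n p" and ij: "int i + int j = n + 1" "int i < p + 1"
 shows "hpart D h w i j = 0[D i j]"
proof (cases i)
 case (Suc i')
 have "w (i', j) = 0[D i' j]" by (rule tF_app[OF w]) (use ij Suc in simp_all)
 then show ?thesis by (simp add: Suc hpart_def h0)
qed (simp add: hpart_def)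

lemma tF_vpart:
 assumes w: "w : tF n p" and ij: "int i + int j = n + 1" "int i < p"
 shows "vpart D v w i j = 0[D i j]"
proof (cases j)
 case (Suc j')
 have "w (i, j') = 0[D i j']" by (rule tF_app[OF w]) (use ij Suc in simp_all)
 then show ?thesis by (simp add: Suc vpart_def v0)
qed (simp add: vpart_def)

lemma filtered: "filtered_complex R (tot D) (td D h v) tF"
proof (rule filtered_complex.intro)
 show "module R (tot D n)" for n by (rule module_tot)
 show "td D h v n : mod_hom R (tot D n) (tot D m)" if "m = n + 1" for n m unfolding that by (rule td_hom)
 show "td D h v m (td D h v n x) = 0[tot D k]" if "x : carrier (tot D n)" "m = n + 1" "k = n + 2" for n m k x
  unfolding that(2,3) by (rule td_td[OF that(1)])
 show "submodule (tF n p) R (tot D n)" for n p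
 proof (rule submodI[OF module_tot])
  show "tF n p <= carrier (tot D n)" by (auto simp: tF_def)
  show "0[tot D n] : tF n p" using ab_tot[of n] by (simp add: tF_def tot_ops ag)
  show "x +[tot D n] y : tF n p" if "x : tF n p" "y : tF n p" for x y
   using that ab_tot[of n] ab_D by (simp add: tF_def tot_ops ag)
  show "c *[tot D n] x : tF n p" if "c : carrier R" "x : tF n p" for c x
   using that module.smult_closed[OF module_tot] module.smult_r_null[OF D] by (simp add: tF_def tot_ops)
 qed
 show "tF n p' <= tF n p" if "p <= p'" for n p p' using that by (auto simp: tF_def)
 show "td D h v n x : tF m p" if x: "x : tF n p" and m: "m = n + 1" for n m p x
  unfolding m tF_def
 proof (intro CollectI conjI allI impI)
  show "td D h v n x : carrier (tot D (n + 1))" by (rule td_closed[OF tF_car[OF x]])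
  fix i j assume ij: "int i + int j = n + 1" "int i < p"
  have "int i < p + 1" using ij(2) by simp
  then show "td D h v n x (i, j) = 0[D i j]"
   unfolding td_app[OF ij(1)] tF_vpart[OF x ij] using tF_hpart[OF x ij(1)] ab_D[of i j] by (simp add: ag)
 qed
 show "tF n p = carrier (tot D n)" if "p <= 0" for n p using that by (auto simp: tF_def)
 show "tF n p = {0[tot D n]}" if np: "n < p" for n p
 proof (intro equalityI subsetI)
  have z: "0[tot D n] : carrier (tot D n)" using ab_tot[of n] by (simp add: ag)
  fix x assume x: "x : tF n p"
  have "x = 0[tot D n]"
  proof (rule tot_eqI[OF tF_car[OF x] z])
   fix i j assume ij: "int i + int j = n"
   then have "int i < p" using np by simp
   then show "x (i, j) = 0[tot D n] (i, j)" using tF_app[OF x ij] tot_ops(1)[OF ij] by simp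
  qed
  then show "x : {0[tot D n]}" by simp
 next
  fix x assume "x : {0[tot D n]}"
  then show "x : tF n p" using ab_tot[of n] by (simp add: tF_def tot_ops ag)
 qed
qed

lemma tF_Suc:
 assumes "w : tF (int p + int q) (int p)" "w (p, q) = 0[D p q]"
 shows "w : tF (int p + int q) (int p + 1)"
 unfolding tF_def
proof (intro CollectI conjI allI impI)
 fix i j assume ij: "int i + int j = int p + int q" "int i < int p + 1"
 show "w (i, j) = 0[D i j]"
 proof (cases "i = p")
  case True
  then have "j = q" using ij by simp
  then show ?thesis using assms(2) True by simp
 next
  case False
  show ?thesis by (rule tF_app[OF assms(1) ij(1)]) (use ij False in simp)
 qed
qed (rule tF_car[OF assms(1)])

lemma vpart_coboundary:
 assumes "w : carrier (tot D n)" "int i + int j = n + 1"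
 shows "vpart D v w i j : coboundaries (D i) (v i) j"
proof (cases j)
 case (Suc j')
 have "w (i, j') : carrier (D i j')" by (rule tot_app[OF assms(1)]) (use assms(2) Suc in simp)
 then show ?thesis by (simp add: Suc vpart_def coboundaries_def)
qed (simp add: vpart_def coboundaries_def)

text \<open>Place a vertical preimage as a single entry, or take zero if \<open>j = 0\<close>.
  Nothing horizontal reaches \<open>(i, j)\<close>, because elements of step \<open>i\<close> vanish
  at smaller first indices.\<close>

lemma coboundary_lift:
 assumes c: "c : coboundaries (D i) (v i) j" and n: "int i + int j = n + 1"
 shows "EX u:tF n (int i). td D h v n u (i, j) = c"
proof -
 have "EX u:tF n (int i). vpart D v u i j = c"
 proof (cases j)
  case 0
  have "0[tot D n] : tF n (int i)" using ab_tot[of n] by (simp add: tF_def tot_ops ag)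
  then show ?thesis using c by (intro bexI[of _ "0[tot D n]"]) (simp_all add: 0 vpart_def coboundaries_def)
 next
  case (Suc j')
  obtain y where y: "c = v i j' y" "y : carrier (D i j')" using c unfolding Suc coboundaries_def nat.case by (rule imageE)
  have n': "int i + int j' = n" using n Suc by simp
  have "single i j' y : tF n (int i)"
   unfolding tF_def using single_closed[OF y(2)] single_app[of _ _ i j' y] by (simp add: n')
  moreover have "vpart D v (single i j' y) i j = c" using single_app[of i j' i j' y] by (simp add: Suc vpart_def y(1))
  ultimately show ?thesis by blast
 qed
 then obtain u where u: "u : tF n (int i)" "vpart D v u i j = c" by blast
 have cc: "c : carrier (D i j)" unfolding u(2)[symmetric] by (rule vpart_closed[OF tF_car[OF u(1)] n])
 have "hpart D h u i j = 0[D i j]" by (rule tF_hpart[OF u(1) n]) simp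
 then have "td D h v n u (i, j) = c" unfolding td_app[OF n] u(2) using ab_D[of i j] cc by (simp add: ag)
 then show ?thesis using u(1) by blast
qed

text \<open>\<open>\<epsilon> p\<close> presents \<open>L p\<close> as the vertical cohomology of
  column \<open>p\<close> in degree \<open>q\<close>, with \<open>dL\<close> induced by
  \<open>h\<close>. An abstract \<open>L\<close> is used because in the application it consists of
  morphisms into cohomology, not of cosets of morphisms.\<close>

context
 fixes q :: nat and L :: "nat => ('r, 'l) module" and dL :: "nat => 'l => 'l" and \<epsilon> :: "nat => 'k => 'l"
 assumes L: "!!p. module R (L p)" and dL: "!!p. dL p : mod_hom R (L p) (L (Suc p))"
  and dLL: "!!p l. l : carrier (L p) ==> dL (Suc p) (dL p l) = 0[L (Suc (Suc p))]"
  and \<epsilon>: "!!p. \<epsilon> p : mod_hom R ((D p q)(|carrier := mod_ker (D p q) (D p (Suc q)) (v p q)|)) (L p)"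
  and \<epsilon>_surj: "!!p l. l : carrier (L p) ==> EX x:mod_ker (D p q) (D p (Suc q)) (v p q). \<epsilon> p x = l"
  and \<epsilon>_zero: "!!p x. x : mod_ker (D p q) (D p (Suc q)) (v p q) ==> \<epsilon> p x = 0[L p] \<longleftrightarrow> x : coboundaries (D p) (v p) q"
  and \<epsilon>_h: "!!p x. x : mod_ker (D p q) (D p (Suc q)) (v p q) ==> \<epsilon> (Suc p) (h p q x) = dL p (\<epsilon> p x)"
begin

abbreviation "Kv p \<equiv> mod_ker (D p q) (D p (Suc q)) (v p q)"

lemma Kv: "submodule (Kv p) R (D p q)" "x : Kv p ==> x : carrier (D p q)"
 by (rule submodule_ker[OF D D v]) (simp add: mod_ker_def)

lemma \<epsilon>_add: "x : Kv p ==> y : Kv p ==> \<epsilon> p (x +[D p q] y) = \<epsilon> p x +[L p] \<epsilon> p y"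
 and \<epsilon>_smult: "c : carrier R ==> x : Kv p ==> \<epsilon> p (c *[D p q] x) = c *[L p] \<epsilon> p x"
 and \<epsilon>_closed: "x : Kv p ==> \<epsilon> p x : carrier (L p)"
 using mod_homD[OF \<epsilon>[of p]] by simp_all

lemma cob_Kv: "coboundaries (D p) (v p) q <= Kv p" "submodule (coboundaries (D p) (v p) q) R (D p q)"
 using cochain_complex(2,3)[of R "D p" "v p", OF D v vv] by blast+

lemma h_Kv:
 assumes "x : Kv p"
 shows "h p q x : Kv (Suc p)"
proof -
 have x: "x : carrier (D p q)" "v p q x = 0[D p (Suc q)]" using assms by (simp_all add: mod_ker_def)
 have hx: "h p q x : carrier (D (Suc p) q)" by (rule mod_homD(1)[OF h x(1)])
 have "v (Suc p) q (h p q x) : carrier (D (Suc p) (Suc q))" by (rule mod_homD(1)[OF v hx])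
 then have "v (Suc p) q (h p q x) = 0[D (Suc p) (Suc q)]" using anti[OF x(1)] ab_D[of "Suc p" "Suc q"] by (simp add: x(2) h0 ag)
 then show ?thesis using hx by (simp add: mod_ker_def)
qed

interpretation f: filtered_complex R "tot D" "td D h v" tF by (rule filtered)

context
 fixes p :: nat and n :: int
 assumes n: "n = int p + int q"
begin

text \<open>The total differential of \<open>w\<close> lies in step \<open>p + 2\<close>, so its
  entries \<open>(p, q + 1)\<close> and \<open>(p + 1, q)\<close> vanish. The former is
  \<open>v\<close> of the leading entry, the latter is \<open>h\<close> of it plus a vertical
  coboundary.\<close>

lemma top_facts:
 assumes w: "w : f.Zr 2 n (int p)"
 shows "w (p, q) : Kv p" "h p q (w (p, q)) : coboundaries (D (Suc p)) (v (Suc p)) q"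
proof -
 have wF: "w : tF n (int p)" and tw: "td D h v n w : tF (n + 1) (int p + 2)" using w by (simp_all add: f.Zr_def)
 have wc: "w (p, q) : carrier (D p q)" by (rule tot_app[OF tF_car[OF wF]]) (simp add: n)
 have i: "int p + int (Suc q) = n + 1" "int (Suc p) + int q = n + 1" by (simp_all add: n)
 have "v p q (w (p, q)) : carrier (D p (Suc q))" by (rule mod_homD(1)[OF v wc])
 moreover have "hpart D h w p (Suc q) = 0[D p (Suc q)]" by (rule tF_hpart[OF wF i(1)]) simp
 moreover have "td D h v n w (p, Suc q) = 0[D p (Suc q)]" by (rule tF_app[OF tw i(1)]) simp
 ultimately have "v p q (w (p, q)) = 0[D p (Suc q)]" unfolding td_app[OF i(1)] using ab_D[of p "Suc q"] by (simp add: vpart_def ag)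
 then show K: "w (p, q) : Kv p" using wc by (simp add: mod_ker_def)
 have z: "td D h v n w (Suc p, q) = 0[D (Suc p) q]" by (rule tF_app[OF tw i(2)]) simp
 let ?c = "vpart D v w (Suc p) q"
 have c: "?c : coboundaries (D (Suc p)) (v (Suc p)) q" by (rule vpart_coboundary[OF tF_car[OF wF] i(2)])
 have hc: "h p q (w (p, q)) : carrier (D (Suc p) q)" by (rule mod_homD(1)[OF h wc])
 have "h p q (w (p, q)) +[D (Suc p) q] ?c = 0[D (Suc p) q]" using z unfolding td_app[OF i(2)] by (simp add: hpart_def)
 then have "h p q (w (p, q)) = -[D (Suc p) q] ?c"
  using abelian_group.minus_equality[OF ab_D _ vpart_closed[OF tF_car[OF wF] i(2)] hc] by simp
 then show "h p q (w (p, q)) : coboundaries (D (Suc p)) (v (Suc p)) q" using submodD(5)[OF cob_Kv(2) D c] by simp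
qed

text \<open>The hypothesis says that \<open>h p q x\<close> is a vertical coboundary; so some
  element of step \<open>p + 1\<close> has \<open>- h p q x\<close> as an entry of its differential
  and corrects \<open>single p q x\<close>.\<close>

lemma lift_cocycle:
 assumes x: "x : Kv p" and l: "dL p (\<epsilon> p x) = 0[L (Suc p)]"
 shows "EX w:f.Zr 2 n (int p). w (p, q) = x"
proof -
 have i: "int p + int (Suc q) = n + 1" "int (Suc p) + int q = n + 1" by (simp_all add: n)
 have xc: "x : carrier (D p q)" and vx: "v p q x = 0[D p (Suc q)]" using x by (simp_all add: mod_ker_def)
 have hx: "h p q x : carrier (D (Suc p) q)" by (rule mod_homD(1)[OF h xc])
 have "h p q x : coboundaries (D (Suc p)) (v (Suc p)) q" using \<epsilon>_zero[OF h_Kv[OF x]] \<epsilon>_h[OF x] l by simp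
 then have "-[D (Suc p) q] h p q x : coboundaries (D (Suc p)) (v (Suc p)) q" by (rule submodD(5)[OF cob_Kv(2) D])
 from coboundary_lift[OF this i(2)] obtain u where u: "u : tF n (int (Suc p))" "td D h v n u (Suc p, q) = -[D (Suc p) q] h p q x" by blast
 let ?s = "single p q x"
 have sc: "?s : carrier (tot D n)" using single_closed[OF xc] by (simp add: n)
 have sa: "?s (a, b) = (if a = p then x else 0[D a b])" if "int a + int b = n" for a b using single_app[of a b p q x] that n by simp
 have uc: "u : carrier (tot D n)" by (rule tF_car[OF u(1)])
 let ?w = "?s +[tot D n] u"
 have s: "?s : tF n (int p)" unfolding tF_def using sc sa by simp
 have uF: "u : tF n (int p)" using f.Fi_mono[of "int p" "int (Suc p)" n] u(1) by auto
 have w: "?w : tF n (int p)" by (rule submodD(4)[OF f.Fi module_tot s uF])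
 have tw: "td D h v n ?w = td D h v n ?s +[tot D (n + 1)] td D h v n u" by (rule mod_homD(2)[OF td_hom sc uc])
 have tu: "td D h v n u : tF (n + 1) (int (Suc p))" by (rule f.Fi_stable[OF u(1) refl])
 have ts: "td D h v n ?s (a, b) = (if a = Suc p then h p q x else if a = p then v p q x else 0[D a b])" if "int a + int b = n + 1" for a b
  using td_single[OF xc, of a b] that n by simp
 have "td D h v n ?w : tF (n + 1) (int p + 2)"
  unfolding tF_def
 proof (intro CollectI conjI allI impI)
  show "td D h v n ?w : carrier (tot D (n + 1))" by (rule td_closed[OF tF_car[OF w]])
  fix a b assume ab: "int a + int b = n + 1" "int a < int p + 2"
  show "td D h v n ?w (a, b) = 0[D a b]"
  proof (cases "a = Suc p")
   case True
   then have b: "b = q" using ab n by simp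
   show ?thesis unfolding tw tot_ops(2)[OF ab(1)] ts[OF ab(1)] unfolding True b u(2) using hx ab_D[of "Suc p" q] by (simp add: ag)
  next
   case False
   then have a: "int a < int (Suc p)" using ab(2) by simp
   have "v p q x = 0[D a b]" if "a = p"
   proof -
    have "b = Suc q" using ab(1) that n by simp
    then show ?thesis using vx that by simp
   qed
   then have "td D h v n ?s (a, b) = 0[D a b]" unfolding ts[OF ab(1)] using False by simp
   then show ?thesis unfolding tw tot_ops(2)[OF ab(1)] tF_app[OF tu ab(1) a] using ab_D[of a b] by (simp add: ag)
  qed
 qed
 then have "?w : f.Zr 2 n (int p)" using w by (simp add: f.Zr_def)
 moreover have "?w (p, q) = x"
 proof -
  have pq: "int p + int q = n" by (simp add: n)
  have "u (p, q) = 0[D p q]" by (rule tF_app[OF u(1) pq]) simp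
  then show ?thesis unfolding tot_ops(2)[OF pq] sa[OF pq] using xc ab_D[of p q] by (simp add: ag)
 qed
 ultimately show ?thesis by blast
qed

text \<open>The entry of \<open>y\<close> at first index \<open>p - 1\<close> is a vertical cocycle,
  since the differential of \<open>y\<close> vanishes there. Hence the leading entry of that
  differential is \<open>h\<close> of a cocycle plus a vertical coboundary, and
  \<open>\<epsilon>\<close> kills the latter. For \<open>p = 0\<close> only the coboundary is
  present.\<close>

lemma top_boundary:
 assumes y: "y : f.Zr 1 (n - 1) (int p - 1)"
 shows "td D h v (n - 1) y (p, q) : Kv p & \<epsilon> p (td D h v (n - 1) y (p, q)) : coboundaries L dL p"
proof -
 have yF: "y : tF (n - 1) (int p - 1)" and ty: "td D h v (n - 1) y : tF n (int p)" using y by (simp_all add: f.Zr_def)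
 have pq: "int p + int q = n - 1 + 1" by (simp add: n)
 let ?c = "vpart D v y p q"
 have c: "?c : coboundaries (D p) (v p) q" by (rule vpart_coboundary[OF tF_car[OF yF] pq])
 have cK: "?c : Kv p" using c cob_Kv(1) by blast
 have ec: "\<epsilon> p ?c = 0[L p]" using \<epsilon>_zero[OF cK] c by simp
 show ?thesis
 proof (cases p)
  case 0
  have "td D h v (n - 1) y (p, q) = ?c" unfolding td_app[OF pq] using Kv(2)[OF cK] ab_D[of p q] by (simp add: hpart_def 0 ag)
  then show ?thesis using cK ec by (simp add: 0 coboundaries_def)
 next
  case (Suc p')
  have p'q: "int p' + int q = n - 1" "int p' + int (Suc q) = n - 1 + 1" "int p' + int (Suc q) = n" using n Suc by simp_all
  let ?y = "y (p', q)"
  have yc: "?y : carrier (D p' q)" by (rule tot_app[OF tF_car[OF yF] p'q(1)])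
  have "hpart D h y p' (Suc q) = 0[D p' (Suc q)]" by (rule tF_hpart[OF yF p'q(2)]) (simp add: Suc)
  moreover have "td D h v (n - 1) y (p', Suc q) = 0[D p' (Suc q)]" by (rule tF_app[OF ty p'q(3)]) (simp add: Suc)
  moreover have "v p' q ?y : carrier (D p' (Suc q))" by (rule mod_homD(1)[OF v yc])
  ultimately have "v p' q ?y = 0[D p' (Suc q)]" unfolding td_app[OF p'q(2)] using ab_D[of p' "Suc q"] by (simp add: vpart_def ag)
  then have yK: "?y : Kv p'" using yc by (simp add: mod_ker_def)
  have hK: "h p' q ?y : Kv p" using h_Kv[OF yK] Suc by simp
  have t: "td D h v (n - 1) y (p, q) = h p' q ?y +[D p q] ?c" unfolding td_app[OF pq] by (simp add: Suc hpart_def)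
  have "\<epsilon> p (td D h v (n - 1) y (p, q)) = \<epsilon> p (h p' q ?y)"
   unfolding t \<epsilon>_add[OF hK cK] ec using \<epsilon>_closed[OF hK] module_ag[OF L[of p]] by (simp add: ag)
  also have "\<dots> = dL p' (\<epsilon> p' ?y)" using \<epsilon>_h[OF yK] Suc by simp
  finally have "\<epsilon> p (td D h v (n - 1) y (p, q)) : coboundaries L dL p" using \<epsilon>_closed[OF yK] by (simp add: Suc coboundaries_def)
  moreover have "td D h v (n - 1) y (p, q) : Kv p" unfolding t by (rule submodD(4)[OF Kv(1) D hK cK])
  ultimately show ?thesis by blast
 qed
qed

text \<open>Lift a preimage of \<open>\<epsilon> p x\<close> under \<open>dL\<close> to a vertical
  cocycle \<open>y'\<close>. Then \<open>x\<close> and the image of \<open>y'\<close> under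
  \<open>h\<close> differ by a vertical coboundary, which \<open>coboundary_lift\<close> realizes
  inside step \<open>p\<close>. For \<open>p = 0\<close> that correction is all there is.\<close>

lemma lift_boundary:
 assumes x: "x : Kv p" and l: "\<epsilon> p x : coboundaries L dL p"
 shows "EX y:f.Zr 1 (n - 1) (int p - 1). td D h v (n - 1) y (p, q) = x"
proof -
 have pq: "int p + int q = n - 1 + 1" by (simp add: n)
 have xc: "x : carrier (D p q)" by (rule Kv(2)[OF x])
 note st = f.Fi_stable[of _ "n - 1" _ n]
 show ?thesis
 proof (cases p)
  case 0
  then have "x : coboundaries (D p) (v p) q" using \<epsilon>_zero[OF x] l by (simp add: coboundaries_def)
  from coboundary_lift[OF this pq] obtain y where y: "y : tF (n - 1) (int p)" "td D h v (n - 1) y (p, q) = x" by blast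
  have "y : f.Zr 1 (n - 1) (int p - 1)" using y(1) st[OF y(1)] f.Fi_mono[of "int p - 1" "int p" "n - 1"] by (auto simp: f.Zr_def)
  then show ?thesis using y(2) by blast
 next
  case (Suc p')
  obtain l' where l': "\<epsilon> p x = dL p' l'" "l' : carrier (L p')" using l unfolding Suc coboundaries_def nat.case by (rule imageE)
  obtain y' where y': "y' : Kv p'" "\<epsilon> p' y' = l'" using \<epsilon>_surj[OF l'(2)] by blast
  have yc: "y' : carrier (D p' q)" "v p' q y' = 0[D p' (Suc q)]" using y'(1) by (simp_all add: mod_ker_def)
  have hK: "h p' q y' : Kv p" using h_Kv[OF y'(1)] Suc by simp
  let ?b = "x -[D p q] h p' q y'"
  have bK: "?b : Kv p" by (rule submodD(6)[OF Kv(1) D x hK])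
  have bh: "?b +[D p q] h p' q y' = x" using ab_D[of p q] xc Kv(2)[OF hK] by - (rule ab_eqI[of "D p q"], simp add: ab)
  have eh: "\<epsilon> p (h p' q y') = \<epsilon> p x" using \<epsilon>_h[OF y'(1)] y'(2) l'(1) Suc by simp
  have ex: "\<epsilon> p ?b +[L p] \<epsilon> p x = \<epsilon> p x" using \<epsilon>_add[OF bK hK] unfolding bh eh by simp
  have "\<epsilon> p ?b = (\<epsilon> p ?b +[L p] \<epsilon> p x) -[L p] \<epsilon> p x"
   using module_ag[OF L[of p]] \<epsilon>_closed[OF x] \<epsilon>_closed[OF bK] by - (rule ab_eqI[of "L p"], simp add: ab)
  also have "\<dots> = 0[L p]" unfolding ex using module_ag[OF L[of p]] \<epsilon>_closed[OF x] by (simp add: a_minus_def ag)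
  finally have "\<epsilon> p ?b = 0[L p]" .
  then have "?b : coboundaries (D p) (v p) q" using \<epsilon>_zero[OF bK] by simp
  from coboundary_lift[OF this pq] obtain u where u: "u : tF (n - 1) (int p)" "td D h v (n - 1) u (p, q) = ?b" by blast
  let ?s = "single p' q y'"
  have n': "n - 1 = int p' + int q" using n Suc by simp
  have sc: "?s : carrier (tot D (n - 1))" using single_closed[OF yc(1)] unfolding n' .
  have sF: "?s : tF (n - 1) (int p - 1)" unfolding tF_def using sc single_app[of _ _ p' q y'] n' Suc by simp
  have uF: "u : tF (n - 1) (int p - 1)" using u(1) f.Fi_mono[of "int p - 1" "int p" "n - 1"] by auto
  let ?y = "?s +[tot D (n - 1)] u"
  have yF: "?y : tF (n - 1) (int p - 1)" by (rule submodD(4)[OF f.Fi module_tot sF uF])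
  have ty: "td D h v (n - 1) ?y = td D h v (n - 1) ?s +[tot D n] td D h v (n - 1) u" by (rule mod_homD(2)[OF f.\<delta> sc tF_car[OF u(1)]]) simp
  have ts: "td D h v (n - 1) ?s (a, b) = (if a = p then h p' q y' else if a = p' then v p' q y' else 0[D a b])" if "int a + int b = n" for a b
   using td_single[OF yc(1), of a b] that n Suc unfolding n' by simp
  have tsF: "td D h v (n - 1) ?s : tF n (int p)" unfolding tF_def
  proof (intro CollectI conjI allI impI)
   show "td D h v (n - 1) ?s : carrier (tot D n)" using td_closed[OF sc] by simp
   fix a b assume ab: "int a + int b = n" "int a < int p"
   have "v p' q y' = 0[D a b]" if "a = p'"
   proof -
    have "b = Suc q" using ab(1) that n Suc by simp
    then show ?thesis using yc(2) that by simp
   qed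
   then show "td D h v (n - 1) ?s (a, b) = 0[D a b]" unfolding ts[OF ab(1)] using ab(2) by auto
  qed
  have "td D h v (n - 1) ?y : tF n (int p)" unfolding ty by (rule submodD(4)[OF f.Fi module_tot tsF st[OF u(1)]]) simp
  then have "?y : f.Zr 1 (n - 1) (int p - 1)" using yF by (simp add: f.Zr_def)
  moreover have "td D h v (n - 1) ?y (p, q) = x"
  proof -
   have i: "int p + int q = n" by (simp add: n)
   show ?thesis unfolding ty tot_ops(2)[OF i] ts[OF i] u(2)
    using bh abelian_group.ag_comm[OF ab_D Kv(2)[OF hK] Kv(2)[OF bK]] by simp
  qed
  ultimately show ?thesis by blast
 qed
qed

text \<open>An element of \<open>Zr 2\<close> is related to the image under
  \<open>\<epsilon>\<close> of its leading entry. The four preceding lemmas say that this relation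
  is defined, reaches every cocycle of \<open>L\<close>, and matches boundaries.\<close>

lemma second_page: "mod_iso R (f.Er 2 (int p) (int q)) (cohomology L dL p)"
proof -
 note c = cochain_complex[of R L dL, OF L dL dLL]
 have pq: "int p + int q = n" by (simp add: n)
 have e: "int 2 = 2" by simp
 have i: "(2::int) - 1 = 1" by simp
 show ?thesis unfolding f.Er_def f.EE_def pq cohomology_def e
 proof (rule mod_iso_subquot_rel[where S = "%w l. w : f.Zr 2 n (int p) & l = \<epsilon> p (w (p, q))", OF module_tot f.submodule_Zr f.submodule_Br L])
  show "submodule (mod_ker (L p) (L (Suc p)) (dL p)) R (L p)" by (rule c(1))
  show "submodule (coboundaries L dL p) R (L p)" by (rule c(2))
  show "w : f.Zr 2 n (int p) & l : mod_ker (L p) (L (Suc p)) (dL p)" if S: "w : f.Zr 2 n (int p) & l = \<epsilon> p (w (p, q))" for w l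
  proof -
   note t = top_facts[OF conjunct1[OF S]]
   have "\<epsilon> (Suc p) (h p q (w (p, q))) = 0[L (Suc p)]" using \<epsilon>_zero[OF h_Kv[OF t(1)]] t(2) by simp
   then show ?thesis using S \<epsilon>_closed[OF t(1)] \<epsilon>_h[OF t(1)] by (simp add: mod_ker_def)
  qed
  show "w +[tot D n] w' : f.Zr 2 n (int p) & l +[L p] l' = \<epsilon> p ((w +[tot D n] w') (p, q))"
   if S: "w : f.Zr 2 n (int p) & l = \<epsilon> p (w (p, q))" "w' : f.Zr 2 n (int p) & l' = \<epsilon> p (w' (p, q))" for w l w' l'
   using S submodD(4)[OF f.submodule_Zr module_tot] \<epsilon>_add[OF top_facts(1) top_facts(1)] unfolding tot_ops(2)[OF pq] by simp
  show "a *[tot D n] w : f.Zr 2 n (int p) & a *[L p] l = \<epsilon> p ((a *[tot D n] w) (p, q))"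
   if S: "a : carrier R" "w : f.Zr 2 n (int p) & l = \<epsilon> p (w (p, q))" for a w l
   using S submodD(7)[OF f.submodule_Zr module_tot] \<epsilon>_smult[OF _ top_facts(1)] unfolding tot_ops(3)[OF pq] by simp
  show "EX l. w : f.Zr 2 n (int p) & l = \<epsilon> p (w (p, q))" if "w : f.Zr 2 n (int p)" for w using that by blast
  show "EX w. w : f.Zr 2 n (int p) & l = \<epsilon> p (w (p, q))" if l: "l : mod_ker (L p) (L (Suc p)) (dL p)" for l
  proof -
   have lc: "l : carrier (L p)" "dL p l = 0[L (Suc p)]" using l by (simp_all add: mod_ker_def)
   obtain x where x: "x : Kv p" "\<epsilon> p x = l" using \<epsilon>_surj[OF lc(1)] by blast
   then obtain w where "w : f.Zr 2 n (int p)" "w (p, q) = x" using lift_cocycle[OF x(1)] lc(2) by blast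
   then show ?thesis using x(2) by blast
  qed
  show "w : f.Br 2 n (int p) \<longleftrightarrow> l : coboundaries L dL p" if S: "w : f.Zr 2 n (int p) & l = \<epsilon> p (w (p, q))" for w l
  proof
   have w: "w : f.Zr 2 n (int p)" and l: "l = \<epsilon> p (w (p, q))" using S by simp_all
   have nn: "n = n - 1 + 1" by simp
   have wF: "w : tF n (int p)" using w by (simp add: f.Zr_def)
   {
    assume "w : f.Br 2 n (int p)"
    then obtain u y where u: "u : f.Zr 1 n (int p + 1)" and y: "y : f.Zr 1 (n - 1) (int p - 1)" and wu: "w = u +[tot D n] td D h v (n - 1) y"
     using f.Br_E[OF _ nn, of w 2 "int p"] by auto
    have "u : tF n (int p + 1)" using u by (simp add: f.Zr_def)
    then have "u (p, q) = 0[D p q]" by (rule tF_app[OF _ pq]) simp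
    then have "w (p, q) = td D h v (n - 1) y (p, q)"
     unfolding wu tot_ops(2)[OF pq] using Kv(2)[OF conjunct1[OF top_boundary[OF y]]] ab_D[of p q] by (simp add: ag)
    then show "l : coboundaries L dL p" unfolding l using top_boundary[OF y] by simp
   next
    assume "l : coboundaries L dL p"
    then obtain y where y: "y : f.Zr 1 (n - 1) (int p - 1)" "td D h v (n - 1) y (p, q) = w (p, q)"
     using lift_boundary[OF top_facts(1)[OF w]] unfolding l by blast
    \<comment> \<open>The differential of \<open>y\<close> agrees with \<open>w\<close> in the
      leading entry, so their difference drops to step \<open>p + 1\<close>.\<close>
    let ?t = "td D h v (n - 1) y" and ?u = "w -[tot D n] td D h v (n - 1) y"
    have tF: "?t : tF n (int p)" using y(1) by (simp add: f.Zr_def)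
    note wc = tF_car[OF wF] and tc = tF_car[OF tF]
    have uF: "?u : tF n (int p)" by (rule submodD(6)[OF f.Fi module_tot wF tF])
    have "?u (p, q) = 0[D p q]" unfolding tot_minus[OF pq wc tc] y(2)
     using tot_app[OF wc pq] ab_D[of p q] by (simp add: a_minus_def ag)
    then have uF1: "?u : tF n (int p + 1)" using tF_Suc[of ?u p q] uF unfolding pq by blast
    have "td D h v n ?t = 0[tot D (n + 1)]" using f.\<delta>\<delta>[OF f.Zr_car[OF y(1)], of n "n + 1"] by simp
    then have "td D h v n ?u = td D h v n w"
     using mod_hom_minus[OF td_hom ab_tot ab_tot wc tc] td_closed[OF wc] ab_tot[of "n + 1"] by (simp add: a_minus_def ag)
    then have "?u : f.Zr (2 - 1) n (int p + 1)" using uF1 w by (simp add: f.Zr_def add.assoc)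
    moreover have "y : f.Zr (2 - 1) (n - 1) (int p - 1)" using y(1) by simp
    ultimately have "?u +[tot D n] ?t : f.Br 2 n (int p)" by (rule f.Br_I[OF _ refl _ nn]) simp
    moreover have "?u +[tot D n] ?t = w" using ab_tot[of n] wc tc by - (rule ab_eqI[of "tot D n"], simp add: ab)
    ultimately show "w : f.Br 2 n (int p)" by simp
   }
  qed
 qed
qed

end

end

end

section \<open>The double complex of the fusion system\<close>

lemma rest_rest: "rest C P (rest C P \<eta>) = rest C P \<eta>"
 by (rule rest_cong) simp

context transporter_data
begin

abbreviation cT :: "('g set, 'g, 'r, 'r) rcmod" where "cT \<equiv> constant_module R"
abbreviation cF :: "('g set, 'g set, 'r, 'r) rcmod" where "cF \<equiv> constant_module R"
abbreviation "RT \<equiv> proj_res T R cT"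
abbreviation "RF \<equiv> proj_res F R cF"
abbreviation "PT \<equiv> %p. pull_left G (res_mod RF p)"
abbreviation "XC \<equiv> homD T R PT (%q. coch G (Suc q) M)"
abbreviation "Xh \<equiv> homh T PT (res_diff RF)"
abbreviation "Xv \<equiv> homv T R PT (%q. coch G (Suc q) M) (%q. cdiff G (Suc q) M)"

lemma left_module_cT: "left_module T R cT" and left_module_cF: "left_module F R cF"
 using left_module_constant[OF R] catT catF by blast+

lemma RT: "projective_resolution T R cT RT" and RF: "projective_resolution F R cF RF"
 by (rule projective_resolution_exists[OF catT R left_module_cT], rule projective_resolution_exists[OF catF R left_module_cF])

lemmas RT_facts = projective_resolutionD[OF RT]
lemmas RF_facts = projective_resolutionD[OF RF]

lemma PT_facts:
 "left_module T R (PT p)" "res_diff RF p : rc_hom T R (PT (Suc p)) (PT p)" "res_aug RF : rc_hom T R (PT 0) cT"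
 using left_module_pull[OF RF_facts(2)] pull_hom[OF RF_facts(3)] pull_hom[OF RF_facts(4)] unfolding pull_left_constant by blast+

lemma cone_transporter:
 "EX s. cone_data G R T M cT (res_mod RT) (res_diff RT) (res_aug RT) PT (res_diff RF) (res_aug RF) s"
proof -
 have F: "x : Obj F" if "x : Obj T" for x using that by simp
 have cc: "mod_at cT x = mod_at cF x" for x by (simp add: constant_module_def)
 have E: "res_aug RF x ` el (PT 0) x = el cT x"
  "res_diff RF 0 x ` el (PT (Suc 0)) x = mod_ker (mod_at (PT 0) x) (mod_at cT x) (res_aug RF x)"
  "res_diff RF (Suc n) x ` el (PT (Suc (Suc n))) x = mod_ker (mod_at (PT (Suc n)) x) (mod_at (PT n) x) (res_diff RF n x)"
  if x: "x : Obj T" for n x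
  unfolding cc pull_left_simps by (rule RF_facts(5)[OF F[OF x]], rule RF_facts(6)[OF F[OF x]], rule RF_facts(7)[OF F[OF x]])
 obtain \<sigma> where s: "(ALL n. \<sigma> n : rc_hom T R (res_mod RT n) (PT n)) &
  (ALL n. ALL x:Obj T. ALL b:el (res_mod RT (Suc n)) x. \<sigma> n x (res_diff RT n x b) = res_diff RF n x (\<sigma> (Suc n) x b)) &
  (ALL x:Obj T. ALL b:el (res_mod RT 0) x. res_aug RF x (\<sigma> 0 x b) = res_aug RT x b)"
  using chain_lift[where Q = PT and d = "res_diff RF" and a = "res_aug RF", OF catT R RT left_module_cT PT_facts] E by blast
 have \<sigma>: "\<sigma> n : rc_hom T R (res_mod RT n) (PT n)"
  "x : Obj T ==> b : el (res_mod RT (Suc n)) x ==> \<sigma> n x (res_diff RT n x b) = res_diff RF n x (\<sigma> (Suc n) x b)"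
  "x : Obj T ==> b : el (res_mod RT 0) x ==> res_aug RF x (\<sigma> 0 x b) = res_aug RT x b" for n x b
  using s by simp_all
 \<comment> \<open>The sign turns the commuting squares of the comparison into the anticommuting
   ones that the cone asks for.\<close>
 let ?s = "%n x b. sg R n *[mod_at (PT n) x] \<sigma> n x b"
 have mP: "module R (mod_at (PT n) x)" if "x : Obj T" for n x by (rule left_moduleD(1)[OF PT_facts(1) that])
 note g = graded_cat.projective_G_lifting[OF gT RT_facts(1)] graded_cat.projective_column[OF gT RT_facts(1) M]
 have "cone_data G R T M cT (res_mod RT) (res_diff RT) (res_aug RT) PT (res_diff RF) (res_aug RF) ?s"
 proof (rule cone_data.intro[OF gT cone_data_axioms.intro])
  show "left_module T R M" "left_module T R cT" by (rule M, rule left_module_cT)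
  show "left_module T R (res_mod RT n)" "left_module T R (PT n)" "res_diff RT n : rc_hom T R (res_mod RT (Suc n)) (res_mod RT n)"
   "res_diff RF n : rc_hom T R (PT (Suc n)) (PT n)" for n by (rule RT_facts(2), rule PT_facts(1), rule RT_facts(3), rule PT_facts(2))
  show "res_aug RT : rc_hom T R (res_mod RT 0) cT" "res_aug RF : rc_hom T R (PT 0) cT" by (rule RT_facts(4), rule PT_facts(3))
  show "?s n : rc_hom T R (res_mod RT n) (PT n)" for n by (rule rc_hom_smult[OF RT_facts(2) PT_facts(1) \<sigma>(1) sg_facts(1)[OF R]])
  show "G_lifting G T R (res_mod RT n) TYPE(('g set, 'g, 'r, 'r) res_univ \<times> ('g set, 'g set, 'r, 'r) res_univ)"
   "G_lifting G T R (PT n) TYPE(('g set, 'g, 'r, 'r) res_univ \<times> ('g set, 'g set, 'r, 'r) res_univ)" for n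
   by (rule g(1), rule pull_lifting[OF RF_facts(1)])
  show "EX g:rc_hom T R (res_mod RT n) (coch G k M). ALL x:Obj T. ALL a:el (res_mod RT n) x. cdiff G k M x (g x a) = f x a"
   if "f : rc_hom T R (res_mod RT n) (coch G (Suc k) M)"
    "!!x a. x : Obj T ==> a : el (res_mod RT n) x ==> cdiff G (Suc k) M x (f x a) = 0[mod_at (coch G (Suc (Suc k)) M) x]" for n k f
   by (rule g(2)[OF that])
  fix x assume x: "x : Obj T"
  show "res_aug RT x ` el (res_mod RT 0) x = el cT x"
   "res_diff RT 0 x ` el (res_mod RT (Suc 0)) x = mod_ker (mod_at (res_mod RT 0) x) (mod_at cT x) (res_aug RT x)"
   "res_diff RT (Suc n) x ` el (res_mod RT (Suc (Suc n))) x = mod_ker (mod_at (res_mod RT (Suc n)) x) (mod_at (res_mod RT n) x) (res_diff RT n x)" for n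
   by (rule RT_facts(5)[OF x], rule RT_facts(6)[OF x], rule RT_facts(7)[OF x])
  show "res_diff RF 0 x ` el (PT (Suc 0)) x = mod_ker (mod_at (PT 0) x) (mod_at cT x) (res_aug RF x)"
   "res_diff RF (Suc n) x ` el (PT (Suc (Suc n))) x = mod_ker (mod_at (PT (Suc n)) x) (mod_at (PT n) x) (res_diff RF n x)" for n
   by (rule E(2)[OF x], rule E(3)[OF x])
  fix b
  show "res_aug RF x (?s 0 x b) = res_aug RT x b" if b: "b : el (res_mod RT 0) x"
   unfolding sg_facts(2)[OF R] module.smult_one[OF mP[OF x] rc_homD(3)[OF \<sigma>(1) x b]] by (rule \<sigma>(3)[OF x b])
  show "res_diff RF n x (?s (Suc n) x b) +[mod_at (PT n) x] ?s n x (res_diff RT n x b) = 0[mod_at (PT n) x]"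
   if b: "b : el (res_mod RT (Suc n)) x" for n
  proof -
   note sb = rc_homD(3)[OF \<sigma>(1) x b]
   let ?y = "res_diff RF n x (\<sigma> (Suc n) x b)"
   have y: "?y : el (PT n) x" by (rule rc_homD(3)[OF PT_facts(2) x sb])
   have "res_diff RF n x (?s (Suc n) x b) = sg R (Suc n) *[mod_at (PT n) x] ?y"
    by (rule mod_homD(3)[OF rc_homD(1)[OF PT_facts(2) x] sg_facts(1)[OF R] sb])
   then show ?thesis unfolding \<sigma>(2)[OF x b]
    using sg_smult(1,3)[OF mP[OF x] y] abelian_group.ag_comm[OF module_ag[OF mP[OF x]] sg_smult(3)[OF mP[OF x] y] sg_smult(3)[OF mP[OF x] y]] by simp
  qed
 qed
 then show ?thesis by - (rule exI, assumption)
qed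

text \<open>The cone argument with the chosen resolution over the transporter category as
  \<open>Q\<close> and the pulled back one as \<open>P\<close>. The relation \<open>c.rel\<close>,
  read from its second argument to its first, induces the isomorphism.\<close>

lemma transporter_cohomology:
 shows "double_complex R XC Xh Xv"
  "mod_iso R (subquot (tot XC (int n)) (mod_ker (tot XC (int n)) (tot XC (int n + 1)) (td XC Xh Xv (int n)))
    (td XC Xh Xv (int n - 1) ` carrier (tot XC (int n - 1)))) (cat_cohomology T R M n)"
proof -
 obtain s where s: "cone_data G R T M cT (res_mod RT) (res_diff RT) (res_aug RT) PT (res_diff RF) (res_aug RF) s"
  using cone_transporter by (elim exE)
 interpret c: cone_data G R T M cT "res_mod RT" "res_diff RT" "res_aug RT" PT "res_diff RF" "res_aug RF" s by (rule s)
 interpret X: double_complex R XC Xh Xv by (rule c.dcX)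
 show "double_complex R XC Xh Xv" by (rule c.dcX)
 have dZ: "c.dZ = ext_coboundary T R cT" by (simp add: fun_eq_iff c.dZ_def ext_coboundary_def rest_def)
 note e = ext_complex[OF catT R left_module_cT M]
 note k = cochain_complex[of R "ext_cochains T R cT M" "ext_coboundary T R cT", OF e]
 note f = c.rel_facts[unfolded dZ, folded ext_cochains_def]
 have e1: "int n - 1 + 1 = int n" by simp
 show "mod_iso R (subquot (tot XC (int n)) (mod_ker (tot XC (int n)) (tot XC (int n + 1)) (td XC Xh Xv (int n)))
    (td XC Xh Xv (int n - 1) ` carrier (tot XC (int n - 1)))) (cat_cohomology T R M n)"
  unfolding Ext_def cohomology_def
 proof (rule mod_iso_subquot_rel[where S = "%x z. c.rel n z x", OF X.module_tot _ _ e(1)])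
  show "submodule (mod_ker (tot XC (int n)) (tot XC (int n + 1)) (td XC Xh Xv (int n))) R (tot XC (int n))"
   by (rule submodule_ker[OF X.module_tot X.module_tot X.td_hom])
  show "submodule (td XC Xh Xv (int n - 1) ` carrier (tot XC (int n - 1))) R (tot XC (int n))"
   by (rule submodule_image[OF X.module_tot X.module_tot X.td_hom[of "int n - 1", unfolded e1] submodule_carrier[OF X.module_tot]])
  show "submodule (mod_ker (ext_cochains T R cT M n) (ext_cochains T R cT M (Suc n)) (ext_coboundary T R cT n)) R (ext_cochains T R cT M n)"
   by (rule k(1), assumption)
  show "submodule (coboundaries (ext_cochains T R cT M) (ext_coboundary T R cT) n) R (ext_cochains T R cT M n)" by (rule k(2), assumption)
  fix x z assume r: "c.rel n z x"
  show "x : mod_ker (tot XC (int n)) (tot XC (int n + 1)) (td XC Xh Xv (int n)) &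
    z : mod_ker (ext_cochains T R cT M n) (ext_cochains T R cT M (Suc n)) (ext_coboundary T R cT n)"
   by (rule conjI[OF conjunct2[OF f(1)[OF r]] conjunct1[OF f(1)[OF r]]])
  show "x : td XC Xh Xv (int n - 1) ` carrier (tot XC (int n - 1)) \<longleftrightarrow> z : coboundaries (ext_cochains T R cT M) (ext_coboundary T R cT) n"
   by (rule f(4)[OF r, symmetric])
  show "c.rel n (a *[ext_cochains T R cT M n] z) (a *[tot XC (int n)] x)" if "a : carrier R" for a
   unfolding ext_cochains_def by (rule c.rel_smult[OF that r])
  show "c.rel n (z +[ext_cochains T R cT M n] z') (x +[tot XC (int n)] x')" if "c.rel n z' x'" for x' z'
   unfolding ext_cochains_def by (rule c.rel_add[OF r that])
 next
  show "EX z. c.rel n z x" if "x : mod_ker (tot XC (int n)) (tot XC (int n + 1)) (td XC Xh Xv (int n))" for x by (rule f(3)[OF that])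
  show "EX x. c.rel n z x" if "z : mod_ker (ext_cochains T R cT M n) (ext_cochains T R cT M (Suc n)) (ext_coboundary T R cT n)" for z by (rule f(2)[OF that])
 qed
qed

abbreviation "XK p q \<equiv> mod_ker (XC p q) (XC p (Suc q)) (Xv p q)"

text \<open>Takes classes of the values. Since \<open>res_mod RF p\<close> is projective, this
  identifies the cohomology of morphisms into invariant cochains with morphisms into cohomology, as
  \<open>eps_surj\<close> and \<open>eps_zero\<close> show.\<close>

definition \<epsilon> :: "nat => nat => ('g set => ('g set, 'g set, 'r, 'r) res_univ => 'g list => 'a)
  => 'g set => ('g set, 'g set, 'r, 'r) res_univ => (unit => (unit, 'g, 'r, 'r) res_univ => 'a) set" where
 "\<epsilon> q p f = rest F (res_mod RF p) (%H a. ec q H (f H a))"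

lemma rest_PT: "rest T (PT p) f = rest F (res_mod RF p) f"
 by (simp add: rest_def)

lemma XC_iff: "f : carrier (XC p q) \<longleftrightarrow> f : rc_hom F R (res_mod RF p) (KF q) & rest F (res_mod RF p) f = f"
proof
 assume "f : carrier (XC p q)"
 then have f: "f : carrier (hom_module T R (PT p) (coch G (Suc q) M))" by (simp add: homD_def)
 show "f : rc_hom F R (res_mod RF p) (KF q) & rest F (res_mod RF p) f = f"
  using hom_moduleD(1)[OF f, unfolded hom_pull_iff[OF RF_facts(2) graded_cat.left_module_coch[OF gT M]]] hom_moduleD(4)[OF f]
  unfolding rest_PT by (rule conjI)
next
 assume f: "f : rc_hom F R (res_mod RF p) (KF q) & rest F (res_mod RF p) f = f"
 have "rest T (PT p) f : carrier (hom_module T R (PT p) (coch G (Suc q) M))"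
  by (rule rest_in_hom_module[OF PT_facts(1)]) (simp only: hom_pull_iff[OF RF_facts(2) graded_cat.left_module_coch[OF gT M]] f)
 then show "f : carrier (XC p q)" unfolding rest_PT homD_def using f by simp
qed

lemma Xv_app: "H : \<H> ==> a : el (res_mod RF p) H ==> Xv p q f H a = sg R p *[mod_at (KF (Suc q)) H] Kd q H (f H a)"
 by (simp add: homv_def)

lemma XC_eqI:
 assumes f: "f : carrier (XC p q)" and g: "g : carrier (XC p q)"
  and eq: "!!H a. H : \<H> ==> a : el (res_mod RF p) H ==> f H a = g H a"
 shows "f = g"
proof (rule hom_module_eqI[OF f[unfolded homD_def] g[unfolded homD_def]])
 fix H a assume "H : Obj T" "a : el (PT p) H"
 then show "f H a = g H a" by (intro eq) simp_all
qed

lemma XC_zero: "H : \<H> ==> a : el (res_mod RF p) H ==> 0[XC p q] H a = 0[mod_at (KF q) H]"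
 by (simp add: homD_def hom_module_ops)

interpretation X: double_complex R XC Xh Xv
 by (rule transporter_cohomology(1))

text \<open>The sign in \<open>Xv\<close> is invertible, so a vertical cocycle is a morphism whose
  values are cocycles; these values lie in the left module \<open>ZKF q\<close>.\<close>

lemma XK_iff: "f : XK p q \<longleftrightarrow> f : rc_hom F R (res_mod RF p) (ZKF q) & rest F (res_mod RF p) f = f"
proof -
 have "f : XK p q \<longleftrightarrow> f : carrier (XC p q) & (ALL H:\<H>. ALL a:el (res_mod RF p) H. f H a : KZ q H)"
 proof -
  have "Xv p q f = 0[XC p (Suc q)] \<longleftrightarrow> (ALL H:\<H>. ALL a:el (res_mod RF p) H. f H a : KZ q H)" if f: "f : carrier (XC p q)"
  proof -
   have fc: "f H a : el (KF q) H" if "H : \<H>" "a : el (res_mod RF p) H" for H a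
    by (rule rc_homD(3)[OF conjunct1[OF f[unfolded XC_iff]] _ that(2)]) (simp add: that(1))
   have z: "0[XC p (Suc q)] : carrier (XC p (Suc q))" using X.ab_D by (simp add: ag)
   have k: "Xv p q f H a = 0[XC p (Suc q)] H a \<longleftrightarrow> f H a : KZ q H" if "H : \<H>" "a : el (res_mod RF p) H" for H a
   proof -
    have "Kd q H (f H a) : el (KF (Suc q)) H" by (rule rc_homD(3)[OF Kd_hom _ fc[OF that]]) (simp add: that)
    note z = sg_smult(4)[OF KF_facts(1)[OF that(1)] this]
    show ?thesis unfolding Xv_app[OF that] XC_zero[OF that] mod_ker_def mem_Collect_eq z by (simp only: fc[OF that] simp_thms)
   qed
   show ?thesis
   proof
    assume "Xv p q f = 0[XC p (Suc q)]"
    then have e: "Xv p q f H a = 0[XC p (Suc q)] H a" for H a by (simp only:)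
    show "ALL H:\<H>. ALL a:el (res_mod RF p) H. f H a : KZ q H"
     by (intro ballI, rule iffD1[OF k], assumption+, rule e)
   next
    assume a: "ALL H:\<H>. ALL a:el (res_mod RF p) H. f H a : KZ q H"
    show "Xv p q f = 0[XC p (Suc q)]"
     by (rule XC_eqI[OF mod_homD(1)[OF X.v f] z]) (simp only: k a[rule_format])
   qed
  qed
  note eqv = this
  show ?thesis unfolding mod_ker_def[of "XC p q"] mem_Collect_eq by (rule conj_cong[OF refl], rule eqv, assumption)
 qed
 also have "\<dots> \<longleftrightarrow> f : rc_hom F R (res_mod RF p) (ZKF q) & rest F (res_mod RF p) f = f"
 proof -
  have "f : rc_hom F R (res_mod RF p) (KF q) & (ALL H:\<H>. ALL a:el (res_mod RF p) H. f H a : KZ q H)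
    \<longleftrightarrow> f : rc_hom F R (res_mod RF p) (ZKF q)"
  proof
   assume a: "f : rc_hom F R (res_mod RF p) (KF q) & (ALL H:\<H>. ALL a:el (res_mod RF p) H. f H a : KZ q H)"
   note d = rc_homD[OF conjunct1[OF a]]
   show "f : rc_hom F R (res_mod RF p) (ZKF q)"
   proof (rule rc_homI)
    fix H assume H: "H : Obj F"
    show "f H : mod_hom R (mod_at (res_mod RF p) H) (mod_at (ZKF q) H)"
     unfolding ZKF_at using mod_homD(2,3)[OF d(1)[OF H]] conjunct2[OF a] H by (intro mod_homI) simp_all
   qed (use d(2) in \<open>simp add: ZKF_at\<close>)
  next
   assume a: "f : rc_hom F R (res_mod RF p) (ZKF q)"
   note d = rc_homD[OF a]
   have v: "f H a : KZ q H" if "H : Obj F" "a : el (res_mod RF p) H" for H a using d(3)[OF that] by (simp add: ZKF_at)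
   have "f : rc_hom F R (res_mod RF p) (KF q)"
   proof (rule rc_homI)
    fix H assume H: "H : Obj F"
    show "f H : mod_hom R (mod_at (res_mod RF p) H) (mod_at (KF q) H)"
     using mod_homD(2,3)[OF d(1)[OF H, unfolded ZKF_at]] v[OF H] by (intro mod_homI) (simp_all add: mod_ker_def)
   qed (use d(2) in \<open>simp add: ZKF_at\<close>)
   then show "f : rc_hom F R (res_mod RF p) (KF q) & (ALL H:\<H>. ALL a:el (res_mod RF p) H. f H a : KZ q H)" using v by simp
  qed
  note eqv = this
  show ?thesis unfolding XC_iff eqv[symmetric] by (simp only: conj_ac)
 qed
 finally show ?thesis .
qed

lemma XK_app: "f : XK p q ==> H : \<H> ==> a : el (res_mod RF p) H ==> f H a : KZ q H"
 using rc_homD(3)[of f F R "res_mod RF p" "ZKF q" H a] unfolding XK_iff by (simp add: ZKF_at)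

abbreviation "EF q \<equiv> ext_cochains F R cF (HQ q)"

lemma eps_hom: "\<epsilon> q p : mod_hom R ((XC p q)(|carrier := XK p q|)) (EF q p)"
proof (rule mod_homI)
 fix f assume "f : carrier ((XC p q)(|carrier := XK p q|))"
 then have f: "f : XK p q" by simp
 show "\<epsilon> q p f : carrier (EF q p)" unfolding \<epsilon>_def ext_cochains_def
  by (rule rest_in_hom_module[OF RF_facts(2) rc_hom_comp[OF conjunct1[OF f[unfolded XK_iff]] HQ_facts(2)]])
 show "\<epsilon> q p (c *[(XC p q)(|carrier := XK p q|)] f) = c *[EF q p] \<epsilon> q p f" if c: "c : carrier R" for c
  unfolding \<epsilon>_def ext_cochains_def hom_module_ops
 proof (rule rest_cong)
  fix H a assume H: "H : Obj F" and a: "a : el (res_mod RF p) H"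
  have H': "H : \<H>" using H by simp
  have "(c *[XC p q] f) H a = c *[mod_at (KF q) H] f H a" using H' a by (simp add: homD_def hom_module_ops)
  then show "ec q H ((c *[(XC p q)(|carrier := XK p q|)] f) H a) = c *[mod_at (HQ q) H] rest F (res_mod RF p) (%H a. ec q H (f H a)) H a"
   using mod_homD(3)[OF ec_hom[OF H', of q] c, of "f H a"] XK_app[OF f H' a] H a by simp
 qed
 fix g assume "g : carrier ((XC p q)(|carrier := XK p q|))"
 then have g: "g : XK p q" by simp
 show "\<epsilon> q p (f +[(XC p q)(|carrier := XK p q|)] g) = \<epsilon> q p f +[EF q p] \<epsilon> q p g"
  unfolding \<epsilon>_def ext_cochains_def hom_module_ops
 proof (rule rest_cong)
  fix H a assume H: "H : Obj F" and a: "a : el (res_mod RF p) H"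
  have H': "H : \<H>" using H by simp
  have "(f +[XC p q] g) H a = f H a +[mod_at (KF q) H] g H a" using H' a by (simp add: homD_def hom_module_ops)
  then show "ec q H ((f +[(XC p q)(|carrier := XK p q|)] g) H a)
    = rest F (res_mod RF p) (%H a. ec q H (f H a)) H a +[mod_at (HQ q) H] rest F (res_mod RF p) (%H a. ec q H (g H a)) H a"
   using mod_homD(2)[OF ec_hom[OF H', of q], of "f H a" "g H a"] XK_app[OF f H' a] XK_app[OF g H' a] H a by simp
 qed
qed

text \<open>Projectivity over the fusion category lifts \<open>l\<close> along the surjection from
  invariant cocycles onto classes.\<close>

lemma eps_surj:
 assumes l: "l : carrier (EF q p)"
 shows "EX f:XK p q. \<epsilon> q p f = l"
proof -
 note lh = hom_moduleD(1)[OF l[unfolded ext_cochains_def]]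
 have "EX g:rc_hom F R (res_mod RF p) (ZKF q). ALL H:Obj F. ALL a:el (res_mod RF p) H. ec q H (g H a) = l H a"
 proof (rule projective_lift[OF catF R RF_facts(1) left_module_ZKF HQ_facts(1) HQ_facts(2) lh])
  fix H a assume H: "H : Obj F" and a: "a : el (res_mod RF p) H"
  show "l H a : ec q H ` el (ZKF q) H" using rc_homD(3)[OF lh H a] ec_surj[of H q] H by (simp add: ZKF_at)
 qed
 then obtain g where g: "g : rc_hom F R (res_mod RF p) (ZKF q)" "ALL H:Obj F. ALL a:el (res_mod RF p) H. ec q H (g H a) = l H a" by (rule bexE)
 let ?f = "rest F (res_mod RF p) g"
 have f: "?f : rc_hom F R (res_mod RF p) (ZKF q)" by (rule rc_hom_cong[OF RF_facts(2) g(1)]) simp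
 have "?f : XK p q" unfolding XK_iff using f by (simp only: rest_rest simp_thms)
 moreover have "\<epsilon> q p ?f = l" unfolding \<epsilon>_def
  by (rule rest_eqI[OF l[unfolded ext_cochains_def]]) (use g(2) in simp)
 ultimately show ?thesis by - (rule bexI, assumption, assumption)
qed

text \<open>A morphism whose values are coboundaries is a coboundary of morphisms: lift it along
  \<open>Kd m\<close> by projectivity. In degree 0 both sides say that \<open>f\<close> is
  zero.\<close>

lemma eps_zero:
 assumes f: "f : XK p q"
 shows "\<epsilon> q p f = 0[EF q p] \<longleftrightarrow> f : coboundaries (XC p) (Xv p) q"
proof -
 have fX: "f : carrier (XC p q)" using f by (simp add: mod_ker_def)
 note fK = conjunct1[OF fX[unfolded XC_iff]]
 have "\<epsilon> q p f = 0[EF q p] \<longleftrightarrow> (ALL H:\<H>. ALL a:el (res_mod RF p) H. f H a : KB q H)"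
 proof
  assume e: "\<epsilon> q p f = 0[EF q p]"
  show "ALL H:\<H>. ALL a:el (res_mod RF p) H. f H a : KB q H"
  proof (intro ballI)
   fix H a assume H: "H : \<H>" and a: "a : el (res_mod RF p) H"
   have "ec q H (f H a) = 0[mod_at (HQ q) H]"
    using fun_cong[OF fun_cong[OF e, of H], of a] H a unfolding \<epsilon>_def ext_cochains_def hom_module_ops by simp
   then show "f H a : KB q H" using ec_zero[OF H XK_app[OF f H a]] by (simp only:)
  qed
 next
  assume b: "ALL H:\<H>. ALL a:el (res_mod RF p) H. f H a : KB q H"
  show "\<epsilon> q p f = 0[EF q p]" unfolding \<epsilon>_def ext_cochains_def hom_module_ops
  proof (rule rest_cong)
   fix H a assume "H : Obj F" and a: "a : el (res_mod RF p) H"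
   then have H: "H : \<H>" by simp
   show "ec q H (f H a) = 0[mod_at (HQ q) H]" using ec_zero[OF H XK_app[OF f H a]] b[rule_format, OF H a] by (simp only:)
  qed
 qed
 also have "\<dots> \<longleftrightarrow> f : coboundaries (XC p) (Xv p) q"
 proof (cases q)
  case 0
  have z: "0[XC p 0] : carrier (XC p 0)" using X.ab_D by (simp add: ag)
  show ?thesis unfolding 0 coboundaries_def nat.case singleton_iff
  proof
   assume a: "ALL H:\<H>. ALL a:el (res_mod RF p) H. f H a = 0[mod_at (KF 0) H]"
   show "f = 0[XC p 0]" by (rule XC_eqI[OF fX[unfolded 0] z]) (simp only: a[rule_format] XC_zero)
  next
   assume "f = 0[XC p 0]"
   then show "ALL H:\<H>. ALL a:el (res_mod RF p) H. f H a = 0[mod_at (KF 0) H]" by (intro ballI) (simp only: XC_zero)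
  qed
 next
  case (Suc m)
  show ?thesis unfolding Suc coboundaries_def nat.case
  proof
   assume b: "ALL H:\<H>. ALL a:el (res_mod RF p) H. f H a : Kd m H ` el (KF m) H"
   have "EX g:rc_hom F R (res_mod RF p) (KF m). ALL H:Obj F. ALL a:el (res_mod RF p) H. Kd m H (g H a) = f H a"
    by (rule projective_lift[OF catF R RF_facts(1) left_module_KF left_module_KF Kd_hom fK[unfolded Suc]]) (use b in simp)
   then obtain g where g: "g : rc_hom F R (res_mod RF p) (KF m)" "ALL H:Obj F. ALL a:el (res_mod RF p) H. Kd m H (g H a) = f H a" by (rule bexE)
   \<comment> \<open>The sign cancels the one in \<open>Xv p m\<close>.\<close>
   let ?g = "rest F (res_mod RF p) (%H a. sg R p *[mod_at (KF m) H] g H a)"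
   have "?g : rc_hom F R (res_mod RF p) (KF m)"
    by (rule rc_hom_cong[OF RF_facts(2) rc_hom_smult[OF RF_facts(2) left_module_KF g(1) sg_facts(1)[OF R]]]) simp
   then have gX: "?g : carrier (XC p m)" unfolding XC_iff by (simp only: rest_rest simp_thms)
   have "f = Xv p m ?g"
   proof (rule XC_eqI[OF fX[unfolded Suc] mod_homD(1)[OF X.v gX]])
    fix H a assume H: "H : \<H>" and a: "a : el (res_mod RF p) H"
    have HF: "H : Obj F" using H by simp
    note ga = rc_homD(3)[OF g(1) HF a]
    have Kg: "Kd m H (g H a) = f H a" using g(2) HF a by blast
    have fa: "f H a : el (KF (Suc m)) H" using rc_homD(3)[OF fK HF a] Suc by (simp only:)
    have "Kd m H (sg R p *[mod_at (KF m) H] g H a) = sg R p *[mod_at (KF (Suc m)) H] f H a"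
     using mod_homD(3)[OF rc_homD(1)[OF Kd_hom HF] sg_facts(1)[OF R] ga] unfolding Kg .
    then show "f H a = Xv p m ?g H a" unfolding Xv_app[OF H a] rest_apply[OF HF a]
     using sg_smult(2)[OF KF_facts(1)[OF H] fa] by simp
   qed
   then show "f : Xv p m ` carrier (XC p m)" using gX by (rule image_eqI)
  next
   assume "f : Xv p m ` carrier (XC p m)"
   then obtain g where g: "f = Xv p m g" "g : carrier (XC p m)" by (rule imageE)
   show "ALL H:\<H>. ALL a:el (res_mod RF p) H. f H a : Kd m H ` el (KF m) H"
   proof (intro ballI)
    fix H a assume H: "H : \<H>" and a: "a : el (res_mod RF p) H"
    have HF: "H : Obj F" using H by simp
    note ga = rc_homD(3)[OF conjunct1[OF g(2)[unfolded XC_iff]] HF a]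
    have "f H a = Kd m H (sg R p *[mod_at (KF m) H] g H a)"
     unfolding g(1) Xv_app[OF H a] by (rule mod_homD(3)[OF rc_homD(1)[OF Kd_hom HF] sg_facts(1)[OF R] ga, symmetric])
    then show "f H a : Kd m H ` el (KF m) H" by (rule image_eqI[OF _ sg_smult(3)[OF KF_facts(1)[OF H] ga]])
   qed
  qed
 qed
 finally show ?thesis .
qed

lemma eps_h: "\<epsilon> q (Suc p) (Xh p q f) = ext_coboundary F R cF p (\<epsilon> q p f)"
proof -
 have "\<epsilon> q (Suc p) (Xh p q f) = rest F (res_mod RF (Suc p)) (%H a. \<epsilon> q p f H (res_diff RF p H a))"
  unfolding \<epsilon>_def
 proof (rule rest_cong)
  fix H a assume H: "H : Obj F" and a: "a : el (res_mod RF (Suc p)) H"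
  show "ec q H (Xh p q f H a) = rest F (res_mod RF p) (%H a. ec q H (f H a)) H (res_diff RF p H a)"
   using H a rc_homD(3)[OF RF_facts(3) H a] by (simp add: homh_def)
 qed
 then show ?thesis by (simp add: ext_coboundary_def rest_def)
qed

text \<open>The filtered total complex has the right second page by \<open>second_page\<close> and
  the right limit by \<open>transporter_cohomology\<close>, both up to isomorphism;
  \<open>spectral_transport\<close> replaces them by the given modules.\<close>

lemma spectral_sequence_exists:
 "EX E d. spectral_sequence R E d & first_quadrant E &
   (ALL p q. E 2 (int p) (int q) = cat_cohomology F R (HQ q) p) & converges_to R E (cat_cohomology T R M)"
proof -
 interpret f: filtered_complex R "tot XC" "td XC Xh Xv" X.tF by (rule X.filtered)
 note e = ext_complex[OF catF R left_module_cF HQ_facts(1)]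
 have E2: "mod_iso R (f.Er 2 (int p) (int q)) (cat_cohomology F R (HQ q) p)" for p q
  unfolding Ext_def
  by (rule X.second_page[where \<epsilon> = "\<epsilon> q"])
   (rule e(1) e(2) eps_hom eps_h refl | (rule e(3) eps_surj eps_zero, assumption))+
 have mE: "module R (cat_cohomology F R (HQ q) p)" for p q
  unfolding Ext_def by (rule cochain_complex(4)[of R "EF q" "ext_coboundary F R cF", OF e], assumption)
 note eT = ext_complex[OF catT R left_module_cT M]
 have mT: "module R (cat_cohomology T R M n)" for n
  unfolding Ext_def by (rule cochain_complex(4)[of R "ext_cochains T R cT M" "ext_coboundary T R cT", OF eT], assumption)
 have iT: "mod_iso R (f.Hc n) (cat_cohomology T R M n)" for n
  unfolding f.Hc_def by (rule transporter_cohomology(2))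
 show ?thesis
  by (rule spectral_transport[OF f.spectral f.first_quadrant_Er f.converges mE E2 f.module_Hc mT iT])
qed

end

theorem proposition9p4:
  fixes R :: "('r, 's) ring_scheme"
    and G :: "('g, 't) monoid_scheme"
    and \<H> :: "'g set set"
    and M :: "('g set, 'g, 'r, 'a) rcmod"
  assumes "cring R"
    and "group G"
    and "conj_closed_collection G \<H>"
    and "left_module (transporter_category G \<H>) R M"
  shows "(\<forall>q. left_module (fusion_category G \<H>) R (centralizer_cohomology R G M q)) \<and>
    (\<exists>E d. spectral_sequence R E d \<and> first_quadrant E \<and>
       (\<forall>p q. E 2 (int p) (int q)
          = cat_cohomology (fusion_category G \<H>) R (centralizer_cohomology R G M q) p) \<and>
       converges_to R E (cat_cohomology (transporter_category G \<H>) R M))"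
proof -
  interpret transporter_data G R \<H> M
    by (rule transporter_data.intro[OF assms(2) transporter_data_axioms.intro[OF assms(1,3,4)]])
  show ?thesis
    by (rule conjI[OF allI[OF HQ_facts(1)] spectral_sequence_exists])
qed

end
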